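(* Let $p$ be an odd prime, $n\ge p$, and let $n+1=a_kp^k+a_{k-1}p^{k-1}+\dots+a_1p+a_0$ be the base-$p$ expansion of $n+1$ ($0\le a_i<p$, $a_k\ne0$). Let $\iota_k:\mathsf{TL}_{a_k-1}^{\mathbb Z_{(p)}}\hookrightarrow\mathsf{TL}_n^{\mathbb Z_{(p)}}$ be the composite of the injections $\iota_{KLR}$ described in the context. Then $${}^p\mathbf{JW}_n=\iota_k\bigl(\mathbb E_{\mathfrak t_{(a_k-1)}}\bigr),$$ where $\mathfrak t_{(a_k-1)}$ is the one-column standard tableau with $a_k-1$ boxes and $\mathbb E_{\mathfrak t_{(a_k-1)}}\in\mathsf{TL}_{a_k-1}^{\mathbb Z_{(p)}}$ is its seminormal idempotent.
   Context: **Algebra and tableaux.** $\mathsf{TL}_N^{\Bbbk}$ is the unital $\Bbbk$-algebra on $u_1,\dots,u_{N-1}$ with $u_i^2=2u_i$, $u_iu_ju_i=u_i$ for $|i-j|=1$, $u_iu_j=u_ju_i$ for $|i-j|>1$ ($\mathsf{TL}_0^{\Bbbk}=\mathsf{TL}_1^{\Bbbk}=\Bbbk$); equivalently, the algebra with basis non-crossing matchings of $N$ top and $N$ bottom points, $D_1D_2$ being $D_1$ on top of $D_2$ with loops replaced by $2$. $\mathbb Z_{(p)}$ is the localization of $\mathbb Z$ at $p$. $\mathrm{Par}_N^{\le2}$: partitions of $N$ with at most two columns; $\mathrm{Std}(\lambda)$: standard $\lambda$-tableaux; $\mathrm{Std}(\mathrm{Par}_N^{\le2})=\bigcup_\lambda\mathrm{Std}(\lambda)$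 (one element, the empty tableau, if $N=0$). Content: $c_{\mathfrak t}(i)=c-r$ if $i$ is in row $r$, column $c$ of $\mathfrak t$. $\mathfrak s\trianglelefteq\mathfrak t$ means that for each $m$ the shape of $\mathfrak s$ restricted to entries $\le m$ is dominated by that of $\mathfrak t$ restricted to entries $\le m$. $\mathfrak S_N$ acts on tableaux by permuting entries; $s_k=(k,k+1)$. **Idempotents.** $\Phi:\mathbb Q\mathfrak S_N\to\mathsf{TL}_N^{\mathbb Q}$ is the homomorphism $s_i\mapsto u_i-1$; $L_1=0$, $L_i=\sum_{j<i}(j,i)$, $\mathbf L_i=\Phi(L_i)$. With $\mathcal C$ the set of all contents $c_{\mathfrak s}(i)$ ($\mathfrak s\in\mathrm{Std}(\mathrm{Par}_N^{\le2})$, $1\le i\le N$), $\mathbb E_{\mathfrak t}=\prod_{c\in\mathcal C}\prod_{i:\,c\ne c_{\mathfrak t}(i)}\frac{\mathbf L_i-c}{c_{\mathfrak t}(i)-c}\in\mathsf{TL}_N^{\mathbb Q}$; these form a complete set of orthogonal primitive idempotents. ($\mathbb E_{\mathfrak t}=1$ if $N\le1$.) If $N<p$ then $\mathbb E_{\mathfrak t}\in\mathsf{TL}_N^{\mathbb Z_{(p)}}$. **$p$-Jones-Wenzl idempotent.** Let $n+1=a_kp^k+\dots+a_0$ be the base-$p$ expansion, and $\mathcal I_n=\{a_kp^k\pm a_{k-1}p^{k-1}\pm\dots\pm a_0\}-1$ (all sign choices). Each $m\in\mathcal I_n$ determines uniquely the signs of the nonzero $a_j$, $j<k$. The tableau $\mathfrak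 t_m\in\mathrm{Std}(\mathrm{Par}_n^{\le2})$ is obtained by placing the numbers $1,\dots,n$ in order as follows: the first $a_kp^k-1$ numbers in the first column; then, for $j=k-1,k-2,\dots,0$, the next $a_jp^j$ numbers in the first column if the sign of $a_j$ in $m$ is $+$, and in the second column if it is $-$. Then ${}^p\mathbf{JW}_n:=\sum_{m\in\mathcal I_n}\mathbb E_{\mathfrak t_m}\in\mathsf{TL}_n^{\mathbb Q}$; it lies in $\mathsf{TL}_n^{\mathbb Z_{(p)}}$. **The injections $\iota_{KLR}$.** Let $N\ge p-1$ and write $N=(p-1)+pN_2+r_0$, $0\le r_0<p$. Let $\mathfrak t_N$ be the one-column standard tableau with $N$ boxes, $[\mathfrak t_N]=\{\mathfrak s\in\mathrm{Std}(\mathrm{Par}_N^{\le2})\mid c_{\mathfrak s}(i)\equiv c_{\mathfrak t_N}(i)\bmod p\ \forall i\}$, $\mathbf e:=\sum_{\mathfrak s\in[\mathfrak t_N]}\mathbb E_{\mathfrak s}\in\mathsf{TL}_N^{\mathbb Z_{(p)}}$. For $\mathfrak t\in\mathrm{Std}(\lambda)$, $\lambda\in\mathrm{Par}_N^{\le2}$, the half-diagram $C_{\mathfrak t}$ has $N$ bottom points: going through $1,\dots,N$ in increasing order, raise a vertical line from $i$ if $i$ is in the first column of $\mathfrak t$, and join $i$ to the nearest still vacant line to its left if $i$ is in the second column; $C_{\mathfrak s\mathfrak t}$ is the horizontal reflection of $C_{\mathfrak s}$ on top of $C_{\mathfrak t}$, and $f_{\mathfrak s\mathfrak t}:=\mathbb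 E_{\mathfrak s}C_{\mathfrak s\mathfrak t}\mathbb E_{\mathfrak t}$ ($\mathfrak s,\mathfrak t$ of the same shape) is a $\mathbb Q$-basis of $\mathsf{TL}_N^{\mathbb Q}$. For $1\le l<N$, $\psi_l\in\mathsf{TL}_N^{\mathbb Z_{(p)}}$ is the image under $\Phi$ of the KLR generator $\psi_l$ of $\mathbb Z_{(p)}\mathfrak S_N$ given by the Hu–Mathas isomorphism; it is the unique element of $\mathsf{TL}_N^{\mathbb Q}$ whose left multiplication is as follows. For $\mathfrak s,\mathfrak a$ of the same shape, put $\mathfrak t=\mathfrak ss_l$, $r=c_{\mathfrak s}(l)-c_{\mathfrak s}(l+1)$, and let $\alpha=1$ if $\mathfrak t$ is standard with $\mathfrak t\lhd\mathfrak s$, $\alpha=(r^2-1)/r^2$ if $\mathfrak t$ is standard with $\mathfrak t\rhd\mathfrak s$. Let $\beta=0$ if $\mathfrak t$ is not standard; otherwise $\beta=\frac{\alpha}{1-r}$ if $r\equiv0$, $\beta=\alpha r$ if $r\equiv1$, $\beta=\frac{\alpha r}{1-r}$ otherwise (congruences mod $p$). Then $\psi_lf_{\mathfrak s\mathfrak a}=\beta f_{\mathfrak t\mathfrak a}-\delta\frac1rf_{\mathfrak s\mathfrak a}$, where $\delta=1$ if $r\equiv0\bmod p$ and $\delta=0$ otherwise (the term $\beta f_{\mathfrak t\mathfrak a}$ is $0$ if $\mathfrak t$ is not standard). For $1\le i<N_2$ let $I=(i+1)p-1$, $\Psi_j=\psi_{I-j+1}\psi_{I-j+3}\cdots\psi_{I+j-1}$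 ($j$ factors) for $1\le j\le p$, and $\mathbb U_i=\mathbf e\,\Psi_1\cdots\Psi_{p-1}\Psi_p\Psi_{p-1}\cdots\Psi_1\,\mathbf e$. Then $\iota_{KLR}:\mathsf{TL}_{N_2}^{\mathbb Z_{(p)}}\to\mathsf{TL}_N^{\mathbb Z_{(p)}}$ is the injective (non-unital) algebra homomorphism with $1\mapsto\mathbf e$ and $u_i\mapsto\mathbb U_i$ ($1\le i<N_2$); for $N_2\in\{0,1\}$ it is just $1\mapsto\mathbf e$. **The chain.** Put $n^0=n$ and, for $i=0,\dots,k-1$, define $n_2^i$ by $n^i=(p-1)+pn_2^i+r^i$, $0\le r^i<p$, and $n^{i+1}=n_2^i$. Then $r^i=a_i$, $n_2^i+1=a_kp^{k-i-1}+a_{k-1}p^{k-i-2}+\dots+a_{i+1}$, and in particular $n_2^{k-1}=a_k-1$. The maps $\iota_{KLR}$ give a chain of injections $\mathsf{TL}_{n_2^{k-1}}^{\mathbb Z_{(p)}}\to\mathsf{TL}_{n_2^{k-2}}^{\mathbb Z_{(p)}}\to\dots\to\mathsf{TL}_{n_2^0}^{\mathbb Z_{(p)}}\to\mathsf{TL}_n^{\mathbb Z_{(p)}}$, and $\iota_k$ is the composite. *)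

theory Defs
  imports
    Complex_Main
    "HOL-Library.FuncSet"
    "HOL-Library.Disjoint_Sets"
    "HOL-Library.Function_Algebras"
    "HOL-Computational_Algebra.Primes"
    "HOL-Number_Theory.Cong"
    "HOL-Combinatorics.Transposition"
begin

datatype pt = Top nat | Bot nat

type_synonym dia = "pt set set"

text \<open>A diagram is a perfect matching of the \<open>N\<close> top and \<open>N\<close> bottom points, given as its set of
  edges. Non-crossing refers to the cyclic order of the points on the boundary of the
  rectangle, top points from left to right and then bottom points from right to left.\<close>

definition points :: "nat \<Rightarrow> pt set" where
  "points N = Top ` {1..N} \<union> Bot ` {1..N}"

fun circ_pos :: "nat \<Rightarrow> pt \<Rightarrow> nat" where
  "circ_pos N (Top i) = i"
| "circ_pos N (Bot i) = 2 * N + 1 - i"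

definition noncrossing :: "nat \<Rightarrow> dia \<Rightarrow> bool" where
  "noncrossing N D \<longleftrightarrow>
     \<not> (\<exists>e\<in>D. \<exists>e'\<in>D. \<exists>a\<in>e. \<exists>b\<in>e. \<exists>c\<in>e'. \<exists>d\<in>e'.
          circ_pos N a < circ_pos N c \<and> circ_pos N c < circ_pos N b \<and> circ_pos N b < circ_pos N d)"

definition diagrams :: "nat \<Rightarrow> dia set" where
  "diagrams N = {D. partition_on (points N) D \<and> (\<forall>e\<in>D. card e = 2) \<and> noncrossing N D}"

text \<open>Stacking \<open>D1\<close> on top of \<open>D2\<close> gives a graph on three layers of points \<open>(0,i)\<close>, \<open>(1,i)\<close>,
  \<open>(2,i)\<close>, the bottom points of \<open>D1\<close> being identified with the top points of \<open>D2\<close> in layer 1.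
  The edges of the composite diagram are the traces on the outer layers of the connected
  components; the components contained in layer 1 are the loops.\<close>

fun upper :: "pt \<Rightarrow> nat \<times> nat" where
  "upper (Top i) = (0, i)"
| "upper (Bot i) = (1, i)"

fun lower :: "pt \<Rightarrow> nat \<times> nat" where
  "lower (Top i) = (1, i)"
| "lower (Bot i) = (2, i)"

fun outer :: "pt \<Rightarrow> nat \<times> nat" where
  "outer (Top i) = (0, i)"
| "outer (Bot i) = (2, i)"

definition glue :: "dia \<Rightarrow> dia \<Rightarrow> (nat \<times> nat) set set" where
  "glue D1 D2 = (`) upper ` D1 \<union> (`) lower ` D2"

definition components :: "dia \<Rightarrow> dia \<Rightarrow> (nat \<times> nat) set set" where
  "components D1 D2 =
     \<Union> (glue D1 D2) // {(x, y). \<exists>e\<in>glue D1 D2. x \<in> e \<and> y \<in> e}\<^sup>+"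

definition dia_comp :: "dia \<Rightarrow> dia \<Rightarrow> dia" where
  "dia_comp D1 D2 = (\<lambda>K. outer -` K) ` components D1 D2 - {{}}"

definition loops :: "dia \<Rightarrow> dia \<Rightarrow> nat" where
  "loops D1 D2 = card {K \<in> components D1 D2. outer -` K = {}}"

text \<open>Elements are coefficient functions on diagrams, with pointwise addition. The algebra over
  a subring \<open>R\<close> of the rationals is the \<open>R\<close>-span of the diagrams.\<close>

type_synonym tl = "dia \<Rightarrow> rat"

definition TL :: "nat \<Rightarrow> rat set \<Rightarrow> tl set" where
  "TL N R = {x. (\<forall>D. x D \<in> R) \<and> (\<forall>D. D \<notin> diagrams N \<longrightarrow> x D = 0)}"

definition localized_int :: "nat \<Rightarrow> rat set" where
  "localized_int p = {of_int a / of_int b | a b. \<not> int p dvd b}"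

definition scale :: "rat \<Rightarrow> tl \<Rightarrow> tl" where
  "scale c x = (\<lambda>D. c * x D)"

definition basis :: "dia \<Rightarrow> tl" where
  "basis D = (\<lambda>D'. if D' = D then 1 else 0)"

definition tl_mult :: "nat \<Rightarrow> tl \<Rightarrow> tl \<Rightarrow> tl" where
  "tl_mult N x y =
     (\<Sum>D1\<in>diagrams N. \<Sum>D2\<in>diagrams N.
        scale (x D1 * y D2 * 2 ^ loops D1 D2) (basis (dia_comp D1 D2)))"

definition tl_one :: "nat \<Rightarrow> tl" where
  "tl_one N = basis ((\<lambda>i. {Top i, Bot i}) ` {1..N})"

definition tl_u :: "nat \<Rightarrow> nat \<Rightarrow> tl" where
  "tl_u N i = basis ({{Top i, Top (i + 1)}, {Bot i, Bot (i + 1)}} \<union>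
                     (\<lambda>j. {Top j, Bot j}) ` ({1..N} - {i, i + 1}))"

definition tl_prod :: "nat \<Rightarrow> tl list \<Rightarrow> tl" where
  "tl_prod N xs = foldr (tl_mult N) xs (tl_one N)"

definition Par2 :: "nat \<Rightarrow> nat list set" where
  "Par2 N = {lam. sorted_wrt (\<ge>) lam \<and> (\<forall>x\<in>set lam. 1 \<le> x \<and> x \<le> 2) \<and> sum_list lam = N}"

text \<open>Boxes are pairs (row, column), counted from 1.\<close>

definition young :: "nat list \<Rightarrow> (nat \<times> nat) set" where
  "young lam = {(r, c). 1 \<le> r \<and> r \<le> length lam \<and> 1 \<le> c \<and> c \<le> lam ! (r - 1)}"

text \<open>A tableau is encoded by the map sending each entry to the box that contains it; this map is
  made unique by requiring the value \<open>undefined\<close> outside the set of entries.\<close>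

type_synonym tab = "nat \<Rightarrow> nat \<times> nat"

definition Std :: "nat list \<Rightarrow> tab set" where
  "Std lam = {t. t \<in> extensional {1..sum_list lam} \<and>
     bij_betw t {1..sum_list lam} (young lam) \<and>
     (\<forall>i\<in>{1..sum_list lam}. \<forall>j\<in>{1..sum_list lam}.
        (fst (t i) = fst (t j) \<and> snd (t i) < snd (t j) \<longrightarrow> i < j) \<and>
        (snd (t i) = snd (t j) \<and> fst (t i) < fst (t j) \<longrightarrow> i < j))}"

definition Std2 :: "nat \<Rightarrow> tab set" where
  "Std2 N = (\<Union>lam\<in>Par2 N. Std lam)"

definition cont :: "tab \<Rightarrow> nat \<Rightarrow> int" where
  "cont t i = int (snd (t i)) - int (fst (t i))"

definition one_column :: "nat \<Rightarrow> tab" where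
  "one_column N = restrict (\<lambda>i. (i, 1)) {1..N}"

text \<open>The shape of the restriction to the entries up to \<open>m\<close>, as the function giving the length
  of each row.\<close>

definition shape_upto :: "tab \<Rightarrow> nat \<Rightarrow> nat \<Rightarrow> nat" where
  "shape_upto t m r = card {i\<in>{1..m}. fst (t i) = r}"

definition tab_le :: "nat \<Rightarrow> tab \<Rightarrow> tab \<Rightarrow> bool" where
  "tab_le N s t \<longleftrightarrow>
     (\<forall>m\<le>N. \<forall>j. (\<Sum>r=1..j. shape_upto s m r) \<le> (\<Sum>r=1..j. shape_upto t m r))"

definition tab_less :: "nat \<Rightarrow> tab \<Rightarrow> tab \<Rightarrow> bool" where
  "tab_less N s t \<longleftrightarrow> tab_le N s t \<and> s \<noteq> t"

definition swap_entries :: "tab \<Rightarrow> nat \<Rightarrow> tab" where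
  "swap_entries t l = t \<circ> transpose l (l + 1)"

text \<open>The tableau obtained by placing \<open>1, 2, \<dots>\<close> in order at the end of the prescribed columns.\<close>

definition tab_of_columns :: "nat list \<Rightarrow> tab" where
  "tab_of_columns cs =
     restrict (\<lambda>i. (count_list (take i cs) (cs ! (i - 1)), cs ! (i - 1))) {1..length cs}"

text \<open>\<open>jm N i\<close> is the image under \<open>\<Phi>\<close> of the Jucys-Murphy element \<open>L_i\<close>. As \<open>\<Phi>\<close> is a homomorphism
  with \<open>s_i \<mapsto> u_i - 1\<close>, its value at a transposition is read off from
  \<open>(j,i) = s_{i-1} \<cdots> s_{j+1} s_j s_{j+1} \<cdots> s_{i-1}\<close>.\<close>

definition Phi_s :: "nat \<Rightarrow> nat \<Rightarrow> tl" where
  "Phi_s N i = tl_u N i - tl_one N"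

definition Phi_transp :: "nat \<Rightarrow> nat \<Rightarrow> nat \<Rightarrow> tl" where
  "Phi_transp N j i = tl_prod N (map (Phi_s N) (rev [j + 1..<i] @ [j] @ [j + 1..<i]))"

definition jm :: "nat \<Rightarrow> nat \<Rightarrow> tl" where
  "jm N i = (\<Sum>j=1..<i. Phi_transp N j i)"

definition contents :: "nat \<Rightarrow> int set" where
  "contents N = {cont s i | s i. s \<in> Std2 N \<and> i \<in> {1..N}}"

text \<open>The elements \<open>jm N i\<close> commute, so the order of the factors does not matter; the one chosen
  here is lexicographic in \<open>(c, i)\<close>.\<close>

definition seminormal_idem :: "nat \<Rightarrow> tab \<Rightarrow> tl" where
  "seminormal_idem N t =
     tl_prod N [scale (1 / of_int (cont t i - c)) (jm N i - scale (of_int c) (tl_one N)).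
                c \<leftarrow> sorted_list_of_set (contents N), i \<leftarrow> [1..<N + 1], c \<noteq> cont t i]"

text \<open>\<open>half_dia t m\<close> is the pair of the arcs drawn after reading the entries \<open>1..m\<close> and the list of
  vertical lines still vacant, the rightmost one first.\<close>

primrec half_dia :: "tab \<Rightarrow> nat \<Rightarrow> nat set set \<times> nat list" where
  "half_dia t 0 = ({}, [])"
| "half_dia t (Suc m) =
     (let (A, vs) = half_dia t m in
        if snd (t (Suc m)) = 1 then (A, Suc m # vs)
        else (insert {hd vs, Suc m} A, tl vs))"

definition cell_dia :: "nat \<Rightarrow> tab \<Rightarrow> tab \<Rightarrow> dia" where
  "cell_dia N s t =
     (`) Top ` fst (half_dia s N) \<union> (`) Bot ` fst (half_dia t N) \<union>
     (\<lambda>(x, y). {Top x, Bot y}) ` set (zip (snd (half_dia s N)) (snd (half_dia t N)))"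

definition fbasis :: "nat \<Rightarrow> tab \<Rightarrow> tab \<Rightarrow> tl" where
  "fbasis N s t = tl_prod N [seminormal_idem N s, basis (cell_dia N s t), seminormal_idem N t]"

definition top_exp :: "nat \<Rightarrow> nat \<Rightarrow> nat" where
  "top_exp p n = (GREATEST k. p ^ k \<le> n + 1)"

definition digit :: "nat \<Rightarrow> nat \<Rightarrow> nat \<Rightarrow> nat" where
  "digit p n j = (n + 1) div p ^ j mod p"

definition signed_value :: "nat \<Rightarrow> nat \<Rightarrow> (nat \<Rightarrow> int) \<Rightarrow> int" where
  "signed_value p n sg =
     int (digit p n (top_exp p n) * p ^ top_exp p n)
     + (\<Sum>j<top_exp p n. sg j * int (digit p n j * p ^ j)) - 1"

definition sign_choices :: "(nat \<Rightarrow> int) set" where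
  "sign_choices = {sg. \<forall>j. sg j \<in> {1, -1}}"

definition jw_index :: "nat \<Rightarrow> nat \<Rightarrow> int set" where
  "jw_index p n = signed_value p n ` sign_choices"

text \<open>The signs of the nonzero digits are determined by \<open>m\<close>; the other ones are arbitrary, and
  do not affect \<open>jw_tab\<close>, since a digit 0 contributes no entries.\<close>

definition signs_of :: "nat \<Rightarrow> nat \<Rightarrow> int \<Rightarrow> nat \<Rightarrow> int" where
  "signs_of p n m = (SOME sg. sg \<in> sign_choices \<and> signed_value p n sg = m)"

definition jw_tab :: "nat \<Rightarrow> nat \<Rightarrow> int \<Rightarrow> tab" where
  "jw_tab p n m = tab_of_columns
     (replicate (digit p n (top_exp p n) * p ^ top_exp p n - 1) 1 @
      concat (map (\<lambda>j. replicate (digit p n j * p ^ j) (if signs_of p n m j = 1 then 1 else 2))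
                  (rev [0..<top_exp p n])))"

definition pJW :: "nat \<Rightarrow> nat \<Rightarrow> tl" where
  "pJW p n = (\<Sum>m\<in>jw_index p n. seminormal_idem n (jw_tab p n m))"

definition residue_block :: "nat \<Rightarrow> nat \<Rightarrow> tab set" where
  "residue_block p N =
     {s \<in> Std2 N. \<forall>i\<in>{1..N}. [cont s i = cont (one_column N) i] (mod int p)}"

definition block_idem :: "nat \<Rightarrow> nat \<Rightarrow> tl" where
  "block_idem p N = (\<Sum>s\<in>residue_block p N. seminormal_idem N s)"

definition axial :: "tab \<Rightarrow> nat \<Rightarrow> int" where
  "axial s l = cont s l - cont s (l + 1)"

definition alpha :: "nat \<Rightarrow> tab \<Rightarrow> nat \<Rightarrow> rat" where
  "alpha N s l =
     (if tab_less N (swap_entries s l) s then 1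
      else (of_int (axial s l) ^ 2 - 1) / of_int (axial s l) ^ 2)"

definition beta :: "nat \<Rightarrow> nat \<Rightarrow> tab \<Rightarrow> nat \<Rightarrow> rat" where
  "beta p N s l =
     (if swap_entries s l \<notin> Std2 N then 0
      else if [axial s l = 0] (mod int p) then alpha N s l / (1 - of_int (axial s l))
      else if [axial s l = 1] (mod int p) then alpha N s l * of_int (axial s l)
      else alpha N s l * of_int (axial s l) / (1 - of_int (axial s l)))"

definition delta :: "nat \<Rightarrow> tab \<Rightarrow> nat \<Rightarrow> rat" where
  "delta p s l = (if [axial s l = 0] (mod int p) then 1 else 0)"

definition psi :: "nat \<Rightarrow> nat \<Rightarrow> nat \<Rightarrow> tl" where
  "psi p N l = (THE x. x \<in> TL N UNIV \<and>
     (\<forall>lam\<in>Par2 N. \<forall>s\<in>Std lam. \<forall>a\<in>Std lam.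
        tl_mult N x (fbasis N s a) =
          (if swap_entries s l \<in> Std2 N
           then scale (beta p N s l) (fbasis N (swap_entries s l) a) else 0)
          - scale (delta p s l / of_int (axial s l)) (fbasis N s a)))"

text \<open>\<open>Psi p N i j\<close> is the product of \<open>\<psi>_{I-j+1+2a}\<close> for \<open>0 \<le> a < j\<close>, where \<open>I = (i+1)p - 1\<close>.\<close>

definition Psi :: "nat \<Rightarrow> nat \<Rightarrow> nat \<Rightarrow> nat \<Rightarrow> tl" where
  "Psi p N i j = tl_prod N (map (\<lambda>a. psi p N ((i + 1) * p - j + 2 * a)) [0..<j])"

definition diamond :: "nat \<Rightarrow> nat \<Rightarrow> nat \<Rightarrow> tl" where
  "diamond p N i = tl_prod N
     ([block_idem p N] @ map (Psi p N i) ([1..<p] @ [p] @ rev [1..<p]) @ [block_idem p N])"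

text \<open>The number \<open>N_2\<close> in \<open>N = (p - 1) + p N_2 + r_0\<close> with \<open>0 \<le> r_0 < p\<close>, for \<open>N \<ge> p - 1\<close>.\<close>

definition next_rank :: "nat \<Rightarrow> nat \<Rightarrow> nat" where
  "next_rank p N = (N - (p - 1)) div p"

text \<open>The defining property of the injection \<open>\<iota>_KLR\<close>: an injective, non-unital homomorphism of
  \<open>\<int>_(p)\<close>-algebras with the prescribed values at the unit and at the generators. It determines
  the map on its domain \<open>TL (next_rank p N) (localized_int p)\<close>.\<close>

definition is_iota_KLR :: "nat \<Rightarrow> nat \<Rightarrow> (tl \<Rightarrow> tl) \<Rightarrow> bool" where
  "is_iota_KLR p N \<phi> \<longleftrightarrow>
     (let M = next_rank p N; A = TL M (localized_int p) in
        \<phi> \<in> A \<rightarrow> TL N (localized_int p) \<and>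
        inj_on \<phi> A \<and>
        (\<forall>x\<in>A. \<forall>y\<in>A. \<phi> (x + y) = \<phi> x + \<phi> y) \<and>
        (\<forall>c\<in>localized_int p. \<forall>x\<in>A. \<phi> (scale c x) = scale c (\<phi> x)) \<and>
        (\<forall>x\<in>A. \<forall>y\<in>A. \<phi> (tl_mult M x y) = tl_mult N (\<phi> x) (\<phi> y)) \<and>
        \<phi> (tl_one M) = block_idem p N \<and>
        (\<forall>i. 1 \<le> i \<and> i < M \<longrightarrow> \<phi> (tl_u M i) = diamond p N i))"

text \<open>\<open>chain_rank p n i\<close> is \<open>n^i\<close>, so that \<open>n_2^i\<close> is \<open>chain_rank p n (Suc i)\<close>.\<close>

primrec chain_rank :: "nat \<Rightarrow> nat \<Rightarrow> nat \<Rightarrow> nat" where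
  "chain_rank p n 0 = n"
| "chain_rank p n (Suc i) = next_rank p (chain_rank p n i)"

primrec chain_comp :: "(nat \<Rightarrow> tl \<Rightarrow> tl) \<Rightarrow> nat \<Rightarrow> tl \<Rightarrow> tl" where
  "chain_comp \<iota> 0 = id"
| "chain_comp \<iota> (Suc k) = chain_comp \<iota> k \<circ> \<iota> k"

end

theory Submission
  imports Defs
begin

text \<open>
  Let \<open>u_i\<close> act as \<open>1 - s_i\<close> on functions of subsets of \<open>{1..N}\<close>, that is, on a tensor power of the
  two-dimensional module. There is one highest weight vector for each two-column tableau; these
  vectors span a faithful module, and the Jucys-Murphy elements act on them by contents. Hence \<open>E_t\<close>
  is the projection onto the vector of \<open>t\<close>, and an element that acts diagonally is determined by its
  eigenvalues. A tableau is a walk that goes up (first column) or down (second column).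

  The KLR generators \<open>\<psi>_l\<close> act on walks by explicit coefficients. The residue block of the one-column
  tableau consists of the walks that are constant on the intervals \<open>[ip, (i+1)p)\<close>: they are the walks of
  length \<open>N_2\<close>, stretched by \<open>p\<close>. Multiplying the coefficients along the diamond shows that it acts on
  a stretched walk with a peak that rises from height \<open>m p - 1\<close> with the diagonal coefficient
  \<open>(m + 1) / m\<close>, which is that of \<open>u_i\<close> on the walk before stretching. This coefficient and
  \<open>u_i\<^sup>2 = 2 u_i\<close> already force the Jucys-Murphy elements to act by the contents of the short walks. So
  \<open>\<iota>_KLR\<close> turns an element that acts diagonally on short walks into one that acts with the same
  eigenvalues on stretched walks. Iterating, \<open>\<iota>_k(E)\<close> is the projection onto the walks that are constant on the
  intervals cut out by the base-\<open>p\<close> digits of \<open>n + 1\<close> and start with \<open>a_k p^k - 1\<close> steps up, and these are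
  the tableaux \<open>t_m\<close>.
\<close>

section \<open>Non-crossing involutions\<close>

text \<open>Diagrams compose through connected components, and this definition does not show that
  the composite is non-crossing. The detour over matrices settles this together with associativity
  and linear independence, at the price of an induction that builds every diagram by multiplying
  with generators on both sides. The injections are prescribed only over the localised integers and
  only at the unit and the generators, whereas \<open>E_t\<close> may have denominators divisible by
  p and then lies outside their domain. An element is therefore transported by multiplying it with a
  product of Jucys-Murphy factors without denominators; this isolates one walk up to a nonzero
  rational scalar, which is cancelled after the injection has been applied. The KLR generators are
  prescribed on the elements \<open>f_st\<close>, so the walk vectors are rescaled until the
  coefficients appear unchanged. Along the diamond the coefficients met on the way in and out cancel
  in pairs, except at axial distances congruent to 1 or -1 modulo p; these exceptions and the
  degenerate generators at the apex produce \<open>(m + 1) / m\<close>.\<close>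

text \<open>A diagram is encoded by the involution that matches the positions of its points on the circle.\<close>

definition nc_inv :: "nat \<Rightarrow> (nat \<Rightarrow> nat) \<Rightarrow> bool" where
  "nc_inv n \<pi> \<longleftrightarrow>
     (\<forall>c\<in>{1..n}. \<pi> c \<in> {1..n} \<and> \<pi> c \<noteq> c \<and> \<pi> (\<pi> c) = c) \<and>
     (\<forall>a\<in>{1..n}. \<forall>c\<in>{1..n}. \<not> (a < c \<and> c < \<pi> a \<and> \<pi> a < \<pi> c))"

definition openers :: "nat \<Rightarrow> (nat \<Rightarrow> nat) \<Rightarrow> nat set" where
  "openers n \<pi> = {c \<in> {1..n}. c < \<pi> c}"

text \<open>The effect on a diagram of multiplying by a generator at adjacent points
  \<open>a\<close>, \<open>b\<close> that are not yet joined: the cup joins the two points, and the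
  cap connects their former partners.\<close>

definition move :: "nat \<Rightarrow> nat \<Rightarrow> (nat \<Rightarrow> nat) \<Rightarrow> nat \<Rightarrow> nat" where
  "move a b \<pi> = (\<lambda>x. if x = a then b else if x = b then a
     else if x = \<pi> a then \<pi> b else if x = \<pi> b then \<pi> a else \<pi> x)"

lemma nc_invD:
  assumes "nc_inv n \<pi>" "c \<in> {1..n}"
  shows "\<pi> c \<in> {1..n}" "\<pi> c \<noteq> c" "\<pi> (\<pi> c) = c"
  using assms unfolding nc_inv_def by auto

lemma nc_inv_nocross:
  assumes "nc_inv n \<pi>" "a \<in> {1..n}" "c \<in> {1..n}" "a < c" "c < \<pi> a"
  shows "\<pi> c < \<pi> a"
proof -
  have "\<pi> c \<noteq> \<pi> a" using nc_invD[OF assms(1)] assms by (metis less_irrefl)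
  then show ?thesis using assms unfolding nc_inv_def by (meson linorder_neqE_nat)
qed

lemma nc_inv_nocross_ge:
  assumes "nc_inv n \<pi>" "a \<in> {1..n}" "c \<in> {1..n}" "a < c" "c < \<pi> a"
  shows "a < \<pi> c"
proof (rule ccontr)
  assume "\<not> a < \<pi> c"
  moreover have "\<pi> c \<noteq> a" using nc_invD[OF assms(1)] assms by (metis less_irrefl)
  ultimately have "\<pi> c < a" by simp
  moreover have "\<pi> (\<pi> c) = c" "\<pi> c \<in> {1..n}" using nc_invD[OF assms(1)] assms by auto
  ultimately show False using nc_inv_nocross[OF assms(1), of "\<pi> c" a] assms by auto
qed

lemma finite_openers [simp]: "finite (openers n \<pi>)"
  by (simp add: openers_def)

lemma even_card_involution:
  assumes "finite A" "\<And>x. x \<in> A \<Longrightarrow> f x \<in> A \<and> f x \<noteq> x \<and> f (f x) = x"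
  shows "even (card A)"
  using assms
proof (induction "card A" arbitrary: A rule: less_induct)
  case less
  show ?case
  proof (cases "A = {}")
    case False
    then obtain x where x: "x \<in> A" by auto
    define B where "B = A - {x, f x}"
    have fx: "f x \<in> A" "f x \<noteq> x" "f (f x) = x" using less x by auto
    have c: "card A = card B + 2"
    proof -
      have "A = insert x (insert (f x) B)" using x fx unfolding B_def by auto
      then show ?thesis using fx less.prems(1) unfolding B_def
        by (metis (no_types, lifting) Diff_iff Diff_insert2 One_nat_def Suc_1 add_2_eq_Suc' card_Suc_Diff1
            finite_Diff insertE singletonD x insert_iff)
    qed
    have "even (card B)"
    proof (rule less.hyps)
      show "card B < card A" using c by simp
      show "finite B" unfolding B_def using less.prems by auto
      fix y assume "y \<in> B"
      then show "f y \<in> B \<and> f y \<noteq> y \<and> f (f y) = y" unfolding B_def using less.prems(2) x fx by (metis Diff_iff insert_iff empty_iff)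
    qed
    then show ?thesis using c by simp
  qed simp
qed

text \<open>The points strictly between the two ends of an arc are matched among themselves, so
  their number is even.\<close>

lemma nc_inv_parity:
  assumes "nc_inv n \<pi>" "c \<in> {1..n}"
  shows "even (\<pi> c) \<longleftrightarrow> odd c"
proof -
  have *: "even (\<pi> c) \<longleftrightarrow> odd c" if c: "c \<in> {1..n}" "c < \<pi> c" for c
  proof -
    define A where "A = {c<..<\<pi> c}"
    have "even (card A)"
    proof (rule even_card_involution)
      show "finite A" unfolding A_def by simp
      fix x assume x: "x \<in> A"
      then have "x \<in> {1..n}" unfolding A_def using c nc_invD[OF assms(1) c(1)] by auto
      then show "\<pi> x \<in> A \<and> \<pi> x \<noteq> x \<and> \<pi> (\<pi> x) = x"
        using x nc_inv_nocross[OF assms(1) c(1), of x] nc_inv_nocross_ge[OF assms(1) c(1), of x] nc_invD[OF assms(1)]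
        unfolding A_def by auto
    qed
    then show ?thesis unfolding A_def using c by auto
  qed
  have "c < \<pi> c \<or> \<pi> c < c" using nc_invD[OF assms] by auto
  then show ?thesis using *[of c] *[of "\<pi> c"] nc_invD[OF assms] assms by auto
qed

text \<open>Openers and closers form a bracket sequence, and non-crossing leaves only the usual
  bracket matching. It is enough to compare the partners of closers, by induction from left to
  right.\<close>

lemma openers_unique:
  assumes a: "nc_inv n \<pi>" and b: "nc_inv n \<pi>'" and o: "openers n \<pi> = openers n \<pi>'" and c: "c \<in> {1..n}"
  shows "\<pi> c = \<pi>' c"
proof -
  have O: "c < \<pi> c \<longleftrightarrow> c < \<pi>' c" if "c \<in> {1..n}" for c using o that unfolding openers_def by blast
  \<comment> \<open>At the least closer \<open>y\<close> where the matchings differ, with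
    \<open>\<pi>1 y < \<pi>2 y\<close>, the opener \<open>\<pi>2 y\<close> lies under the arc of
    \<open>\<pi>1\<close> that ends in \<open>y\<close>. Its partner under \<open>\<pi>1\<close> is
    thus a smaller closer, where the matchings already agree.\<close>
  have key: False if nc1: "nc_inv n \<pi>1" and nc2: "nc_inv n \<pi>2"
     and O: "\<And>c. c \<in> {1..n} \<Longrightarrow> c < \<pi>1 c \<longleftrightarrow> c < \<pi>2 c"
     and IH: "\<And>y'. y' \<in> {1..n} \<Longrightarrow> y' < y \<Longrightarrow> \<pi>1 y' < y' \<Longrightarrow> \<pi>1 y' = \<pi>2 y'"
     and y: "y \<in> {1..n}" "\<pi>1 y < y" "\<pi>1 y < \<pi>2 y" for \<pi>1 \<pi>2 y
  proof -
    define x where "x = \<pi>2 y"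
    have x: "x \<in> {1..n}" "\<pi>2 x = y" using nc_invD[OF nc2 y(1)] unfolding x_def by auto
    have xy: "x < y" using O[OF y(1)] y nc_invD[OF nc2 y(1)] unfolding x_def by auto
    then have ox: "x < \<pi>1 x" using O[OF x(1)] x by auto
    define y' where "y' = \<pi>1 x"
    have y': "y' \<in> {1..n}" "\<pi>1 y' = x" using nc_invD[OF nc1 x(1)] unfolding y'_def by auto
    have p: "\<pi>1 y \<in> {1..n}" "\<pi>1 (\<pi>1 y) = y" using nc_invD[OF nc1 y(1)] by auto
    have "y' < y" using nc_inv_nocross[OF nc1 p(1) x(1)] xy y p unfolding x_def y'_def by auto
    then have "\<pi>1 y' = \<pi>2 y'" using IH y' ox unfolding y'_def by auto
    then have "\<pi>2 y' = x" using y' by simp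
    then have "y' = y" using x nc_invD[OF nc2 y'(1)] by metis
    then show False using \<open>y' < y\<close> by simp
  qed
  have closers: "\<pi> y = \<pi>' y" if "y \<in> {1..n}" "\<pi> y < y" for y
    using that
  proof (induction y rule: less_induct)
    case (less y)
    have "\<pi>' y < y" using O[OF less.prems(1)] less.prems nc_invD[OF b less.prems(1)] by auto
    show ?case
    proof (rule ccontr)
      assume "\<pi> y \<noteq> \<pi>' y"
      then consider "\<pi> y < \<pi>' y" | "\<pi>' y < \<pi> y" by linarith
      then show False
      proof cases
        case 1
        show False by (rule key[OF a b O _ _ _ 1]) (use less in auto)
      next
        case 2
        show False
        proof (rule key[OF b a _ _ _ _ 2])
          fix y' assume y': "y' \<in> {1..n}" "y' < y" "\<pi>' y' < y'"
          then have "\<pi> y' < y'" using O[OF y'(1)] nc_invD[OF a y'(1)] by auto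
          then show "\<pi>' y' = \<pi> y'" using less y' by simp
        qed (use O less \<open>\<pi>' y < y\<close> in auto)
      qed
    qed
  qed
  show ?thesis
  proof (cases "\<pi> c < c")
    case False
    then have "c < \<pi> c" using nc_invD[OF a c] by auto
    then have "\<pi> (\<pi> c) = \<pi>' (\<pi> c)" using closers nc_invD[OF a c] by auto
    then have "c = \<pi>' (\<pi> c)" using nc_invD[OF a c] by auto
    then show ?thesis using nc_invD[OF a c] nc_invD[OF b] by metis
  qed (use closers c in auto)
qed

lemma move_eqs:
  assumes "nc_inv n \<pi>" "a \<in> {1..n}" "b \<in> {1..n}" "a \<noteq> b" "\<pi> a \<noteq> b"
  shows "move a b \<pi> a = b" "move a b \<pi> b = a" "move a b \<pi> (\<pi> a) = \<pi> b" "move a b \<pi> (\<pi> b) = \<pi> a"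
    and "\<And>x. x \<notin> {a, b, \<pi> a, \<pi> b} \<Longrightarrow> move a b \<pi> x = \<pi> x"
    and "\<pi> a \<noteq> a" "\<pi> b \<noteq> b" "\<pi> b \<noteq> a" "\<pi> a \<noteq> \<pi> b"
proof -
  have *: "\<pi> a \<noteq> a" "\<pi> b \<noteq> b" "\<pi> (\<pi> a) = a" "\<pi> (\<pi> b) = b" using nc_invD[OF assms(1)] assms by auto
  then have **: "\<pi> b \<noteq> a" "\<pi> a \<noteq> \<pi> b" using assms by auto
  then show "\<pi> a \<noteq> a" "\<pi> b \<noteq> b" "\<pi> b \<noteq> a" "\<pi> a \<noteq> \<pi> b" using * by auto
  show "move a b \<pi> a = b" "move a b \<pi> b = a" "move a b \<pi> (\<pi> a) = \<pi> b" "move a b \<pi> (\<pi> b) = \<pi> a"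
    "\<And>x. x \<notin> {a, b, \<pi> a, \<pi> b} \<Longrightarrow> move a b \<pi> x = \<pi> x"
    using * ** assms unfolding move_def by auto
qed

lemma nc_inv_inside_iff:
  assumes nc: "nc_inv n \<pi>" and e: "e \<in> {1..n}" "e < \<pi> e" and z: "z \<in> {1..n}" "z \<noteq> e" "z \<noteq> \<pi> e"
  shows "(e < z \<and> z < \<pi> e) \<longleftrightarrow> (e < \<pi> z \<and> \<pi> z < \<pi> e)"
proof
  assume "e < z \<and> z < \<pi> e"
  then show "e < \<pi> z \<and> \<pi> z < \<pi> e"
    using nc_inv_nocross[OF nc e(1) z(1)] nc_inv_nocross_ge[OF nc e(1) z(1)] by blast
next
  assume *: "e < \<pi> z \<and> \<pi> z < \<pi> e"
  have "\<pi> z \<in> {1..n}" "\<pi> (\<pi> z) = z" using nc_invD[OF nc z(1)] by blast+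
  then show "e < z \<and> z < \<pi> e"
    using nc_inv_nocross[OF nc e(1), of "\<pi> z"] nc_inv_nocross_ge[OF nc e(1), of "\<pi> z"] * by metis
qed

text \<open>Because \<open>a\<close> and \<open>Suc a\<close> are adjacent, an arc that avoids both
  encloses both or neither of them, hence both or neither of their partners. So no old arc crosses
  the new arc between the partners.\<close>

lemma nc_inv_move:
  assumes nc: "nc_inv n \<pi>" and a: "1 \<le> a" "Suc a \<le> n" "\<pi> a \<noteq> Suc a"
  shows "nc_inv n (move a (Suc a) \<pi>)"
proof -
  define b where "b = Suc a"
  let ?m = "move a b \<pi>"
  have ab: "a \<in> {1..n}" "b \<in> {1..n}" "a \<noteq> b" "\<pi> a \<noteq> b" using a unfolding b_def by auto
  note e = move_eqs[OF nc ab]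
  have D: "\<And>c. c \<in> {1..n} \<Longrightarrow> \<pi> c \<in> {1..n} \<and> \<pi> c \<noteq> c \<and> \<pi> (\<pi> c) = c" using nc_invD[OF nc] by blast
  have 1: "?m c \<in> {1..n} \<and> ?m c \<noteq> c \<and> ?m (?m c) = c" if c: "c \<in> {1..n}" for c
  proof (cases "c \<in> {a, b, \<pi> a, \<pi> b}")
    case True
    then consider "c = a" | "c = b" | "c = \<pi> a" | "c = \<pi> b" by blast
    then show ?thesis
    proof cases
      case 1 then show ?thesis using e(1,2) ab by simp
    next
      case 2 then show ?thesis using e(1,2) ab by simp
    next
      case 3 then show ?thesis using e(3,4,9) D[OF ab(2)] by simp
    next
      case 4 then show ?thesis using e(3,4,9) D[OF ab(1)] by simp
    qed
  next
    case False
    then have "\<pi> c \<notin> {a, b, \<pi> a, \<pi> b}" using D[OF c] D[OF ab(1)] D[OF ab(2)] by (metis insertE insert_iff empty_iff)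
    then have "?m (\<pi> c) = \<pi> (\<pi> c)" by (rule e(5))
    moreover have "?m c = \<pi> c" using False by (rule e(5))
    ultimately show ?thesis using D[OF c] by metis
  qed
  have 2: False if x: "x \<in> {1..n}" "y \<in> {1..n}" "x < y" "y < ?m x" "?m x < ?m y" for x y
  proof -
    have "x \<noteq> a" using x e(1) b_def by auto
    have "x \<noteq> b" using x e(2) b_def by auto
    have "y \<noteq> a"
    proof
      assume "y = a"
      then have "?m x < b" using x e(1) by auto
      then show False using x \<open>y = a\<close> b_def by auto
    qed
    have "y \<noteq> b" using x e(2) b_def by auto
    let ?A = "\<pi> a" and ?B = "\<pi> b"
    have nb: "?m x \<noteq> a" "?m x \<noteq> b" "?m y \<noteq> a" "?m y \<noteq> b"
      using 1[OF x(1)] 1[OF x(2)] e(1,2) \<open>x \<noteq> a\<close> \<open>x \<noteq> b\<close> \<open>y \<noteq> a\<close> \<open>y \<noteq> b\<close> by metis+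
    have ins: "(u < ?A \<and> ?A < \<pi> u) \<longleftrightarrow> (u < ?B \<and> ?B < \<pi> u)"
      if u: "u \<in> {1..n}" "u < \<pi> u" "u \<noteq> a" "u \<noteq> b" "\<pi> u \<noteq> a" "\<pi> u \<noteq> b" for u
      using nc_inv_inside_iff[OF nc u(1,2) ab(1)] nc_inv_inside_iff[OF nc u(1,2) ab(2)] u unfolding b_def by auto
    consider "x \<in> {?A, ?B}" "y \<in> {?A, ?B}" | "x \<in> {?A, ?B}" "y \<notin> {?A, ?B}" | "x \<notin> {?A, ?B}" "y \<in> {?A, ?B}" | "x \<notin> {?A, ?B}" "y \<notin> {?A, ?B}"
      by blast
    then show False
    proof cases
      case 1 then show False using e(3,4) x by auto
    next
      case 2
      then have my: "?m y = \<pi> y" using e(5)[of y] \<open>y \<noteq> a\<close> \<open>y \<noteq> b\<close> by auto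
      
      have "y < \<pi> y" using x(4,5) my by simp
      moreover have "\<pi> y \<noteq> a" "\<pi> y \<noteq> b" using nb my by simp_all
      ultimately have i: "(y < ?A \<and> ?A < \<pi> y) \<longleftrightarrow> (y < ?B \<and> ?B < \<pi> y)"
        using ins[OF x(2) _ \<open>y \<noteq> a\<close> \<open>y \<noteq> b\<close>] by blast
      from 2 consider "x = ?A" "?m x = ?B" | "x = ?B" "?m x = ?A" using e(3,4) by blast
      then show False using i x(3,4,5) my by cases (metis less_asym)+
    next
      case 3
      then have mx: "?m x = \<pi> x" using e(5)[of x] \<open>x \<noteq> a\<close> \<open>x \<noteq> b\<close> by auto
      
      have "x < \<pi> x" using x(3,4) mx by simp
      moreover have "\<pi> x \<noteq> a" "\<pi> x \<noteq> b" using nb mx by simp_all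
      ultimately have i: "(x < ?A \<and> ?A < \<pi> x) \<longleftrightarrow> (x < ?B \<and> ?B < \<pi> x)"
        using ins[OF x(1) _ \<open>x \<noteq> a\<close> \<open>x \<noteq> b\<close>] by blast
      from 3 consider "y = ?A" "?m y = ?B" | "y = ?B" "?m y = ?A" using e(3,4) by blast
      then show False using i x(3,4,5) mx by cases (metis less_asym)+
    next
      case 4
      then have "?m x = \<pi> x" "?m y = \<pi> y" using e(5)[of x] e(5)[of y] \<open>x \<noteq> a\<close> \<open>x \<noteq> b\<close> \<open>y \<noteq> a\<close> \<open>y \<noteq> b\<close> by auto
      then show False using nc x unfolding nc_inv_def by (metis (no_types))
    qed
  qed
  show ?thesis unfolding nc_inv_def b_def[symmetric] using 1 2 by blast
qed

lemma card_openers: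
  assumes "nc_inv (2 * N) \<pi>"
  shows "card (openers (2 * N) \<pi>) = N"
proof -
  let ?O = "openers (2 * N) \<pi>"
  have b: "bij_betw \<pi> ?O ({1..2*N} - ?O)"
  proof (rule bij_betwI')
    fix x y assume "x \<in> ?O" "y \<in> ?O"
    then show "(\<pi> x = \<pi> y) = (x = y)" using nc_invD[OF assms] unfolding openers_def by (metis (no_types, lifting) mem_Collect_eq)
  next
    fix x assume "x \<in> ?O"
    then show "\<pi> x \<in> {1..2*N} - ?O" using nc_invD[OF assms, of x] unfolding openers_def by auto
  next
    fix y assume y: "y \<in> {1..2*N} - ?O"
    then have "\<pi> y \<in> ?O" "y = \<pi> (\<pi> y)" using nc_invD[OF assms, of y] unfolding openers_def by auto
    then show "\<exists>x\<in>?O. y = \<pi> x" by blast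
  qed
  have "card ?O = card ({1..2*N} - ?O)" using bij_betw_same_card[OF b] .
  also have "\<dots> = card {1..2*N} - card ?O" by (rule card_Diff_subset) (auto simp: openers_def)
  finally have "card ?O = 2 * N - card ?O" by simp
  moreover have "card ?O \<le> card {1..2*N}" by (rule card_mono) (auto simp: openers_def)
  ultimately show ?thesis by auto
qed

lemma nc_inv_id: "nc_inv (2 * N) (\<lambda>c. 2 * N + 1 - c)"
  unfolding nc_inv_def by auto presburger+

lemma openers_id: "openers (2 * N) (\<lambda>c. 2 * N + 1 - c) = {1..N}"
  unfolding openers_def by auto

definition pt_at :: "nat \<Rightarrow> nat \<Rightarrow> pt" where
  "pt_at N c = (if c \<le> N then Top c else Bot (2 * N + 1 - c))"

definition dia_of :: "nat \<Rightarrow> (nat \<Rightarrow> nat) \<Rightarrow> dia" where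
  "dia_of N \<pi> = (\<lambda>c. {pt_at N c, pt_at N (\<pi> c)}) ` {1..2 * N}"

lemma sum_exchange_less:
  fixes g :: "nat \<Rightarrow> nat"
  assumes "finite O'" "u \<in> O'" "v \<notin> O'" "g u < g v"
  shows "sum g O' < sum g (insert v (O' - {u}))"
proof -
  have "sum g O' = g u + sum g (O' - {u})" using assms by (simp add: sum.remove)
  moreover have "sum g (insert v (O' - {u})) = g v + sum g (O' - {u})" using assms by simp
  ultimately show ?thesis using assms by simp
qed

text \<open>\<open>m\<close> re-pairs four points, from \<open>{y, z}\<close>, \<open>{x, w}\<close>
  to \<open>{x, y}\<close>, \<open>{z, w}\<close>; joining \<open>y\<close> and \<open>z\<close>
  again undoes this. It lets the induction over moves be run from the target back to the
  source.\<close>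

lemma move_restore:
  assumes "m y = x" "m z = w" "\<pi> y = z" "\<pi> z = y" "\<pi> x = w" "\<pi> w = x"
    "\<And>c. c \<notin> {x, y, z, w} \<Longrightarrow> m c = \<pi> c"
  shows "move y z m c = \<pi> c"
proof -
  consider "c = y" | "c = z" | "c \<noteq> y" "c \<noteq> z" "c = x" | "c \<noteq> y" "c \<noteq> z" "c = w" | "c \<notin> {x, y, z, w}" by blast
  then show ?thesis
    by cases (auto simp: move_def assms)
qed

text \<open>This joins \<open>2 * N\<close> and \<open>1\<close>, which are adjacent on the circle
  but not as numbers, so that \<open>nc_inv_move\<close> does not cover it. The way back is an
  ordinary move at \<open>1\<close>, \<open>2\<close>.\<close>

lemma nc_inv_outer_exchange:
  assumes nc: "nc_inv (2 * N) \<pi>" and N: "2 \<le> N" and e: "\<pi> 1 = 2" "\<pi> (2 * N - 1) = 2 * N"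
  defines "\<pi>' \<equiv> (\<lambda>c. if c = 1 then 2 * N else if c = 2 * N then 1 else if c = 2 then 2 * N - 1 else if c = 2 * N - 1 then 2 else \<pi> c)"
  shows "nc_inv (2 * N) \<pi>'"
proof -
  have s: "\<pi>' 1 = 2 * N" "\<pi>' (2 * N) = 1" "\<pi>' 2 = 2 * N - 1" "\<pi>' (2 * N - 1) = 2"
    using N unfolding \<pi>'_def by auto
  have o: "\<pi>' c = \<pi> c" if "3 \<le> c" "c \<le> 2 * N - 2" for c using that N unfolding \<pi>'_def by auto
  have e': "\<pi> 2 = 1" "\<pi> (2 * N) = 2 * N - 1"
    using nc_invD(3)[OF nc, of 1] nc_invD(3)[OF nc, of "2 * N - 1"] N e by auto
  have mid: "3 \<le> \<pi> c \<and> \<pi> c \<le> 2 * N - 2" if c: "3 \<le> c" "c \<le> 2 * N - 2" for c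
  proof -
    have c': "c \<in> {1..2 * N}" using c by auto
    have q: "c = \<pi> z" if "\<pi> c = z" for z using nc_invD(3)[OF nc c'] that by metis
    have "\<pi> c \<noteq> 1" "\<pi> c \<noteq> 2" "\<pi> c \<noteq> 2 * N - 1" "\<pi> c \<noteq> 2 * N"
      using q[of 1] q[of 2] q[of "2 * N - 1"] q[of "2 * N"] e e' c by linarith+
    moreover have "\<pi> c \<in> {1..2 * N}" using nc_invD(1)[OF nc c'] .
    ultimately show ?thesis by auto
  qed
  have cases: "c = 1 \<or> c = 2 \<or> c = 2 * N - 1 \<or> c = 2 * N \<or> (3 \<le> c \<and> c \<le> 2 * N - 2)" if "c \<in> {1..2 * N}" for c
    using that by auto
  have N1: "2 * N - 1 \<noteq> 2" "1 \<le> 2 * N - 1" "2 \<noteq> 2 * N - 1" "2 * N - 1 \<noteq> 2 * N" "2 * N - 1 \<le> 2 * N" using N by arith+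
  have 1: "\<pi>' c \<in> {1..2 * N} \<and> \<pi>' c \<noteq> c \<and> \<pi>' (\<pi>' c) = c" if c: "c \<in> {1..2 * N}" for c
    using cases[OF c]
  proof (elim disjE)
    assume c3: "3 \<le> c \<and> c \<le> 2 * N - 2"
    then have "\<pi>' c = \<pi> c" "\<pi>' (\<pi> c) = \<pi> (\<pi> c)" using o mid by blast+
    then show ?thesis using nc_invD[OF nc c] by metis
  next
    assume "c = 1" then show ?thesis using s(1,2) N by simp
  next
    assume "c = 2" then show ?thesis using s(3,4) N1 by simp
  next
    assume "c = 2 * N - 1" then show ?thesis using s(3,4) N1 N by simp
  next
    assume "c = 2 * N" then show ?thesis using s(1,2) N by simp
  qed
  have 2: False if x: "a \<in> {1..2 * N}" "c \<in> {1..2 * N}" "a < c" "c < \<pi>' a" "\<pi>' a < \<pi>' c" for a c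
    using cases[OF x(1)]
  proof (elim disjE)
    assume "a = 1" then show False using 1[OF x(2)] x s by auto
  next
    assume a: "a = 2"
    then have "2 * N - 1 < \<pi>' c" using x(5) s(3) by simp
    moreover have "\<pi>' c \<le> 2 * N" using 1[OF x(2)] by simp
    ultimately have "\<pi>' c = 2 * N" by linarith
    then have "c = 1" using 1[OF x(2)] s(2) by metis
    then show False using x(3) a by simp
  next
    assume "a = 2 * N - 1" then show False using x s N by auto
  next
    assume "a = 2 * N" then show False using x by auto
  next
    assume a: "3 \<le> a \<and> a \<le> 2 * N - 2"
    then have "3 \<le> c \<and> c \<le> 2 * N - 2" using x(3,4) mid[of a] o[of a] by simp
    then show False using nc_inv_nocross[OF nc x(1,2,3)] x(4,5) o[of a] o[of c] a by simp
  qed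
  show ?thesis unfolding nc_inv_def using 1 2 by blast
qed

section \<open>Translation between diagrams and involutions of boundary positions\<close>

lemma circ_pos_pt_at [simp]: "c \<in> {1..2 * N} \<Longrightarrow> circ_pos N (pt_at N c) = c"
  by (auto simp: pt_at_def)

lemma pt_at_circ_pos [simp]: "x \<in> points N \<Longrightarrow> pt_at N (circ_pos N x) = x"
  by (auto simp: pt_at_def points_def)

lemma circ_pos_in: "x \<in> points N \<Longrightarrow> circ_pos N x \<in> {1..2 * N}"
  by (auto simp: points_def)

lemma pt_at_in: "c \<in> {1..2 * N} \<Longrightarrow> pt_at N c \<in> points N"
  by (cases "c \<le> N") (auto simp: pt_at_def points_def intro!: image_eqI[of _ Bot])

lemma pt_at_eq_iff: "c \<in> {1..2 * N} \<Longrightarrow> d \<in> {1..2 * N} \<Longrightarrow> pt_at N c = pt_at N d \<longleftrightarrow> c = d"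
  by (metis circ_pos_pt_at)

lemma finite_points [simp]: "finite (points N)"
  by (simp add: points_def)

lemma finite_diagrams [simp]: "finite (diagrams N)"
proof (rule finite_subset)
  show "diagrams N \<subseteq> Pow (Pow (points N))"
    unfolding diagrams_def partition_on_def by auto
qed simp

lemma dia_of_cong: "(\<And>c. c \<in> {1..2 * N} \<Longrightarrow> \<pi> c = \<pi>' c) \<Longrightarrow> dia_of N \<pi> = dia_of N \<pi>'"
  unfolding dia_of_def by (intro image_cong) auto

lemma dia_of_in_diagrams:
  assumes nc: "nc_inv (2 * N) \<pi>"
  shows "dia_of N \<pi> \<in> diagrams N"
proof -
  note D = nc_invD[OF nc]
  have 1: "partition_on (points N) (dia_of N \<pi>)"
  proof (rule partition_onI)
    show "\<Union> (dia_of N \<pi>) = points N"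
    proof (rule set_eqI)
      fix x
      show "x \<in> \<Union> (dia_of N \<pi>) \<longleftrightarrow> x \<in> points N"
      proof
        assume "x \<in> \<Union> (dia_of N \<pi>)"
        then show "x \<in> points N" unfolding dia_of_def using pt_at_in D(1) by blast
      next
        assume x: "x \<in> points N"
        then have "x \<in> {pt_at N (circ_pos N x), pt_at N (\<pi> (circ_pos N x))}" by simp
        then show "x \<in> \<Union> (dia_of N \<pi>)" unfolding dia_of_def using circ_pos_in[OF x] by blast
      qed
    qed
    fix p q assume "p \<in> dia_of N \<pi>" "q \<in> dia_of N \<pi>" "p \<noteq> q"
    then obtain c d where c: "c \<in> {1..2*N}" "p = {pt_at N c, pt_at N (\<pi> c)}"
      and d: "d \<in> {1..2*N}" "q = {pt_at N d, pt_at N (\<pi> d)}" unfolding dia_of_def by blast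
    have "c \<noteq> d" "c \<noteq> \<pi> d" using c d \<open>p \<noteq> q\<close> D(3)[OF d(1)] by (metis, metis insert_commute)
    then have "\<pi> c \<noteq> d" "\<pi> c \<noteq> \<pi> d" using D(3)[OF d(1)] D(3)[OF c(1)] by metis+
    then show "disjnt p q"
      using \<open>c \<noteq> d\<close> \<open>c \<noteq> \<pi> d\<close> pt_at_eq_iff[OF c(1) d(1)] pt_at_eq_iff[OF c(1) D(1)[OF d(1)]]
         pt_at_eq_iff[OF D(1)[OF c(1)] d(1)] pt_at_eq_iff[OF D(1)[OF c(1)] D(1)[OF d(1)]]
      unfolding c(2) d(2) by (simp add: disjnt_def)
  next
    show "{} \<notin> dia_of N \<pi>" unfolding dia_of_def by auto
  qed
  have 2: "card e = 2" if h: "e \<in> dia_of N \<pi>" for e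
  proof -
    obtain c where c: "c \<in> {1..2*N}" "e = {pt_at N c, pt_at N (\<pi> c)}" using h unfolding dia_of_def by blast
    have "pt_at N c \<noteq> pt_at N (\<pi> c)" using pt_at_eq_iff[OF c(1) D(1)[OF c(1)]] D(2)[OF c(1)] by metis
    then show ?thesis using c by simp
  qed
  have e: "y = x \<or> circ_pos N y = \<pi> (circ_pos N x)"
    if h: "e \<in> dia_of N \<pi>" "x \<in> e" "y \<in> e" for x y e
  proof -
    obtain c where c: "c \<in> {1..2*N}" "e = {pt_at N c, pt_at N (\<pi> c)}" using h(1) unfolding dia_of_def by blast
    show ?thesis using c h(2,3) D(1)[OF c(1)] D(3)[OF c(1)] circ_pos_pt_at by (metis insertE singletonD)
  qed
  have 3: "noncrossing N (dia_of N \<pi>)"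
    unfolding noncrossing_def
  proof (clarify)
    fix e e' a b c d
    assume h: "e \<in> dia_of N \<pi>" "e' \<in> dia_of N \<pi>" "a \<in> e" "b \<in> e" "c \<in> e'" "d \<in> e'"
      "circ_pos N a < circ_pos N c" "circ_pos N c < circ_pos N b" "circ_pos N b < circ_pos N d"
    have ac: "circ_pos N a \<in> {1..2*N}" "circ_pos N c \<in> {1..2*N}"
      using h 1 circ_pos_in unfolding partition_on_def by blast+
    have "circ_pos N b = \<pi> (circ_pos N a)" "circ_pos N d = \<pi> (circ_pos N c)"
      using e h by (metis less_asym less_trans)+
    then show False using nc_inv_nocross[OF nc ac] h by simp
  qed
  show ?thesis unfolding diagrams_def using 1 2 3 by blast
qed

lemma diagrams_obtain:
  assumes D: "D \<in> diagrams N"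
  obtains \<pi> where "nc_inv (2 * N) \<pi>" "D = dia_of N \<pi>"
proof -
  have P: "partition_on (points N) D" and c2: "\<And>e. e \<in> D \<Longrightarrow> card e = 2" and ncr: "noncrossing N D"
    using D unfolding diagrams_def by auto
  have ex: "\<exists>y. y \<noteq> x \<and> {x, y} \<in> D" if x: "x \<in> points N" for x
  proof -
    obtain e where e: "e \<in> D" "x \<in> e" using P x unfolding partition_on_def by blast
    obtain u v where "e = {u, v}" "u \<noteq> v" using c2[OF e(1)] by (meson card_2_iff)
    then have "e = {x, u} \<and> u \<noteq> x \<or> e = {x, v} \<and> v \<noteq> x" using e(2) by auto
    then show ?thesis using e(1) by metis
  qed
  then obtain f where f: "\<And>x. x \<in> points N \<Longrightarrow> f x \<noteq> x \<and> {x, f x} \<in> D" by metis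
  have fp: "f x \<in> points N" if "x \<in> points N" for x using f[OF that] P unfolding partition_on_def by blast
  have uniq: "e = e'" if "e \<in> D" "e' \<in> D" "x \<in> e" "x \<in> e'" for e e' x
    using P that unfolding partition_on_def disjoint_def by blast
  have ff: "f (f x) = x" if x: "x \<in> points N" for x
  proof -
    have "{f x, f (f x)} = {x, f x}"
      using uniq[of "{f x, f (f x)}" "{x, f x}" "f x"] f[OF x] f[OF fp[OF x]] by blast
    then show ?thesis using f[OF fp[OF x]] by (metis doubleton_eq_iff)
  qed
  define \<pi> where "\<pi> c = circ_pos N (f (pt_at N c))" for c
  have pp: "pt_at N (\<pi> c) = f (pt_at N c)" if "c \<in> {1..2*N}" for c
    unfolding \<pi>_def using fp[OF pt_at_in[OF that]] by simp
  have "nc_inv (2 * N) \<pi>"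
    unfolding nc_inv_def
  proof (intro conjI ballI notI)
    fix c assume c: "c \<in> {1..2*N}"
    note pc = pt_at_in[OF c]
    show "\<pi> c \<in> {1..2*N}" unfolding \<pi>_def by (rule circ_pos_in[OF fp[OF pc]])
    show "\<pi> c = c \<Longrightarrow> False" using pp[OF c] f[OF pc] by metis
    show "\<pi> (\<pi> c) = c" unfolding \<pi>_def[of "\<pi> c"] pp[OF c] ff[OF pc] using c by simp
  next
    fix a c assume a: "a \<in> {1..2*N}" and c: "c \<in> {1..2*N}" and h: "a < c \<and> c < \<pi> a \<and> \<pi> a < \<pi> c"
    have "{pt_at N a, f (pt_at N a)} \<in> D" "{pt_at N c, f (pt_at N c)} \<in> D" using f pt_at_in a c by blast+
    moreover have "circ_pos N (pt_at N a) = a" "circ_pos N (pt_at N c) = c" using a c by simp_all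
    ultimately show False using ncr h unfolding noncrossing_def \<pi>_def
      by (metis insertI1 insertI2)
  qed
  moreover have "D = dia_of N \<pi>"
  proof (rule set_eqI)
    fix e
    show "e \<in> D \<longleftrightarrow> e \<in> dia_of N \<pi>"
    proof
      assume e: "e \<in> D"
      then obtain x where x: "x \<in> e" using P unfolding partition_on_def by (metis all_not_in_conv)
      then have xp: "x \<in> points N" using e P unfolding partition_on_def by blast
      have "e = {x, f x}" using uniq[OF e _ x, of "{x, f x}"] f[OF xp] by blast
      moreover have "pt_at N (\<pi> (circ_pos N x)) = f x" using pp[OF circ_pos_in[OF xp]] xp by simp
      ultimately have "e = {pt_at N (circ_pos N x), pt_at N (\<pi> (circ_pos N x))}" using xp by simp
      then show "e \<in> dia_of N \<pi>" unfolding dia_of_def using circ_pos_in[OF xp] by blast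
    next
      assume "e \<in> dia_of N \<pi>"
      then obtain c where "c \<in> {1..2*N}" "e = {pt_at N c, pt_at N (\<pi> c)}" unfolding dia_of_def by blast
      then show "e \<in> D" using f[OF pt_at_in] pp by metis
    qed
  qed
  ultimately show ?thesis using that by blast
qed

lemma dia_of_id: "dia_of N (\<lambda>c. 2 * N + 1 - c) = (\<lambda>i. {Top i, Bot i}) ` {1..N}"
proof (intro equalityI subsetI)
  fix e assume "e \<in> dia_of N (\<lambda>c. 2 * N + 1 - c)"
  then obtain c where c: "c \<in> {1..2 * N}" "e = {pt_at N c, pt_at N (2 * N + 1 - c)}" unfolding dia_of_def by blast
  show "e \<in> (\<lambda>i. {Top i, Bot i}) ` {1..N}"
  proof (cases "c \<le> N")
    case True
    then have "pt_at N (2 * N + 1 - c) = Bot c" "pt_at N c = Top c" using c by (auto simp: pt_at_def)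
    then have "e = {Top c, Bot c}" using c by simp
    then show ?thesis using c True by auto
  next
    case False
    then have "e = {Bot (2 * N + 1 - c), Top (2 * N + 1 - c)}" using c by (auto simp: pt_at_def)
    moreover have "2 * N + 1 - c \<in> {1..N}" using c False by auto
    ultimately show ?thesis by (metis (mono_tags, lifting) image_eqI insert_commute)
  qed
next
  fix e assume "e \<in> (\<lambda>i. {Top i, Bot i}) ` {1..N}"
  then obtain i where i: "i \<in> {1..N}" "e = {Top i, Bot i}" by blast
  then have "e = {pt_at N i, pt_at N (2 * N + 1 - i)}" "i \<in> {1..2 * N}" by (auto simp: pt_at_def)
  then show "e \<in> dia_of N (\<lambda>c. 2 * N + 1 - c)" unfolding dia_of_def by blast
qed

lemma dia_of_u:
  assumes i: "1 \<le> i" "i < N"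
  shows "dia_of N (move i (Suc i) (\<lambda>c. 2 * N + 1 - c)) =
    {{Top i, Top (i + 1)}, {Bot i, Bot (i + 1)}} \<union> (\<lambda>j. {Top j, Bot j}) ` ({1..N} - {i, i + 1})"
    (is "dia_of N ?m = ?A \<union> ?B")
proof (intro equalityI subsetI)
  fix e assume "e \<in> dia_of N ?m"
  then obtain c where c: "c \<in> {1..2 * N}" "e = {pt_at N c, pt_at N (?m c)}" unfolding dia_of_def by blast
  consider "c = i" | "c = Suc i" | "c = 2 * N + 1 - i" | "c = 2 * N + 1 - Suc i" | "c \<notin> {i, Suc i, 2 * N + 1 - i, 2 * N + 1 - Suc i}"
    by blast
  then show "e \<in> ?A \<union> ?B"
  proof cases
    case 1 then show ?thesis using c i by (simp add: move_def pt_at_def)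
  next
    case 2 then show ?thesis using c i by (auto simp add: move_def pt_at_def)
  next
    case 3
    then have "pt_at N c = Bot i" "?m c = 2 * N - i" using i c by (auto simp: pt_at_def move_def)
    moreover have "pt_at N (2 * N - i) = Bot (i + 1)" using i by (auto simp: pt_at_def)
    ultimately show ?thesis using c by simp
  next
    case 4
    then have "pt_at N c = Bot (i + 1)" "?m c = 2 * N + 1 - i" using i c by (auto simp: pt_at_def move_def)
    moreover have "pt_at N (2 * N + 1 - i) = Bot i" using i by (auto simp: pt_at_def)
    ultimately show ?thesis using c by auto
  next
    case 5
    then have m: "?m c = 2 * N + 1 - c" by (simp add: move_def)
    show ?thesis
    proof (cases "c \<le> N")
      case True
      then have "pt_at N (2 * N + 1 - c) = Bot c" "pt_at N c = Top c" using c by (auto simp: pt_at_def)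
      then have "e = {Top c, Bot c}" using c m by simp
      then show ?thesis using c True 5 by auto
    next
      case False
      then have "e = {Top (2 * N + 1 - c), Bot (2 * N + 1 - c)}" using c m by (auto simp: pt_at_def)
      moreover have "2 * N + 1 - c \<in> {1..N} - {i, i + 1}" using c False 5 by auto
      ultimately show ?thesis by blast
    qed
  qed
next
  fix e assume "e \<in> ?A \<union> ?B"
  then consider "e = {Top i, Top (i + 1)}" | "e = {Bot i, Bot (i + 1)}" | j where "j \<in> {1..N} - {i, i + 1}" "e = {Top j, Bot j}" by blast
  then have "\<exists>c\<in>{1..2 * N}. e = {pt_at N c, pt_at N (?m c)}"
  proof cases
    case 1
    then have "e = {pt_at N i, pt_at N (?m i)}" "i \<in> {1..2 * N}" using i by (auto simp: pt_at_def move_def)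
    then show ?thesis by blast
  next
    case 2
    have "?m (2 * N + 1 - i) = 2 * N - i" using i by (auto simp: move_def)
    then have "e = {pt_at N (2 * N + 1 - i), pt_at N (?m (2 * N + 1 - i))}" "2 * N + 1 - i \<in> {1..2 * N}"
      using 2 i by (auto simp: pt_at_def)
    then show ?thesis by blast
  next
    case 3
    have "?m j = 2 * N + 1 - j" using i 3 by (auto simp: move_def)
    then have "e = {pt_at N j, pt_at N (?m j)}" "j \<in> {1..2 * N}" using 3 by (auto simp: pt_at_def)
    then show ?thesis by blast
  qed
  then show "e \<in> dia_of N ?m" unfolding dia_of_def by blast
qed

text \<open>The identity is the involution whose openers are the top positions. Every other
  involution arises by a move from one whose openers weigh more, so the induction is on the missing
  weight. The condition \<open>a \<noteq> N\<close> keeps the joined points in one row, so that the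
  move is multiplication by a generator from the left or from the right.\<close>

lemma nc_inv_induct [consumes 1, case_names id move cong]:
  assumes nc: "nc_inv (2 * N) \<pi>"
    and id: "P (\<lambda>c. 2 * N + 1 - c)"
    and mv: "\<And>\<pi> a. nc_inv (2 * N) \<pi> \<Longrightarrow> P \<pi> \<Longrightarrow> 1 \<le> a \<Longrightarrow> Suc a \<le> 2 * N \<Longrightarrow> a \<noteq> N \<Longrightarrow> \<pi> a \<noteq> Suc a \<Longrightarrow>
      P (move a (Suc a) \<pi>)"
    and cong: "\<And>\<pi> \<pi>'. P \<pi> \<Longrightarrow> (\<And>c. c \<in> {1..2 * N} \<Longrightarrow> \<pi> c = \<pi>' c) \<Longrightarrow> P \<pi>'"
  shows "P \<pi>"
proof -
  \<comment> \<open>Every top position outweighs every bottom position, and within a row the weight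
    grows with the position. Shifting an opener by one place to the right within a row, or from the
    bottom to the top, therefore raises the total.\<close>
  define g where "g c = (if c \<le> N then 2 * N + c else c)" for c
  define G where "G \<pi> = sum g (openers (2 * N) \<pi>)" for \<pi>
  define B where "B = sum g {1..2 * N}"
  have GB: "G \<pi> \<le> B" for \<pi> unfolding G_def B_def by (rule sum_mono2) (auto simp: openers_def)
  show ?thesis using nc
  proof (induction "B - G \<pi>" arbitrary: \<pi> rule: less_induct)
    case less
    note nc = less.prems
    have O: "c \<in> openers (2 * N) \<pi> \<longleftrightarrow> c \<in> {1..2 * N} \<and> c < \<pi> c" for c \<pi> unfolding openers_def by simp
    have step: "P \<pi>"
      if \<pi>': "nc_inv (2 * N) \<pi>'" and a: "1 \<le> a" "Suc a \<le> 2 * N" "a \<noteq> N" "\<pi>' a \<noteq> Suc a"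
        and ow: "openers (2 * N) \<pi>' = insert v (openers (2 * N) \<pi> - {u})" "u \<in> openers (2 * N) \<pi>"
          "v \<notin> openers (2 * N) \<pi>" "g u < g v"
        and b: "\<And>c. c \<in> {1..2 * N} \<Longrightarrow> move a (Suc a) \<pi>' c = \<pi> c" for \<pi>' a u v
    proof -
      have "G \<pi> < G \<pi>'" unfolding G_def ow(1) by (rule sum_exchange_less) (use ow in auto)
      then have "B - G \<pi>' < B - G \<pi>" using GB[of \<pi>'] by linarith
      then have "P \<pi>'" using less.hyps \<pi>' by blast
      then have "P (move a (Suc a) \<pi>')" using mv \<pi>' a by blast
      then show ?thesis using cong b by blast
    qed
    \<comment> \<open>A short arc \<open>{x + 1, x + 2}\<close> right after an opener
      \<open>x\<close>. The heavier predecessor joins \<open>x\<close> to \<open>x + 1\<close> and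
      lets \<open>x + 2\<close> open the long arc instead; moving at \<open>x + 1\<close> gives
      \<open>\<pi>\<close> back.\<close>
    have A1: "P \<pi>" if x: "1 \<le> x" "x + 2 \<le> 2 * N" "x + 2 \<le> N \<or> N < x" "\<pi> (x + 1) = x + 2" "x < \<pi> x" for x
    proof -
      have r: "x \<in> {1..2 * N}" "x + 1 \<in> {1..2 * N}" "x + 2 \<in> {1..2 * N}" using x by auto
      have d: "\<pi> (x + 2) = x + 1" using nc_invD(3)[OF nc r(2)] x(4) by simp
      have px: "\<pi> x \<noteq> x + 1" "\<pi> x \<noteq> x + 2" using nc_invD(3)[OF nc r(1)] x(4) d by (metis Suc_n_not_le_n add_2_eq_Suc' add.commute le_add2 plus_1_eq_Suc n_not_Suc_n)+
      let ?m = "move x (Suc x) \<pi>"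
      have m: "?m x = x + 1" "?m (x + 1) = x" "?m (x + 2) = \<pi> x" "?m (\<pi> x) = x + 2"
        using move_eqs(1-4)[OF nc r(1,2) _ px(1)] x(4) by simp_all
      have mo: "?m y = \<pi> y" if "y \<notin> {x, x + 1, x + 2, \<pi> x}" for y
        using move_eqs(5)[OF nc r(1,2) _ px(1), of y] that x(4) by simp
      have ncm: "nc_inv (2 * N) ?m" by (rule nc_inv_move[OF nc]) (use x px in auto)
      have p2: "\<pi> (\<pi> x) = x" "\<pi> x \<in> {1..2 * N}" using nc_invD[OF nc r(1)] by auto
      show ?thesis
      proof (rule step[OF ncm, of "x + 1" "x + 2" "x + 1"])
        show "1 \<le> x + 1" "Suc (x + 1) \<le> 2 * N" "x + 1 \<noteq> N" "?m (x + 1) \<noteq> Suc (x + 1)" using x m by auto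
        show "openers (2 * N) ?m = insert (x + 2) (openers (2 * N) \<pi> - {x + 1})"
        proof (rule set_eqI)
          fix y
          consider "y = x" | "y = x + 1" | "y = x + 2" | "y = \<pi> x" | "y \<notin> {x, x + 1, x + 2, \<pi> x}" by blast
          then show "y \<in> openers (2 * N) ?m \<longleftrightarrow> y \<in> insert (x + 2) (openers (2 * N) \<pi> - {x + 1})"
          proof cases
            case 4
            have "\<pi> x > x + 2" using px x(5) by linarith
            then show ?thesis using 4 O m p2 px by auto
          next
            case 5 then show ?thesis using O mo[OF 5] by simp
          qed (use O m x r px in auto)
        qed
        show "x + 1 \<in> openers (2 * N) \<pi>" "x + 2 \<notin> openers (2 * N) \<pi>" using O r x d by auto
        show "g (x + 1) < g (x + 2)" using x unfolding g_def by auto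
        show "move (x + 1) (Suc (x + 1)) ?m c = \<pi> c" for c
        proof -
          have "move (x + 1) (x + 2) ?m c = \<pi> c"
            by (rule move_restore[OF m(2) m(3) x(4) d refl p2(1) mo])
          then show ?thesis by simp
        qed
      qed
    qed
    \<comment> \<open>The mirror case: a short arc \<open>{x, x + 1}\<close> right before a closer
      whose opener \<open>w\<close> lies further left. The predecessor joins \<open>x + 1\<close> to
      \<open>x + 2\<close> and lets \<open>x\<close> close the long arc.\<close>
    have A2: "P \<pi>" if x: "1 \<le> x" "x + 2 \<le> 2 * N" "x + 2 \<le> N \<or> N < x" "\<pi> x = x + 1" "\<pi> (x + 2) < x" for x
    proof -
      have r: "x \<in> {1..2 * N}" "x + 1 \<in> {1..2 * N}" "x + 2 \<in> {1..2 * N}" using x by auto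
      have d: "\<pi> (x + 1) = x" using nc_invD(3)[OF nc r(1)] x(4) by simp
      define w where "w = \<pi> (x + 2)"
      have w: "\<pi> w = x + 2" "w \<in> {1..2 * N}" "w < x" using nc_invD[OF nc r(3)] x(5) unfolding w_def by auto
      let ?m = "move (x + 1) (Suc (x + 1)) \<pi>"
      have m: "?m (x + 1) = x + 2" "?m (x + 2) = x + 1" "?m x = w" "?m w = x"
        and mo: "\<And>y. y \<notin> {x, x + 1, x + 2, w} \<Longrightarrow> ?m y = \<pi> y"
        using move_eqs(1-5)[OF nc r(2,3)] d unfolding w_def[symmetric] by simp_all
      have ncm: "nc_inv (2 * N) ?m" by (rule nc_inv_move[OF nc]) (use x d in auto)
      show ?thesis
      proof (rule step[OF ncm, of x "x + 1" x])
        show "1 \<le> x" "Suc x \<le> 2 * N" "x \<noteq> N" "?m x \<noteq> Suc x" using x m w by auto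
        show "openers (2 * N) ?m = insert (x + 1) (openers (2 * N) \<pi> - {x})"
        proof (rule set_eqI)
          fix y
          consider "y = x" | "y = x + 1" | "y = x + 2" | "y = w" | "y \<notin> {x, x + 1, x + 2, w}" by blast
          then show "y \<in> openers (2 * N) ?m \<longleftrightarrow> y \<in> insert (x + 1) (openers (2 * N) \<pi> - {x})"
          proof cases
            case 3 then show ?thesis using O m w x(5) by auto
          next
            case 5 then show ?thesis using O mo[OF 5] by simp
          qed (use O m x r w in auto)
        qed
        show "x \<in> openers (2 * N) \<pi>" "x + 1 \<notin> openers (2 * N) \<pi>" using O r x d by auto
        show "g x < g (x + 1)" using x unfolding g_def by auto
        show "move x (Suc x) ?m c = \<pi> c" for c
        proof -
          have "?m c = \<pi> c" if "c \<notin> {w, x, x + 1, x + 2}" for c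
            by (rule mo) (use that in blast)
          then have "move x (x + 1) ?m c = \<pi> c"
            by (rule move_restore[OF m(3) m(1) x(4) d w(1) w_def[symmetric]])
          then show ?thesis by simp
        qed
      qed
    qed
    \<comment> \<open>The remaining case, with short arcs at both ends of the circle. The opener
      \<open>2 * N - 1\<close> is traded for \<open>2\<close>, which is heavier only because top
      positions received the extra weight \<open>2 * N\<close>.\<close>
    have Bc: "P \<pi>" if N: "2 \<le> N" and e: "\<pi> 1 = 2" "\<pi> (2 * N - 1) = 2 * N"
    proof -
      define \<pi>' where "\<pi>' = (\<lambda>c. if c = 1 then 2 * N else if c = 2 * N then 1 else if c = 2 then 2 * N - 1 else if c = 2 * N - 1 then 2 else \<pi> c)"
      have nc': "nc_inv (2 * N) \<pi>'" unfolding \<pi>'_def by (rule nc_inv_outer_exchange[OF nc N e])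
      have s: "\<pi>' 1 = 2 * N" "\<pi>' (2 * N) = 1" "\<pi>' 2 = 2 * N - 1" "\<pi>' (2 * N - 1) = 2"
        using N unfolding \<pi>'_def by auto
      have o: "\<pi>' c = \<pi> c" if "c \<notin> {1, 2, 2 * N - 1, 2 * N}" for c using that unfolding \<pi>'_def by auto
      have e': "\<pi> 2 = 1" "\<pi> (2 * N) = 2 * N - 1"
        using nc_invD(3)[OF nc, of 1] nc_invD(3)[OF nc, of "2 * N - 1"] N e by auto
      show ?thesis
      proof (rule step[OF nc', of 1 2 "2 * N - 1"])
        show "1 \<le> (1::nat)" "Suc 1 \<le> 2 * N" "1 \<noteq> N" "\<pi>' 1 \<noteq> Suc 1" using N s by auto
        show "openers (2 * N) \<pi>' = insert 2 (openers (2 * N) \<pi> - {2 * N - 1})"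
        proof (rule set_eqI)
          fix y
          consider "y = 1" | "y = 2" | "y = 2 * N - 1" | "y = 2 * N" | "y \<notin> {1, 2, 2 * N - 1, 2 * N}" by blast
          then show "y \<in> openers (2 * N) \<pi>' \<longleftrightarrow> y \<in> insert 2 (openers (2 * N) \<pi> - {2 * N - 1})"
          proof cases
            case 5 then show ?thesis using O o[OF 5] by simp
          qed (use O s N e e' in auto)
        qed
        show "2 * N - 1 \<in> openers (2 * N) \<pi>" "2 \<notin> openers (2 * N) \<pi>" using O N e e' by auto
        show "g (2 * N - 1) < g 2" using N unfolding g_def by auto
        show "move 1 (Suc 1) \<pi>' c = \<pi> c" for c
        proof -
          have "\<pi>' c = \<pi> c" if "c \<notin> {2 * N, 1, 2, 2 * N - 1}" for c
            by (rule o) (use that in blast)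
          then have "move 1 2 \<pi>' c = \<pi> c"
            by (rule move_restore[OF s(1) s(3) e(1) e'(1) e'(2) e(2)])
          then show ?thesis by (simp add: numeral_2_eq_2)
        qed
      qed
    qed
    have cl: "\<pi> c < c" if "c \<in> {1..2 * N}" "c \<notin> openers (2 * N) \<pi>" for c
      using that nc_invD[OF nc that(1)] O by (meson linorder_neqE_nat)
    show ?case
    proof (cases "\<forall>c\<in>{1..N}. c \<in> openers (2 * N) \<pi>")
      case True
      have "openers (2 * N) \<pi> = {1..N}"
        using card_openers[OF nc] True by (metis card_atLeastAtMost card_subset_eq diff_Suc_1 finite_openers subsetI)
      then have "2 * N + 1 - c = \<pi> c" if "c \<in> {1..2 * N}" for c
        using openers_unique[OF nc_inv_id nc, of c] that openers_id by auto
      then show ?thesis using cong[OF id] by blast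
    next
      case False
      \<comment> \<open>The first closer among the top positions ends a short arc. If it is not at
        position 2, the case \<open>A1\<close> applies. Otherwise, since there are exactly
        \<open>N\<close> openers, some opener lies at the bottom; the last one starts a short arc,
        and \<open>A2\<close> or \<open>Bc\<close> applies.\<close>
      define j where "j = (LEAST c. c \<in> {1..N} \<and> c \<notin> openers (2 * N) \<pi>)"
      have j: "j \<in> {1..N}" "j \<notin> openers (2 * N) \<pi>"
        unfolding j_def using LeastI_ex[of "\<lambda>c. c \<in> {1..N} \<and> c \<notin> openers (2 * N) \<pi>"] False by blast+
      have jl: "c \<in> openers (2 * N) \<pi>" if "1 \<le> c" "c < j" for c
        using not_less_Least[of c "\<lambda>c. c \<in> {1..N} \<and> c \<notin> openers (2 * N) \<pi>"] that j unfolding j_def[symmetric] by auto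
      have jr: "j \<in> {1..2 * N}" using j by auto
      have pj: "\<pi> j < j" "\<pi> j \<in> {1..2 * N}" "\<pi> (\<pi> j) = j" using cl[OF jr j(2)] nc_invD[OF nc jr] by auto
      have j2: "2 \<le> j" using pj by auto
      have pj1: "\<pi> (j - 1) = j"
      proof (rule ccontr)
        assume ne: "\<pi> (j - 1) \<noteq> j"
        have r: "j - 1 \<in> {1..2 * N}" using j2 jr by auto
        have "j - 1 < \<pi> (j - 1)" using jl[of "j - 1"] j2 O by auto
        then have lt: "j < \<pi> (j - 1)" using ne by linarith
        have "\<pi> j \<noteq> j - 1" using ne pj by metis
        then have "\<pi> j < j - 1" using pj by linarith
        then show False using nc_inv_nocross[OF nc pj(2) r] pj lt j2 by auto
      qed
      show ?thesis
      proof (cases "3 \<le> j")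
        case True
        have "j - 2 < \<pi> (j - 2)" using jl[of "j - 2"] True O by auto
        then show ?thesis using A1[of "j - 2"] True j pj1 by (auto simp: numeral_2_eq_2 Suc_diff_Suc)
      next
        case f: False
        then have je: "j = 2" using j2 by simp
        have N2: "2 \<le> N" using j je by auto
        have "\<exists>c. c \<in> openers (2 * N) \<pi> \<and> N < c"
        proof (rule ccontr)
          assume "\<not> ?thesis"
          then have "openers (2 * N) \<pi> \<subseteq> {1..N}" using O by (auto simp: not_less)
          then have "openers (2 * N) \<pi> = {1..N}"
            using card_openers[OF nc] by (metis card_atLeastAtMost card_subset_eq diff_Suc_1 finite_atLeastAtMost)
          then show False using j by auto
        qed
        define k where "k = Max (openers (2 * N) \<pi>)"
        have ne: "openers (2 * N) \<pi> \<noteq> {}" using \<open>\<exists>c. c \<in> openers (2 * N) \<pi> \<and> N < c\<close> by auto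
        have k: "k \<in> openers (2 * N) \<pi>" unfolding k_def using ne by simp
        have kM: "c \<le> k" if "c \<in> openers (2 * N) \<pi>" for c unfolding k_def using that by simp
        have kN: "N < k" using \<open>\<exists>c. c \<in> openers (2 * N) \<pi> \<and> N < c\<close> kM by (meson less_le_trans)
        have kr: "k \<in> {1..2 * N}" "k < \<pi> k" using k O by auto
        have pk: "\<pi> k \<in> {1..2 * N}" using nc_invD[OF nc kr(1)] by auto
        have pk1: "\<pi> k = k + 1"
        proof (rule ccontr)
          assume nee: "\<pi> k \<noteq> k + 1"
          have r: "k + 1 \<in> {1..2 * N}" using kr pk by auto
          have "\<pi> (k + 1) < k + 1" using cl[OF r] kM[of "k + 1"] by auto
          moreover have "k < \<pi> (k + 1)" using nc_inv_nocross_ge[OF nc kr(1) r] nee kr(2) by linarith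
          ultimately show False by simp
        qed
        show ?thesis
        proof (cases "k + 2 \<le> 2 * N")
          case True
          have r: "k + 2 \<in> {1..2 * N}" using True by auto
          have "\<pi> (k + 2) < k + 2" using cl[OF r] kM[of "k + 2"] by auto
          moreover have "\<pi> (k + 2) \<noteq> k" "\<pi> (k + 2) \<noteq> k + 1"
            using nc_invD(3)[OF nc r] nc_invD(3)[OF nc kr(1)] pk1 by auto
          ultimately have "\<pi> (k + 2) < k" by linarith
          then show ?thesis using A2[of k] True kN pk1 kr by auto
        next
          case False
          then have "k + 1 = 2 * N" using pk pk1 by auto
          then have "\<pi> (2 * N - 1) = 2 * N" using pk1 by (metis add_diff_cancel_right')
          moreover have "\<pi> 1 = 2" using pj1 je by simp
          ultimately show ?thesis using Bc N2 by blast
        qed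
      qed
    qed
  qed
qed

section \<open>The action on functions of subsets\<close>

type_synonym vec = "nat set \<Rightarrow> rat"

text \<open>The alternating labels make the diagram with a cup and a cap at \<open>i\<close> the antisymmetriser \<open>1 - s_i\<close>.\<close>

fun lab :: "nat set \<Rightarrow> nat set \<Rightarrow> pt \<Rightarrow> bool" where
  "lab S T (Top j) = ((j \<in> S) \<noteq> even j)"
| "lab S T (Bot j) = ((j \<in> T) \<noteq> even j)"

definition mono_dia :: "dia \<Rightarrow> nat set \<Rightarrow> nat set \<Rightarrow> bool" where
  "mono_dia D S T \<longleftrightarrow> (\<forall>e\<in>D. \<forall>a\<in>e. \<forall>b\<in>e. lab S T a = lab S T b)"

text \<open>The sign changes when one of two adjacent points in \<open>S\<close> is replaced by the
  other; this makes a cup the antisymmetric tensor rather than the symmetric one.\<close>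

definition R :: "dia \<Rightarrow> nat set \<Rightarrow> nat set \<Rightarrow> rat" where
  "R D S T = (if mono_dia D S T then (-1) ^ (\<Sum>S + \<Sum>T) else 0)"

definition rho :: "nat \<Rightarrow> tl \<Rightarrow> vec \<Rightarrow> vec" where
  "rho N x v = (\<lambda>S. if S \<subseteq> {1..N}
     then \<Sum>T\<in>Pow {1..N}. (\<Sum>D\<in>diagrams N. x D * R D S T) * v T else 0)"

definition sc :: "rat \<Rightarrow> vec \<Rightarrow> vec" where
  "sc c v = (\<lambda>S. c * v S)"

definition supp :: "nat \<Rightarrow> vec \<Rightarrow> bool" where
  "supp N v \<longleftrightarrow> (\<forall>S. \<not> S \<subseteq> {1..N} \<longrightarrow> v S = 0)"

definition sws :: "nat \<Rightarrow> nat set \<Rightarrow> nat set" where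
  "sws i S = transpose i (Suc i) ` S"

definition sw :: "nat \<Rightarrow> vec \<Rightarrow> vec" where
  "sw i v = (\<lambda>S. v (sws i S))"

lemma sum_apply: "(\<Sum>a\<in>A. f a) x = (\<Sum>a\<in>A. f a x :: 'b :: comm_monoid_add)"
  by (induction A rule: infinite_finite_induct) (simp_all add: zero_fun_def plus_fun_def)

lemma R_neq_0: "R D S T \<noteq> 0 \<longleftrightarrow> mono_dia D S T"
  by (simp add: R_def)

subsection \<open>Composition of diagrams\<close>

lemma partition_on_components:
  assumes P: "partition_on (points N) D1" "partition_on (points N) D2"
  shows "partition_on (\<Union> (glue D1 D2)) (components D1 D2)"
    and "(\<forall>e\<in>glue D1 D2. \<forall>x\<in>e. \<forall>y\<in>e. f x = f y) \<longleftrightarrow> (\<forall>K\<in>components D1 D2. \<forall>x\<in>K. \<forall>y\<in>K. f x = f y)"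
proof -
  let ?V = "\<Union> (glue D1 D2)"
  let ?r = "{(x, y). \<exists>e\<in>glue D1 D2. x \<in> e \<and> y \<in> e}"
  have rV: "?r \<subseteq> ?V \<times> ?V" by auto
  have "equiv ?V (?r\<^sup>+)"
  proof (rule equivI)
    show "?r\<^sup>+ \<subseteq> ?V \<times> ?V" using trancl_subset_Sigma[OF rV] .
    show "refl_on ?V (?r\<^sup>+)" by (rule refl_onI) auto
    show "sym (?r\<^sup>+)" by (rule sym_trancl) (auto simp: sym_def)
    show "trans (?r\<^sup>+)" by (rule trans_trancl)
  qed
  then show "partition_on ?V (components D1 D2)"
    unfolding components_def by (rule partition_on_quotient)
  show "(\<forall>e\<in>glue D1 D2. \<forall>x\<in>e. \<forall>y\<in>e. f x = f y) \<longleftrightarrow> (\<forall>K\<in>components D1 D2. \<forall>x\<in>K. \<forall>y\<in>K. f x = f y)"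
  proof
    assume L: "\<forall>e\<in>glue D1 D2. \<forall>x\<in>e. \<forall>y\<in>e. f x = f y"
    have *: "f x = f y" if "(x, y) \<in> ?r\<^sup>+" for x y
      using that by (induction rule: trancl_induct) (use L in auto)
    show "\<forall>K\<in>components D1 D2. \<forall>x\<in>K. \<forall>y\<in>K. f x = f y"
    proof (intro ballI)
      fix K x y assume "K \<in> components D1 D2" "x \<in> K" "y \<in> K"
      from this(1) obtain z where "K = ?r\<^sup>+ `` {z}" unfolding components_def by (rule quotientE)
      then have "(z, x) \<in> ?r\<^sup>+" "(z, y) \<in> ?r\<^sup>+" using \<open>x \<in> K\<close> \<open>y \<in> K\<close> by blast+
      then show "f x = f y" using *[of z x] *[of z y] by simp
    qed
  next
    assume L: "\<forall>K\<in>components D1 D2. \<forall>x\<in>K. \<forall>y\<in>K. f x = f y"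
    show "\<forall>e\<in>glue D1 D2. \<forall>x\<in>e. \<forall>y\<in>e. f x = f y"
    proof (intro ballI)
      fix e x y assume e: "e \<in> glue D1 D2" "x \<in> e" "y \<in> e"
      let ?K = "?r\<^sup>+ `` {x}"
      have "?K \<in> components D1 D2" unfolding components_def quotient_def using e by blast
      moreover have "x \<in> ?K" "y \<in> ?K" using e by auto
      ultimately show "f x = f y" using L by blast
    qed
  qed
qed

lemma Union_glue:
  assumes P: "partition_on (points N) D1" "partition_on (points N) D2"
  shows "\<Union> (glue D1 D2) = {0, 1, 2} \<times> {1..N}"
proof -
  have "\<Union> (glue D1 D2) = upper ` points N \<union> lower ` points N"
    using P unfolding glue_def partition_on_def by blast
  also have "\<dots> = {0, 1, 2} \<times> {1..N}" unfolding points_def by (auto simp: image_Un image_image)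
  finally show ?thesis .
qed

lemma outer_in: "outer x \<in> {0, 1, 2} \<times> {1..N} \<longleftrightarrow> x \<in> points N"
  by (cases x) (auto simp: points_def)

lemma partition_on_dia_comp:
  assumes P: "partition_on (points N) D1" "partition_on (points N) D2"
  shows "partition_on (points N) (dia_comp D1 D2)"
proof -
  note C = partition_on_components(1)[OF P, unfolded Union_glue[OF P]]
  show ?thesis
  proof (rule partition_onI)
    show "\<Union> (dia_comp D1 D2) = points N"
    proof -
      have "\<Union> (dia_comp D1 D2) = outer -` \<Union> (components D1 D2)" 
      proof (rule set_eqI)
        fix x
        show "x \<in> \<Union> (dia_comp D1 D2) \<longleftrightarrow> x \<in> outer -` \<Union> (components D1 D2)"
        proof
          assume "x \<in> \<Union> (dia_comp D1 D2)"
          then obtain p where p: "p \<in> dia_comp D1 D2" "x \<in> p" ..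
          from p(1) obtain K where "K \<in> components D1 D2" "p = outer -` K" unfolding dia_comp_def by blast
          then show "x \<in> outer -` \<Union> (components D1 D2)" using p(2) by blast
        next
          assume "x \<in> outer -` \<Union> (components D1 D2)"
          then obtain K where K: "K \<in> components D1 D2" "x \<in> outer -` K" by blast
          then have "outer -` K \<in> dia_comp D1 D2" unfolding dia_comp_def by blast
          then show "x \<in> \<Union> (dia_comp D1 D2)" using K by blast
        qed
      qed
      also have "\<dots> = points N" 
        by (rule set_eqI) (simp only: vimage_eq partition_onD1[OF C, symmetric] outer_in)
      finally show ?thesis .
    qed
    fix p q assume "p \<in> dia_comp D1 D2" "q \<in> dia_comp D1 D2" "p \<noteq> q"
    then obtain K L where K: "K \<in> components D1 D2" "L \<in> components D1 D2" "p = outer -` K" "q = outer -` L"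
      unfolding dia_comp_def by auto
    then have "K \<noteq> L" using \<open>p \<noteq> q\<close> by blast
    then have "K \<inter> L = {}" using disjointD[OF partition_onD2[OF C] K(1,2)] by blast
    then show "disjnt p q" using K unfolding disjnt_def by auto
  qed (auto simp: dia_comp_def)
qed

definition lay :: "nat set \<Rightarrow> nat set \<Rightarrow> nat set \<Rightarrow> nat \<times> nat \<Rightarrow> bool" where
  "lay S T U z = ((snd z \<in> (if fst z = 0 then S else if fst z = 1 then T else U)) \<noteq> even (snd z))"

lemma lab_lay1: "lab S T x = lay S T U (upper x)"
  by (cases x) (simp_all add: lay_def)

lemma lab_lay2: "lab T U x = lay S T U (lower x)"
  by (cases x) (simp_all add: lay_def)

lemma lab_lay3: "lab S U x = lay S T U (outer x)"
  by (cases x) (simp_all add: lay_def)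

lemmas lab_lay = lab_lay1 lab_lay2 lab_lay3

lemma mono_glue:
  "mono_dia D1 S T \<and> mono_dia D2 T U \<longleftrightarrow> (\<forall>e\<in>glue D1 D2. \<forall>x\<in>e. \<forall>y\<in>e. lay S T U x = lay S T U y)"
  by (simp add: mono_dia_def glue_def ball_Un lab_lay1[of S T _ U] lab_lay2[of T U _ S])

text \<open>A component that reaches an outer layer has its label prescribed there, consistently
  because the composite is monochromatic. A component inside layer 1 may take either label, and this
  is where the loop value 2 comes from.\<close>

lemma card_middle_labelings:
  assumes P: "partition_on (points N) D1" "partition_on (points N) D2"
    and S: "S \<subseteq> {1..N}" "U \<subseteq> {1..N}" and m: "mono_dia (dia_comp D1 D2) S U"
  shows "card {T \<in> Pow {1..N}. mono_dia D1 S T \<and> mono_dia D2 T U} = 2 ^ loops D1 D2"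
proof -
  let ?C = "components D1 D2"
  define L where "L = {K \<in> ?C. outer -` K = {}}"
  note C = partition_on_components(1)[OF P, unfolded Union_glue[OF P]]
  let ?V = "{0, 1, 2} \<times> {1..N}"
  have finC: "finite ?C" using finite_elements[OF _ C] by simp
  have ex1: "\<exists>K\<in>?C. z \<in> K" if "z \<in> ?V" for z using C that unfolding partition_on_def by blast
  have uniq: "K = K'" if "K \<in> ?C" "K' \<in> ?C" "z \<in> K" "z \<in> K'" for K K' z
    using disjointD[OF partition_onD2[OF C] that(1,2)] that(3,4) by blast
  have sub: "K \<subseteq> ?V" "K \<noteq> {}" if "K \<in> ?C" for K
    using partition_onD1[OF C] partition_onD3[OF C] that by blast+
  have const: "(T \<subseteq> {1..N} \<and> mono_dia D1 S T \<and> mono_dia D2 T U) \<longleftrightarrow>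
      T \<subseteq> {1..N} \<and> (\<forall>K\<in>?C. \<forall>x\<in>K. \<forall>y\<in>K. lay S T U x = lay S T U y)" for T
    using mono_glue[of D1 S T D2 U] partition_on_components(2)[OF P, of "lay S T U"] by simp
  have outc: "lay S {} U (outer x) = lay S {} U (outer y)" if "K \<in> ?C" "outer x \<in> K" "outer y \<in> K" for K x y
  proof -
    have "outer -` K \<in> dia_comp D1 D2" using that unfolding dia_comp_def by auto
    then have "lab S U x = lab S U y" using m that unfolding mono_dia_def by blast
    then show ?thesis using lab_lay(3) by metis
  qed
  \<comment> \<open>\<open>X\<close> is the set of loops labelled True; every other component copies
    its label from the outer layers.\<close>
  define val where "val X K = (if K \<in> L then K \<in> X else (\<exists>x. outer x \<in> K \<and> lay S {} U (outer x)))" for X K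
  define TX where "TX X = {j \<in> {1..N}. (\<exists>K\<in>?C. (1, j) \<in> K \<and> val X K) \<noteq> even j}" for X
  have layO: "lay S T U (outer x) = lay S {} U (outer x)" for T x by (cases x) (auto simp: lay_def)
  have layX: "lay S (TX X) U z = val X K" if K: "K \<in> ?C" "z \<in> K" for X K z
  proof (cases "fst z = 1")
    case True
    then obtain j where z: "z = (1, j)" by (cases z) auto
    have j: "j \<in> {1..N}" using sub(1)[OF K(1)] K z by auto
    have "(\<exists>K\<in>?C. (1, j) \<in> K \<and> val X K) = val X K" using uniq K z by metis
    then have "j \<in> TX X \<longleftrightarrow> val X K \<noteq> even j" unfolding TX_def using j by auto
    then show ?thesis unfolding lay_def z by auto
  next
    case False
    have "z \<in> ?V" using sub K by blast
    then have "\<exists>x. z = outer x"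
    proof -
      obtain a b where ab: "z = (a, b)" by (cases z)
      then have "a = 0 \<or> a = 2" using False \<open>z \<in> ?V\<close> by auto
      then have "z = outer (Top b) \<or> z = outer (Bot b)" using ab by auto
      then show ?thesis by blast
    qed
    then obtain x where x: "z = outer x" by blast
    have "K \<notin> L" unfolding L_def using K x by auto
    then have "val X K = (\<exists>x. outer x \<in> K \<and> lay S {} U (outer x))" unfolding val_def by simp
    also have "\<dots> = lay S {} U (outer x)" using outc[OF K(1)] K(2) x by metis
    finally show ?thesis using layO x by metis
  qed
  have bij: "bij_betw TX (Pow L) {T \<in> Pow {1..N}. mono_dia D1 S T \<and> mono_dia D2 T U}"
  proof (rule bij_betw_imageI)
    show "inj_on TX (Pow L)"
    proof (rule inj_onI)
      fix X Y assume X: "X \<in> Pow L" and Y: "Y \<in> Pow L" and e: "TX X = TX Y"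
      have "K \<in> X \<longleftrightarrow> K \<in> Y" if K: "K \<in> L" for K
      proof -
        have KC: "K \<in> ?C" using K unfolding L_def by simp
        then obtain z where z: "z \<in> K" using sub by blast
        have "val X K = val Y K" using layX[OF KC z, of X] layX[OF KC z, of Y] e by simp
        then show ?thesis unfolding val_def using K by simp
      qed
      then show "X = Y" using X Y by blast
    qed
    show "TX ` Pow L = {T \<in> Pow {1..N}. mono_dia D1 S T \<and> mono_dia D2 T U}"
    proof (intro equalityI subsetI)
      fix T assume "T \<in> TX ` Pow L"
      then obtain X where X: "T = TX X" by blast
      have "T \<subseteq> {1..N}" unfolding X TX_def by blast
      moreover have "\<forall>K\<in>?C. \<forall>x\<in>K. \<forall>y\<in>K. lay S T U x = lay S T U y" unfolding X using layX by blast
      ultimately show "T \<in> {T \<in> Pow {1..N}. mono_dia D1 S T \<and> mono_dia D2 T U}" using const[of T] by blast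
    next
      fix T assume T: "T \<in> {T \<in> Pow {1..N}. mono_dia D1 S T \<and> mono_dia D2 T U}"
      then have TN: "T \<subseteq> {1..N}" and cT: "\<And>K x y. K \<in> ?C \<Longrightarrow> x \<in> K \<Longrightarrow> y \<in> K \<Longrightarrow> lay S T U x = lay S T U y"
        using const[of T] by blast+
      define X where "X = {K \<in> L. \<exists>x\<in>K. lay S T U x}"
      have v: "lay S T U z = val X K" if K: "K \<in> ?C" "z \<in> K" for K z
      proof (cases "K \<in> L")
        case True
        have "val X K \<longleftrightarrow> (\<exists>x\<in>K. lay S T U x)" unfolding val_def X_def using True by simp
        then show ?thesis using cT[OF K] K(2) by blast
      next
        case False
        then have "outer -` K \<noteq> {}" using K unfolding L_def by simp
        then obtain x where x: "outer x \<in> K" by blast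
        have "lay S T U z = lay S T U (outer x)" by (rule cT[OF K x])
        also have "\<dots> = lay S {} U (outer x)" by (rule layO)
        also have "\<dots> = val X K" unfolding val_def using False outc[OF K(1)] x by metis
        finally show ?thesis .
      qed
      have "T = TX X"
      proof (rule set_eqI)
        fix j
        show "j \<in> T \<longleftrightarrow> j \<in> TX X"
        proof (cases "j \<in> {1..N}")
          case True
          then obtain K where K: "K \<in> ?C" "(1, j) \<in> K" using ex1[of "(1, j)"] by auto
          have "lay S T U (1, j) = lay S (TX X) U (1, j)" by (simp only: v[OF K] layX[OF K, of X])
          then show ?thesis unfolding lay_def by (simp split: if_splits) blast
        next
          case False
          then show ?thesis using TN unfolding TX_def by blast
        qed
      qed
      moreover have "X \<in> Pow L" unfolding X_def by blast
      ultimately show "T \<in> TX ` Pow L" by blast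
    qed
  qed
  have "card {T \<in> Pow {1..N}. mono_dia D1 S T \<and> mono_dia D2 T U} = card (Pow L)"
    using bij_betw_same_card[OF bij] by simp
  also have "\<dots> = 2 ^ card L" by (rule card_Pow) (use finC in \<open>simp add: L_def\<close>)
  finally show ?thesis unfolding loops_def L_def .
qed

text \<open>Stacking becomes matrix multiplication: the signs of the middle set cancel, and the
  number of contributing middle sets is a power of 2 that counts the loops.\<close>

lemma R_dia_comp:
  assumes P: "partition_on (points N) D1" "partition_on (points N) D2"
    and S: "S \<subseteq> {1..N}" "U \<subseteq> {1..N}"
  shows "(\<Sum>T\<in>Pow {1..N}. R D1 S T * R D2 T U) = 2 ^ loops D1 D2 * R (dia_comp D1 D2) S U"
proof -
  let ?A = "{T \<in> Pow {1..N}. mono_dia D1 S T \<and> mono_dia D2 T U}"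
  have "(\<Sum>T\<in>Pow {1..N}. R D1 S T * R D2 T U) =
      (\<Sum>T\<in>Pow {1..N}. if mono_dia D1 S T \<and> mono_dia D2 T U then (-1) ^ (\<Sum>S + \<Sum>U) else 0)"
    by (rule sum.cong) (auto simp: R_def power_add)
  also have "\<dots> = of_nat (card ?A) * (-1) ^ (\<Sum>S + \<Sum>U)"
    by (simp add: sum.inter_filter[symmetric])
  also have "\<dots> = 2 ^ loops D1 D2 * R (dia_comp D1 D2) S U"
  proof (cases "mono_dia (dia_comp D1 D2) S U")
    case True
    then show ?thesis unfolding card_middle_labelings[OF P S True] R_def by simp
  next
    case False
    have "?A = {}"
    proof (rule ccontr)
      assume "?A \<noteq> {}"
      then obtain T where "mono_dia D1 S T \<and> mono_dia D2 T U" by blast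
      then have *: "\<forall>K\<in>components D1 D2. \<forall>x\<in>K. \<forall>y\<in>K. lay S T U x = lay S T U y"
        using mono_glue[of D1 S T D2 U] partition_on_components(2)[OF P, of "lay S T U"] by blast
      have "mono_dia (dia_comp D1 D2) S U"
        unfolding mono_dia_def
      proof (intro ballI)
        fix e a b assume e: "e \<in> dia_comp D1 D2" "a \<in> e" "b \<in> e"
        from e(1) obtain K where "K \<in> components D1 D2" "e = outer -` K" unfolding dia_comp_def by blast
        then have "lay S T U (outer a) = lay S T U (outer b)" using * e by blast
        then show "lab S U a = lab S U b" by (simp only: lab_lay3[of S U _ T])
      qed
      then show False using False by blast
    qed
    then show ?thesis using False by (metis R_neq_0 card.empty mult_zero_left mult_zero_right of_nat_0)
  qed
  finally show ?thesis .
qed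

text \<open>The indicator of a block is monochromatic for its own partition. If it is monochromatic
  for the other partition too, every block of the other one that meets it is contained in
  it.\<close>

lemma partition_determined:
  assumes P: "partition_on (points N) P" "partition_on (points N) Q"
    and m: "\<And>S T. S \<subseteq> {1..N} \<Longrightarrow> T \<subseteq> {1..N} \<Longrightarrow> mono_dia P S T \<longleftrightarrow> mono_dia Q S T"
  shows "P = Q"
proof -
  have key: "q \<subseteq> p" if P: "partition_on (points N) P" and Q: "partition_on (points N) Q"
    and m: "\<And>S T. S \<subseteq> {1..N} \<Longrightarrow> T \<subseteq> {1..N} \<Longrightarrow> mono_dia P S T \<Longrightarrow> mono_dia Q S T"
    and p: "p \<in> P" and q: "q \<in> Q" and x: "x \<in> p" "x \<in> q" for P Q p q x
  proof -
    \<comment> \<open>\<open>S\<close> and \<open>T\<close> are chosen so that exactly the points of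
      \<open>p\<close> receive the label True.\<close>
    define S where "S = {j \<in> {1..N}. (Top j \<in> p) \<noteq> even j}"
    define T where "T = {j \<in> {1..N}. (Bot j \<in> p) \<noteq> even j}"
    have l: "lab S T x = (x \<in> p)" if "x \<in> points N" for x
      using that unfolding points_def S_def T_def by auto
    have "mono_dia P S T" unfolding mono_dia_def
    proof (intro ballI)
      fix e a b assume e: "e \<in> P" "a \<in> e" "b \<in> e"
      then have "a \<in> points N" "b \<in> points N" using P unfolding partition_on_def by auto
      moreover have "a \<in> p \<longleftrightarrow> b \<in> p" using e p P unfolding partition_on_def disjoint_def by blast
      ultimately show "lab S T a = lab S T b" using l by blast
    qed
    moreover have "S \<subseteq> {1..N}" "T \<subseteq> {1..N}" unfolding S_def T_def by auto
    ultimately have mQ: "mono_dia Q S T" using m by blast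
    show ?thesis
    proof
      fix y assume y: "y \<in> q"
      have "x \<in> points N" "y \<in> points N" using q x y Q unfolding partition_on_def by auto
      moreover have "lab S T x = lab S T y" using mQ q x y unfolding mono_dia_def by blast
      ultimately show "y \<in> p" using l x by blast
    qed
  qed
  have sub: "P \<subseteq> Q" if P: "partition_on (points N) P" and Q: "partition_on (points N) Q"
    and m: "\<And>S T. S \<subseteq> {1..N} \<Longrightarrow> T \<subseteq> {1..N} \<Longrightarrow> mono_dia P S T \<longleftrightarrow> mono_dia Q S T" for P Q
  proof
    fix p assume p: "p \<in> P"
    then obtain x where x: "x \<in> p" "x \<in> points N" using P unfolding partition_on_def by (metis Union_iff all_not_in_conv)
    then obtain q where q: "q \<in> Q" "x \<in> q" using Q unfolding partition_on_def by blast
    have "q \<subseteq> p" by (rule key[OF P Q _ p q(1) x(1) q(2)]) (use m in blast)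
    moreover have "p \<subseteq> q" by (rule key[OF Q P _ q(1) p q(2) x(1)]) (use m in blast)
    ultimately show "p \<in> Q" using q by auto
  qed
  show ?thesis using sub[OF P m] sub[OF P(2,1) m[symmetric]] by blast
qed

subsection \<open>Cup moves\<close>

definition cons :: "nat \<Rightarrow> (nat \<Rightarrow> nat) \<Rightarrow> (nat \<Rightarrow> bool) \<Rightarrow> bool" where
  "cons n \<pi> f \<longleftrightarrow> (\<forall>c\<in>{1..n}. f c = f (\<pi> c))"

lemma mono_dia_of: "mono_dia (dia_of N \<pi>) S T \<longleftrightarrow> cons (2 * N) \<pi> (\<lambda>c. lab S T (pt_at N c))"
  unfolding mono_dia_def dia_of_def cons_def by auto

lemma cons_split:
  assumes nc: "nc_inv n \<pi>" and ab: "a \<in> {1..n}" "b \<in> {1..n}"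
  shows "cons n \<pi> f \<longleftrightarrow> f a = f (\<pi> a) \<and> f b = f (\<pi> b) \<and> (\<forall>c\<in>{1..n} - {a, b, \<pi> a, \<pi> b}. f c = f (\<pi> c))" (is "?l = ?r")
proof
  assume ?l then show ?r using ab unfolding cons_def by blast
next
  assume r: ?r
  show ?l unfolding cons_def
  proof
    fix c assume c: "c \<in> {1..n}"
    show "f c = f (\<pi> c)"
    proof (cases "c \<in> {a, b, \<pi> a, \<pi> b}")
      case True
      then show ?thesis using r nc_invD(3)[OF nc ab(1)] nc_invD(3)[OF nc ab(2)] by (metis insertE singletonD)
    next
      case False then show ?thesis using r c by blast
    qed
  qed
qed

text \<open>After the move the two former partners must carry a common label, and so must
  \<open>a\<close> and \<open>b\<close>. Either these labels agree, and \<open>f\<close> fits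
  \<open>\<pi>\<close>, or they are opposite, and \<open>f\<close> fits \<open>\<pi>\<close> once
  \<open>a\<close> and \<open>b\<close> are flipped; never both.\<close>

lemma cons_move:
  assumes nc: "nc_inv n \<pi>" and ab: "a \<in> {1..n}" "b \<in> {1..n}" "a \<noteq> b" "\<pi> a \<noteq> b"
  shows "cons n (move a b \<pi>) f \<longleftrightarrow> f a = f b \<and> (cons n \<pi> f \<or> cons n \<pi> (f(a := \<not> f a, b := \<not> f b)))"
    and "\<not> (cons n \<pi> f \<and> cons n \<pi> (f(a := \<not> f a, b := \<not> f b)))"
proof -
  let ?f = "f(a := \<not> f a, b := \<not> f b)"
  let ?C = "{1..n} - {a, b, \<pi> a, \<pi> b}"
  note e = move_eqs[OF nc ab]
  have p: "\<pi> a \<in> {1..n}" "\<pi> b \<in> {1..n}" "\<pi> (\<pi> a) = a" "\<pi> (\<pi> b) = b" using nc_invD[OF nc ab(1)] nc_invD[OF nc ab(2)] by auto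
  have A: "cons n (move a b \<pi>) f \<longleftrightarrow> f a = f b \<and> f (\<pi> a) = f (\<pi> b) \<and> (\<forall>c\<in>?C. f c = f (\<pi> c))" (is "?l = ?r")
  proof
    assume l: ?l
    then have "f a = f b" "f (\<pi> a) = f (\<pi> b)" using e(1,3) ab p unfolding cons_def by metis+
    moreover have "f c = f (\<pi> c)" if "c \<in> ?C" for c
    proof -
      have "move a b \<pi> c = \<pi> c" by (rule e(5)) (use that in blast)
      moreover have "f c = f (move a b \<pi> c)" using l that unfolding cons_def by blast
      ultimately show ?thesis by simp
    qed
    ultimately show ?r by blast
  next
    assume r: ?r
    show ?l unfolding cons_def
    proof
      fix c assume c: "c \<in> {1..n}"
      show "f c = f (move a b \<pi> c)"
      proof (cases "c \<in> {a, b, \<pi> a, \<pi> b}")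
        case True
        then show ?thesis using r e(1-4) by (metis insertE singletonD)
      next
        case False
        then have "move a b \<pi> c = \<pi> c" by (rule e(5))
        then show ?thesis using r c False by simp
      qed
    qed
  qed
  have B: "cons n \<pi> f \<longleftrightarrow> f a = f (\<pi> a) \<and> f b = f (\<pi> b) \<and> (\<forall>c\<in>?C. f c = f (\<pi> c))"
    by (rule cons_split[OF nc ab(1,2)])
  have f: "?f a = (\<not> f a)" "?f b = (\<not> f b)" "?f (\<pi> a) = f (\<pi> a)" "?f (\<pi> b) = f (\<pi> b)"
    using ab e(6-9) by auto
  have fc: "?f c = f c \<and> ?f (\<pi> c) = f (\<pi> c)" if c: "c \<in> ?C" for c
  proof -
    have "\<pi> c \<noteq> a" "\<pi> c \<noteq> b" using nc_invD(3)[OF nc, of c] c by (metis DiffD1 DiffD2 insertCI)+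
    then show ?thesis using c by auto
  qed
  have C: "cons n \<pi> ?f \<longleftrightarrow> (\<not> f a) = f (\<pi> a) \<and> (\<not> f b) = f (\<pi> b) \<and> (\<forall>c\<in>?C. f c = f (\<pi> c))"
    unfolding cons_split[OF nc ab(1,2), of ?f] f using fc by simp
  show "cons n (move a b \<pi>) f \<longleftrightarrow> f a = f b \<and> (cons n \<pi> f \<or> cons n \<pi> ?f)"
    unfolding A B C by blast
  show "\<not> (cons n \<pi> f \<and> cons n \<pi> ?f)" unfolding B C by blast
qed

lemma cons_cup:
  assumes nc: "nc_inv n \<pi>" and ab: "a \<in> {1..n}" "b \<in> {1..n}" "a \<noteq> b" "\<pi> a = b"
  shows "cons n \<pi> f \<Longrightarrow> f a = f b" and "f a = f b \<Longrightarrow> cons n \<pi> (f(a := \<not> f a, b := \<not> f b)) \<longleftrightarrow> cons n \<pi> f"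
proof -
  have pb: "\<pi> b = a" using nc_invD(3)[OF nc ab(1)] ab by simp
  let ?f = "f(a := \<not> f a, b := \<not> f b)"
  show "cons n \<pi> f \<Longrightarrow> f a = f b" using ab unfolding cons_def by metis
  have fc: "?f c = f c \<and> ?f (\<pi> c) = f (\<pi> c)" if c: "c \<in> {1..n} - {a, b, \<pi> a, \<pi> b}" for c
  proof -
    have "\<pi> c \<noteq> a" "\<pi> c \<noteq> b" using nc_invD(3)[OF nc, of c] c by (metis DiffD1 DiffD2 insertCI)+
    then show ?thesis using c by auto
  qed
  have f: "?f a = (\<not> f a)" "?f b = (\<not> f b)" using ab by auto
  show "f a = f b \<Longrightarrow> cons n \<pi> ?f \<longleftrightarrow> cons n \<pi> f"
    unfolding cons_split[OF nc ab(1,2)] ab(4) pb f using fc unfolding ab(4) pb by simp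
qed

lemma in_sws: "j \<in> sws i S \<longleftrightarrow> transpose i (Suc i) j \<in> S"
  unfolding sws_def by (metis image_iff transpose_involutory)

lemma sws_same: "(i \<in> S) = (Suc i \<in> S) \<Longrightarrow> sws i S = S"
  by (rule set_eqI) (auto simp: in_sws transpose_def)

lemma sws_sws [simp]: "sws i (sws i S) = S"
  by (rule set_eqI) (simp add: in_sws)

lemma sws_subset: "1 \<le> i \<Longrightarrow> i < N \<Longrightarrow> sws i S \<subseteq> {1..N} \<longleftrightarrow> S \<subseteq> {1..N}"
proof -
  assume i: "1 \<le> i" "i < N"
  have *: "sws i S \<subseteq> {1..N}" if "S \<subseteq> {1..N}" for S
  proof
    fix j assume "j \<in> sws i S"
    then have "transpose i (Suc i) j \<in> {1..N}" using that in_sws by blast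
    then show "j \<in> {1..N}" using i by (cases "j = i"; cases "j = Suc i") auto
  qed
  show ?thesis using *[of S] *[of "sws i S"] by auto
qed

lemma sgn_sws:
  assumes "finite S" "(i \<in> S) \<noteq> (Suc i \<in> S)"
  shows "(-1 :: rat) ^ (\<Sum>(sws i S) + k) = - ((-1) ^ (\<Sum>S + k))"
proof -
  have *: "\<Sum>(sws i S) = \<Sum>S + 1" if "finite S" "i \<in> S" "Suc i \<notin> S" for S
  proof -
    have "sws i S = insert (Suc i) (S - {i})"
      using that by (intro set_eqI) (auto simp: in_sws transpose_def split: if_splits)
    moreover have "\<Sum>S = i + \<Sum>(S - {i})" using that by (simp add: sum.remove)
    ultimately show ?thesis using that by simp
  qed
  show ?thesis
  proof (cases "i \<in> S")
    case True
    then show ?thesis using *[of S] assms by simp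
  next
    case False
    have "\<Sum>(sws i (sws i S)) = \<Sum>(sws i S) + 1"
      by (rule *) (use assms False in \<open>auto simp: in_sws sws_def[symmetric]\<close>, simp add: sws_def)
    then have "\<Sum>S = \<Sum>(sws i S) + 1" by simp
    then show ?thesis by simp
  qed
qed

text \<open>Multiplication by the generator from the left, written as the operator
  \<open>1 - s_i\<close>. If exactly one of \<open>i\<close>, \<open>Suc i\<close> is in
  \<open>S\<close>, the swap flips both labels and the sign; otherwise \<open>S\<close> is fixed,
  the labels at the two points differ, and both sides vanish.\<close>

lemma R_move_left:
  assumes nc: "nc_inv (2 * N) \<pi>" and i: "1 \<le> i" "i < N" and S: "S \<subseteq> {1..N}"
  shows "R (dia_of N \<pi>) S T - R (dia_of N \<pi>) (sws i S) T =
    (if \<pi> i = Suc i then 2 * R (dia_of N \<pi>) S T else R (dia_of N (move i (Suc i) \<pi>)) S T)"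
proof -
  let ?D = "dia_of N \<pi>"
  define f where "f = (\<lambda>c. lab S T (pt_at N c))"
  have r: "i \<in> {1..2 * N}" "Suc i \<in> {1..2 * N}" "i \<noteq> Suc i" using i by auto
  have fin: "finite S" using S finite_subset by auto
  have fi: "f i = ((i \<in> S) \<noteq> even i)" "f (Suc i) = ((Suc i \<in> S) \<noteq> odd i)" using i by (simp_all add: f_def pt_at_def)
  show ?thesis
  proof (cases "f i = f (Suc i)")
    case True
    then have ne: "(i \<in> S) \<noteq> (Suc i \<in> S)" using fi by auto
    have f': "(\<lambda>c. lab (sws i S) T (pt_at N c)) = f(i := \<not> f i, Suc i := \<not> f (Suc i))"
    proof
      fix c
      show "lab (sws i S) T (pt_at N c) = (f(i := \<not> f i, Suc i := \<not> f (Suc i))) c"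
        using i ne by (auto simp: f_def pt_at_def in_sws)
    qed
    have sg: "(-1 :: rat) ^ (\<Sum>(sws i S) + \<Sum>T) = - ((-1) ^ (\<Sum>S + \<Sum>T))" by (rule sgn_sws[OF fin ne])
    show ?thesis
    proof (cases "\<pi> i = Suc i")
      case t: True
      then show ?thesis unfolding R_def mono_dia_of f' f_def[symmetric] sg cons_cup(2)[OF nc r t True] by simp
    next
      case False
      show ?thesis unfolding R_def mono_dia_of f' f_def[symmetric] sg
        using cons_move[OF nc r False, of f] True False by (simp split: if_splits)
    qed
  next
    case False
    then have e: "(i \<in> S) = (Suc i \<in> S)" using fi by auto
    have "R ?D S T = 0" if t: "\<pi> i = Suc i"
      using cons_cup(1)[OF nc r t, of f] False unfolding R_def mono_dia_of f_def by auto
    moreover have "R (dia_of N (move i (Suc i) \<pi>)) S T = 0" if t: "\<pi> i \<noteq> Suc i"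
      using cons_move(1)[OF nc r t, of f] False unfolding R_def mono_dia_of f_def by auto
    ultimately show ?thesis using sws_same[OF e] by auto
  qed
qed

text \<open>The bottom points are numbered backwards on the circle, so \<open>Bot (i + 1)\<close>
  and \<open>Bot i\<close> occupy the positions \<open>2 * N - i\<close> and the next one.\<close>

lemma R_move_right:
  assumes nc: "nc_inv (2 * N) \<pi>" and i: "1 \<le> i" "i < N" and S: "T \<subseteq> {1..N}"
  defines "a \<equiv> 2 * N - i"
  assumes na: "\<pi> a \<noteq> Suc a"
  shows "R (dia_of N \<pi>) S T - R (dia_of N \<pi>) S (sws i T) = R (dia_of N (move a (Suc a) \<pi>)) S T"
proof -
  let ?D = "dia_of N \<pi>"
  define f where "f = (\<lambda>c. lab S T (pt_at N c))"
  have r: "a \<in> {1..2 * N}" "Suc a \<in> {1..2 * N}" "a \<noteq> Suc a" using i unfolding a_def by auto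
  have fin: "finite T" using S finite_subset by auto
  have aN: "N < a" using i unfolding a_def by auto
  have b: "2 * N + 1 - a = Suc i" "2 * N + 1 - Suc a = i" using i unfolding a_def by auto
  have fi: "f a = ((Suc i \<in> T) \<noteq> odd i)" "f (Suc a) = ((i \<in> T) \<noteq> even i)" using aN b by (simp_all add: f_def pt_at_def)
  show ?thesis
  proof (cases "f a = f (Suc a)")
    case True
    then have ne: "(i \<in> T) \<noteq> (Suc i \<in> T)" using fi by auto
    have f': "(\<lambda>c. lab S (sws i T) (pt_at N c)) = f(a := \<not> f a, Suc a := \<not> f (Suc a))"
    proof
      fix c
      consider "c \<le> N" | "c = a" | "c = Suc a" | "N < c" "c \<noteq> a" "c \<noteq> Suc a" by linarith
      then show "lab S (sws i T) (pt_at N c) = (f(a := \<not> f a, Suc a := \<not> f (Suc a))) c"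
      proof cases
        case 1 then show ?thesis using aN by (simp add: f_def pt_at_def)
      next
        case 2 then show ?thesis using aN b ne by (auto simp: f_def pt_at_def in_sws)
      next
        case 3 then show ?thesis using aN b ne by (auto simp: f_def pt_at_def in_sws)
      next
        case 4
        then have "2 * N + 1 - c \<noteq> i" "2 * N + 1 - c \<noteq> Suc i" using b i unfolding a_def by linarith+
        then show ?thesis using 4 by (simp add: f_def pt_at_def in_sws)
      qed
    qed
    have sg: "(-1 :: rat) ^ (\<Sum>S + \<Sum>(sws i T)) = - ((-1) ^ (\<Sum>S + \<Sum>T))"
      using sgn_sws[OF fin ne, of "\<Sum>S"] by (simp add: add.commute)
    show ?thesis unfolding R_def mono_dia_of f' f_def[symmetric] sg
      using cons_move[OF nc r na, of f] True by (simp split: if_splits)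
  next
    case False
    then have e: "(i \<in> T) = (Suc i \<in> T)" using fi by auto
    have "R (dia_of N (move a (Suc a) \<pi>)) S T = 0"
      using cons_move(1)[OF nc r na, of f] False unfolding R_def mono_dia_of f_def by auto
    then show ?thesis using sws_same[OF e] by auto
  qed
qed

lemma R_id:
  assumes S: "S \<subseteq> {1..N}" "T \<subseteq> {1..N}"
  shows "R ((\<lambda>i. {Top i, Bot i}) ` {1..N}) S T = (if S = T then 1 else 0)"
proof -
  have "mono_dia ((\<lambda>i. {Top i, Bot i}) ` {1..N}) S T \<longleftrightarrow> (\<forall>j\<in>{1..N}. j \<in> S \<longleftrightarrow> j \<in> T)"
    unfolding mono_dia_def by auto
  also have "\<dots> \<longleftrightarrow> S = T" using S by blast
  finally show ?thesis unfolding R_def by (auto simp: power_add simp flip: power_mult_distrib)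
qed

lemma diagrams_partition: "D \<in> diagrams N \<Longrightarrow> partition_on (points N) D"
  unfolding diagrams_def by simp

lemma diagrams_induct [consumes 1, case_names id left right]:
  assumes D: "D \<in> diagrams N"
    and base: "P ((\<lambda>i. {Top i, Bot i}) ` {1..N})"
    and left: "\<And>D D' i. D \<in> diagrams N \<Longrightarrow> D' \<in> diagrams N \<Longrightarrow> 1 \<le> i \<Longrightarrow> i < N \<Longrightarrow>
      (\<And>S T. S \<subseteq> {1..N} \<Longrightarrow> R D' S T = R D S T - R D (sws i S) T) \<Longrightarrow> P D \<Longrightarrow> P D'"
    and right: "\<And>D D' i. D \<in> diagrams N \<Longrightarrow> D' \<in> diagrams N \<Longrightarrow> 1 \<le> i \<Longrightarrow> i < N \<Longrightarrow>
      (\<And>S T. T \<subseteq> {1..N} \<Longrightarrow> R D' S T = R D S T - R D S (sws i T)) \<Longrightarrow> P D \<Longrightarrow> P D'"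
  shows "P D"
proof -
  obtain \<pi> where nc: "nc_inv (2 * N) \<pi>" and De: "D = dia_of N \<pi>" using diagrams_obtain[OF D] .
  have "P (dia_of N \<pi>)" using nc
  proof (induction rule: nc_inv_induct)
    case id then show ?case unfolding dia_of_id by (rule base)
  next
    case (move \<pi> a)
    have D': "dia_of N (move a (Suc a) \<pi>) \<in> diagrams N"
      by (rule dia_of_in_diagrams[OF nc_inv_move]) (use move in auto)
    have D: "dia_of N \<pi> \<in> diagrams N" by (rule dia_of_in_diagrams) (use move in auto)
    show ?case
    proof (cases "a < N")
      case True
      show ?thesis
        by (rule left[OF D D' move.hyps(2) True _ move.IH]) (use R_move_left[OF move.hyps(1) _ True] move.hyps in auto)
    next
      case False
      define i where "i = 2 * N - a"
      have i: "1 \<le> i" "i < N" "a = 2 * N - i" using False move unfolding i_def by auto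
      show ?thesis
        by (rule right[OF D D' i(1,2) _ move.IH]) (use R_move_right[OF move.hyps(1) i(1,2)] move.hyps i in auto)
    qed
  next
    case (cong \<pi> \<pi>')
    then show ?case using dia_of_cong[of N \<pi> \<pi>'] by simp
  qed
  then show ?thesis using De by simp
qed

lemma R_left_diagram:
  assumes D: "D \<in> diagrams N" and i: "1 \<le> i" "i < N"
  obtains D' m where "D' \<in> diagrams N" "\<And>S T. S \<subseteq> {1..N} \<Longrightarrow> R D S T - R D (sws i S) T = 2 ^ m * R D' S T"
proof -
  obtain \<pi> where nc: "nc_inv (2 * N) \<pi>" and De: "D = dia_of N \<pi>" using diagrams_obtain[OF D] .
  show ?thesis
  proof (cases "\<pi> i = Suc i")
    case True
    have "\<And>S T. S \<subseteq> {1..N} \<Longrightarrow> R D S T - R D (sws i S) T = 2 ^ 1 * R D S T"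
      using R_move_left[OF nc i] True unfolding De by simp
    then show ?thesis using that D by blast
  next
    case False
    have "\<And>S T. S \<subseteq> {1..N} \<Longrightarrow> R D S T - R D (sws i S) T = 2 ^ 0 * R (dia_of N (move i (Suc i) \<pi>)) S T"
      using R_move_left[OF nc i] False unfolding De by simp
    moreover have "dia_of N (move i (Suc i) \<pi>) \<in> diagrams N"
      by (rule dia_of_in_diagrams[OF nc_inv_move[OF nc]]) (use i False in auto)
    ultimately show ?thesis using that by blast
  qed
qed

lemma sum_sws: "1 \<le> i \<Longrightarrow> i < N \<Longrightarrow> (\<Sum>T\<in>Pow {1..N}. g (sws i T)) = (\<Sum>T\<in>Pow {1..N}. g T)"
  by (rule sum.reindex_bij_witness[of _ "sws i" "sws i"]) (simp_all only: sws_sws Pow_iff sws_subset)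

text \<open>That the composite is non-crossing is proved without planar topology. Peeling generators
  off \<open>D1\<close> shows that the product of the two matrices is a power of 2 times the matrix
  of some non-crossing diagram, and a diagram can be recovered from its matrix.\<close>

lemma dia_comp_in_diagrams:
  assumes D: "D1 \<in> diagrams N" "D2 \<in> diagrams N"
  shows "dia_comp D1 D2 \<in> diagrams N"
proof -
  have "\<forall>D2\<in>diagrams N. \<exists>k. \<exists>D'\<in>diagrams N. \<forall>S\<in>Pow {1..N}. \<forall>U\<in>Pow {1..N}.
      (\<Sum>T\<in>Pow {1..N}. R D1 S T * R D2 T U) = 2 ^ k * R D' S U"
    using D(1)
  proof (induction rule: diagrams_induct)
    case id
    show ?case
    proof
      fix D2 assume D2: "D2 \<in> diagrams N"
      have "\<forall>S\<in>Pow {1..N}. \<forall>U\<in>Pow {1..N}.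
        (\<Sum>T\<in>Pow {1..N}. R ((\<lambda>i. {Top i, Bot i}) ` {1..N}) S T * R D2 T U) = 2 ^ 0 * R D2 S U"
      proof (intro ballI)
        fix S U :: "nat set" assume S: "S \<in> Pow {1..N}" "U \<in> Pow {1..N}"
        have "(\<Sum>T\<in>Pow {1..N}. R ((\<lambda>i. {Top i, Bot i}) ` {1..N}) S T * R D2 T U) =
            (\<Sum>T\<in>Pow {1..N}. if S = T then R D2 T U else 0)"
          by (rule sum.cong[OF refl], subst R_id) (use S in auto)
        also have "\<dots> = R D2 S U" using S by (subst sum.delta') auto
        finally show "(\<Sum>T\<in>Pow {1..N}. R ((\<lambda>i. {Top i, Bot i}) ` {1..N}) S T * R D2 T U) = 2 ^ 0 * R D2 S U" by simp
      qed
      then show "\<exists>k. \<exists>D'\<in>diagrams N. \<forall>S\<in>Pow {1..N}. \<forall>U\<in>Pow {1..N}.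
        (\<Sum>T\<in>Pow {1..N}. R ((\<lambda>i. {Top i, Bot i}) ` {1..N}) S T * R D2 T U) = 2 ^ k * R D' S U" using D2 by blast
    qed
  next
    case (left D D' i)
    show ?case
    proof
      fix D2 assume D2: "D2 \<in> diagrams N"
      obtain k E where E: "E \<in> diagrams N" and k: "\<And>S U. S \<in> Pow {1..N} \<Longrightarrow> U \<in> Pow {1..N} \<Longrightarrow>
          (\<Sum>T\<in>Pow {1..N}. R D S T * R D2 T U) = 2 ^ k * R E S U" using left(6) D2 by blast
      obtain F m where F: "F \<in> diagrams N" and m: "\<And>S T. S \<subseteq> {1..N} \<Longrightarrow> R E S T - R E (sws i S) T = 2 ^ m * R F S T"
        by (rule R_left_diagram[OF E left(3,4)]) blast
      have "(\<Sum>T\<in>Pow {1..N}. R D' S T * R D2 T U) = 2 ^ (k + m) * R F S U"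
        if S: "S \<in> Pow {1..N}" "U \<in> Pow {1..N}" for S U
      proof -
        have s: "sws i S \<in> Pow {1..N}" using S sws_subset[OF left(3,4)] by auto
        have "(\<Sum>T\<in>Pow {1..N}. R D' S T * R D2 T U) = (\<Sum>T\<in>Pow {1..N}. R D S T * R D2 T U - R D (sws i S) T * R D2 T U)"
          by (rule sum.cong) (use S left(5) in \<open>auto simp: left_diff_distrib\<close>)
        also have "\<dots> = 2 ^ k * R E S U - 2 ^ k * R E (sws i S) U"
          using k[OF S] k[OF s S(2)] by (simp add: sum_subtractf)
        also have "\<dots> = 2 ^ k * (2 ^ m * R F S U)" using m[of S U] S by (simp flip: right_diff_distrib)
        finally show ?thesis by (simp add: power_add)
      qed
      then show "\<exists>k. \<exists>F\<in>diagrams N. \<forall>S\<in>Pow {1..N}. \<forall>U\<in>Pow {1..N}.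
          (\<Sum>T\<in>Pow {1..N}. R D' S T * R D2 T U) = 2 ^ k * R F S U" using F by blast
    qed
  next
    case (right D D' i)
    show ?case
    proof
      fix D2 assume D2: "D2 \<in> diagrams N"
      obtain F m where F: "F \<in> diagrams N" and m: "\<And>S T. S \<subseteq> {1..N} \<Longrightarrow> R D2 S T - R D2 (sws i S) T = 2 ^ m * R F S T"
        by (rule R_left_diagram[OF D2 right(3,4)]) blast
      obtain k E where E: "E \<in> diagrams N" and k: "\<And>S U. S \<in> Pow {1..N} \<Longrightarrow> U \<in> Pow {1..N} \<Longrightarrow>
          (\<Sum>T\<in>Pow {1..N}. R D S T * R F T U) = 2 ^ k * R E S U" using right(6) F by blast
      have "(\<Sum>T\<in>Pow {1..N}. R D' S T * R D2 T U) = 2 ^ (m + k) * R E S U"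
        if S: "S \<in> Pow {1..N}" "U \<in> Pow {1..N}" for S U
      proof -
        have "(\<Sum>T\<in>Pow {1..N}. R D' S T * R D2 T U) = (\<Sum>T\<in>Pow {1..N}. R D S T * R D2 T U - R D S (sws i T) * R D2 T U)"
          by (rule sum.cong) (use S right(5) in \<open>auto simp: left_diff_distrib\<close>)
        also have "\<dots> = (\<Sum>T\<in>Pow {1..N}. R D S T * R D2 T U) - (\<Sum>T\<in>Pow {1..N}. R D S (sws i T) * R D2 (sws i (sws i T)) U)"
          by (simp add: sum_subtractf)
        \<comment> \<open>The swap permutes the summation range, so an operator at the bottom of the
          upper diagram moves to the top of the lower one.\<close>
        also have "(\<Sum>T\<in>Pow {1..N}. R D S (sws i T) * R D2 (sws i (sws i T)) U) = (\<Sum>T\<in>Pow {1..N}. R D S T * R D2 (sws i T) U)"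
          by (rule sum_sws[OF right(3,4), of "\<lambda>T. R D S T * R D2 (sws i T) U"])
        also have "(\<Sum>T\<in>Pow {1..N}. R D S T * R D2 T U) - (\<Sum>T\<in>Pow {1..N}. R D S T * R D2 (sws i T) U) =
            (\<Sum>T\<in>Pow {1..N}. 2 ^ m * (R D S T * R F T U))"
          unfolding sum_subtractf[symmetric] right_diff_distrib[symmetric]
          by (rule sum.cong) (use m in auto)
        also have "\<dots> = 2 ^ m * (2 ^ k * R E S U)" using k[OF S] by (simp flip: sum_distrib_left)
        finally show ?thesis by (simp add: power_add)
      qed
      then show "\<exists>k. \<exists>F\<in>diagrams N. \<forall>S\<in>Pow {1..N}. \<forall>U\<in>Pow {1..N}.
          (\<Sum>T\<in>Pow {1..N}. R D' S T * R D2 T U) = 2 ^ k * R F S U" using E by blast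
    qed
  qed
  then obtain k E where E: "E \<in> diagrams N" and k: "\<And>S U. S \<in> Pow {1..N} \<Longrightarrow> U \<in> Pow {1..N} \<Longrightarrow>
      (\<Sum>T\<in>Pow {1..N}. R D1 S T * R D2 T U) = 2 ^ k * R E S U" using D(2) by blast
  note P = diagrams_partition[OF D(1)] diagrams_partition[OF D(2)]
  \<comment> \<open>Both matrices are nonzero multiples of the product matrix, hence have the same
    zero pattern, and this pattern determines the partition.\<close>
  have "dia_comp D1 D2 = E"
  proof (rule partition_determined[OF partition_on_dia_comp[OF P] diagrams_partition[OF E]])
    fix S T :: "nat set" assume S: "S \<subseteq> {1..N}" "T \<subseteq> {1..N}"
    have "2 ^ loops D1 D2 * R (dia_comp D1 D2) S T = 2 ^ k * R E S T"
      using R_dia_comp[OF P S] k[of S T] S by simp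
    then have "R (dia_comp D1 D2) S T \<noteq> 0 \<longleftrightarrow> R E S T \<noteq> 0" by (metis mult_eq_0_iff power_not_zero zero_neq_numeral)
    then show "mono_dia (dia_comp D1 D2) S T \<longleftrightarrow> mono_dia E S T" by (simp only: R_neq_0)
  qed
  then show ?thesis using E by simp
qed

subsection \<open>The diagram algebra\<close>

definition Rm :: "nat \<Rightarrow> tl \<Rightarrow> nat set \<Rightarrow> nat set \<Rightarrow> rat" where
  "Rm N x S T = (\<Sum>D\<in>diagrams N. x D * R D S T)"

lemma rho_Rm: "rho N x v S = (if S \<subseteq> {1..N} then \<Sum>T\<in>Pow {1..N}. Rm N x S T * v T else 0)"
  by (simp add: rho_def Rm_def)

lemma Rm_add: "Rm N (x + y) S T = Rm N x S T + Rm N y S T"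
  by (simp add: Rm_def distrib_right sum.distrib)

lemma Rm_diff: "Rm N (x - y) S T = Rm N x S T - Rm N y S T"
  by (simp add: Rm_def left_diff_distrib sum_subtractf)

lemma Rm_scale: "Rm N (scale c x) S T = c * Rm N x S T"
  by (simp add: Rm_def scale_def sum_distrib_left mult.assoc)

lemma Rm_0: "Rm N 0 S T = 0"
  by (simp add: Rm_def)

lemma Rm_sum: "Rm N (\<Sum>a\<in>A. f a) S T = (\<Sum>a\<in>A. Rm N (f a) S T)"
  by (induction A rule: infinite_finite_induct) (simp_all only: sum.infinite sum.empty sum.insert Rm_0 Rm_add not_False_eq_True if_False if_True)

lemma Rm_basis: "D \<in> diagrams N \<Longrightarrow> Rm N (basis D) S T = R D S T"
proof -
  assume D: "D \<in> diagrams N"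
  have "Rm N (basis D) S T = (\<Sum>D'\<in>diagrams N. if D' = D then R D' S T else 0)"
    unfolding Rm_def basis_def by (rule sum.cong) auto
  then show ?thesis using D by simp
qed

lemma rho_add: "rho N (x + y) v = rho N x v + rho N y v"
  by (rule ext) (simp add: rho_Rm Rm_add distrib_right sum.distrib)

lemma rho_diff: "rho N (x - y) v = rho N x v - rho N y v"
  by (rule ext) (simp add: rho_Rm Rm_diff left_diff_distrib sum_subtractf)

lemma rho_scale: "rho N (scale c x) v = sc c (rho N x v)"
  by (rule ext) (simp add: rho_Rm Rm_scale sc_def sum_distrib_left mult.assoc)

lemma rho_zero: "rho N 0 v = 0"
  by (rule ext) (simp add: rho_Rm Rm_0)

lemma rho_sum: "rho N (\<Sum>a\<in>A. f a) v = (\<Sum>a\<in>A. rho N (f a) v)"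
  by (induction A rule: infinite_finite_induct) (simp_all only: sum.infinite sum.empty sum.insert rho_zero rho_add not_False_eq_True)

lemma rho_vadd: "rho N x (v + w) = rho N x v + rho N x w"
  by (rule ext) (simp add: rho_Rm distrib_left sum.distrib)

lemma rho_vsc: "rho N x (sc c v) = sc c (rho N x v)"
  by (rule ext) (simp add: rho_Rm sc_def sum_distrib_left algebra_simps)

lemma rho_vzero: "rho N x 0 = 0"
  by (rule ext) (simp add: rho_Rm)

lemma rho_vsum: "rho N x (\<Sum>a\<in>A. f a) = (\<Sum>a\<in>A. rho N x (f a))"
  by (induction A rule: infinite_finite_induct) (simp_all only: sum.infinite sum.empty sum.insert rho_vzero rho_vadd not_False_eq_True)

lemma sc_simps: "sc a (sc b v) = sc (a * b) v" "sc 1 v = v" "sc 0 v = 0" "sc c 0 = 0"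
  "sc c (v + w) = sc c v + sc c w" "sc c (v - w) = sc c v - sc c w"
  by (auto simp: sc_def algebra_simps)

lemma supp_rho [simp]: "supp N (rho N x v)"
  by (simp add: supp_def rho_def)

lemma supp_add: "supp N v \<Longrightarrow> supp N w \<Longrightarrow> supp N (v + w)"
  by (simp add: supp_def)

lemma supp_diff: "supp N v \<Longrightarrow> supp N w \<Longrightarrow> supp N (v - w)"
  by (simp add: supp_def)

lemma supp_sc: "supp N v \<Longrightarrow> supp N (sc c v)"
  by (simp add: supp_def sc_def)

lemma supp_0: "supp N 0"
  by (simp add: supp_def)

lemma tl_one_diagram: "(\<lambda>i. {Top i, Bot i}) ` {1..N} \<in> diagrams N"
  using dia_of_in_diagrams[OF nc_inv_id[of N]] unfolding dia_of_id .

lemma rho_one: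
  assumes "supp N v"
  shows "rho N (tl_one N) v = v"
proof
  fix S
  show "rho N (tl_one N) v S = v S"
  proof (cases "S \<subseteq> {1..N}")
    case True
    have "rho N (tl_one N) v S = (\<Sum>T\<in>Pow {1..N}. if S = T then v T else 0)"
      unfolding rho_Rm tl_one_def Rm_basis[OF tl_one_diagram] using True
      by (simp only: if_True) (rule sum.cong[OF refl], subst R_id, auto)
    also have "\<dots> = v S" using True by (subst sum.delta') auto
    finally show ?thesis .
  next
    case False
    then show ?thesis using assms unfolding supp_def rho_Rm by auto
  qed
qed

abbreviation u_dia :: "nat \<Rightarrow> nat \<Rightarrow> dia" where
  "u_dia N i \<equiv> {{Top i, Top (i + 1)}, {Bot i, Bot (i + 1)}} \<union> (\<lambda>j. {Top j, Bot j}) ` ({1..N} - {i, i + 1})"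

lemma tl_u_diagram:
  assumes "1 \<le> i" "i < N"
  shows "u_dia N i \<in> diagrams N"
    and "S \<subseteq> {1..N} \<Longrightarrow> R (u_dia N i) S T =
      R ((\<lambda>i. {Top i, Bot i}) ` {1..N}) S T - R ((\<lambda>i. {Top i, Bot i}) ` {1..N}) (sws i S) T"
proof -
  have ne: "2 * N + 1 - i \<noteq> Suc i" using assms by linarith
  show "u_dia N i \<in> diagrams N"
    unfolding dia_of_u[OF assms, symmetric]
    by (rule dia_of_in_diagrams[OF nc_inv_move[OF nc_inv_id]]) (use assms ne in auto)
  show "R (u_dia N i) S T = R ((\<lambda>i. {Top i, Bot i}) ` {1..N}) S T - R ((\<lambda>i. {Top i, Bot i}) ` {1..N}) (sws i S) T"
    if "S \<subseteq> {1..N}"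
    using R_move_left[OF nc_inv_id assms that, of T] ne unfolding dia_of_u[OF assms, symmetric] dia_of_id[symmetric] by simp
qed

lemma rho_u:
  assumes "supp N v" and i: "1 \<le> i" "i < N"
  shows "rho N (tl_u N i) v = v - sw i v"
proof
  fix S
  show "rho N (tl_u N i) v S = (v - sw i v) S"
  proof (cases "S \<subseteq> {1..N}")
    case True
    then have s: "sws i S \<subseteq> {1..N}" using sws_subset[OF i] by blast
    have "rho N (tl_u N i) v S = (\<Sum>T\<in>Pow {1..N}. (if S = T then v T else 0) - (if sws i S = T then v T else 0))"
      unfolding rho_Rm tl_u_def Rm_basis[OF tl_u_diagram(1)[OF i]] using True
    proof (simp only: if_True, intro sum.cong[OF refl])
      fix T assume "T \<in> Pow {1..N}"
      then have T: "T \<subseteq> {1..N}" by simp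
      show "R (u_dia N i) S T * v T =
         (if S = T then v T else 0) - (if sws i S = T then v T else 0)"
        unfolding tl_u_diagram(2)[OF i True] R_id[OF True T] R_id[OF s T] by simp
    qed
    also have "\<dots> = v S - v (sws i S)" unfolding sum_subtractf using True s by (subst (1 2) sum.delta') auto
    finally show ?thesis by (simp add: sw_def)
  next
    case False
    then have "\<not> sws i S \<subseteq> {1..N}" using sws_subset[OF i] by blast
    then show ?thesis using assms False unfolding supp_def rho_Rm sw_def by simp
  qed
qed

lemma Rm_mult:
  assumes S: "S \<subseteq> {1..N}" "U \<subseteq> {1..N}"
  shows "Rm N (tl_mult N x y) S U = (\<Sum>T\<in>Pow {1..N}. Rm N x S T * Rm N y T U)"
proof -
  have "Rm N (tl_mult N x y) S U = (\<Sum>D1\<in>diagrams N. \<Sum>D2\<in>diagrams N. x D1 * y D2 * (2 ^ loops D1 D2 * R (dia_comp D1 D2) S U))"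
    unfolding tl_mult_def Rm_sum Rm_scale
    by (intro sum.cong refl) (simp add: Rm_basis[OF dia_comp_in_diagrams])
  also have "\<dots> = (\<Sum>D1\<in>diagrams N. \<Sum>D2\<in>diagrams N. x D1 * y D2 * (\<Sum>T\<in>Pow {1..N}. R D1 S T * R D2 T U))"
    by (intro sum.cong refl) (simp only: R_dia_comp[OF diagrams_partition diagrams_partition S])
  also have "\<dots> = (\<Sum>D1\<in>diagrams N. \<Sum>D2\<in>diagrams N. \<Sum>T\<in>Pow {1..N}. (x D1 * R D1 S T) * (y D2 * R D2 T U))"
    by (simp add: sum_distrib_left algebra_simps)
  also have "\<dots> = (\<Sum>D1\<in>diagrams N. \<Sum>T\<in>Pow {1..N}. \<Sum>D2\<in>diagrams N. (x D1 * R D1 S T) * (y D2 * R D2 T U))"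
    by (rule sum.cong[OF refl], rule sum.swap)
  also have "\<dots> = (\<Sum>T\<in>Pow {1..N}. \<Sum>D1\<in>diagrams N. \<Sum>D2\<in>diagrams N. (x D1 * R D1 S T) * (y D2 * R D2 T U))"
    by (rule sum.swap)
  also have "\<dots> = (\<Sum>T\<in>Pow {1..N}. Rm N x S T * Rm N y T U)"
    by (simp add: Rm_def sum_product)
  finally show ?thesis .
qed

lemma rho_mult: "rho N (tl_mult N x y) v = rho N x (rho N y v)"
proof
  fix S
  show "rho N (tl_mult N x y) v S = rho N x (rho N y v) S"
  proof (cases "S \<subseteq> {1..N}")
    case True
    have "rho N (tl_mult N x y) v S = (\<Sum>U\<in>Pow {1..N}. \<Sum>T\<in>Pow {1..N}. Rm N x S T * (Rm N y T U * v U))"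
      unfolding rho_Rm using True by (simp add: Rm_mult sum_distrib_right mult.assoc)
    also have "\<dots> = (\<Sum>T\<in>Pow {1..N}. \<Sum>U\<in>Pow {1..N}. Rm N x S T * (Rm N y T U * v U))"
      by (rule sum.swap)
    also have "\<dots> = (\<Sum>T\<in>Pow {1..N}. Rm N x S T * rho N y v T)"
      by (rule sum.cong[OF refl]) (simp add: rho_Rm sum_distrib_left)
    also have "\<dots> = rho N x (rho N y v) S" using True by (simp add: rho_Rm[of N x])
    finally show ?thesis .
  next
    case False then show ?thesis by (simp add: rho_Rm)
  qed
qed

section \<open>Linear independence of the diagrams\<close>

text \<open>\<open>O'\<close> is a transversal of the arcs, and the openers are the transversal that
  consists of the smaller ends.\<close>

lemma openers_weight:
  assumes nc: "nc_inv n \<pi>" and O: "O' \<subseteq> {1..n}"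
    and alt: "\<And>c. c \<in> {1..n} \<Longrightarrow> (c \<in> O') \<noteq> (\<pi> c \<in> O')"
  shows "\<Sum>(openers n \<pi>) \<le> \<Sum>O'" and "\<Sum>(openers n \<pi>) = \<Sum>O' \<Longrightarrow> openers n \<pi> = O'"
proof -
  define h where "h c = (if c \<in> O' then c else \<pi> c)" for c
  have O'op: "c \<in> openers n \<pi> \<longleftrightarrow> c \<in> {1..n} \<and> c < \<pi> c" for c unfolding openers_def by simp
  have b: "bij_betw h (openers n \<pi>) O'"
  proof (rule bij_betwI')
    fix x y assume x: "x \<in> openers n \<pi>" and y: "y \<in> openers n \<pi>"
    have "x = y" if e: "h x = h y"
    proof -
      have D: "\<pi> (\<pi> x) = x" "\<pi> (\<pi> y) = y" using nc_invD[OF nc] x y O'op by blast+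
      have "x = y \<or> x = \<pi> y \<or> \<pi> x = y \<or> \<pi> x = \<pi> y" using e unfolding h_def by metis
      then show ?thesis using D x y O'op by (metis less_asym)
    qed
    then show "(h x = h y) = (x = y)" by blast
  next
    fix x assume "x \<in> openers n \<pi>" then show "h x \<in> O'" unfolding h_def using alt O'op by metis
  next
    fix y assume y: "y \<in> O'"
    then have yr: "y \<in> {1..n}" using O by blast
    show "\<exists>x\<in>openers n \<pi>. y = h x"
    proof (cases "y < \<pi> y")
      case True then show ?thesis using y yr O'op unfolding h_def by metis
    next
      case False
      then have "\<pi> y < y" using nc_invD(2)[OF nc yr] by linarith
      then have "\<pi> y \<in> openers n \<pi>" using O'op nc_invD[OF nc yr] by simp
      moreover have "h (\<pi> y) = y" unfolding h_def using alt[OF yr] y nc_invD(3)[OF nc yr] by simp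
      ultimately show ?thesis by metis
    qed
  qed
  have le: "c \<le> h c" if "c \<in> openers n \<pi>" for c using that O'op unfolding h_def by simp
  have s: "\<Sum>O' = sum h (openers n \<pi>)" using sum.reindex_bij_betw[OF b, of "\<lambda>x. x"] by simp
  show "\<Sum>(openers n \<pi>) \<le> \<Sum>O'" unfolding s by (rule sum_mono) (use le in auto)
  assume e: "\<Sum>(openers n \<pi>) = \<Sum>O'"
  have "h c = c" if c: "c \<in> openers n \<pi>" for c
  proof (rule ccontr)
    assume "h c \<noteq> c"
    then have "c < h c" using le[OF c] by linarith
    then have "\<Sum>(openers n \<pi>) < sum h (openers n \<pi>)"
      by (intro sum_strict_mono_ex1) (use le c in auto)
    then show False using e s by simp
  qed
  then have "h ` openers n \<pi> = openers n \<pi>" by (metis (no_types, lifting) image_cong image_ident)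
  then show "openers n \<pi> = O'" using b unfolding bij_betw_def by simp
qed

text \<open>Triangularity. Among the diagrams in the support, take one whose openers have the least
  sum and turn its openers into a labelling. Any other diagram in the support with a nonzero entry
  there has these openers as a transversal, so its own openers have at most this sum; by minimality
  they are the same.\<close>

lemma Rm_injective:
  assumes x: "x \<in> TL N UNIV" and z: "\<And>S T. S \<subseteq> {1..N} \<Longrightarrow> T \<subseteq> {1..N} \<Longrightarrow> Rm N x S T = 0"
  shows "x = 0"
proof (rule ccontr)
  assume "x \<noteq> 0"
  define W where "W = {\<pi>. nc_inv (2 * N) \<pi> \<and> x (dia_of N \<pi>) \<noteq> 0}"
  have "W \<noteq> {}"
  proof -
    obtain D where D: "x D \<noteq> 0" using \<open>x \<noteq> 0\<close> by (metis ext zero_fun_def)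
    then have "D \<in> diagrams N" using x unfolding TL_def by auto
    then show ?thesis using diagrams_obtain D unfolding W_def by (metis (mono_tags, lifting) empty_Collect_eq)
  qed
  then obtain \<pi> where \<pi>: "\<pi> \<in> W" and mn: "\<And>\<pi>'. \<pi>' \<in> W \<Longrightarrow> \<Sum>(openers (2 * N) \<pi>) \<le> \<Sum>(openers (2 * N) \<pi>')"
    using arg_min_nat_lemma[of "\<lambda>\<pi>. \<pi> \<in> W" _ "\<lambda>\<pi>. \<Sum>(openers (2 * N) \<pi>)"] by blast
  have nc: "nc_inv (2 * N) \<pi>" and x\<pi>: "x (dia_of N \<pi>) \<noteq> 0" using \<pi> unfolding W_def by auto
  let ?O = "openers (2 * N) \<pi>"
  \<comment> \<open>On the circle the label at position \<open>c\<close> becomes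
    \<open>(c \<in> ?O) \<noteq> even c\<close>; \<open>T\<close> is a complement because the
    position \<open>2 * N + 1 - j\<close> and the index \<open>j\<close> have opposite parity. The
    ends of an arc also have opposite parity, so equal labels mean that exactly one end lies in
    \<open>?O\<close>.\<close>
  define S where "S = {j \<in> {1..N}. j \<in> ?O}"
  define T where "T = {j \<in> {1..N}. 2 * N + 1 - j \<notin> ?O}"
  have ST: "S \<subseteq> {1..N}" "T \<subseteq> {1..N}" unfolding S_def T_def by auto
  have l: "lab S T (pt_at N c) = ((c \<in> ?O) \<noteq> even c)" if c: "c \<in> {1..2 * N}" for c
  proof (cases "c \<le> N")
    case True then show ?thesis using c unfolding S_def pt_at_def by auto
  next
    case False
    then have "2 * N + 1 - c \<in> {1..N}" "2 * N + 1 - (2 * N + 1 - c) = c" using c by auto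
    moreover have "even (2 * N + 1 - c) \<longleftrightarrow> odd c" using c by auto
    ultimately show ?thesis using False unfolding T_def pt_at_def by auto
  qed
  have R0: "R (dia_of N \<pi>') S T * x (dia_of N \<pi>') = 0"
    if nc': "nc_inv (2 * N) \<pi>'" and ne: "dia_of N \<pi>' \<noteq> dia_of N \<pi>" for \<pi>'
  proof (rule ccontr)
    assume h: "R (dia_of N \<pi>') S T * x (dia_of N \<pi>') \<noteq> 0"
    then have "\<pi>' \<in> W" unfolding W_def using nc' by auto
    have "cons (2 * N) \<pi>' (\<lambda>c. lab S T (pt_at N c))" using h R_neq_0 mono_dia_of by auto
    then have "(c \<in> ?O) \<noteq> (\<pi>' c \<in> ?O)" if c: "c \<in> {1..2 * N}" for c
      using l[OF c] l[OF nc_invD(1)[OF nc' c]] nc_inv_parity[OF nc' c] c unfolding cons_def by blast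
    note w = openers_weight[OF nc' _ this]
    have Os: "?O \<subseteq> {1..2 * N}" unfolding openers_def by auto
    have "openers (2 * N) \<pi>' = ?O" by (rule w(2)[OF Os]) (use w(1)[OF Os] mn[OF \<open>\<pi>' \<in> W\<close>] in simp_all)
    then have "dia_of N \<pi>' = dia_of N \<pi>" using dia_of_cong openers_unique[OF nc' nc] by blast
    then show False using ne by simp
  qed
  have "Rm N x S T = (\<Sum>D\<in>diagrams N. if D = dia_of N \<pi> then x D * R D S T else 0)"
    unfolding Rm_def
  proof (rule sum.cong[OF refl])
    fix D assume "D \<in> diagrams N"
    then obtain \<pi>' where "nc_inv (2 * N) \<pi>'" "D = dia_of N \<pi>'" using diagrams_obtain by blast
    then show "x D * R D S T = (if D = dia_of N \<pi> then x D * R D S T else 0)" using R0[of \<pi>'] by (auto simp: mult.commute)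
  qed
  also have "\<dots> = x (dia_of N \<pi>) * R (dia_of N \<pi>) S T" using dia_of_in_diagrams[OF nc] by simp
  finally have "R (dia_of N \<pi>) S T = 0" using z[OF ST] x\<pi> by simp
  moreover have "cons (2 * N) \<pi> (\<lambda>c. lab S T (pt_at N c))"
    unfolding cons_def
  proof
    fix c assume c: "c \<in> {1..2 * N}"
    have "(c \<in> ?O) \<noteq> (\<pi> c \<in> ?O)" using nc_invD[OF nc c] c unfolding openers_def by auto
    then show "lab S T (pt_at N c) = lab S T (pt_at N (\<pi> c))"
      using l[OF c] l[OF nc_invD(1)[OF nc c]] nc_inv_parity[OF nc c] by blast
  qed
  ultimately show False using R_neq_0 mono_dia_of by blast
qed

lemma TL_diff: "x \<in> TL N UNIV \<Longrightarrow> y \<in> TL N UNIV \<Longrightarrow> x - y \<in> TL N UNIV"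
  by (simp add: TL_def)

lemma rho_delta:
  assumes "S \<subseteq> {1..N}" "T \<subseteq> {1..N}"
  shows "rho N x (\<lambda>U. if U = T then 1 else 0) S = Rm N x S T"
  using assms by (simp add: rho_Rm if_distrib[of "\<lambda>x. _ * x"] cong: if_cong)

lemma TL_eqI:
  assumes "x \<in> TL N UNIV" "y \<in> TL N UNIV" and e: "\<And>v. supp N v \<Longrightarrow> rho N x v = rho N y v"
  shows "x = y"
proof -
  have "x - y = 0"
  proof (rule Rm_injective[OF TL_diff[OF assms(1,2)]])
    fix S T :: "nat set" assume S: "S \<subseteq> {1..N}" "T \<subseteq> {1..N}"
    have "supp N (\<lambda>U. if U = T then 1 else 0)" unfolding supp_def using S by auto
    then show "Rm N (x - y) S T = 0" using e rho_delta[OF S, of x] rho_delta[OF S, of y] by (simp add: Rm_diff)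
  qed
  then show ?thesis by simp
qed

definition subring :: "rat set \<Rightarrow> bool" where
  "subring Q \<longleftrightarrow> 1 \<in> Q \<and> (\<forall>a\<in>Q. \<forall>b\<in>Q. a - b \<in> Q \<and> a * b \<in> Q)"

lemma subring_UNIV [simp]: "subring UNIV"
  by (simp add: subring_def)

lemma subringD:
  assumes "subring Q"
  shows "1 \<in> Q" "0 \<in> Q" "a \<in> Q \<Longrightarrow> b \<in> Q \<Longrightarrow> a - b \<in> Q" "a \<in> Q \<Longrightarrow> b \<in> Q \<Longrightarrow> a * b \<in> Q"
    "a \<in> Q \<Longrightarrow> - a \<in> Q" "a \<in> Q \<Longrightarrow> b \<in> Q \<Longrightarrow> a + b \<in> Q"
proof -
  show 1: "1 \<in> Q" and d: "\<And>a b. a \<in> Q \<Longrightarrow> b \<in> Q \<Longrightarrow> a - b \<in> Q" and "a \<in> Q \<Longrightarrow> b \<in> Q \<Longrightarrow> a * b \<in> Q"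
    using assms unfolding subring_def by auto
  show 0: "0 \<in> Q" using d[OF 1 1] by simp
  show m: "- a \<in> Q" if "a \<in> Q" for a using d[OF 0 that] by simp
  show "a \<in> Q \<Longrightarrow> b \<in> Q \<Longrightarrow> a + b \<in> Q" using d[of a "- b"] m by simp
qed

lemma subring_sum: "subring Q \<Longrightarrow> (\<And>a. a \<in> A \<Longrightarrow> f a \<in> Q) \<Longrightarrow> (\<Sum>a\<in>A. f a) \<in> Q"
  by (induction A rule: infinite_finite_induct) (simp_all add: subringD)

lemma subring_of_nat: "subring Q \<Longrightarrow> of_nat n \<in> Q"
  by (induction n) (simp_all add: subringD)

lemma subring_of_int: "subring Q \<Longrightarrow> of_int n \<in> Q"
  using subring_of_nat subringD(5) by (cases n) (metis of_int_of_nat_eq, metis of_int_minus of_int_of_nat_eq)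

lemma subring_power: "subring Q \<Longrightarrow> a \<in> Q \<Longrightarrow> a ^ n \<in> Q"
  by (induction n) (simp_all add: subringD)

lemma TL_mono: "x \<in> TL N Q \<Longrightarrow> x \<in> TL N UNIV"
  by (simp add: TL_def)

lemma TL_closed:
  assumes Q: "subring Q"
  shows "x \<in> TL N Q \<Longrightarrow> y \<in> TL N Q \<Longrightarrow> x + y \<in> TL N Q"
    and "x \<in> TL N Q \<Longrightarrow> y \<in> TL N Q \<Longrightarrow> x - y \<in> TL N Q"
    and "c \<in> Q \<Longrightarrow> x \<in> TL N Q \<Longrightarrow> scale c x \<in> TL N Q"
    and "0 \<in> TL N Q"
    and "D \<in> diagrams N \<Longrightarrow> basis D \<in> TL N Q"
    and "x \<in> TL N Q \<Longrightarrow> y \<in> TL N Q \<Longrightarrow> tl_mult N x y \<in> TL N Q"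
    and "tl_one N \<in> TL N Q"
    and "1 \<le> i \<Longrightarrow> i < N \<Longrightarrow> tl_u N i \<in> TL N Q"
proof -
  note q = subringD[OF Q]
  show "x \<in> TL N Q \<Longrightarrow> y \<in> TL N Q \<Longrightarrow> x + y \<in> TL N Q" "x \<in> TL N Q \<Longrightarrow> y \<in> TL N Q \<Longrightarrow> x - y \<in> TL N Q"
    and sc: "\<And>c x. c \<in> Q \<Longrightarrow> x \<in> TL N Q \<Longrightarrow> scale c x \<in> TL N Q" and "0 \<in> TL N Q"
    using q by (simp_all add: TL_def scale_def)
  show b: "basis D \<in> TL N Q" if "D \<in> diagrams N" for D using q that by (auto simp: TL_def basis_def)
  show "tl_one N \<in> TL N Q" unfolding tl_one_def by (rule b[OF tl_one_diagram])
  show "1 \<le> i \<Longrightarrow> i < N \<Longrightarrow> tl_u N i \<in> TL N Q" unfolding tl_u_def by (rule b[OF tl_u_diagram(1)])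
  assume x: "x \<in> TL N Q" and y: "y \<in> TL N Q"
  have app: "tl_mult N x y D = (\<Sum>D1\<in>diagrams N. \<Sum>D2\<in>diagrams N. x D1 * y D2 * 2 ^ loops D1 D2 * basis (dia_comp D1 D2) D)" for D
    unfolding tl_mult_def sum_apply scale_def ..
  have two: "2 ^ n \<in> Q" for n using subring_power[OF Q] subring_of_nat[OF Q, of 2] by simp
  have "tl_mult N x y D \<in> Q" for D
    unfolding app
  proof (intro subring_sum[OF Q] q(4))
    show "x D1 \<in> Q" "y D1 \<in> Q" for D1 using x y unfolding TL_def by auto
    show "basis D' D \<in> Q" for D' using q by (simp add: basis_def)
  qed (rule two)
  moreover have "tl_mult N x y D = 0" if "D \<notin> diagrams N" for D
    unfolding app
    by (intro sum.neutral ballI) (use dia_comp_in_diagrams that in \<open>auto simp: basis_def\<close>)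
  ultimately show "tl_mult N x y \<in> TL N Q" unfolding TL_def by blast
qed

lemma TL_sum: "subring Q \<Longrightarrow> (\<And>a. a \<in> A \<Longrightarrow> f a \<in> TL N Q) \<Longrightarrow> (\<Sum>a\<in>A. f a) \<in> TL N Q"
  by (induction A rule: infinite_finite_induct) (simp_all add: TL_closed)

lemma tl_prod_simps: "tl_prod N [] = tl_one N" "tl_prod N (x # xs) = tl_mult N x (tl_prod N xs)"
  by (simp_all add: tl_prod_def)

lemma TL_prod: "subring Q \<Longrightarrow> (\<And>x. x \<in> set xs \<Longrightarrow> x \<in> TL N Q) \<Longrightarrow> tl_prod N xs \<in> TL N Q"
  by (induction xs) (simp_all add: tl_prod_simps TL_closed)

lemma rho_prod: "supp N v \<Longrightarrow> rho N (tl_prod N xs) v = foldr (\<lambda>x. rho N x) xs v"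
  by (induction xs) (simp_all add: tl_prod_simps rho_mult rho_one)

text \<open>Associativity is inherited from the composition of operators, by faithfulness.\<close>

lemma tl_mult_assoc:
  assumes "x \<in> TL N UNIV" "y \<in> TL N UNIV" "z \<in> TL N UNIV"
  shows "tl_mult N (tl_mult N x y) z = tl_mult N x (tl_mult N y z)"
  by (rule TL_eqI[of _ N]) (simp_all add: TL_closed assms rho_mult)

lemma tl_mult_one:
  assumes "x \<in> TL N UNIV"
  shows "tl_mult N (tl_one N) x = x" "tl_mult N x (tl_one N) = x"
  by (rule TL_eqI[of _ N]; simp add: TL_closed assms rho_mult rho_one)+

section \<open>Walks and highest weight vectors\<close>

text \<open>A walk \<open>c\<close> encodes a two-column tableau: \<open>c i\<close> holds if \<open>i\<close> is in the first column.\<close>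

primrec ht :: "(nat \<Rightarrow> bool) \<Rightarrow> nat \<Rightarrow> int" where
  "ht c 0 = 0"
| "ht c (Suc m) = ht c m + (if c (Suc m) then 1 else -1)"

definition good :: "nat \<Rightarrow> (nat \<Rightarrow> bool) \<Rightarrow> bool" where
  "good N c \<longleftrightarrow> (\<forall>m\<le>N. 0 \<le> ht c m)"

definition swc :: "nat \<Rightarrow> (nat \<Rightarrow> bool) \<Rightarrow> nat \<Rightarrow> bool" where
  "swc i c = c(i := c (Suc i), Suc i := c i)"

lemma swc_simps [simp]: "swc i c i = c (Suc i)" "swc i c (Suc i) = c i" "swc i (swc i c) = c"
  "j \<noteq> i \<Longrightarrow> j \<noteq> Suc i \<Longrightarrow> swc i c j = c j"
  by (auto simp: swc_def)

lemma ht_cong: "(\<And>i. 1 \<le> i \<Longrightarrow> i \<le> m \<Longrightarrow> c i = c' i) \<Longrightarrow> ht c m = ht c' m"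
  by (induction m) auto

lemma good_cong: "(\<And>i. 1 \<le> i \<Longrightarrow> i \<le> N \<Longrightarrow> c i = c' i) \<Longrightarrow> good N c = good N c'"
  unfolding good_def using ht_cong[of _ c c'] by (metis order_trans)

lemma ht_swc:
  assumes "1 \<le> i" "m \<noteq> i"
  shows "ht (swc i c) m = ht c m"
proof (cases "m < i")
  case True
  then show ?thesis by (intro ht_cong) auto
next
  case False
  then have "Suc i \<le> m" using assms by auto
  then show ?thesis
  proof (induction m rule: dec_induct)
    case base
    obtain j where j: "i = Suc j" using assms by (cases i) auto
    have "ht (swc i c) j = ht c j" by (intro ht_cong) (use j in auto)
    moreover have "swc (Suc j) c (Suc j) = c (Suc (Suc j))" "swc (Suc j) c (Suc (Suc j)) = c (Suc j)" by simp_all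
    ultimately show ?case by (simp add: j)
  next
    case (step n)
    then show ?case by simp
  qed
qed

lemma ht_swc_at: "1 \<le> i \<Longrightarrow> ht (swc i c) i = ht c (i - 1) + (if c (Suc i) then 1 else -1)"
  by (cases i) (auto intro!: ht_cong)

lemma good_swc_peak:
  assumes "good N c" "1 \<le> i" "i < N" "1 \<le> ht c (i - 1)"
  shows "good N (swc i c)"
  unfolding good_def
proof (intro allI impI)
  fix m assume "m \<le> N"
  then show "0 \<le> ht (swc i c) m"
    using assms ht_swc[of i m c] ht_swc_at[of i c] unfolding good_def by (cases "m = i") auto
qed

lemma good_swc_valley:
  assumes "good N c" "1 \<le> i" "i < N" "c (Suc i)"
  shows "good N (swc i c)"
  unfolding good_def
proof (intro allI impI)
  fix m assume "m \<le> N"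
  moreover have "0 \<le> ht c (i - 1)" using assms unfolding good_def by simp
  ultimately show "0 \<le> ht (swc i c) m"
    using assms ht_swc[of i m c] ht_swc_at[of i c] unfolding good_def by (cases "m = i") auto
qed

text \<open>A subset records the tensor factors that carry the second basis vector.
  \<open>t0\<close> and \<open>t1\<close> append one more factor, carrying the first or the second
  basis vector.\<close>

definition t0 :: "nat \<Rightarrow> vec \<Rightarrow> vec" where
  "t0 m y = (\<lambda>S. if Suc m \<in> S then 0 else y S)"

definition t1 :: "nat \<Rightarrow> vec \<Rightarrow> vec" where
  "t1 m y = (\<lambda>S. if Suc m \<in> S then y (S - {Suc m}) else 0)"

text \<open>\<open>low\<close> and \<open>rai\<close> are the lowering and raising operators of \<open>sl\<^sub>2\<close>.\<close>

definition low :: "nat \<Rightarrow> vec \<Rightarrow> vec" where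
  "low m y = (\<lambda>S. \<Sum>j\<in>S \<inter> {1..m}. y (S - {j}))"

definition rai :: "nat \<Rightarrow> vec \<Rightarrow> vec" where
  "rai m y = (\<lambda>S. if S \<subseteq> {1..m} then \<Sum>j\<in>{1..m} - S. y (insert j S) else 0)"

definition ip :: "nat \<Rightarrow> vec \<Rightarrow> vec \<Rightarrow> rat" where
  "ip m x y = (\<Sum>S\<in>Pow {1..m}. x S * y S)"

text \<open>The Clebsch-Gordan recursion: the two summands of the tensor product of an irreducible
  \<open>sl\<^sub>2\<close>-module with the two-dimensional one have these highest weight vectors.\<close>

primrec vc :: "(nat \<Rightarrow> bool) \<Rightarrow> nat \<Rightarrow> vec" where
  "vc c 0 = (\<lambda>S. if S = {} then 1 else 0)"
| "vc c (Suc m) = (if c (Suc m) then t0 m (vc c m)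
     else sc (of_int (ht c m)) (t1 m (vc c m)) - t0 m (low m (vc c m)))"

lemma t_linear: "t0 m (x + y) = t0 m x + t0 m y" "t0 m (x - y) = t0 m x - t0 m y" "t0 m (sc a x) = sc a (t0 m x)" "t0 m 0 = 0"
  "t1 m (x + y) = t1 m x + t1 m y" "t1 m (x - y) = t1 m x - t1 m y" "t1 m (sc a x) = sc a (t1 m x)" "t1 m 0 = 0"
  by (auto simp: t0_def t1_def sc_def)

lemma low_linear: "low m (x + y) = low m x + low m y" "low m (x - y) = low m x - low m y" "low m (sc a x) = sc a (low m x)" "low m 0 = 0"
  by (auto simp: low_def sc_def sum.distrib sum_subtractf sum_distrib_left)

lemma rai_linear: "rai m (x + y) = rai m x + rai m y" "rai m (x - y) = rai m x - rai m y" "rai m (sc a x) = sc a (rai m x)" "rai m 0 = 0"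
  by (auto simp: rai_def sc_def sum.distrib sum_subtractf sum_distrib_left)

lemma supp_t0: "supp m y \<Longrightarrow> supp (Suc m) (t0 m y)"
proof -
  assume y: "supp m y"
  have "t0 m y S = 0" if "\<not> S \<subseteq> {1..Suc m}" for S
  proof -
    have "\<not> S \<subseteq> {1..m}" using that by (meson atLeastatMost_subset_iff le_SucI order_refl subset_trans)
    then show ?thesis using y unfolding supp_def t0_def by simp
  qed
  then show ?thesis unfolding supp_def by blast
qed

lemma supp_t1: "supp m y \<Longrightarrow> supp (Suc m) (t1 m y)"
proof -
  assume y: "supp m y"
  have "t1 m y S = 0" if "\<not> S \<subseteq> {1..Suc m}" for S
  proof -
    have "S \<subseteq> {1..Suc m}" if h: "S - {Suc m} \<subseteq> {1..m}"
    proof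
      fix x assume "x \<in> S"
      then have "x = Suc m \<or> x \<in> {1..m}" using h by blast
      then show "x \<in> {1..Suc m}" by auto
    qed
    then have "\<not> S - {Suc m} \<subseteq> {1..m}" using that by blast
    then show ?thesis using y unfolding supp_def t1_def by simp
  qed
  then show ?thesis unfolding supp_def by blast
qed

lemma supp_low: "supp m y \<Longrightarrow> supp m (low m y)"
proof -
  assume y: "supp m y"
  have "low m y S = 0" if "\<not> S \<subseteq> {1..m}" for S
    unfolding low_def
  proof (rule sum.neutral, rule ballI)
    fix j assume "j \<in> S \<inter> {1..m}"
    then have "\<not> S - {j} \<subseteq> {1..m}" using that by blast
    then show "y (S - {j}) = 0" by (rule y[unfolded supp_def, rule_format])
  qed
  then show ?thesis unfolding supp_def by blast
qed

lemma supp_vc [simp]: "supp m (vc c m)"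
proof (induction m)
  case 0 then show ?case by (auto simp: supp_def)
next
  case (Suc m) then show ?case by (simp add: supp_t0 supp_t1 supp_low supp_diff supp_sc)
qed

lemma low_t0: "low (Suc m) (t0 m y) = t0 m (low m y) + t1 m y"
proof
  fix S
  show "low (Suc m) (t0 m y) S = (t0 m (low m y) + t1 m y) S"
  proof (cases "Suc m \<in> S")
    case True
    then have e: "S \<inter> {1..Suc m} = insert (Suc m) (S \<inter> {1..m})" by auto
    have "low (Suc m) (t0 m y) S = t0 m y (S - {Suc m}) + (\<Sum>j\<in>S \<inter> {1..m}. t0 m y (S - {j}))"
      unfolding low_def e by simp
    also have "(\<Sum>j\<in>S \<inter> {1..m}. t0 m y (S - {j})) = 0" by (rule sum.neutral) (use True in \<open>auto simp: t0_def\<close>)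
    finally show ?thesis using True by (simp add: t0_def t1_def)
  next
    case False
    then have e: "S \<inter> {1..Suc m} = S \<inter> {1..m}" by (auto simp: le_Suc_eq)
    show ?thesis unfolding low_def e using False by (simp add: t0_def t1_def)
  qed
qed

lemma low_t1: "low (Suc m) (t1 m y) = t1 m (low m y)"
proof
  fix S
  show "low (Suc m) (t1 m y) S = t1 m (low m y) S"
  proof (cases "Suc m \<in> S")
    case True
    then have e: "S \<inter> {1..Suc m} = insert (Suc m) (S \<inter> {1..m})" "(S - {Suc m}) \<inter> {1..m} = S \<inter> {1..m}" by auto
    have "low (Suc m) (t1 m y) S = t1 m y (S - {Suc m}) + (\<Sum>j\<in>S \<inter> {1..m}. t1 m y (S - {j}))"
      unfolding low_def e by simp
    also have "(\<Sum>j\<in>S \<inter> {1..m}. t1 m y (S - {j})) = (\<Sum>j\<in>S \<inter> {1..m}. y (S - {Suc m} - {j}))"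
      by (rule sum.cong) (use True in \<open>auto simp: t1_def insert_commute Diff_insert2[symmetric]\<close>)
    finally have "low (Suc m) (t1 m y) S = (\<Sum>j\<in>S \<inter> {1..m}. y (S - {Suc m} - {j}))" using True by (simp add: t1_def)
    moreover have "t1 m (low m y) S = (\<Sum>j\<in>S \<inter> {1..m}. y (S - {Suc m} - {j}))"
      using True unfolding t1_def low_def e(2) by simp
    ultimately show ?thesis by simp
  next
    case False
    then show ?thesis by (auto simp: low_def t1_def intro!: sum.neutral)
  qed
qed

lemma rai_t0: "rai (Suc m) (t0 m y) = t0 m (rai m y)"
proof
  fix S
  show "rai (Suc m) (t0 m y) S = t0 m (rai m y) S"
  proof (cases "Suc m \<in> S")
    case True then show ?thesis by (auto simp: rai_def t0_def intro!: sum.neutral)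
  next
    case False
    then have e: "S \<subseteq> {1..Suc m} \<longleftrightarrow> S \<subseteq> {1..m}" by (auto simp: subset_iff le_Suc_eq)
    have "{1..Suc m} - S = insert (Suc m) ({1..m} - S)" using False by auto
    then have "(\<Sum>j\<in>{1..Suc m} - S. t0 m y (insert j S)) = t0 m y (insert (Suc m) S) + (\<Sum>j\<in>{1..m} - S. t0 m y (insert j S))"
      by simp
    also have "\<dots> = (\<Sum>j\<in>{1..m} - S. y (insert j S))"
      unfolding t0_def using False by (auto intro!: sum.cong)
    finally show ?thesis unfolding rai_def e using False by (simp add: t0_def)
  qed
qed

lemma rai_t1:
  assumes "supp m y"
  shows "rai (Suc m) (t1 m y) = t1 m (rai m y) + t0 m y"
proof
  fix S
  show "rai (Suc m) (t1 m y) S = (t1 m (rai m y) + t0 m y) S"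
  proof (cases "Suc m \<in> S")
    case True
    then have e: "S \<subseteq> {1..Suc m} \<longleftrightarrow> S - {Suc m} \<subseteq> {1..m}" "{1..m} - (S - {Suc m}) = {1..m} - S" "{1..Suc m} - S = {1..m} - S"
      by (auto simp: subset_iff le_Suc_eq)
    have "(\<Sum>j\<in>{1..m} - S. t1 m y (insert j S)) = (\<Sum>j\<in>{1..m} - S. y (insert j (S - {Suc m})))"
      by (rule sum.cong) (use True in \<open>auto simp: t1_def insert_Diff_if\<close>)
    then have "rai (Suc m) (t1 m y) S = (if S - {Suc m} \<subseteq> {1..m} then \<Sum>j\<in>{1..m} - S. y (insert j (S - {Suc m})) else 0)"
      unfolding rai_def e by simp
    moreover have "(t1 m (rai m y) + t0 m y) S = (if S - {Suc m} \<subseteq> {1..m} then \<Sum>j\<in>{1..m} - S. y (insert j (S - {Suc m})) else 0)"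
      unfolding plus_fun_apply t1_def t0_def rai_def e(2) using True by simp
    ultimately show ?thesis by simp
  next
    case False
    then have e: "S \<subseteq> {1..Suc m} \<longleftrightarrow> S \<subseteq> {1..m}" by (auto simp: subset_iff le_Suc_eq)
    have "{1..Suc m} - S = insert (Suc m) ({1..m} - S)" using False by auto
    then have "(\<Sum>j\<in>{1..Suc m} - S. t1 m y (insert j S)) = t1 m y (insert (Suc m) S) + (\<Sum>j\<in>{1..m} - S. t1 m y (insert j S))"
      by simp
    also have "(\<Sum>j\<in>{1..m} - S. t1 m y (insert j S)) = 0" by (rule sum.neutral) (use False in \<open>auto simp: t1_def\<close>)
    finally show ?thesis unfolding rai_def e using False assms by (auto simp: t0_def t1_def supp_def)
  qed
qed

text \<open>The relation \<open>[E, F] = H\<close>. The terms that remove one point and insert a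
  different one occur in both products and cancel; what remains counts the points outside
  \<open>S\<close> minus those inside.\<close>

lemma rai_low_comm:
  assumes "supp m y"
  shows "rai m (low m y) S - low m (rai m y) S = (of_nat m - 2 * of_nat (card S)) * y S"
proof (cases "S \<subseteq> {1..m}")
  case False
  then have "y S = 0" using assms by (simp add: supp_def)
  moreover have "low m (rai m y) S = 0" unfolding low_def by (rule sum.neutral) (use False in \<open>auto simp: rai_def\<close>)
  ultimately show ?thesis using False by (simp add: rai_def)
next
  case True
  then have fin: "finite S" by (rule finite_subset) simp
  let ?C = "{1..m} - S"
  have "rai m (low m y) S = (\<Sum>j\<in>?C. y S + (\<Sum>i\<in>S. y (insert j S - {i})))"
    unfolding rai_def using True
  proof (simp only: if_True, intro sum.cong refl)
    fix j assume j: "j \<in> ?C"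
    then have "insert j S \<inter> {1..m} = insert j S" using True by auto
    moreover have "j \<notin> S" using j by simp
    ultimately show "low m y (insert j S) = y S + (\<Sum>i\<in>S. y (insert j S - {i}))"
      unfolding low_def using fin by simp
  qed
  moreover have "low m (rai m y) S = (\<Sum>i\<in>S. y S + (\<Sum>j\<in>?C. y (insert j S - {i})))"
    unfolding low_def
  proof (intro sum.cong)
    show "S \<inter> {1..m} = S" using True by auto
    fix i assume i: "i \<in> S"
    have "{1..m} - (S - {i}) = insert i ?C" using i True by auto
    moreover have "S - {i} \<subseteq> {1..m}" using True by auto
    ultimately have "rai m y (S - {i}) = (\<Sum>j\<in>insert i ?C. y (insert j (S - {i})))" by (simp add: rai_def)
    also have "\<dots> = y S + (\<Sum>j\<in>?C. y (insert j (S - {i})))" using i by (simp add: insert_absorb)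
    also have "(\<Sum>j\<in>?C. y (insert j (S - {i}))) = (\<Sum>j\<in>?C. y (insert j S - {i}))"
      by (rule sum.cong) (use i in \<open>auto simp: insert_Diff_if\<close>)
    finally show "rai m y (S - {i}) = y S + (\<Sum>j\<in>?C. y (insert j S - {i}))" .
  qed
  moreover have "(\<Sum>j\<in>?C. \<Sum>i\<in>S. y (insert j S - {i})) = (\<Sum>i\<in>S. \<Sum>j\<in>?C. y (insert j S - {i}))" by (rule sum.swap)
  ultimately have "rai m (low m y) S - low m (rai m y) S = of_nat (card ?C) * y S - of_nat (card S) * y S"
    by (simp add: sum.distrib)
  moreover have "card ?C = m - card S" "card S \<le> m"
    using True fin card_mono[OF _ True] by (simp_all add: card_Diff_subset)
  ultimately show ?thesis by (simp add: of_nat_diff algebra_simps)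
qed

lemma vc_weight: "vc c m S \<noteq> 0 \<Longrightarrow> S \<subseteq> {1..m} \<and> 2 * int (card S) = int m - ht c m"
proof (induction m arbitrary: S)
  case 0 then show ?case by (auto split: if_splits)
next
  case (Suc m)
  have sub: "S \<subseteq> {1..Suc m}" using supp_vc[of "Suc m" c] Suc.prems unfolding supp_def by blast
  then have fin: "finite S" by (rule finite_subset) simp
  have "2 * int (card S) = int (Suc m) - ht c (Suc m)"
  proof (cases "c (Suc m)")
    case True
    then have "vc c m S \<noteq> 0" using Suc.prems by (auto simp: t0_def split: if_splits)
    then show ?thesis using Suc.IH[of S] True by simp
  next
    case False
    show ?thesis
    proof (cases "Suc m \<in> S")
      case True
      then have "vc c m (S - {Suc m}) \<noteq> 0" using Suc.prems False by (auto simp: t0_def t1_def sc_def)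
      then have "2 * int (card (S - {Suc m})) = int m - ht c m" using Suc.IH by blast
      moreover have "card S = Suc (card (S - {Suc m}))" by (rule card.remove[OF fin True])
      ultimately show ?thesis using False by simp
    next
      case f: False
      then have "low m (vc c m) S \<noteq> 0" using Suc.prems False by (auto simp: t0_def t1_def sc_def)
      then obtain j where "j \<in> S \<inter> {1..m}" and j0: "vc c m (S - {j}) \<noteq> 0"
        unfolding low_def by (rule sum.not_neutral_contains_not_neutral)
      then have j: "j \<in> S" "vc c m (S - {j}) \<noteq> 0" by simp_all
      then have "2 * int (card (S - {j})) = int m - ht c m" using Suc.IH by blast
      moreover have "card S = Suc (card (S - {j}))" by (rule card.remove[OF fin j(1)])
      ultimately show ?thesis using False by simp
    qed
  qed
  then show ?case using sub by blast
qed

text \<open>The factor \<open>ht c m\<close> in the recursion is what makes a down step preserve the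
  highest weight property: raising the \<open>t1\<close> part returns \<open>t0\<close> of the
  vector, and raising \<open>low\<close> returns it times its weight \<open>ht c m\<close>.\<close>

lemma vc_sl2: "rai m (vc c m) = 0" "rai m (low m (vc c m)) = sc (of_int (ht c m)) (vc c m)"
proof -
  have EF: "rai m (low m (vc c m)) = sc (of_int (ht c m)) (vc c m)" if "rai m (vc c m) = 0" for m
  proof
    fix S
    have w: "(of_nat m - 2 * of_nat (card S)) * vc c m S = of_int (ht c m) * vc c m S"
    proof (cases "vc c m S = 0")
      case False
      then have "2 * int (card S) = int m - ht c m" using vc_weight by blast
      then have "ht c m = int m - 2 * int (card S)" by simp
      then show ?thesis by simp
    qed simp
    have "rai m (low m (vc c m)) S - low m (rai m (vc c m)) S = (of_nat m - 2 * of_nat (card S)) * vc c m S"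
      by (rule rai_low_comm) simp
    then show "rai m (low m (vc c m)) S = sc (of_int (ht c m)) (vc c m) S"
      unfolding that low_linear w by (simp add: sc_def)
  qed
  show E: "rai m (vc c m) = 0"
  proof (induction m)
    case 0 show ?case by (rule ext) (simp add: rai_def)
  next
    case (Suc m)
    show ?case
    proof (cases "c (Suc m)")
      case True then show ?thesis by (simp only: vc.simps if_True rai_t0 Suc t_linear)
    next
      case False
      then show ?thesis
        by (simp only: vc.simps if_False rai_linear rai_t0 rai_t1[OF supp_vc] EF[OF Suc] Suc t_linear sc_simps) simp
    qed
  qed
  show "rai m (low m (vc c m)) = sc (of_int (ht c m)) (vc c m)" by (rule EF[OF E])
qed

lemma sum_Pow_Suc: "(\<Sum>S\<in>Pow {1..Suc m}. g S) = (\<Sum>S\<in>Pow {1..m}. g S + g (insert (Suc m) S) :: rat)"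
proof -
  have e: "{1..Suc m} = insert (Suc m) {1..m}" by auto
  have "(\<Sum>S\<in>Pow {1..Suc m}. g S) = (\<Sum>S\<in>Pow {1..m}. g S) + (\<Sum>S\<in>insert (Suc m) ` Pow {1..m}. g S)"
    unfolding e Pow_insert by (rule sum.union_disjoint) auto
  also have "(\<Sum>S\<in>insert (Suc m) ` Pow {1..m}. g S) = (\<Sum>S\<in>Pow {1..m}. g (insert (Suc m) S))"
  proof -
    have "Suc m \<notin> S" if "S \<in> Pow {1..m}" for S using that by auto
    then have "inj_on (insert (Suc m)) (Pow {1..m})" by (intro inj_onI) (metis insert_ident)
    then show ?thesis by (simp only: sum.reindex o_def)
  qed
  finally show ?thesis by (simp add: sum.distrib)
qed

lemma ip_t: "ip (Suc m) (t0 m x) (t0 m y) = ip m x y" "ip (Suc m) (t0 m x) (t1 m y) = 0"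
  "ip (Suc m) (t1 m x) (t0 m y) = 0" "ip (Suc m) (t1 m x) (t1 m y) = ip m x y"
proof -
  have *: "Suc m \<notin> S" "insert (Suc m) S - {Suc m} = S" if "S \<in> Pow {1..m}" for S using that by auto
  show "ip (Suc m) (t0 m x) (t0 m y) = ip m x y" "ip (Suc m) (t0 m x) (t1 m y) = 0"
    "ip (Suc m) (t1 m x) (t0 m y) = 0" "ip (Suc m) (t1 m x) (t1 m y) = ip m x y"
    unfolding ip_def sum_Pow_Suc t0_def t1_def
    by (intro sum.cong sum.neutral ballI refl; simp only: *; simp)+
qed

lemma ip_linear: "ip m (x + y) z = ip m x z + ip m y z" "ip m (x - y) z = ip m x z - ip m y z" "ip m (sc a x) z = a * ip m x z"
  "ip m z (x + y) = ip m z x + ip m z y" "ip m z (x - y) = ip m z x - ip m z y" "ip m z (sc a x) = a * ip m z x"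
  "ip m 0 z = 0" "ip m z 0 = 0"
  by (simp_all add: ip_def sc_def algebra_simps sum.distrib sum_subtractf sum_distrib_left)

lemma ip_commute: "ip m x y = ip m y x"
  by (simp add: ip_def mult.commute)

text \<open>Lowering and raising are adjoint: removing \<open>j\<close> from a set and inserting
  \<open>j\<close> into a set run through the same pairs.\<close>

lemma ip_low: "ip m (low m x) y = ip m x (rai m y)"
proof -
  have "ip m (low m x) y = (\<Sum>S\<in>Pow {1..m}. \<Sum>j\<in>S \<inter> {1..m}. x (S - {j}) * y S)"
    unfolding ip_def low_def by (simp add: sum_distrib_right)
  also have "\<dots> = (\<Sum>(S, j)\<in>Sigma (Pow {1..m}) (\<lambda>S. S \<inter> {1..m}). x (S - {j}) * y S)"
    by (rule sum.Sigma) auto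
  also have "\<dots> = (\<Sum>(T, j)\<in>Sigma (Pow {1..m}) (\<lambda>T. {1..m} - T). x T * y (insert j T))"
    by (rule sum.reindex_bij_witness[of _ "\<lambda>(T, j). (insert j T, j)" "\<lambda>(S, j). (S - {j}, j)"])
      (auto simp: insert_absorb)
  also have "\<dots> = (\<Sum>T\<in>Pow {1..m}. \<Sum>j\<in>{1..m} - T. x T * y (insert j T))"
    by (rule sum.Sigma[symmetric]) auto
  also have "\<dots> = ip m x (rai m y)" unfolding ip_def rai_def by (intro sum.cong refl) (auto simp: sum_distrib_left)
  finally show ?thesis .
qed

text \<open>The squared length of \<open>vc c m\<close>. At a down step from height \<open>d\<close>
  the \<open>t1\<close> part contributes the factor \<open>d^2\<close> and the lowered part the
  factor \<open>d\<close>.\<close>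

primrec nrm :: "(nat \<Rightarrow> bool) \<Rightarrow> nat \<Rightarrow> rat" where
  "nrm c 0 = 1"
| "nrm c (Suc m) = (if c (Suc m) then nrm c m else of_int (ht c m) * (of_int (ht c m) + 1) * nrm c m)"

lemma vc_orthogonal: "ip m (vc c m) (vc c' m) = (if \<forall>i\<in>{1..m}. c i = c' i then nrm c m else 0)"
proof (induction m)
  case 0 then show ?case by (simp add: ip_def)
next
  case (Suc m)
  let ?v = "vc c m" and ?w = "vc c' m"
  have l: "ip m (low m ?v) ?w = 0" "ip m ?v (low m ?w) = 0"
    using ip_low[of m ?v ?w] ip_low[of m ?w ?v] by (simp_all add: vc_sl2 ip_linear ip_commute[of m ?v])
  have ll: "ip m (low m ?v) (low m ?w) = of_int (ht c' m) * ip m ?v ?w"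
    using ip_low[of m ?v "low m ?w"] by (simp add: vc_sl2 ip_linear)
  have all: "(\<forall>i\<in>{1..Suc m}. c i = c' i) \<longleftrightarrow> (\<forall>i\<in>{1..m}. c i = c' i) \<and> c (Suc m) = c' (Suc m)"
  proof -
    have e: "{1..Suc m} = insert (Suc m) {1..m}" by auto
    show ?thesis by (simp only: e ball_simps) blast
  qed
  have h: "ht c m = ht c' m" if "\<forall>i\<in>{1..m}. c i = c' i" using that by (intro ht_cong) auto
  show ?case unfolding all
    by (cases "c (Suc m)"; cases "c' (Suc m)";
        simp only: vc.simps nrm.simps if_True if_False ip_linear ip_t l ll Suc;
        use h in \<open>auto simp: algebra_simps\<close>)
qed

lemma good_less: "good N c \<Longrightarrow> m \<le> N \<Longrightarrow> good m c"
  unfolding good_def by auto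

text \<open>A down step of a good walk starts at height at least 1, so the factor of the squared
  length is positive.\<close>

lemma nrm_pos: "good m c \<Longrightarrow> 0 < nrm c m"
proof (induction m)
  case (Suc m)
  have g: "good m c" using Suc.prems good_less[of "Suc m" c m] by simp
  show ?case
  proof (cases "c (Suc m)")
    case False
    then have "1 \<le> ht c m" using Suc.prems unfolding good_def by (metis (full_types) ht.simps(2) order_refl add_diff_cancel_right' diff_conv_add_uminus diff_ge_0_iff_ge)
    then have "0 < (of_int (ht c m) :: rat)" by simp
    then show ?thesis using Suc.IH[OF g] False by simp
  qed (use Suc.IH[OF g] in simp)
qed simp

lemma ip_self_0: "supp m x \<Longrightarrow> ip m x x = 0 \<Longrightarrow> x = 0"
proof
  fix S assume s: "supp m x" and z: "ip m x x = 0"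
  show "x S = 0 S"
  proof (cases "S \<subseteq> {1..m}")
    case True
    have "\<forall>S\<in>Pow {1..m}. x S * x S = 0" using z unfolding ip_def by (subst (asm) sum_nonneg_eq_0_iff) auto
    then show ?thesis using True by auto
  qed (use s in \<open>auto simp: supp_def\<close>)
qed

text \<open>By adjointness the squared length of the lowered vector is the weight times that of the
  vector itself.\<close>

lemma low_vc_ht_0: "ht c m = 0 \<Longrightarrow> low m (vc c m) = 0"
  by (rule ip_self_0[of m]) (simp_all add: supp_low ip_low vc_sl2 ip_linear sc_simps)

lemma vc_cong: "(\<And>i. 1 \<le> i \<Longrightarrow> i \<le> m \<Longrightarrow> c i = c' i) \<Longrightarrow> vc c m = vc c' m"
  by (induction m) (auto simp: ht_cong[of _ c c'])

lemma vc_zero_mono: "m \<le> N \<Longrightarrow> vc c m = 0 \<Longrightarrow> vc c N = 0"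
  by (induction N rule: dec_induct) (auto simp only: vc.simps t_linear low_linear sc_simps split: if_splits, simp)

section \<open>Adjacent transpositions on the highest weight vectors\<close>

lemma sw_linear: "sw i (x + y) = sw i x + sw i y" "sw i (x - y) = sw i x - sw i y" "sw i (sc a x) = sc a (sw i x)" "sw i 0 = 0"
  by (auto simp: sw_def sc_def)

lemma sw_sw [simp]: "sw i (sw i x) = x"
  by (simp add: sw_def)

lemma supp_sw: "1 \<le> i \<Longrightarrow> i < N \<Longrightarrow> supp N x \<Longrightarrow> supp N (sw i x)"
  unfolding supp_def sw_def using sws_subset by blast

lemma sw_t: "i < m \<Longrightarrow> sw i (t0 m y) = t0 m (sw i y)" "i < m \<Longrightarrow> sw i (t1 m y) = t1 m (sw i y)"
proof -
  assume i: "i < m"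
  have m: "Suc m \<in> sws i S \<longleftrightarrow> Suc m \<in> S" for S using i by (simp add: in_sws)
  have d: "sws i S - {Suc m} = sws i (S - {Suc m})" for S
    using i by (auto simp: in_sws transpose_def split: if_splits)
  show "sw i (t0 m y) = t0 m (sw i y)" "sw i (t1 m y) = t1 m (sw i y)"
    by (auto simp: sw_def t0_def t1_def m d)
qed

lemma sw_low:
  assumes "1 \<le> i" "i < m"
  shows "sw i (low m y) = low m (sw i y)"
proof
  fix S
  have r: "transpose i (Suc i) j \<in> {1..m} \<longleftrightarrow> j \<in> {1..m}" for j using assms by (auto simp: transpose_def)
  have "sw i (low m y) S = (\<Sum>j\<in>sws i S \<inter> {1..m}. y (sws i S - {j}))" by (simp add: sw_def low_def)
  also have "\<dots> = (\<Sum>j\<in>S \<inter> {1..m}. y (sws i (S - {j})))"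
  proof (rule sum.reindex_bij_witness[of _ "transpose i (Suc i)" "transpose i (Suc i)"])
    fix j assume j: "j \<in> sws i S \<inter> {1..m}"
    show "transpose i (Suc i) j \<in> S \<inter> {1..m}" using j r by (simp only: Int_iff in_sws)
    show "y (sws i (S - {transpose i (Suc i) j})) = y (sws i S - {j})"
      by (rule arg_cong[of _ _ y], rule set_eqI) (simp add: in_sws, metis transpose_involutory)
  next
    fix j assume j: "j \<in> S \<inter> {1..m}"
    show "transpose i (Suc i) j \<in> sws i S \<inter> {1..m}" using j r by (simp only: Int_iff in_sws transpose_involutory)
  qed (simp_all add: transpose_involutory)
  also have "\<dots> = low m (sw i y) S" by (simp add: sw_def low_def)
  finally show "sw i (low m y) S = low m (sw i y) S" .
qed

lemma sw_tt:
  "sw (Suc j) (t0 (Suc j) (t0 j x)) = t0 (Suc j) (t0 j x)"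
  "sw (Suc j) (t1 (Suc j) (t1 j x)) = t1 (Suc j) (t1 j x)"
  "sw (Suc j) (t0 (Suc j) (t1 j x)) = t1 (Suc j) (t0 j x)"
  "sw (Suc j) (t1 (Suc j) (t0 j x)) = t0 (Suc j) (t1 j x)"
proof -
  let ?a = "Suc j" and ?b = "Suc (Suc j)"
  have m: "?a \<in> sws ?a S \<longleftrightarrow> ?b \<in> S" "?b \<in> sws ?a S \<longleftrightarrow> ?a \<in> S" for S by (simp_all add: in_sws)
  have s: "sws ?a S = S" if "(?a \<in> S) = (?b \<in> S)" for S using sws_same that by blast
  have d1: "sws ?a S - {?a} = S - {?b}" if "?b \<in> S" "?a \<notin> S" for S using that by (auto simp: in_sws transpose_def split: if_splits)
  have d2: "sws ?a S - {?b} = S - {?a}" if "?a \<in> S" "?b \<notin> S" for S using that by (auto simp: in_sws transpose_def split: if_splits)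
  show "sw (Suc j) (t0 (Suc j) (t0 j x)) = t0 (Suc j) (t0 j x)"
    by (rule ext) (auto simp: sw_def t0_def m s)
  show "sw (Suc j) (t1 (Suc j) (t1 j x)) = t1 (Suc j) (t1 j x)"
    by (rule ext) (auto simp: sw_def t1_def m s)
  show "sw (Suc j) (t0 (Suc j) (t1 j x)) = t1 (Suc j) (t0 j x)"
    by (rule ext) (auto simp: sw_def t0_def t1_def m d1)
  show "sw (Suc j) (t1 (Suc j) (t0 j x)) = t0 (Suc j) (t1 j x)"
    by (rule ext) (auto simp: sw_def t0_def t1_def m d2)
qed

text \<open>Only the moment after step \<open>Suc i\<close> needs a computation in the last two
  tensor factors: all later steps are built from operators that commute with the
  transposition.\<close>

lemma sw_vc_equal:
  assumes i: "1 \<le> i" "i < N" and e: "c i = c (Suc i)"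
  shows "sw i (vc c N) = vc c N"
proof -
  have "Suc i \<le> N" using i by simp
  then show ?thesis
  proof (induction N rule: dec_induct)
    case base
    obtain j where j: "i = Suc j" using i by (cases i) auto
    show ?case
    proof (cases "c i")
      case True
      then have "c (Suc j)" "c (Suc (Suc j))" using e j by auto
      then show ?thesis by (simp only: j vc.simps if_True sw_tt)
    next
      case False
      then have c: "\<not> c (Suc j)" "\<not> c (Suc (Suc j))" using e j by auto
      let ?x = "vc c j" and ?d = "of_int (ht c j) :: rat"
      have h: "of_int (ht c (Suc j)) = ?d - 1" using c by simp
      have v: "vc c (Suc (Suc j)) = sc (?d - 1) (sc ?d (t1 (Suc j) (t1 j ?x)) - t1 (Suc j) (t0 j (low j ?x)))
          - (sc ?d (t0 (Suc j) (t1 j (low j ?x))) - (t0 (Suc j) (t0 j (low j (low j ?x))) + t0 (Suc j) (t1 j (low j ?x))))"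
        using c h by (simp only: vc.simps if_False low_linear low_t0 low_t1 t_linear)
      show ?thesis unfolding j v sw_linear sw_tt by (rule ext) (simp add: sc_def algebra_simps)
    qed
  next
    case (step n)
    then have "i < n" "1 \<le> i" using i by auto
    then show ?case using step.IH
      by (cases "c (Suc n)") (simp_all only: vc.simps if_True if_False sw_t sw_linear sw_low)
  qed
qed

text \<open>Young's seminormal form. With \<open>d\<close> the height before the peak,
  \<open>k = 1 + 1 / (d + 1)\<close> is the diagonal entry of \<open>u_i\<close>, where
  \<open>d + 1\<close> is the axial distance up to sign. In this normalisation the off-diagonal
  entry is its negative.\<close>

lemma sw_vc_peak:
  assumes i: "1 \<le> i" "i < N" and e: "c i" "\<not> c (Suc i)" and d: "0 \<le> ht c (i - 1)"
  defines "k \<equiv> (of_int (ht c (i - 1)) + 2) / (of_int (ht c (i - 1)) + 1) :: rat"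
  shows "vc c N - sw i (vc c N) = sc k (vc c N - vc (swc i c) N)"
proof -
  have "Suc i \<le> N" using i by simp
  then show ?thesis
  proof (induction N rule: dec_induct)
    case base
    obtain j where j: "i = Suc j" using i by (cases i) auto
    let ?x = "vc c j" and ?d = "of_int (ht c j) :: rat"
    have c: "c (Suc j)" "\<not> c (Suc (Suc j))" using e j by auto
    have d0: "?d \<ge> 0" using d j by simp
    have h: "of_int (ht c (Suc j)) = ?d + 1" using c by simp
    have v: "vc c (Suc (Suc j)) = sc (?d + 1) (t1 (Suc j) (t0 j ?x)) - (t0 (Suc j) (t0 j (low j ?x)) + t0 (Suc j) (t1 j ?x))"
      using c h by (simp only: vc.simps if_True if_False low_t0 t_linear)
    have x': "vc (swc i c) j = ?x" "ht (swc i c) j = ht c j" using j by (auto intro!: vc_cong ht_cong)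
    have c': "\<not> swc i c (Suc j)" "swc i c (Suc (Suc j))" using c j by auto
    have v': "vc (swc i c) (Suc (Suc j)) = sc ?d (t0 (Suc j) (t1 j ?x)) - t0 (Suc j) (t0 j (low j ?x))"
      using c' x' by (simp only: vc.simps if_True if_False t_linear)
    have k: "k = (?d + 2) / (?d + 1)" unfolding k_def j by simp
    have nz: "?d + 1 \<noteq> 0" using d0 by linarith
    show ?case unfolding j
      unfolding v v'[unfolded j] sw_linear sw_tt k by (rule ext) (use nz in \<open>simp add: sc_def field_simps\<close>)
  next
    case (step n)
    then have n: "i < n" "1 \<le> i" "n \<noteq> i" "Suc n \<noteq> i" "Suc n \<noteq> Suc i" using i by auto
    have s: "sw i (vc c n) = vc c n - sc k (vc c n - vc (swc i c) n)" using step.IH by (metis diff_diff_eq2 add_diff_cancel_left')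
    have hs: "ht (swc i c) n = ht c n" "swc i c (Suc n) = c (Suc n)" using ht_swc n by simp_all
    show ?case
      using n by (cases "c (Suc n)")
        (simp_all only: vc.simps hs if_True if_False sw_t sw_linear sw_low s t_linear low_linear,
         (rule ext, simp add: sc_def algebra_simps)+)
  qed
qed

text \<open>The swapped walk steps down at height 0, where both terms of the recursion vanish. The
  peak formula therefore remains true there, and it says that \<open>u_i\<close> acts by 2.\<close>

lemma vc_swc_ht_0:
  assumes i: "1 \<le> i" "i < N" and e: "c i" "\<not> c (Suc i)" and d: "ht c (i - 1) = 0"
  shows "vc (swc i c) N = 0"
proof -
  obtain j where j: "i = Suc j" using i by (cases i) auto
  have x': "vc (swc i c) j = vc c j" "ht (swc i c) j = ht c j" using j by (auto intro!: vc_cong ht_cong)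
  have "\<not> swc i c (Suc j)" using e j by auto
  then have "vc (swc i c) (Suc j) = sc 0 (t1 j (vc c j)) - t0 j 0"
    using x' d j low_vc_ht_0[of c j] by (simp only: vc.simps if_False) simp
  then have "vc (swc i c) (Suc j) = 0" by (simp add: sc_simps t_linear)
  then show ?thesis using vc_zero_mono[of "Suc j" N] i j by simp
qed

subsection \<open>Faithfulness\<close>

inductive_set lspan :: "vec set \<Rightarrow> vec set" for B where
  zero: "0 \<in> lspan B"
| add: "b \<in> B \<Longrightarrow> x \<in> lspan B \<Longrightarrow> sc k b + x \<in> lspan B"

lemma lspan_base: "b \<in> B \<Longrightarrow> b \<in> lspan B"
  using lspan.add[OF _ lspan.zero, of b B 1] by (simp add: sc_simps)

lemma lspan_plus: "x \<in> lspan B \<Longrightarrow> y \<in> lspan B \<Longrightarrow> x + y \<in> lspan B"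
proof (induction rule: lspan.induct)
  case zero then show ?case by (simp only: add_0_left)
next
  case (add b x k)
  have "sc k b + x + y = sc k b + (x + y)" by (rule add.assoc)
  then show ?case using lspan.add[OF add(1) add(3)[OF add(4)], of k] by (simp only:)
qed

lemma lspan_sc: "x \<in> lspan B \<Longrightarrow> sc k x \<in> lspan B"
proof (induction rule: lspan.induct)
  case zero then show ?case by (simp only: sc_simps lspan.zero)
next
  case (add b x l)
  then show ?case using lspan.add[OF add(1) add(3), of "k * l"] by (simp only: sc_simps)
qed

lemma lspan_diff: "x \<in> lspan B \<Longrightarrow> y \<in> lspan B \<Longrightarrow> x - y \<in> lspan B"
proof -
  assume "x \<in> lspan B" "y \<in> lspan B"
  then have "x + sc (-1) y \<in> lspan B" by (intro lspan_plus lspan_sc)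
  moreover have "x + sc (-1) y = x - y" by (rule ext) (simp add: sc_def)
  ultimately show ?thesis by (simp only:)
qed

lemma lspan_sum: "(\<And>a. a \<in> A \<Longrightarrow> f a \<in> lspan B) \<Longrightarrow> (\<Sum>a\<in>A. f a) \<in> lspan B"
  by (induction A rule: infinite_finite_induct)
    (simp_all only: sum.infinite sum.empty sum.insert lspan.zero lspan_plus not_False_eq_True insertI1 insertI2)

lemma lspan_linear_image:
  assumes "x \<in> lspan B" and F: "\<And>x y. F (x + y) = F x + F y" "\<And>k x. F (sc k x) = sc k (F x)" "F 0 = 0"
    and B: "\<And>b. b \<in> B \<Longrightarrow> F b \<in> lspan B'"
  shows "F x \<in> lspan B'"
  using assms(1) by induction (simp_all only: F lspan.zero lspan_plus lspan_sc B)

text \<open>The weight strings of the irreducible sl_2-modules generated by the highest weight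
  vectors.\<close>

definition towers :: "nat \<Rightarrow> vec set" where
  "towers N = {(low N ^^ k) (vc c N) | k c. good N c}"

lemma pow_low_linear: "(low m ^^ k) (x + y) = (low m ^^ k) x + (low m ^^ k) y" "(low m ^^ k) (x - y) = (low m ^^ k) x - (low m ^^ k) y"
  "(low m ^^ k) (sc a x) = sc a ((low m ^^ k) x)" "(low m ^^ k) 0 = 0"
  by (induction k) (simp_all only: funpow.simps o_apply id_apply low_linear)

lemma pow_low_t1: "(low (Suc m) ^^ k) (t1 m y) = t1 m ((low m ^^ k) y)"
  by (induction k) (simp_all only: funpow.simps o_apply id_apply low_t1)

lemma pow_low_t0: "(low (Suc m) ^^ Suc k) (t0 m y) = t0 m ((low m ^^ Suc k) y) + sc (of_nat (Suc k)) (t1 m ((low m ^^ k) y))"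
proof (induction k)
  case 0 then show ?case by (simp add: low_t0 sc_simps)
next
  case (Suc k)
  have "(low (Suc m) ^^ Suc (Suc k)) (t0 m y) = low (Suc m) ((low (Suc m) ^^ Suc k) (t0 m y))" by simp
  also have "\<dots> = t0 m (low m ((low m ^^ Suc k) y)) + t1 m ((low m ^^ Suc k) y) + sc (of_nat (Suc k)) (t1 m (low m ((low m ^^ k) y)))"
    by (simp only: Suc low_linear low_t0 low_t1)
  also have "\<dots> = t0 m ((low m ^^ Suc (Suc k)) y) + sc (of_nat (Suc (Suc k))) (t1 m ((low m ^^ Suc k) y))"
    by (rule ext) (simp add: sc_def algebra_simps)
  finally show ?case .
qed

text \<open>Complete reducibility in concrete form. Appending a factor to a string gives two
  strings, one for the up step and one for the down step, and together they span everything that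
  \<open>t0\<close> and \<open>t1\<close> make of the old string.\<close>

lemma towers_spanning: "supp N y \<Longrightarrow> y \<in> lspan (towers N)"
proof (induction N arbitrary: y)
  case 0
  have "y = sc (y {}) (vc (\<lambda>_. True) 0)"
  proof
    fix S show "y S = sc (y {}) (vc (\<lambda>_. True) 0) S" using 0 by (cases "S = {}") (auto simp: sc_def supp_def)
  qed
  moreover have "vc (\<lambda>_. True) 0 \<in> towers 0"
    unfolding towers_def good_def by (auto intro!: exI[of _ 0] exI[of _ "\<lambda>_. True"])
  ultimately show ?case using lspan_sc[OF lspan_base] by metis
next
  case (Suc N)
  define y0 y1 where "y0 = (\<lambda>S. if S \<subseteq> {1..N} then y S else 0)" and "y1 = (\<lambda>S. if S \<subseteq> {1..N} then y (insert (Suc N) S) else 0)"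
  have y: "y = t0 N y0 + t1 N y1"
  proof
    fix S
    have e: "{1..Suc N} = insert (Suc N) {1..N}" by auto
    show "y S = (t0 N y0 + t1 N y1) S"
    proof (cases "S \<subseteq> {1..Suc N}")
      case True
      show ?thesis
      proof (cases "Suc N \<in> S")
        case t: True
        then have "S - {Suc N} \<subseteq> {1..N}" "insert (Suc N) (S - {Suc N}) = S" using True e by auto
        then show ?thesis using t by (simp add: t0_def t1_def y1_def)
      next
        case False
        then have "S \<subseteq> {1..N}" using True e by auto
        then show ?thesis using False by (simp add: t0_def t1_def y0_def)
      qed
    next
      case False
      then have "\<not> S - {Suc N} \<subseteq> {1..N}" "\<not> S \<subseteq> {1..N}" using e by (blast, auto)
      moreover have "y S = 0" using Suc.prems False unfolding supp_def by blast
      ultimately show ?thesis by (simp add: t0_def t1_def y0_def y1_def)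
    qed
  qed
  have s: "supp N y0" "supp N y1" by (simp_all add: supp_def y0_def y1_def)
  have gens: "t0 N b \<in> lspan (towers (Suc N)) \<and> t1 N b \<in> lspan (towers (Suc N))" if b: "b \<in> towers N" for b
  proof -
    obtain k c where b: "b = (low N ^^ k) (vc c N)" and g: "good N c" using b unfolding towers_def by blast
    let ?v = "vc c N" and ?d = "of_int (ht c N) :: rat" and ?L = "lspan (towers (Suc N))"
    define cu cd where "cu = c(Suc N := True)" and "cd = c(Suc N := False)"
    have eq: "vc cu N = ?v" "vc cd N = ?v" "ht cu N = ht c N" "ht cd N = ht c N" "good N cu" "good N cd"
      unfolding cu_def cd_def by (auto intro!: vc_cong ht_cong good_cong[THEN iffD1, OF _ g])
    have h0: "0 \<le> ht c N" using g unfolding good_def by simp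
    have gS: "good (Suc N) c'" if "good N c'" "0 \<le> ht c' (Suc N)" for c'
      using that unfolding good_def by (metis le_SucE)
    have gu: "good (Suc N) cu" by (rule gS[OF eq(5)]) (simp add: eq(3) h0, simp add: cu_def)
    have vu: "vc cu (Suc N) = t0 N ?v" using eq by (simp add: cu_def)
    have up: "(low (Suc N) ^^ j) (t0 N ?v) \<in> ?L" for j
    proof -
      have "(low (Suc N) ^^ j) (vc cu (Suc N)) \<in> towers (Suc N)" unfolding towers_def using gu by blast
      then show ?thesis unfolding vu by (rule lspan_base)
    qed
    \<comment> \<open>At height 0 there is no down walk, but then lowering kills the vector, and
      lowering \<open>t0\<close> of the vector gives its \<open>t1\<close> directly.\<close>
    have t1k: "t1 N ((low N ^^ j) ?v) \<in> ?L" for j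
    proof (cases "ht c N = 0")
      case True
      then have z: "low N ?v = 0" by (rule low_vc_ht_0)
      show ?thesis
      proof (cases j)
        case 0
        have "low (Suc N) (t0 N ?v) = t1 N ?v" by (simp only: low_t0 z t_linear add_0_left)
        then show ?thesis using up[of 1] 0 by simp
      next
        case (Suc i)
        have "(low N ^^ j) ?v = (low N ^^ i) (low N ?v)" unfolding Suc by (simp add: funpow_swap1)
        also have "\<dots> = 0" unfolding z by (rule pow_low_linear)
        finally show ?thesis by (simp only: t_linear lspan.zero)
      qed
    next
      case False
      then have h1: "1 \<le> ht c N" using h0 by linarith
      have "\<not> cd (Suc N)" by (simp add: cd_def)
      then have vd: "vc cd (Suc N) = sc ?d (t1 N ?v) - t0 N (low N ?v)" using eq by simp
      have gd: "good (Suc N) cd" by (rule gS[OF eq(6)]) (use h1 eq(4) \<open>\<not> cd (Suc N)\<close> in simp)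
      have dn: "(low (Suc N) ^^ j) (vc cd (Suc N)) \<in> ?L"
        by (rule lspan_base, unfold towers_def) (use gd in blast)
      have L0: "(low (Suc N) ^^ j) (t0 N (low N ?v)) = t0 N ((low N ^^ Suc j) ?v) + sc (of_nat j) (t1 N ((low N ^^ j) ?v))"
      proof (cases j)
        case 0 then show ?thesis by (simp add: sc_simps)
      next
        case (Suc i)
        show ?thesis unfolding Suc pow_low_t0 by (simp add: funpow_swap1)
      qed
      \<comment> \<open>The up string, taken one place further, cancels the \<open>t0\<close> part
        of the down string. What remains is the wanted vector times \<open>ht c N + 1\<close>, which
        is invertible.\<close>
      have "(low (Suc N) ^^ j) (vc cd (Suc N)) + (low (Suc N) ^^ Suc j) (t0 N ?v) = sc (?d + 1) (t1 N ((low N ^^ j) ?v))"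
        unfolding vd pow_low_linear pow_low_t1 L0 pow_low_t0 by (rule ext) (simp add: sc_def algebra_simps)
      then have "sc (?d + 1) (t1 N ((low N ^^ j) ?v)) \<in> ?L" using lspan_plus[OF dn up[of "Suc j"]] by (simp only:)
      then have "sc (1 / (?d + 1)) (sc (?d + 1) (t1 N ((low N ^^ j) ?v))) \<in> ?L" by (rule lspan_sc)
      moreover have "?d + 1 \<noteq> 0"
      proof -
        have "1 \<le> ?d" using h1 by simp
        then show ?thesis by linarith
      qed
      ultimately show ?thesis by (simp add: sc_simps)
    qed
    have "t0 N ((low N ^^ k) ?v) \<in> ?L"
    proof (cases k)
      case 0 then show ?thesis using up[of 0] by simp
    next
      case (Suc i)
      have "t0 N ((low N ^^ k) ?v) = (low (Suc N) ^^ Suc i) (t0 N ?v) - sc (of_nat (Suc i)) (t1 N ((low N ^^ i) ?v))"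
        unfolding Suc pow_low_t0 by (rule add_diff_cancel_right'[symmetric])
      then show ?thesis using lspan_diff[OF up[of "Suc i"] lspan_sc[OF t1k[of i]]] by (simp only:)
    qed
    then show ?thesis using t1k b by simp
  qed
  have "t0 N y0 \<in> lspan (towers (Suc N))"
    by (rule lspan_linear_image[OF Suc.IH[OF s(1)]]) (simp_all only: t_linear gens)
  moreover have "t1 N y1 \<in> lspan (towers (Suc N))"
    by (rule lspan_linear_image[OF Suc.IH[OF s(2)]]) (simp_all only: t_linear gens)
  ultimately show ?case unfolding y by (rule lspan_plus)
qed

section \<open>Commutation with sl_2 and the module of highest weight vectors\<close>

lemma rho_basis: "D \<in> diagrams N \<Longrightarrow> rho N (basis D) v S = (if S \<subseteq> {1..N} then \<Sum>T\<in>Pow {1..N}. R D S T * v T else 0)"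
  by (simp add: rho_Rm Rm_basis)

lemma rho_expand: "rho N x v = (\<Sum>D\<in>diagrams N. sc (x D) (rho N (basis D) v))"
proof
  fix S
  show "rho N x v S = (\<Sum>D\<in>diagrams N. sc (x D) (rho N (basis D) v)) S"
  proof (cases "S \<subseteq> {1..N}")
    case True
    have "rho N x v S = (\<Sum>T\<in>Pow {1..N}. \<Sum>D\<in>diagrams N. x D * (R D S T * v T))"
      using True by (simp add: rho_def sum_distrib_right mult.assoc)
    also have "\<dots> = (\<Sum>D\<in>diagrams N. \<Sum>T\<in>Pow {1..N}. x D * (R D S T * v T))" by (rule sum.swap)
    also have "\<dots> = (\<Sum>D\<in>diagrams N. sc (x D) (rho N (basis D) v) S)"
      using True by (intro sum.cong refl) (simp add: sc_def rho_basis sum_distrib_left)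
    finally show ?thesis by (simp only: sum_apply)
  next
    case False
    then show ?thesis by (simp add: rho_def sum_apply sc_def)
  qed
qed

lemma basis_induct [consumes 1, case_names id left right]:
  assumes D: "D \<in> diagrams N"
    and base: "\<And>D. D \<in> diagrams N \<Longrightarrow> (\<And>v. supp N v \<Longrightarrow> rho N (basis D) v = v) \<Longrightarrow> P D"
    and left: "\<And>D D' i. D \<in> diagrams N \<Longrightarrow> D' \<in> diagrams N \<Longrightarrow> 1 \<le> i \<Longrightarrow> i < N \<Longrightarrow>
      (\<And>v. supp N v \<Longrightarrow> rho N (basis D') v = rho N (basis D) v - sw i (rho N (basis D) v)) \<Longrightarrow> P D \<Longrightarrow> P D'"
    and right: "\<And>D D' i. D \<in> diagrams N \<Longrightarrow> D' \<in> diagrams N \<Longrightarrow> 1 \<le> i \<Longrightarrow> i < N \<Longrightarrow>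
      (\<And>v. supp N v \<Longrightarrow> rho N (basis D') v = rho N (basis D) (v - sw i v)) \<Longrightarrow> P D \<Longrightarrow> P D'"
  shows "P D"
  using D
proof (induction rule: diagrams_induct)
  case id
  show ?case by (rule base[OF tl_one_diagram]) (use rho_one[of N] in \<open>simp add: tl_one_def\<close>)
next
  case (left D D' i)
  show ?case
  proof (rule assms(3)[OF left(1-4) _ left(6)])
    fix v assume "supp N v"
    show "rho N (basis D') v = rho N (basis D) v - sw i (rho N (basis D) v)"
    proof
      fix S
      show "rho N (basis D') v S = (rho N (basis D) v - sw i (rho N (basis D) v)) S"
        using left(5) sws_subset[OF left(3,4), of S]
        by (simp add: rho_basis left(1,2) sw_def left_diff_distrib sum_subtractf)
    qed
  qed
next
  case (right D D' i)
  show ?case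
  proof (rule assms(4)[OF right(1-4) _ right(6)])
    fix v assume "supp N v"
    show "rho N (basis D') v = rho N (basis D) (v - sw i v)"
    proof
      fix S
      have "(\<Sum>T\<in>Pow {1..N}. R D S (sws i T) * v T) = (\<Sum>T\<in>Pow {1..N}. R D S T * sw i v T)"
        using sum_sws[OF right(3,4), of "\<lambda>T. R D S T * sw i v T"] by (simp add: sw_def)
      then show "rho N (basis D') v S = rho N (basis D) (v - sw i v) S"
        using right(5) by (simp add: rho_basis right(1,2) left_diff_distrib right_diff_distrib sum_subtractf)
    qed
  qed
qed

lemma low_sum: "low m (\<Sum>a\<in>A. f a) = (\<Sum>a\<in>A. low m (f a))"
  by (induction A rule: infinite_finite_induct)
    (simp_all only: sum.infinite sum.empty sum.insert low_linear not_False_eq_True)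

text \<open>Transpositions of tensor factors commute with the diagonal action of sl_2, and all
  diagrams are built from them; this is the easy half of Schur-Weyl duality.\<close>

lemma rho_low:
  assumes "supp N v"
  shows "rho N x (low N v) = low N (rho N x v)"
proof -
  have "\<forall>v. supp N v \<longrightarrow> rho N (basis D) (low N v) = low N (rho N (basis D) v)" if "D \<in> diagrams N" for D
    using that
  proof (induction rule: basis_induct)
    case (id D)
    then show ?case by (simp add: supp_low)
  next
    case (left D D' i)
    show ?case
      by (intro allI impI) (simp only: left(5) supp_low left(6) sw_low[OF left(3,4)] low_linear)
  next
    case (right D D' i)
    show ?case
    proof (intro allI impI)
      fix v assume v: "supp N v"
      then have s: "supp N (v - sw i v)" by (intro supp_diff supp_sw right(3,4))
      have "rho N (basis D') (low N v) = rho N (basis D) (low N (v - sw i v))"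
        by (simp only: right(5) supp_low v sw_low[OF right(3,4)] low_linear)
      also have "\<dots> = low N (rho N (basis D') v)" using right(6) s by (simp only: right(5) v)
      finally show "rho N (basis D') (low N v) = low N (rho N (basis D') v)" .
    qed
  qed
  then show ?thesis using assms
    unfolding rho_expand[of N x] low_sum low_linear by (intro sum.cong refl) simp
qed

lemma rho_pow_low: "supp N v \<Longrightarrow> rho N x ((low N ^^ k) v) = (low N ^^ k) (rho N x v)"
proof (induction k)
  case (Suc k)
  have "supp N ((low N ^^ k) v)" using Suc.prems by (induction k) (simp_all add: supp_low)
  then show ?case using Suc by (simp add: rho_low)
qed simp

text \<open>An operator that commutes with lowering is determined on each string by its value at the
  top.\<close>

lemma TL_faithful:
  assumes "x \<in> TL N UNIV" "y \<in> TL N UNIV" and e: "\<And>c. good N c \<Longrightarrow> rho N x (vc c N) = rho N y (vc c N)"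
  shows "x = y"
proof (rule TL_eqI[OF assms(1,2)])
  fix v assume "supp N v"
  then have "v \<in> lspan (towers N)" by (rule towers_spanning)
  then show "rho N x v = rho N y v"
  proof induction
    case zero then show ?case by (simp only: rho_vzero)
  next
    case (add b w k)
    then obtain j c where "b = (low N ^^ j) (vc c N)" "good N c" unfolding towers_def by blast
    then have "rho N x b = rho N y b" using e by (simp add: rho_pow_low)
    then show ?case using add by (simp only: rho_vadd rho_vsc)
  qed
qed

definition Wsp :: "nat \<Rightarrow> vec set" where
  "Wsp N = lspan {vc c N | c. good N c}"

lemma vc_in_Wsp: "good N c \<Longrightarrow> vc c N \<in> Wsp N"
  unfolding Wsp_def by (rule lspan_base) blast

lemma supp_Wsp: "w \<in> Wsp N \<Longrightarrow> supp N w"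
  unfolding Wsp_def
proof (induction rule: lspan.induct)
  case zero then show ?case by (rule supp_0)
next
  case (add b x k)
  then obtain c where "b = vc c N" by blast
  then have "supp N b" by simp
  then show ?case by (intro supp_add supp_sc add(3))
qed

lemma ht_nonneg: "good N c \<Longrightarrow> m \<le> N \<Longrightarrow> 0 \<le> ht c m"
  by (simp add: good_def)

lemma sw_Wsp:
  assumes i: "1 \<le> i" "i < N" and w: "w \<in> Wsp N"
  shows "sw i w \<in> Wsp N"
proof -
  have peak: "sw i (vc c N) = vc c N - sc ((of_int (ht c (i - 1)) + 2) / (of_int (ht c (i - 1)) + 1)) (vc c N - vc (swc i c) N)"
    "vc (swc i c) N \<in> Wsp N"
    if g: "good N c" and c: "c i" "\<not> c (Suc i)" for c
  proof -
    have h: "0 \<le> ht c (i - 1)" using ht_nonneg[OF g] i by simp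
    show "sw i (vc c N) = vc c N - sc ((of_int (ht c (i - 1)) + 2) / (of_int (ht c (i - 1)) + 1)) (vc c N - vc (swc i c) N)"
      using sw_vc_peak[OF i c h] by (metis diff_diff_eq2 add_diff_cancel_left')
    show "vc (swc i c) N \<in> Wsp N"
    proof (cases "ht c (i - 1) = 0")
      case True
      then show ?thesis using vc_swc_ht_0[OF i c] unfolding Wsp_def by (simp only: lspan.zero)
    next
      case False
      then show ?thesis using good_swc_peak[OF g i] h vc_in_Wsp by simp
    qed
  qed
  have gen: "sw i (vc c N) \<in> Wsp N" if g: "good N c" for c
  proof -
    consider "c i = c (Suc i)" | "c i" "\<not> c (Suc i)" | "\<not> c i" "c (Suc i)" by blast
    then show ?thesis
    proof cases
      case 1 then show ?thesis using sw_vc_equal[OF i] vc_in_Wsp[OF g] by simp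
    next
      case 2
      show ?thesis unfolding peak(1)[OF g 2] unfolding Wsp_def
        by (intro lspan_diff lspan_sc) (use vc_in_Wsp[OF g] peak(2)[OF g 2] in \<open>simp_all add: Wsp_def\<close>)
    next
      case 3
      \<comment> \<open>The image of a valley vector is found from the formula at the peak
        \<open>swc i c\<close>: apply the transposition once more and solve, using that
        \<open>k\<close> is nonzero.\<close>
      define c' where "c' = swc i c"
      have g': "good N c'" unfolding c'_def by (rule good_swc_valley[where c=c, OF g i 3(2)])
      have c': "c' i" "\<not> c' (Suc i)" "swc i c' = c" using 3 by (simp_all add: c'_def)
      define k where "k = (of_int (ht c' (i - 1)) + 2) / (of_int (ht c' (i - 1)) + 1 :: rat)"
      have k0: "k \<noteq> 0" using ht_nonneg[OF g', of "i - 1"] i unfolding k_def by (simp add: add_eq_0_iff2) linarith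
      have s: "sw i (vc c' N) = vc c' N - sc k (vc c' N - vc c N)" using peak(1)[OF g' c'(1,2)] unfolding c'(3) k_def .
      have "sw i (sw i (vc c' N)) = sw i (vc c' N - sc k (vc c' N - vc c N))" using s by (rule arg_cong)
      then have "sw i (sw i (vc c' N)) = sw i (vc c' N) - sc k (sw i (vc c' N) - sw i (vc c N))"
        by (simp only: sw_linear)
      then have "vc c' N = sw i (vc c' N) - sc k (sw i (vc c' N) - sw i (vc c N))" by simp
      then have "sw i (vc c N) = sw i (vc c' N) + sc (1 / k) (vc c' N - sw i (vc c' N))"
        using k0 by (auto simp: fun_eq_iff sc_def field_simps)
      moreover have "sw i (vc c' N) \<in> Wsp N" unfolding s unfolding Wsp_def
        by (intro lspan_diff lspan_sc) (use vc_in_Wsp[OF g] vc_in_Wsp[OF g'] in \<open>simp_all add: Wsp_def\<close>)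
      ultimately show ?thesis using vc_in_Wsp[OF g'] unfolding Wsp_def by (simp only: lspan_plus lspan_sc lspan_diff)
    qed
  qed
  show ?thesis using w unfolding Wsp_def
  proof (rule lspan_linear_image)
    fix b assume "b \<in> {vc c N |c. good N c}"
    then show "sw i b \<in> lspan {vc c N |c. good N c}" using gen unfolding Wsp_def by blast
  qed (rule sw_linear)+
qed

lemma rho_Wsp:
  assumes w: "w \<in> Wsp N"
  shows "rho N x w \<in> Wsp N"
proof -
  have "\<forall>w\<in>Wsp N. rho N (basis D) w \<in> Wsp N" if "D \<in> diagrams N" for D
    using that
  proof (induction rule: basis_induct)
    case (id D)
    then show ?case using supp_Wsp by metis
  next
    case (left D D' i)
    show ?case
    proof
      fix w assume w: "w \<in> Wsp N"
      then have "rho N (basis D) w \<in> Wsp N" using left(6) by blast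
      then have "rho N (basis D) w - sw i (rho N (basis D) w) \<in> Wsp N"
        using sw_Wsp[OF left(3,4)] lspan_diff unfolding Wsp_def by blast
      then show "rho N (basis D') w \<in> Wsp N" by (simp only: left(5)[OF supp_Wsp[OF w]])
    qed
  next
    case (right D D' i)
    show ?case
    proof
      fix w assume w: "w \<in> Wsp N"
      then have "w - sw i w \<in> Wsp N"
        using sw_Wsp[OF right(3,4)] lspan_diff unfolding Wsp_def by blast
      then have "rho N (basis D) (w - sw i w) \<in> Wsp N" using right(6) by blast
      then show "rho N (basis D') w \<in> Wsp N" by (simp only: right(5)[OF supp_Wsp[OF w]])
    qed
  qed
  then show ?thesis using w unfolding rho_expand[of N x] unfolding Wsp_def by (intro lspan_sum lspan_sc) blast
qed

section \<open>Jucys-Murphy elements\<close>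

primrec up :: "(nat \<Rightarrow> bool) \<Rightarrow> nat \<Rightarrow> nat" where
  "up c 0 = 0"
| "up c (Suc m) = up c m + (if c (Suc m) then 1 else 0)"

definition dn :: "(nat \<Rightarrow> bool) \<Rightarrow> nat \<Rightarrow> nat" where
  "dn c = up (\<lambda>i. \<not> c i)"

text \<open>The content of the entry \<open>i\<close>: it sits in row
  \<open>up c (i - 1) + 1\<close> of the first column or in row \<open>dn c (i - 1) + 1\<close> of
  the second.\<close>

definition cn :: "(nat \<Rightarrow> bool) \<Rightarrow> nat \<Rightarrow> int" where
  "cn c i = (if c i then - int (up c (i - 1)) else 1 - int (dn c (i - 1)))"

lemma dn_simps [simp]: "dn c 0 = 0" "dn c (Suc m) = dn c m + (if c (Suc m) then 0 else 1)"
  by (simp_all add: dn_def)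

lemma ht_up_dn: "ht c m = int (up c m) - int (dn c m)"
  by (induction m) auto

lemma up_dn_sum: "up c m + dn c m = m"
  by (induction m) auto

lemma up_cong: "(\<And>i. 1 \<le> i \<Longrightarrow> i \<le> m \<Longrightarrow> c i = c' i) \<Longrightarrow> up c m = up c' m"
  by (induction m) auto

lemma dn_cong: "(\<And>i. 1 \<le> i \<Longrightarrow> i \<le> m \<Longrightarrow> c i = c' i) \<Longrightarrow> dn c m = dn c' m"
  unfolding dn_def by (rule up_cong) auto

lemma up_swc: "1 \<le> i \<Longrightarrow> m \<noteq> i \<Longrightarrow> up (swc i c) m = up c m"
  using ht_swc[of i m c] up_dn_sum[of c m] up_dn_sum[of "swc i c" m] unfolding ht_up_dn by linarith

lemma dn_swc: "1 \<le> i \<Longrightarrow> m \<noteq> i \<Longrightarrow> dn (swc i c) m = dn c m"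
  using up_swc[of i m c] up_dn_sum[of c m] up_dn_sum[of "swc i c" m] by linarith

lemma cn_swc: 
  assumes "1 \<le> i" "c i \<noteq> c (Suc i)"
  shows "cn (swc i c) i = cn c (Suc i)" "cn (swc i c) (Suc i) = cn c i"
proof -
  obtain j where j: "i = Suc j" using assms by (cases i) auto
  have "up (swc i c) j = up c j" "dn (swc i c) j = dn c j" using up_swc[of i j c] dn_swc[of i j c] j by simp_all
  then show "cn (swc i c) i = cn c (Suc i)" "cn (swc i c) (Suc i) = cn c i" using assms(2) unfolding cn_def j by auto
qed

lemma cn_step: "1 \<le> i \<Longrightarrow> c i = c (Suc i) \<Longrightarrow> cn c (Suc i) = cn c i - 1"
  by (cases i) (auto simp: cn_def)

lemma cn_axial: 
  assumes "1 \<le> i" "c i" "\<not> c (Suc i)"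
  shows "cn c i - cn c (Suc i) = - (ht c (i - 1) + 1)"
  using assms by (cases i) (auto simp: cn_def ht_up_dn)

text \<open>After a common beginning, the next content is \<open>- up\<close> for a step up and
  \<open>1 - dn\<close> for a step down. These differ because a good walk has \<open>dn\<close> at
  most \<open>up\<close>.\<close>

lemma cn_determines:
  assumes g: "good M c" "good M d" and e: "\<And>i. i \<in> {1..M} \<Longrightarrow> cn c i = cn d i"
  shows "i \<in> {1..M} \<Longrightarrow> c i = d i"
proof (induction i rule: less_induct)
  case (less i)
  have "up c (i - 1) = up d (i - 1)" "dn c (i - 1) = dn d (i - 1)"
    by (auto intro!: up_cong dn_cong less.IH) (use less.prems in auto)
  moreover have "int (dn c (i - 1)) \<le> int (up c (i - 1))"
    using ht_nonneg[OF g(1), of "i - 1"] less.prems unfolding ht_up_dn by auto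
  ultimately show ?case using e[OF less.prems] unfolding cn_def by (auto split: if_splits)
qed

lemma Phi_s_TL: "subring Q \<Longrightarrow> 1 \<le> i \<Longrightarrow> i < M \<Longrightarrow> Phi_s M i \<in> TL M Q"
  unfolding Phi_s_def by (intro TL_closed) auto

lemma Phi_transp_TL: "subring Q \<Longrightarrow> 1 \<le> j \<Longrightarrow> j < i \<Longrightarrow> i \<le> M \<Longrightarrow> Phi_transp M j i \<in> TL M Q"
  unfolding Phi_transp_def by (rule TL_prod) (auto intro!: Phi_s_TL)

lemma jm_TL: "subring Q \<Longrightarrow> i \<le> M \<Longrightarrow> jm M i \<in> TL M Q"
  unfolding jm_def by (rule TL_sum) (auto intro!: Phi_transp_TL)

lemma tl_prod_append:
  assumes "\<And>x. x \<in> set (xs @ ys) \<Longrightarrow> x \<in> TL N UNIV"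
  shows "tl_prod N (xs @ ys) = tl_mult N (tl_prod N xs) (tl_prod N ys)"
  using assms by (induction xs) (simp_all add: tl_prod_simps tl_mult_one TL_prod tl_mult_assoc)

lemma Phi_transp_Suc:
  assumes "1 \<le> j" "j < i" "i < M"
  shows "Phi_transp M j (Suc i) = tl_mult M (Phi_s M i) (tl_mult M (Phi_transp M j i) (Phi_s M i))"
proof -
  have l: "rev [j + 1..<Suc i] @ [j] @ [j + 1..<Suc i] = i # (rev [j + 1..<i] @ [j] @ [j + 1..<i]) @ [i]"
    using assms by simp
  have s: "Phi_s M i \<in> TL M UNIV" by (rule Phi_s_TL) (use assms in auto)
  show ?thesis unfolding Phi_transp_def l list.map map_append tl_prod_simps
    by (subst tl_prod_append) (use assms s in \<open>auto intro!: Phi_s_TL simp: tl_prod_simps tl_mult_one\<close>)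
qed

text \<open>Conjugation by \<open>s_i\<close> carries the transposition \<open>(j, i)\<close> to
  \<open>(j, i + 1)\<close>, and the one remaining summand \<open>(i, i + 1)\<close> is
  \<open>s_i\<close> itself.\<close>

lemma jm_Suc:
  assumes i: "1 \<le> i" "i < M"
  shows "jm M (Suc i) = tl_mult M (Phi_s M i) (tl_mult M (jm M i) (Phi_s M i)) + Phi_s M i"
proof -
  have s: "Phi_s M i \<in> TL M UNIV" by (rule Phi_s_TL) (use i in auto)
  have j: "jm M i \<in> TL M UNIV" by (rule jm_TL) (use i in auto)
  have j': "jm M (Suc i) \<in> TL M UNIV" by (rule jm_TL) (use i in auto)
  have e: "{1..<Suc i} = insert i {1..<i}" using i by auto
  have p: "Phi_transp M i (Suc i) = Phi_s M i"
    using s by (simp add: Phi_transp_def tl_prod_simps tl_mult_one)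
  show ?thesis
  proof (rule TL_eqI[OF j'])
    show "tl_mult M (Phi_s M i) (tl_mult M (jm M i) (Phi_s M i)) + Phi_s M i \<in> TL M UNIV"
      by (intro TL_closed subring_UNIV s j)
    fix v assume v: "supp M v"
    have "rho M (jm M (Suc i)) v = rho M (Phi_s M i) v + (\<Sum>k\<in>{1..<i}. rho M (Phi_transp M k (Suc i)) v)"
      unfolding jm_def e rho_sum by (subst sum.insert) (simp_all only: p finite_atLeastLessThan, simp)
    also have "(\<Sum>k\<in>{1..<i}. rho M (Phi_transp M k (Suc i)) v) =
        (\<Sum>k\<in>{1..<i}. rho M (Phi_s M i) (rho M (Phi_transp M k i) (rho M (Phi_s M i) v)))"
      by (rule sum.cong[OF refl]) (use i in \<open>simp add: Phi_transp_Suc rho_mult\<close>)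
    also have "\<dots> = rho M (Phi_s M i) (rho M (jm M i) (rho M (Phi_s M i) v))"
      unfolding jm_def rho_sum rho_vsum ..
    finally show "rho M (jm M (Suc i)) v = rho M (tl_mult M (Phi_s M i) (tl_mult M (jm M i) (Phi_s M i)) + Phi_s M i) v"
      by (simp only: rho_add rho_mult add.commute)
  qed
qed

text \<open>An action in which \<open>u_i\<close> relates walks with a peak and a valley at \<open>i\<close> as in Young's seminormal form.
  The diagonal entry at the peak is prescribed; the other entries are forced by \<open>u_i\<^sup>2 = 2 u_i\<close>
  up to a rescaling of the basis.\<close>

locale seminormal_action =
  fixes M :: nat and Q :: "rat set" and H :: "tl \<Rightarrow> vec \<Rightarrow> vec"
    and X :: "'x set" and b :: "'x \<Rightarrow> vec" and y :: "'x \<Rightarrow> nat \<Rightarrow> bool"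
  assumes Q: "subring Q"
    and H_add: "\<And>x z v. x \<in> TL M Q \<Longrightarrow> z \<in> TL M Q \<Longrightarrow> H (x + z) v = H x v + H z v"
    and H_scale: "\<And>c x v. c \<in> Q \<Longrightarrow> x \<in> TL M Q \<Longrightarrow> H (scale c x) v = sc c (H x v)"
    and H_mult: "\<And>x z v. x \<in> TL M Q \<Longrightarrow> z \<in> TL M Q \<Longrightarrow> H (tl_mult M x z) v = H x (H z v)"
    and H_vadd: "\<And>x v w. x \<in> TL M Q \<Longrightarrow> H x (v + w) = H x v + H x w"
    and H_vsc: "\<And>x k v. x \<in> TL M Q \<Longrightarrow> H x (sc k v) = sc k (H x v)"
    and H_one: "\<And>x. x \<in> X \<Longrightarrow> H (tl_one M) (b x) = b x"
    and walk: "\<And>x. x \<in> X \<Longrightarrow> good M (y x)"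
    and flat: "\<And>x i. x \<in> X \<Longrightarrow> 1 \<le> i \<Longrightarrow> i < M \<Longrightarrow> y x i = y x (Suc i) \<Longrightarrow> H (tl_u M i) (b x) = 0"
    and tip: "\<And>x i. x \<in> X \<Longrightarrow> 1 \<le> i \<Longrightarrow> i < M \<Longrightarrow> y x i \<noteq> y x (Suc i) \<Longrightarrow>
      (y x i \<and> ht (y x) (i - 1) = 0 \<and> H (tl_u M i) (b x) = sc 2 (b x)) \<or>
      (\<exists>p\<in>X. \<exists>q\<in>X. \<exists>B. (x = p \<or> x = q) \<and> y p i \<and> \<not> y p (Suc i) \<and> 0 \<le> ht (y p) (i - 1) \<and>
         (\<forall>j\<in>{1..M}. y q j = swc i (y p) j) \<and> B \<noteq> 0 \<and>
         H (tl_u M i) (b p) = sc ((of_int (ht (y p) (i - 1)) + 2) / (of_int (ht (y p) (i - 1)) + 1)) (b p) + sc B (b q))"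
begin

lemma u_TL: "1 \<le> i \<Longrightarrow> i < M \<Longrightarrow> tl_u M i \<in> TL M Q"
  by (rule TL_closed(8)[OF Q])

lemma H_diff: "x \<in> TL M Q \<Longrightarrow> z \<in> TL M Q \<Longrightarrow> H (x - z) v = H x v - H z v"
proof -
  assume x: "x \<in> TL M Q" and z: "z \<in> TL M Q"
  have m: "- 1 \<in> Q" using subringD(5)[OF Q subringD(1)[OF Q]] .
  have "x - z = x + scale (- 1) z" by (rule ext) (simp add: scale_def)
  then have "H (x - z) v = H x v + sc (- 1) (H z v)"
    using H_add[OF x TL_closed(3)[OF Q m z]] H_scale[OF m z] by (simp only:)
  then show ?thesis by (auto simp: sc_def fun_eq_iff)
qed

lemma H_vzero: "x \<in> TL M Q \<Longrightarrow> H x 0 = 0"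
  using H_vsc[of x 0 0] by (simp only: sc_simps)

lemma u_square:
  assumes "1 \<le> i" "i < M"
  shows "H (tl_u M i) (H (tl_u M i) v) = sc 2 (H (tl_u M i) v)"
proof -
  note u = u_TL[OF assms]
  have "tl_mult M (tl_u M i) (tl_u M i) = scale 2 (tl_u M i)"
  proof (rule TL_eqI[of _ M])
    show "tl_mult M (tl_u M i) (tl_u M i) \<in> TL M UNIV" "scale 2 (tl_u M i) \<in> TL M UNIV"
      using TL_closed[OF subring_UNIV] assms by auto
    fix v assume v: "supp M v"
    have "rho M (tl_u M i) (v - sw i v) = v - sw i v - sw i (v - sw i v)"
      using rho_u[OF _ assms] supp_diff[OF v supp_sw[OF assms v]] by blast
    also have "\<dots> = sc 2 (v - sw i v)" by (rule ext) (simp add: sw_linear sc_def)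
    finally show "rho M (tl_mult M (tl_u M i) (tl_u M i)) v = rho M (scale 2 (tl_u M i)) v"
      by (simp only: rho_mult rho_scale rho_u[OF v assms])
  qed
  moreover have "2 \<in> Q" using subring_of_nat[OF Q, of 2] by simp
  ultimately show ?thesis using H_mult[OF u u] H_scale[OF _ u] by metis
qed

lemma Phi_s_act:
  assumes "1 \<le> i" "i < M" "x \<in> X"
  shows "H (Phi_s M i) (b x) = H (tl_u M i) (b x) - b x"
  unfolding Phi_s_def using H_diff[OF u_TL[OF assms(1,2)] TL_closed(7)[OF Q]] H_one[OF assms(3)] by simp

text \<open>Induction along the recursion \<open>L_{i+1} = s_i L_i s_i + s_i\<close>. On a peak and
  its valley \<open>s_i\<close> has the diagonal entries \<open>1 / m\<close> and
  \<open>- 1 / m\<close>, where \<open>m\<close> is the difference of the two contents, so the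
  recursion exchanges these contents. Straight steps and peaks on the ground have
  \<open>s_i = -1\<close> and \<open>s_i = 1\<close>.\<close>

lemma jm_act: "x \<in> X \<Longrightarrow> 1 \<le> i \<Longrightarrow> i \<le> M \<Longrightarrow> H (jm M i) (b x) = sc (of_int (cn (y x) i)) (b x)"
proof (induction i arbitrary: x)
  case 0 then show ?case by simp
next
  case (Suc i)
  show ?case
  proof (cases "i = 0")
    case True
    \<comment> \<open>A good walk starts upwards, so the first entry has content 0, in agreement
      with \<open>L_1 = 0\<close>.\<close>
    have "0 \<le> ht (y x) 1" using ht_nonneg[OF walk[OF Suc.prems(1)], of 1] Suc.prems by simp
    then have "y x 1" by (auto split: if_splits)
    then have "cn (y x) (Suc 0) = 0" by (simp add: cn_def)
    moreover have "jm M (Suc 0) = 0" by (simp add: jm_def)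
    moreover have "H 0 (b x) = 0" using H_diff[of "tl_one M" "tl_one M" "b x"] TL_closed(7)[OF Q] by (simp only: diff_self)
    ultimately show ?thesis by (simp only: True of_int_0 sc_simps)
  next
    case False
    then have i: "1 \<le> i" "i < M" using Suc.prems by auto
    note s = Phi_s_TL[OF Q i]
    have j: "jm M i \<in> TL M Q" by (rule jm_TL[OF Q]) (use i in simp)
    have IH: "H (jm M i) (b x) = sc (of_int (cn (y x) i)) (b x)" if "x \<in> X" for x using Suc.IH[OF that] i by simp
    have rec: "H (jm M (Suc i)) v = H (Phi_s M i) (H (jm M i) (H (Phi_s M i) v)) + H (Phi_s M i) v" for v
      unfolding jm_Suc[OF i] using H_add[OF TL_closed(6)[OF Q s TL_closed(6)[OF Q j s]] s]
        H_mult[OF s TL_closed(6)[OF Q j s]] H_mult[OF j s] by simp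
    show ?thesis
    proof (cases "y x i = y x (Suc i)")
      case True
      have S: "H (Phi_s M i) (b x) = sc (- 1) (b x)"
        unfolding Phi_s_act[OF i Suc.prems(1)] flat[OF Suc.prems(1) i True] by (rule ext) (simp add: sc_def)
      have "H (jm M (Suc i)) (b x) = sc (of_int (cn (y x) i)) (b x) + sc (- 1) (b x)"
        unfolding rec S H_vsc[OF j] IH[OF Suc.prems(1)] H_vsc[OF s] by (simp add: sc_simps S)
      also have "\<dots> = sc (of_int (cn (y x) i - 1)) (b x)" by (simp add: sc_def fun_eq_iff algebra_simps)
      finally show ?thesis using cn_step[of i "y x"] i True by simp
    next
      case ne: False
      from tip[OF Suc.prems(1) i ne] show ?thesis
      proof (elim disjE)
        assume h: "y x i \<and> ht (y x) (i - 1) = 0 \<and> H (tl_u M i) (b x) = sc 2 (b x)"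
        then have S: "H (Phi_s M i) (b x) = b x"
          unfolding Phi_s_act[OF i Suc.prems(1)] by (auto simp: sc_def fun_eq_iff)
        have "H (jm M (Suc i)) (b x) = sc (of_int (cn (y x) i)) (b x) + b x"
          unfolding rec S IH[OF Suc.prems(1)] H_vsc[OF s] ..
        also have "\<dots> = sc (of_int (cn (y x) i + 1)) (b x)" by (simp add: sc_def fun_eq_iff algebra_simps)
        also have "cn (y x) i + 1 = cn (y x) (Suc i)" using cn_axial[of i "y x"] h ne i by simp
        finally show ?thesis .
      next
        assume "\<exists>p\<in>X. \<exists>q\<in>X. \<exists>B. (x = p \<or> x = q) \<and> y p i \<and> \<not> y p (Suc i) \<and> 0 \<le> ht (y p) (i - 1) \<and>
         (\<forall>j\<in>{1..M}. y q j = swc i (y p) j) \<and> B \<noteq> 0 \<and>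
         H (tl_u M i) (b p) = sc ((of_int (ht (y p) (i - 1)) + 2) / (of_int (ht (y p) (i - 1)) + 1)) (b p) + sc B (b q)"
        then obtain p q B where p: "p \<in> X" "y p i" "\<not> y p (Suc i)" "0 \<le> ht (y p) (i - 1)" and q: "q \<in> X" and xpq: "x = p \<or> x = q"
          and yq: "\<And>j. j \<in> {1..M} \<Longrightarrow> y q j = swc i (y p) j" and B: "B \<noteq> 0"
          and U: "H (tl_u M i) (b p) = sc ((of_int (ht (y p) (i - 1)) + 2) / (of_int (ht (y p) (i - 1)) + 1)) (b p) + sc B (b q)"
          by auto
        define m where "m = (of_int (ht (y p) (i - 1)) + 1 :: rat)"
        have "0 \<le> rat_of_int (ht (y p) (i - 1))" using p(4) by simp
        then have m0: "m \<noteq> 0" unfolding m_def by linarith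
        define A where "A = (m + 1) / m"
        have U: "H (tl_u M i) (b p) = sc A (b p) + sc B (b q)" using U unfolding A_def m_def by (simp add: add.assoc)
        note u = u_TL[OF i]
        \<comment> \<open>The relation \<open>u_i^2 = 2 u_i\<close>, applied to \<open>b p\<close>,
          is an equation for the image of \<open>b q\<close>; it can be solved because
          \<open>B\<close> is invertible.\<close>
        have "sc A (sc A (b p) + sc B (b q)) + sc B (H (tl_u M i) (b q)) = sc 2 (sc A (b p) + sc B (b q))"
          using u_square[OF i, of "b p"] unfolding U H_vadd[OF u] H_vsc[OF u] .
        then have Uq: "H (tl_u M i) (b q) = sc ((2 - A) * A / B) (b p) + sc (2 - A) (b q)"
          using B by (auto simp: sc_def fun_eq_iff field_simps)
        have Sp: "H (Phi_s M i) (b p) = sc (1 / m) (b p) + sc B (b q)"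
          unfolding Phi_s_act[OF i p(1)] U A_def using m0 by (auto simp: sc_def fun_eq_iff field_simps)
        have Sq: "H (Phi_s M i) (b q) = sc ((m - 1) * (m + 1) / (m * m * B)) (b p) + sc (- 1 / m) (b q)"
          unfolding Phi_s_act[OF i q] Uq A_def using m0 B by (auto simp: sc_def fun_eq_iff field_simps)
        have cq: "cn (y q) j = cn (swc i (y p)) j" if "j \<in> {1..M}" for j
          unfolding cn_def using yq that by (auto intro!: up_cong dn_cong)
        define c1 c2 where "c1 = (of_int (cn (y p) i) :: rat)" and "c2 = (of_int (cn (y p) (Suc i)) :: rat)"
        have "cn (y p) i = cn (y p) (Suc i) - (ht (y p) (i - 1) + 1)" using cn_axial[of i "y p"] p i by linarith
        then have cc: "c1 = c2 - m" unfolding c1_def c2_def m_def by simp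
        have q1: "of_int (cn (y q) i) = c2" "of_int (cn (y q) (Suc i)) = c1"
          using cq[of i] cq[of "Suc i"] cn_swc[of i "y p"] p i unfolding c1_def c2_def by auto
        have Jp: "H (jm M i) (b p) = sc c1 (b p)" using IH[OF p(1)] unfolding c1_def .
        have Jq: "H (jm M i) (b q) = sc c2 (b q)" using IH[OF q] unfolding q1 .
        note lin = H_vadd[OF s] H_vsc[OF s] H_vadd[OF j] H_vsc[OF j] Jp Jq Sp Sq
        have "H (jm M (Suc i)) (b p) = sc c2 (b p)"
          unfolding rec lin cc using m0 B by (auto simp: sc_def fun_eq_iff field_simps)
        moreover have "H (jm M (Suc i)) (b q) = sc c1 (b q)"
          unfolding rec lin cc using m0 B by (auto simp: sc_def fun_eq_iff field_simps)
        ultimately show ?thesis using xpq q1 unfolding c2_def by auto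
      qed
    qed
  qed
qed

lemma factor_act:
  assumes "x \<in> X" "1 \<le> i" "i \<le> M" "k \<in> Q"
  shows "H (scale k (jm M i - scale (of_int c) (tl_one M))) (b x) = sc (k * (of_int (cn (y x) i) - of_int c)) (b x)"
    and "scale k (jm M i - scale (of_int c) (tl_one M)) \<in> TL M Q"
proof -
  have j: "jm M i \<in> TL M Q" by (rule jm_TL[OF Q]) (use assms in simp)
  have c: "of_int c \<in> Q" by (rule subring_of_int[OF Q])
  note o = TL_closed(7)[OF Q, of M]
  show "scale k (jm M i - scale (of_int c) (tl_one M)) \<in> TL M Q"
    by (intro TL_closed(3,2)[OF Q] assms j o c)
  show "H (scale k (jm M i - scale (of_int c) (tl_one M))) (b x) = sc (k * (of_int (cn (y x) i) - of_int c)) (b x)"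
    unfolding H_scale[OF assms(4) TL_closed(2)[OF Q j TL_closed(3)[OF Q c o]]]
      H_diff[OF j TL_closed(3)[OF Q c o]] H_scale[OF c o] H_one[OF assms(1)] jm_act[OF assms(1-3)]
    by (auto simp: sc_def fun_eq_iff algebra_simps)
qed

lemma prod_act:
  assumes x: "x \<in> X" and z: "\<And>z. z \<in> set zs \<Longrightarrow> z \<in> TL M Q \<and> (\<exists>k. H z (b x) = sc k (b x))"
  shows "\<exists>k. H (tl_prod M zs) (b x) = sc k (b x)"
    and "(\<And>z. z \<in> set zs \<Longrightarrow> H z (b x) = b x) \<Longrightarrow> H (tl_prod M zs) (b x) = b x"
    and "(\<And>z. z \<in> set zs \<Longrightarrow> \<exists>k. k \<noteq> 0 \<and> H z (b x) = sc k (b x)) \<Longrightarrow> \<exists>k. k \<noteq> 0 \<and> H (tl_prod M zs) (b x) = sc k (b x)"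
    and "\<exists>z\<in>set zs. H z (b x) = 0 \<Longrightarrow> H (tl_prod M zs) (b x) = 0"
proof -
  have T: "tl_prod M zs \<in> TL M Q" if "\<And>z. z \<in> set zs \<Longrightarrow> z \<in> TL M Q" for zs by (rule TL_prod[OF Q that])
  have 1: "\<exists>k. H (tl_prod M zs) (b x) = sc k (b x)" if "\<And>z. z \<in> set zs \<Longrightarrow> z \<in> TL M Q \<and> (\<exists>k. H z (b x) = sc k (b x))" for zs
    using that
  proof (induction zs)
    case Nil
    have "H (tl_prod M []) (b x) = sc 1 (b x)" using H_one[OF x] by (simp add: tl_prod_simps sc_simps)
    then show ?case ..
  next
    case (Cons z zs)
    then obtain k l where "H (tl_prod M zs) (b x) = sc k (b x)" "H z (b x) = sc l (b x)" by (metis list.set_intros)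
    then show ?case using Cons.prems T[of zs] by (auto simp: tl_prod_simps H_mult H_vsc sc_simps)
  qed
  show "\<exists>k. H (tl_prod M zs) (b x) = sc k (b x)" using 1 z by blast
  show "(\<And>z. z \<in> set zs \<Longrightarrow> H z (b x) = b x) \<Longrightarrow> H (tl_prod M zs) (b x) = b x"
    using z
  proof (induction zs)
    case Nil then show ?case using H_one[OF x] by (simp add: tl_prod_simps)
  next
    case (Cons z zs)
    have "H (tl_prod M zs) (b x) = b x" using Cons by (metis list.set_intros(2))
    moreover have "z \<in> TL M Q" "tl_prod M zs \<in> TL M Q" "H z (b x) = b x" using Cons.prems T[of zs] by auto
    ultimately show ?case by (simp only: tl_prod_simps H_mult)
  qed
  show "(\<And>z. z \<in> set zs \<Longrightarrow> \<exists>k. k \<noteq> 0 \<and> H z (b x) = sc k (b x)) \<Longrightarrow> \<exists>k. k \<noteq> 0 \<and> H (tl_prod M zs) (b x) = sc k (b x)"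
    using z
  proof (induction zs)
    case Nil
    have "H (tl_prod M []) (b x) = sc 1 (b x)" using H_one[OF x] by (simp add: tl_prod_simps sc_simps)
    then show ?case by (metis zero_neq_one)
  next
    case (Cons z zs)
    then obtain k l where kl: "H (tl_prod M zs) (b x) = sc k (b x)" "H z (b x) = sc l (b x)" "k \<noteq> 0" "l \<noteq> 0"
      by (metis list.set_intros)
    then have "H (tl_prod M (z # zs)) (b x) = sc (k * l) (b x)"
      using Cons.prems T[of zs] by (auto simp: tl_prod_simps H_mult H_vsc sc_simps)
    then show ?case using kl by (metis mult_eq_0_iff)
  qed
  show "\<exists>z\<in>set zs. H z (b x) = 0 \<Longrightarrow> H (tl_prod M zs) (b x) = 0"
    using z
  proof (induction zs)
    case (Cons z zs)
    have zT: "z \<in> TL M Q" "tl_prod M zs \<in> TL M Q" using Cons.prems T[of zs] by auto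
    obtain k where k: "H (tl_prod M zs) (b x) = sc k (b x)" using 1[of zs] Cons.prems by (metis list.set_intros(2))
    show ?case
    proof (cases "H z (b x) = 0")
      case True
      then show ?thesis using zT k by (simp only: tl_prod_simps H_mult H_vsc sc_simps)
    next
      case False
      then have "H (tl_prod M zs) (b x) = 0" using Cons by (metis set_ConsD list.set_intros(2))
      then show ?thesis using zT by (simp only: tl_prod_simps H_mult H_vzero)
    qed
  qed simp
qed

end

section \<open>Tableaux\<close>

definition wt :: "nat \<Rightarrow> (nat \<Rightarrow> bool) \<Rightarrow> tab" where
  "wt N c = restrict (\<lambda>i. if c i then (up c i, 1) else (dn c i, 2)) {1..N}"

definition shp :: "nat \<Rightarrow> (nat \<Rightarrow> bool) \<Rightarrow> nat list" where
  "shp N c = replicate (dn c N) 2 @ replicate (up c N - dn c N) 1"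

lemma wt_apply: "i \<in> {1..N} \<Longrightarrow> wt N c i = (if c i then (up c i, 1) else (dn c i, 2))"
  by (simp add: wt_def)

lemma snd_wt: "i \<in> {1..N} \<Longrightarrow> snd (wt N c i) = 1 \<longleftrightarrow> c i"
  by (simp add: wt_def)

lemma wt_cong: "(\<And>i. i \<in> {1..N} \<Longrightarrow> c i = d i) \<Longrightarrow> wt N c = wt N d"
proof (rule ext)
  fix i assume e: "\<And>i. i \<in> {1..N} \<Longrightarrow> c i = d i"
  show "wt N c i = wt N d i"
  proof (cases "i \<in> {1..N}")
    case True
    have "up c i = up d i" "dn c i = dn d i" using True e by (auto intro!: up_cong dn_cong)
    then show ?thesis using True e by (simp add: wt_apply)
  next
    case False
    show ?thesis by (simp only: wt_def restrict_apply if_not_P[OF False])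
  qed
qed

lemma wt_eq_iff: "wt N c = wt N d \<longleftrightarrow> (\<forall>i\<in>{1..N}. c i = d i)"
proof
  assume "wt N c = wt N d"
  then show "\<forall>i\<in>{1..N}. c i = d i" using snd_wt by metis
qed (use wt_cong in blast)

lemma cont_wt: "i \<in> {1..N} \<Longrightarrow> cont (wt N c) i = cn c i"
  by (cases i) (auto simp: cont_def wt_apply cn_def)

lemma up_mono: "i \<le> j \<Longrightarrow> up c i \<le> up c j"
  by (induction j rule: dec_induct) auto

lemma up_strict: "i < j \<Longrightarrow> c j \<Longrightarrow> up c i < up c j"
  using up_mono[of i "j - 1" c] by (cases j) auto

lemma dn_mono: "i \<le> j \<Longrightarrow> dn c i \<le> dn c j"
  unfolding dn_def by (rule up_mono)

lemma dn_strict: "i < j \<Longrightarrow> \<not> c j \<Longrightarrow> dn c i < dn c j"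
  unfolding dn_def by (rule up_strict)

lemma up_bij: "bij_betw (up c) {i \<in> {1..m}. c i} {1..up c m}"
proof (rule bij_betw_imageI)
  show "inj_on (up c) {i \<in> {1..m}. c i}"
    by (rule inj_onI) (metis (mono_tags, lifting) mem_Collect_eq less_irrefl linorder_neqE_nat up_strict)
  show "up c ` {i \<in> {1..m}. c i} = {1..up c m}"
  proof (induction m)
    case 0 then show ?case by simp
  next
    case (Suc m)
    show ?case
    proof (cases "c (Suc m)")
      case True
      then have "{i \<in> {1..Suc m}. c i} = insert (Suc m) {i \<in> {1..m}. c i}" by auto
      then have "up c ` {i \<in> {1..Suc m}. c i} = insert (up c (Suc m)) {1..up c m}" using Suc by simp
      then show ?thesis using True by auto
    next
      case False
      then have "{i \<in> {1..Suc m}. c i} = {i \<in> {1..m}. c i}" by (auto simp: le_Suc_eq)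
      then show ?thesis using Suc False by simp
    qed
  qed
qed

lemma dn_bij: "bij_betw (dn c) {i \<in> {1..m}. \<not> c i} {1..dn c m}"
  unfolding dn_def by (rule up_bij)

lemma up_card: "up c m = card {i \<in> {1..m}. c i}"
  using bij_betw_same_card[OF up_bij[of c m]] by simp

lemma dn_card: "dn c m = card {i \<in> {1..m}. \<not> c i}"
  unfolding dn_def by (rule up_card)

lemma good_dn_up: "good N c \<Longrightarrow> m \<le> N \<Longrightarrow> dn c m \<le> up c m"
  using ht_nonneg[of N c m] unfolding ht_up_dn by simp

lemma sorted_wrt_replicate_ge: "sorted_wrt (\<ge>) (replicate n (a :: nat))"
  by (induction n) auto

lemma shp_props:
  assumes g: "good N c"
  shows "shp N c \<in> Par2 N" "sum_list (shp N c) = N"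
    "young (shp N c) = {1..up c N} \<times> {1} \<union> {1..dn c N} \<times> {2}"
proof -
  have le: "dn c N \<le> up c N" using good_dn_up[OF g] by simp
  show s: "sum_list (shp N c) = N"
    using le up_dn_sum[of c N] unfolding shp_def by (simp add: sum_list_replicate)
  show "shp N c \<in> Par2 N" unfolding Par2_def using s by (auto simp: shp_def sorted_wrt_append sorted_wrt_replicate_ge)
  show "young (shp N c) = {1..up c N} \<times> {1} \<union> {1..dn c N} \<times> {2}"
    unfolding young_def shp_def using le by (auto simp: nth_append split: if_splits)
qed

text \<open>The columns increase by construction. The rows increase because the walk stays above 0:
  the second column never catches up with the first, so each of its entries comes after its left
  neighbour.\<close>

lemma wt_in_Std:
  assumes g: "good N c"
  shows "wt N c \<in> Std (shp N c)"
proof -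
  note sp = shp_props[OF g]
  have 1: "wt N c \<in> extensional {1..N}" unfolding wt_def by simp
  let ?U = "{i \<in> {1..N}. c i}" and ?D = "{i \<in> {1..N}. \<not> c i}"
  have b1: "bij_betw (wt N c) ?U ({1..up c N} \<times> {1})"
  proof -
    have "bij_betw (\<lambda>i. (up c i, 1::nat)) ?U ({1..up c N} \<times> {1})"
      using up_bij[of c N] unfolding bij_betw_def inj_on_def by auto
    then show ?thesis by (rule bij_betw_cong[THEN iffD1, rotated]) (simp add: wt_apply)
  qed
  have b2: "bij_betw (wt N c) ?D ({1..dn c N} \<times> {2})"
  proof -
    have "bij_betw (\<lambda>i. (dn c i, 2::nat)) ?D ({1..dn c N} \<times> {2})"
      using dn_bij[of c N] unfolding bij_betw_def inj_on_def by auto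
    then show ?thesis by (rule bij_betw_cong[THEN iffD1, rotated]) (simp add: wt_apply)
  qed
  have "bij_betw (wt N c) (?U \<union> ?D) ({1..up c N} \<times> {1} \<union> {1..dn c N} \<times> {2})"
    by (rule bij_betw_combine[OF b1 b2]) auto
  moreover have "?U \<union> ?D = {1..N}" by auto
  ultimately have 2: "bij_betw (wt N c) {1..N} (young (shp N c))" unfolding sp(3) by simp
  have 3: "(fst (wt N c i) = fst (wt N c j) \<and> snd (wt N c i) < snd (wt N c j) \<longrightarrow> i < j) \<and>
        (snd (wt N c i) = snd (wt N c j) \<and> fst (wt N c i) < fst (wt N c j) \<longrightarrow> i < j)"
    if ij: "i \<in> {1..N}" "j \<in> {1..N}" for i j
  proof (intro conjI impI; elim conjE)
    assume h: "fst (wt N c i) = fst (wt N c j)" "snd (wt N c i) < snd (wt N c j)"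
    then have c: "c i" "\<not> c j" "up c i = dn c j" using ij by (auto simp: wt_apply split: if_splits)
    show "i < j"
    proof (rule ccontr)
      assume "\<not> i < j"
      then have "j < i" using c by (metis linorder_neqE_nat)
      then have "up c j < up c i" using up_strict c by blast
      then show False using good_dn_up[OF g, of j] c ij by simp
    qed
  next
    assume h: "snd (wt N c i) = snd (wt N c j)" "fst (wt N c i) < fst (wt N c j)"
    then have "c i = c j" "up c i < up c j \<or> dn c i < dn c j" using ij by (auto simp: wt_apply split: if_splits)
    then show "i < j" by (meson dn_mono leD not_less up_mono)
  qed
  show ?thesis unfolding Std_def sp(2) using 1 2 3 by blast
qed

lemma Par2_two_columns:
  assumes "lam \<in> Par2 N"
  shows "(r, k) \<in> young lam \<Longrightarrow> k = 1 \<or> k = 2" "(r, k) \<in> young lam \<Longrightarrow> 1 \<le> r" "(r, 2) \<in> young lam \<Longrightarrow> (r, 1) \<in> young lam"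
    "(r, k) \<in> young lam \<Longrightarrow> 1 \<le> r' \<Longrightarrow> r' \<le> r \<Longrightarrow> (r', k) \<in> young lam"
proof -
  have v: "\<And>x. x \<in> set lam \<Longrightarrow> 1 \<le> x \<and> x \<le> 2" and s: "sorted_wrt (\<ge>) lam" using assms unfolding Par2_def by auto
  show "(r, k) \<in> young lam \<Longrightarrow> k = 1 \<or> k = 2"
  proof -
    assume "(r, k) \<in> young lam"
    then have "1 \<le> k" "k \<le> lam ! (r - 1)" "lam ! (r - 1) \<in> set lam" unfolding young_def by auto
    then show ?thesis using v[of "lam ! (r - 1)"] by auto
  qed
  show "(r, k) \<in> young lam \<Longrightarrow> 1 \<le> r" unfolding young_def by auto
  show "(r, 2) \<in> young lam \<Longrightarrow> (r, 1) \<in> young lam" unfolding young_def by auto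
  show "(r', k) \<in> young lam" if h: "(r, k) \<in> young lam" "1 \<le> r'" "r' \<le> r"
  proof -
    have "lam ! (r - 1) \<le> lam ! (r' - 1)"
    proof (cases "r' = r")
      case False
      then show ?thesis using s h unfolding sorted_wrt_iff_nth_less young_def by auto
    qed simp
    then show ?thesis using h unfolding young_def by auto
  qed
qed

text \<open>Entries increase down a column, so the row of an entry is its rank within the column,
  and the columns alone determine the tableau. The third conclusion makes the final height a
  function of the shape.\<close>

lemma Std_obtain_walk:
  assumes lam: "lam \<in> Par2 N" and t: "t \<in> Std lam"
  obtains c where "good N c" "t = wt N c" "dn c N = card {z \<in> young lam. snd z = 2}"
proof -
  have sN: "sum_list lam = N" using lam unfolding Par2_def by auto
  have ext: "t \<in> extensional {1..N}" and bij: "bij_betw t {1..N} (young lam)"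
    and row: "\<And>i j. i \<in> {1..N} \<Longrightarrow> j \<in> {1..N} \<Longrightarrow> fst (t i) = fst (t j) \<Longrightarrow> snd (t i) < snd (t j) \<Longrightarrow> i < j"
    and col: "\<And>i j. i \<in> {1..N} \<Longrightarrow> j \<in> {1..N} \<Longrightarrow> snd (t i) = snd (t j) \<Longrightarrow> fst (t i) < fst (t j) \<Longrightarrow> i < j"
    using t unfolding Std_def sN by auto
  note P = Par2_two_columns[OF lam]
  have ty: "t i \<in> young lam" if "i \<in> {1..N}" for i using bij that unfolding bij_betw_def by blast
  have inj: "i = j" if "t i = t j" "i \<in> {1..N}" "j \<in> {1..N}" for i j using bij that unfolding bij_betw_def inj_on_def by blast
  have ex: "\<exists>j\<in>{1..N}. t j = z" if "z \<in> young lam" for z using bij that unfolding bij_betw_def by force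
  define c where "c i \<longleftrightarrow> snd (t i) = 1" for i
  have sn: "snd (t i) = 1 \<or> snd (t i) = 2" if "i \<in> {1..N}" for i using P(1) ty[OF that] by (metis prod.collapse)
  have rank: "fst (t i) = card {j \<in> {1..i}. snd (t j) = snd (t i)}" if i: "i \<in> {1..N}" for i
  proof -
    let ?A = "{j \<in> {1..i}. snd (t j) = snd (t i)}"
    have img: "(\<lambda>j. fst (t j)) ` ?A = {1..fst (t i)}"
    proof (intro equalityI subsetI)
      fix r assume "r \<in> (\<lambda>j. fst (t j)) ` ?A"
      then obtain j where j: "j \<in> {1..i}" "snd (t j) = snd (t i)" "r = fst (t j)" by auto
      have jN: "j \<in> {1..N}" using j i by auto
      have "1 \<le> r" using P(2) ty[OF jN] j by (metis prod.collapse)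
      moreover have "r \<le> fst (t i)" using col[OF i jN] j by (metis atLeastAtMost_iff not_le)
      ultimately show "r \<in> {1..fst (t i)}" by simp
    next
      fix r assume r: "r \<in> {1..fst (t i)}"
      have "(r, snd (t i)) \<in> young lam" using P(4)[of "fst (t i)" "snd (t i)" r] ty[OF i] r by simp
      then obtain j where j: "j \<in> {1..N}" "t j = (r, snd (t i))" using ex by blast
      have "j \<le> i"
      proof (cases "r = fst (t i)")
        case True
        then have "t j = t i" using j by simp
        then show ?thesis using inj j i by blast
      next
        case False
        then show ?thesis using col[OF j(1) i] j r by simp
      qed
      then show "r \<in> (\<lambda>j. fst (t j)) ` ?A" using j by (auto intro!: image_eqI[of _ _ j])
    qed
    have "inj_on (\<lambda>j. fst (t j)) ?A"
    proof (rule inj_onI)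
      fix x y assume x: "x \<in> ?A" and y: "y \<in> ?A" and e: "fst (t x) = fst (t y)"
      have "t x = t y" using x y e by (simp add: prod_eq_iff)
      then show "x = y" using inj x y i by auto
    qed
    then have "card ((\<lambda>j. fst (t j)) ` ?A) = card ?A" by (rule card_image)
    then show ?thesis unfolding img by simp
  qed
  have tw: "t i = wt N c i" if i: "i \<in> {1..N}" for i
  proof (cases "c i")
    case True
    then have "{j \<in> {1..i}. snd (t j) = snd (t i)} = {j \<in> {1..i}. c j}" unfolding c_def by auto
    then have "fst (t i) = up c i" using rank[OF i] up_card by simp
    then show ?thesis using True i unfolding wt_apply[OF i] c_def by (simp add: prod_eq_iff)
  next
    case False
    have "{j \<in> {1..i}. snd (t j) = snd (t i)} = {j \<in> {1..i}. \<not> c j}"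
    proof (rule Collect_cong, rule conj_cong[OF refl])
      fix j assume "j \<in> {1..i}"
      then have "j \<in> {1..N}" using i by auto
      then show "(snd (t j) = snd (t i)) = (\<not> c j)" using False sn[of j] sn[OF i] unfolding c_def by auto
    qed
    then have "fst (t i) = dn c i" using rank[OF i] dn_card by simp
    then show ?thesis using False sn[OF i] i unfolding wt_apply[OF i] c_def by (simp add: prod_eq_iff)
  qed
  have "t = wt N c"
  proof
    fix i show "t i = wt N c i"
      using tw[of i] ext unfolding extensional_def wt_def by (cases "i \<in> {1..N}") auto
  qed
  moreover have "good N c" unfolding good_def
  proof (intro allI impI)
    fix m assume m: "m \<le> N"
    show "0 \<le> ht c m"
    proof (cases "dn c m = 0")
      case True then show ?thesis by (simp add: ht_up_dn)
    next
      case False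
      \<comment> \<open>The last second-column entry up to \<open>m\<close> has a smaller left
        neighbour in the same row, so the first column is at least as long.\<close>
      then have "dn c m \<in> dn c ` {i \<in> {1..m}. \<not> c i}" using dn_bij[of c m] unfolding bij_betw_def by auto
      then obtain i where i: "i \<in> {1..m}" "\<not> c i" "dn c i = dn c m" by auto
      then have iN: "i \<in> {1..N}" using m by auto
      have ti: "t i = (dn c m, 2)" using tw[OF iN] i iN by (simp add: wt_apply)
      then have "(dn c m, 1) \<in> young lam" using P(3) ty[OF iN] by simp
      then obtain j where j: "j \<in> {1..N}" "t j = (dn c m, 1)" using ex by blast
      then have "j < i" using row[OF j(1) iN] ti by simp
      have "c j" using j unfolding c_def by simp
      then have "up c j = dn c m" using tw[OF j(1)] j by (simp add: wt_apply)
      then have "dn c m \<le> up c m" using up_mono[of j m c] \<open>j < i\<close> i by simp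
      then show ?thesis by (simp add: ht_up_dn)
    qed
  qed
  moreover have "dn c N = card {z \<in> young lam. snd z = 2}"
  proof -
    have "t ` {i \<in> {1..N}. \<not> c i} = {z \<in> young lam. snd z = 2}"
    proof (intro equalityI subsetI)
      fix z assume "z \<in> t ` {i \<in> {1..N}. \<not> c i}"
      then show "z \<in> {z \<in> young lam. snd z = 2}" using ty sn unfolding c_def by auto
    next
      fix z assume z: "z \<in> {z \<in> young lam. snd z = 2}"
      then obtain i where "i \<in> {1..N}" "t i = z" using ex by blast
      then show "z \<in> t ` {i \<in> {1..N}. \<not> c i}" using z unfolding c_def by auto
    qed
    moreover have "inj_on t {i \<in> {1..N}. \<not> c i}" using inj by (auto intro: inj_onI)
    ultimately show ?thesis using card_image dn_card by metis
  qed
  ultimately show ?thesis using that by blast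
qed

lemma Std2_iff: "t \<in> Std2 N \<longleftrightarrow> (\<exists>c. good N c \<and> t = wt N c)"
proof
  assume "t \<in> Std2 N"
  then obtain lam where "lam \<in> Par2 N" "t \<in> Std lam" unfolding Std2_def by blast
  then show "\<exists>c. good N c \<and> t = wt N c" using Std_obtain_walk by metis
next
  assume "\<exists>c. good N c \<and> t = wt N c"
  then show "t \<in> Std2 N" using wt_in_Std shp_props(1) unfolding Std2_def by blast
qed

lemma wt_in_Std2: "wt N c \<in> Std2 N \<longleftrightarrow> good N c"
proof
  assume "wt N c \<in> Std2 N"
  then obtain d where "good N d" "wt N c = wt N d" unfolding Std2_iff by blast
  then show "good N c" unfolding wt_eq_iff using good_cong[of N c d] by auto
qed (use Std2_iff in blast)

lemma swap_entries_wt: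
  assumes l: "1 \<le> l" "l < N" and c: "c l \<noteq> c (Suc l)"
  shows "swap_entries (wt N c) l = wt N (swc l c)"
proof
  fix i
  have d: "up (swc l c) l = up c (l - 1) + (if c (Suc l) then 1 else 0)" "dn (swc l c) l = dn c (l - 1) + (if c (Suc l) then 0 else 1)"
  proof -
    obtain j where j: "l = Suc j" using l by (cases l) auto
    have "up (swc l c) j = up c j" "dn (swc l c) j = dn c j" using up_swc[of l j c] dn_swc[of l j c] l j by simp_all
    then show "up (swc l c) l = up c (l - 1) + (if c (Suc l) then 1 else 0)" "dn (swc l c) l = dn c (l - 1) + (if c (Suc l) then 0 else 1)"
      unfolding j by simp_all
  qed
  have cl: "up c l = up c (l - 1) + (if c l then 1 else 0)" "dn c l = dn c (l - 1) + (if c l then 0 else 1)"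
    using l by (cases l; simp)+
  consider "i = l" | "i = Suc l" | "i \<noteq> l" "i \<noteq> Suc l" by blast
  then show "swap_entries (wt N c) l i = wt N (swc l c) i"
  proof cases
    case 1 then show ?thesis using l c d cl by (auto simp: swap_entries_def wt_def)
  next
    case 2
    then show ?thesis using l c d cl up_swc[of l "Suc l" c] dn_swc[of l "Suc l" c]
      by (auto simp: swap_entries_def wt_def simp del: up.simps dn_simps)
        (simp_all)
  next
    case 3 then show ?thesis using l up_swc[of l i c] dn_swc[of l i c] by (auto simp: swap_entries_def wt_def)
  qed
qed

lemma swap_entries_equal:
  assumes l: "1 \<le> l" "l < N" and c: "c l = c (Suc l)"
  shows "swap_entries (wt N c) l \<notin> Std2 N"
proof
  assume "swap_entries (wt N c) l \<in> Std2 N"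
  then obtain d where d: "swap_entries (wt N c) l = wt N d" unfolding Std2_iff by blast
  have e: "wt N d l = wt N c (Suc l)" "wt N d (Suc l) = wt N c l"
    unfolding d[symmetric] by (simp_all add: swap_entries_def)
  show False
  proof (cases "c l")
    case True
    then have "c (Suc l)" using c by simp
    then show False using e True l up_strict[of l "Suc l" c] up_strict[of l "Suc l" d] by (auto simp: wt_apply split: if_splits)
  next
    case False
    then have "\<not> c (Suc l)" using c by simp
    then show False using e False l dn_strict[of l "Suc l" c] dn_strict[of l "Suc l" d] by (auto simp: wt_apply split: if_splits)
  qed
qed

lemma rho_seminormal_action: "seminormal_action N UNIV (rho N) {c. good N c} (\<lambda>c. vc c N) (\<lambda>c. c)"
proof
  show "rho N (tl_one N) (vc x N) = vc x N" for x by (rule rho_one) simp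
  show "rho N (tl_u N i) (vc x N) = 0" if i: "1 \<le> i" "i < N" and e: "x i = x (Suc i)" for x i
    by (simp only: rho_u[OF supp_vc i] sw_vc_equal[of i N x, OF i e] diff_self)
  fix x i
  assume x: "x \<in> {c. good N c}" and i: "1 \<le> i" "i < N" and ne: "x i \<noteq> x (Suc i)"
  let ?k = "\<lambda>c. (rat_of_int (ht c (i - 1)) + 2) / (of_int (ht c (i - 1)) + 1)"
  have peak: "rho N (tl_u N i) (vc c N) = sc (?k c) (vc c N) + sc (- ?k c) (vc (swc i c) N) \<and> 0 \<le> ht c (i - 1) \<and> - ?k c \<noteq> 0"
    if g: "good N c" and c: "c i" "\<not> c (Suc i)" for c
  proof (intro conjI)
    show h: "0 \<le> ht c (i - 1)" using ht_nonneg[OF g, of "i - 1"] i by simp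
    show "rho N (tl_u N i) (vc c N) = sc (?k c) (vc c N) + sc (- ?k c) (vc (swc i c) N)"
      unfolding rho_u[OF supp_vc i] sw_vc_peak[OF i c h] by (rule ext) (simp add: sc_def right_diff_distrib)
    have "0 \<le> rat_of_int (ht c (i - 1))" using h by simp
    then have "0 < ?k c" by simp
    then show "- ?k c \<noteq> 0" by (metis neg_equal_0_iff_equal less_irrefl)
  qed
  show "(x i \<and> ht x (i - 1) = 0 \<and> rho N (tl_u N i) (vc x N) = sc 2 (vc x N)) \<or>
      (\<exists>p\<in>{c. good N c}. \<exists>q\<in>{c. good N c}. \<exists>B. (x = p \<or> x = q) \<and> p i \<and> \<not> p (Suc i) \<and> 0 \<le> ht p (i - 1) \<and>
         (\<forall>j\<in>{1..N}. q j = swc i p j) \<and> B \<noteq> 0 \<and>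
         rho N (tl_u N i) (vc p N) = sc (?k p) (vc p N) + sc B (vc q N))"
  proof (cases "x i")
    case True
    then have c: "x i" "\<not> x (Suc i)" using ne by auto
    have g: "good N x" using x by simp
    note pk = peak[OF g c]
    show ?thesis
    proof (cases "ht x (i - 1) = 0")
      case z: True
      have "rho N (tl_u N i) (vc x N) = sc 2 (vc x N)"
        using pk unfolding vc_swc_ht_0[OF i c z] z sc_simps by simp
      then show ?thesis using c z by blast
    next
      case False
      then have "good N (swc i x)" using good_swc_peak[OF g i] pk by simp
      then show ?thesis using g c pk by blast
    qed
  next
    case False
    then have c: "\<not> x i" "x (Suc i)" using ne by auto
    have g: "good N x" using x by simp
    have g': "good N (swc i x)" by (rule good_swc_valley[where c=x, OF g i c(2)])
    have c': "swc i x i" "\<not> swc i x (Suc i)" using c by simp_all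
    have s: "swc i (swc i x) = x" by simp
    note pk = peak[OF g' c', unfolded s]
    show ?thesis
      by (rule disjI2, rule bexI[of _ "swc i x"], rule bexI[of _ x], rule exI[of _ "- ?k (swc i x)"])
        (use pk c' g g' s in \<open>simp_all only: mem_Collect_eq simp_thms ball_triv\<close>)
  qed
qed (simp_all add: rho_add rho_scale rho_mult rho_vadd rho_vsc)

section \<open>Seminormal idempotents as spectral projections\<close>

lemma contents_eq: "contents N = {cn c i | c i. good N c \<and> i \<in> {1..N}}"
  unfolding contents_def using Std2_iff cont_wt by (metis (no_types, lifting))

lemma finite_contents: "finite (contents N)"
  and contents_bounds: "k \<in> contents N \<Longrightarrow> - int N < k \<and> k \<le> 1"
proof -
  have b: "- int N < cn c i \<and> cn c i \<le> 1" if "i \<in> {1..N}" for c i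
    using up_dn_sum[of c "i - 1"] that unfolding cn_def by auto
  show *: "\<And>k. k \<in> contents N \<Longrightarrow> - int N < k \<and> k \<le> 1" unfolding contents_eq using b by blast
  then have "contents N \<subseteq> {- int N..1}" by force
  then show "finite (contents N)" by (rule finite_subset) simp
qed

text \<open>For \<open>k = 1\<close> the product of these factors lies in the algebra over every subring, unlike
  \<open>seminormal_idem N t\<close> itself.\<close>

definition idem_factors :: "nat \<Rightarrow> tab \<Rightarrow> (int \<Rightarrow> nat \<Rightarrow> rat) \<Rightarrow> tl list" where
  "idem_factors N t k = [scale (k c i) (jm N i - scale (of_int c) (tl_one N)).
     c \<leftarrow> sorted_list_of_set (contents N), i \<leftarrow> [1..<N + 1], c \<noteq> cont t i]"

lemma set_idem_factors: "z \<in> set (idem_factors N t k) \<longleftrightarrow>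
    (\<exists>c\<in>contents N. \<exists>i\<in>{1..N}. c \<noteq> cont t i \<and> z = scale (k c i) (jm N i - scale (of_int c) (tl_one N)))"
proof -
  have l: "set [1..<N + 1] = {1..N}" by auto
  have "set (idem_factors N t k) = (\<Union>c\<in>contents N. \<Union>i\<in>{1..N}.
      if c \<noteq> cont t i then {scale (k c i) (jm N i - scale (of_int c) (tl_one N))} else {})"
    unfolding idem_factors_def set_concat set_map image_image set_sorted_list_of_set[OF finite_contents] l
    by (intro SUP_cong refl) auto
  then show ?thesis by (simp only: UN_iff) (auto split: if_splits)
qed

lemma seminormal_idem_factors: "seminormal_idem N t = tl_prod N (idem_factors N t (\<lambda>c i. 1 / of_int (cont t i - c)))"
  unfolding seminormal_idem_def idem_factors_def ..

context seminormal_action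
begin

text \<open>A walk other than \<open>c\<close> differs from it in the content of some entry, and the
  factor belonging to that content and that entry kills its vector. At \<open>c\<close> itself every
  factor acts by a nonzero scalar, which is 1 if the factors are normalised.\<close>

lemma factors_act:
  assumes x: "x \<in> X" and g: "good M c" and k: "\<And>e i. e \<in> contents M \<Longrightarrow> i \<in> {1..M} \<Longrightarrow> e \<noteq> cn c i \<Longrightarrow> k e i \<in> Q \<and> k e i \<noteq> 0"
  shows "wt M (y x) \<noteq> wt M c \<Longrightarrow> H (tl_prod M (idem_factors M (wt M c) k)) (b x) = 0"
    and "wt M (y x) = wt M c \<Longrightarrow> \<exists>q. q \<noteq> 0 \<and> H (tl_prod M (idem_factors M (wt M c) k)) (b x) = sc q (b x)"
    and "wt M (y x) = wt M c \<Longrightarrow> k = (\<lambda>e i. 1 / of_int (cont (wt M c) i - e)) \<Longrightarrow>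
      H (tl_prod M (idem_factors M (wt M c) k)) (b x) = b x"
    and "tl_prod M (idem_factors M (wt M c) k) \<in> TL M Q"
proof -
  let ?F = "idem_factors M (wt M c) k"
  have F: "\<exists>e i. z = scale (k e i) (jm M i - scale (of_int e) (tl_one M)) \<and> e \<in> contents M \<and> i \<in> {1..M} \<and> e \<noteq> cn c i"
    if "z \<in> set ?F" for z
    using that cont_wt[of _ M c] unfolding set_idem_factors by metis
  have z: "z \<in> TL M Q \<and> (\<exists>k. H z (b x) = sc k (b x))" if z: "z \<in> set ?F" for z
    using F[OF z] factor_act[OF x] k by (metis atLeastAtMost_iff)
  show "tl_prod M ?F \<in> TL M Q" by (rule TL_prod[OF Q]) (use z in blast)
  note pa = prod_act[OF x z]
  {
    assume ne: "wt M (y x) \<noteq> wt M c"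
    then have "\<not> (\<forall>i\<in>{1..M}. y x i = c i)" unfolding wt_eq_iff .
    then obtain i where i: "i \<in> {1..M}" "cn (y x) i \<noteq> cn c i" using cn_determines[OF walk[OF x] g] by blast
    have m: "cn (y x) i \<in> contents M" unfolding contents_eq using walk[OF x] i by blast
    let ?z = "scale (k (cn (y x) i) i) (jm M i - scale (of_int (cn (y x) i)) (tl_one M))"
    have "?z \<in> set ?F" unfolding set_idem_factors using m i cont_wt[of i M c] by metis
    moreover have "H ?z (b x) = 0"
      using factor_act(1)[OF x, of i "k (cn (y x) i) i" "cn (y x) i"] k[OF m i] i by (simp add: sc_simps(3) del: zero_fun_apply)
    ultimately show "H (tl_prod M ?F) (b x) = 0" using pa(4) by blast
  next
    assume e: "wt M (y x) = wt M c"
    have ce: "cn (y x) i = cn c i" if "i \<in> {1..M}" for i using cont_wt[OF that] e by metis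
    show "\<exists>q. q \<noteq> 0 \<and> H (tl_prod M ?F) (b x) = sc q (b x)"
    proof (rule pa(3))
      fix z assume "z \<in> set ?F"
      then obtain e i where ei: "z = scale (k e i) (jm M i - scale (of_int e) (tl_one M))" "e \<in> contents M" "i \<in> {1..M}" "e \<noteq> cn c i"
        using F by blast
      have "H z (b x) = sc (k e i * (of_int (cn c i) - of_int e)) (b x)"
        using factor_act(1)[OF x, of i "k e i" e] k[OF ei(2-4)] ei ce[OF ei(3)] by simp
      moreover have "k e i * (of_int (cn c i) - of_int e) \<noteq> 0" using k[OF ei(2-4)] ei by simp
      ultimately show "\<exists>k. k \<noteq> 0 \<and> H z (b x) = sc k (b x)" by blast
    qed
    assume kd: "k = (\<lambda>e i. 1 / of_int (cont (wt M c) i - e))"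
    show "H (tl_prod M ?F) (b x) = b x"
    proof (rule pa(2))
      fix z assume "z \<in> set ?F"
      then obtain e i where ei: "z = scale (k e i) (jm M i - scale (of_int e) (tl_one M))" "e \<in> contents M" "i \<in> {1..M}" "e \<noteq> cn c i"
        using F by blast
      have "H z (b x) = sc (k e i * (of_int (cn c i) - of_int e)) (b x)"
        using factor_act(1)[OF x, of i "k e i" e] k[OF ei(2-4)] ei ce[OF ei(3)] by simp
      moreover have "k e i * (of_int (cn c i) - of_int e) = 1" using ei unfolding kd cont_wt[OF ei(3)] by simp
      ultimately show "H z (b x) = b x" by (simp only: sc_simps)
    qed
  }
qed

end

lemma rho_seminormal:
  assumes "good N c" "good N d"
  shows "rho N (seminormal_idem N (wt N c)) (vc d N) = (if wt N d = wt N c then vc d N else 0)"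
    and "seminormal_idem N (wt N c) \<in> TL N UNIV"
proof -
  interpret seminormal_action N UNIV "rho N" "{c. good N c}" "\<lambda>c. vc c N" "\<lambda>c. c" by (rule rho_seminormal_action)
  define kk :: "int \<Rightarrow> nat \<Rightarrow> rat" where "kk = (\<lambda>e i. 1 / of_int (cont (wt N c) i - e))"
  have k: "kk e i \<in> UNIV \<and> kk e i \<noteq> 0"
    if "e \<in> contents N" "i \<in> {1..N}" "e \<noteq> cn c i" for e i
    using that cont_wt[of i N c] unfolding kk_def by simp
  have d: "d \<in> {c. good N c}" using assms by simp
  show "seminormal_idem N (wt N c) \<in> TL N UNIV" unfolding seminormal_idem_factors kk_def[symmetric]
    by (rule factors_act(4)[OF d assms(1) k])
  show "rho N (seminormal_idem N (wt N c)) (vc d N) = (if wt N d = wt N c then vc d N else 0)"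
  proof (cases "wt N d = wt N c")
    case True
    have "rho N (tl_prod N (idem_factors N (wt N c) kk)) (vc d N) = vc d N"
      by (rule factors_act(3)[OF d assms(1) k True kk_def])
    then show ?thesis using True unfolding seminormal_idem_factors kk_def by simp
  next
    case False
    have "rho N (tl_prod N (idem_factors N (wt N c) kk)) (vc d N) = 0"
      by (rule factors_act(1)[OF d assms(1) k False])
    then show ?thesis using False unfolding seminormal_idem_factors kk_def by (simp only: if_False)
  qed
qed

section \<open>The basis of matrix units\<close>

definition arcs_ok :: "nat set set \<Rightarrow> nat set \<Rightarrow> bool" where
  "arcs_ok A S \<longleftrightarrow> (\<forall>e\<in>A. card (e \<inter> S) = 1)"

definition sgn_set :: "nat set \<Rightarrow> rat" where
  "sgn_set S = (-1) ^ \<Sum>S"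

definition hA :: "nat \<Rightarrow> (nat \<Rightarrow> bool) \<Rightarrow> nat \<Rightarrow> nat set set" where
  "hA N c m = fst (half_dia (wt N c) m)"

definition hV :: "nat \<Rightarrow> (nat \<Rightarrow> bool) \<Rightarrow> nat \<Rightarrow> nat list" where
  "hV N c m = snd (half_dia (wt N c) m)"

lemma h_0: "hA N c 0 = {}" "hV N c 0 = []"
  by (simp_all add: hA_def hV_def)

lemma h_Suc:
  assumes "Suc m \<le> N"
  shows "hA N c (Suc m) = (if c (Suc m) then hA N c m else insert {hd (hV N c m), Suc m} (hA N c m))"
    "hV N c (Suc m) = (if c (Suc m) then Suc m # hV N c m else tl (hV N c m))"
  using assms snd_wt[of "Suc m" N c] by (simp_all add: hA_def hV_def split: prod.split)

lemma length_hV: "good N c \<Longrightarrow> m \<le> N \<Longrightarrow> int (length (hV N c m)) = ht c m"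
proof (induction m)
  case (Suc m)
  have "0 \<le> ht c (Suc m)" using ht_nonneg[OF Suc.prems] .
  then show ?case using Suc by (auto simp: h_Suc)
qed (simp add: h_0)

text \<open>The vacant lines are listed from right to left; their parities alternate because the points
  between two of them are joined among themselves.\<close>

lemma half_invariants:
  assumes g: "good N c"
  shows "m \<le> N \<Longrightarrow> \<Union>(hA N c m) \<union> set (hV N c m) = {1..m} \<and> \<Union>(hA N c m) \<inter> set (hV N c m) = {} \<and>
    sorted_wrt (>) (hV N c m) \<and>
    (\<forall>e\<in>hA N c m. \<exists>a b. e = {a, b} \<and> a < b \<and> odd (a + b) \<and> (\<forall>v\<in>set (hV N c m). \<not> (a < v \<and> v < b))) \<and>
    disjoint (hA N c m) \<and>
    (\<forall>e\<in>hA N c m. \<forall>e'\<in>hA N c m. \<forall>a\<in>e. \<forall>b\<in>e. \<forall>x\<in>e'. \<forall>y\<in>e'. \<not> (a < x \<and> x < b \<and> b < y)) \<and>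
    (\<forall>j<length (hV N c m). even (hV N c m ! j) \<longleftrightarrow> even (length (hV N c m) - j))"
proof (induction m)
  case 0
  then show ?case by (simp add: h_0)
next
  case (Suc m)
  let ?A = "hA N c m" and ?V = "hV N c m"
  note I = Suc.IH[OF Suc_leD[OF Suc.prems]]
  note r2 = conjunct2[OF I] note r3 = conjunct2[OF r2] note r4 = conjunct2[OF r3] note r5 = conjunct2[OF r4] note r6 = conjunct2[OF r5]
  note IH = conjunct1[OF I] conjunct1[OF r2] conjunct1[OF r3] conjunct1[OF r4, rule_format] conjunct1[OF r5]
    conjunct1[OF r6, rule_format] conjunct2[OF r6, rule_format]
  \<comment> \<open>The number of vacant lines is the height, which has the parity of
    \<open>m\<close>. This fixes the parity of the line that the next down step closes.\<close>
  have len: "even (length ?V) \<longleftrightarrow> even m"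
  proof -
    have "int (length ?V) = int (up c m) - int (dn c m)" using length_hV[OF g, of m] Suc.prems by (simp add: ht_up_dn)
    then have "m = length ?V + 2 * dn c m" using up_dn_sum[of c m] by linarith
    then have "even m \<longleftrightarrow> even (length ?V + 2 * dn c m)" by (rule arg_cong)
    then show ?thesis by simp
  qed
  have Ar: "a \<le> m" if "e \<in> ?A" "a \<in> e" for a e using IH(1) that by (metis UnionI UnI1 atLeastAtMost_iff)
  have Vr: "v \<le> m" "1 \<le> v" if "v \<in> set ?V" for v using IH(1) that by (metis UnI2 atLeastAtMost_iff)+
  have eS: "{1..Suc m} = insert (Suc m) {1..m}" by auto
  show ?case
  proof (cases "c (Suc m)")
    case True
    have h: "hA N c (Suc m) = ?A" "hV N c (Suc m) = Suc m # ?V" using h_Suc[OF Suc.prems] True by simp_all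
    have 1: "\<Union>?A \<union> set (Suc m # ?V) = {1..Suc m}" unfolding eS IH(1)[symmetric] by simp
    have 2: "\<Union>?A \<inter> set (Suc m # ?V) = {}" using IH(2) Ar by fastforce
    have 3: "sorted_wrt (>) (Suc m # ?V)" using IH(3) Vr by fastforce
    have 4: "\<exists>a b. e = {a, b} \<and> a < b \<and> odd (a + b) \<and> (\<forall>v\<in>set (Suc m # ?V). \<not> (a < v \<and> v < b))" if e: "e \<in> ?A" for e
    proof -
      obtain a b where ab: "e = {a, b}" "a < b" "odd (a + b)" "\<forall>v\<in>set ?V. \<not> (a < v \<and> v < b)" using IH(4)[OF e] by blast
      have "b \<le> m" using Ar[OF e] ab by simp
      then have "\<forall>v\<in>set (Suc m # ?V). \<not> (a < v \<and> v < b)" using ab(4) by simp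
      then show ?thesis using ab by blast
    qed
    have 5: "even ((Suc m # ?V) ! j) \<longleftrightarrow> even (length (Suc m # ?V) - j)" if "j < length (Suc m # ?V)" for j
      using that len IH(7)[of "j - 1"] by (cases j) auto
    have 4: "\<forall>e\<in>?A. \<exists>a b. e = {a, b} \<and> a < b \<and> odd (a + b) \<and> (\<forall>v\<in>set (Suc m # ?V). \<not> (a < v \<and> v < b))"
      by (rule ballI, rule 4)
    have 5: "\<forall>j<length (Suc m # ?V). even ((Suc m # ?V) ! j) \<longleftrightarrow> even (length (Suc m # ?V) - j)"
      by (intro allI impI, rule 5)
    show ?thesis unfolding h by (intro conjI 1 2 3 4 IH(5) conjunct1[OF r6] 5)
  next
    case False
    have "0 \<le> ht c (Suc m)" by (rule ht_nonneg[OF g Suc.prems])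
    then have "1 \<le> length ?V" using False length_hV[OF g, of m] Suc.prems by simp
    then obtain v V where V: "?V = v # V" by (cases ?V) auto
    have h: "hA N c (Suc m) = insert {v, Suc m} ?A" "hV N c (Suc m) = V" using h_Suc[OF Suc.prems] False V by simp_all
    have vV: "v \<notin> set V" "\<And>w. w \<in> set V \<Longrightarrow> w < v" using IH(3) unfolding V by auto
    have vA: "v \<notin> \<Union>?A" using IH(2) unfolding V by auto
    have sV: "Suc m \<notin> set V" using Vr unfolding V by fastforce
    have sA: "Suc m \<notin> \<Union>?A" using Ar by fastforce
    have vm: "v \<le> m" using Vr unfolding V by simp
    have 1: "\<Union>(insert {v, Suc m} ?A) \<union> set V = {1..Suc m}" unfolding eS IH(1)[symmetric] V by auto
    have 2: "\<Union>(insert {v, Suc m} ?A) \<inter> set V = {}" using IH(2) vV sV unfolding V by auto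
    have 3: "sorted_wrt (>) V" using IH(3) unfolding V by simp
    have pv: "even v \<longleftrightarrow> even m" using IH(7)[of 0] len unfolding V by simp
    have 4: "\<exists>a b. e = {a, b} \<and> a < b \<and> odd (a + b) \<and> (\<forall>v\<in>set V. \<not> (a < v \<and> v < b))" if e: "e \<in> insert {v, Suc m} ?A" for e
    proof (cases "e = {v, Suc m}")
      case True
      have "v < Suc m" "odd (v + Suc m)" using vm pv by auto
      moreover have "\<forall>w\<in>set V. \<not> (v < w \<and> w < Suc m)" using vV(2) less_asym by blast
      ultimately have "v < Suc m \<and> odd (v + Suc m) \<and> (\<forall>w\<in>set V. \<not> (v < w \<and> w < Suc m))" by blast
      then show ?thesis using True by blast
    next
      case False
      then obtain a b where "e = {a, b}" "a < b" "odd (a + b)" "\<forall>v\<in>set ?V. \<not> (a < v \<and> v < b)" using IH(4)[of e] e by blast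
      then show ?thesis unfolding V by (metis list.set_intros(2))
    qed
    have 5: "disjoint (insert {v, Suc m} ?A)"
    proof (rule disjointI)
      fix a b assume a: "a \<in> insert {v, Suc m} ?A" and b: "b \<in> insert {v, Suc m} ?A" and ne: "a \<noteq> b"
      have "{v, Suc m} \<inter> d = {}" if "d \<in> ?A" for d using that vA sA by auto
      then show "a \<inter> b = {}" using a b ne disjointD[OF IH(5)] by (metis Int_commute insertE)
    qed
    have nv: "\<not> (a < v \<and> v < b)" if e: "e \<in> ?A" "a \<in> e" "b \<in> e" for e a b
    proof -
      obtain a' b' where ab: "e = {a', b'}" "a' < b'" "\<forall>w\<in>set ?V. \<not> (a' < w \<and> w < b')" using IH(4)[OF e(1)] by blast
      then have "\<not> (a' < v \<and> v < b')" unfolding V by simp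
      then show ?thesis using e ab by auto
    qed
    have 6: "\<not> (a < x \<and> x < b \<and> b < y)" if e: "e \<in> insert {v, Suc m} ?A" "e' \<in> insert {v, Suc m} ?A" "a \<in> e" "b \<in> e" "x \<in> e'" "y \<in> e'" for e e' a b x y
    proof
      assume lt: "a < x \<and> x < b \<and> b < y"
      have r: "z \<le> Suc m" if "z \<in> d" "d \<in> insert {v, Suc m} ?A" for z d using that Ar vm by fastforce
      have "b \<noteq> Suc m" using lt r[OF e(6,2)] by auto
      have eA: "e \<in> ?A"
      proof (rule ccontr)
        assume "e \<notin> ?A"
        then have "e = {v, Suc m}" using e by blast
        then have "b = v" "a = v \<or> a = Suc m" using e \<open>b \<noteq> Suc m\<close> by auto
        then show False using lt vm by auto
      qed
      show False
      proof (cases "e' \<in> ?A")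
        case True then show False using IH(6)[OF eA True e(3-6)] lt by blast
      next
        case False
        then have "e' = {v, Suc m}" using e by blast
        moreover have "x \<noteq> Suc m" using lt Ar[OF eA e(4)] by auto
        ultimately have "x = v" using e by auto
        then show False using nv[OF eA e(3,4)] lt by blast
      qed
    qed
    have 7: "even (V ! j) \<longleftrightarrow> even (length V - j)" if "j < length V" for j
      using IH(7)[of "Suc j"] that unfolding V by simp
    let ?B = "insert {v, Suc m} ?A"
    have 4: "\<forall>e\<in>?B. \<exists>a b. e = {a, b} \<and> a < b \<and> odd (a + b) \<and> (\<forall>v\<in>set V. \<not> (a < v \<and> v < b))"
      by (rule ballI, rule 4)
    have 6: "\<forall>e\<in>?B. \<forall>e'\<in>?B. \<forall>a\<in>e. \<forall>b\<in>e. \<forall>x\<in>e'. \<forall>y\<in>e'. \<not> (a < x \<and> x < b \<and> b < y)"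
      by (intro ballI, rule 6)
    have 7: "\<forall>j<length V. even (V ! j) \<longleftrightarrow> even (length V - j)"
      by (intro allI impI, rule 7)
    show ?thesis unfolding h by (intro conjI 1 2 3 4 5 6 7)
  qed
qed

lemma half_full:
  assumes g: "good N c"
  defines "A \<equiv> hA N c N" and "V \<equiv> hV N c N"
  shows "\<Union>A \<union> set V = {1..N}" "\<Union>A \<inter> set V = {}" "sorted_wrt (>) V"
    "e \<in> A \<Longrightarrow> \<exists>a b. e = {a, b} \<and> a < b \<and> odd (a + b) \<and> (\<forall>v\<in>set V. \<not> (a < v \<and> v < b))"
    "disjoint A"
    "e \<in> A \<Longrightarrow> e' \<in> A \<Longrightarrow> a \<in> e \<Longrightarrow> b \<in> e \<Longrightarrow> x \<in> e' \<Longrightarrow> y \<in> e' \<Longrightarrow> \<not> (a < x \<and> x < b \<and> b < y)"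
    "j < length V \<Longrightarrow> even (V ! j) \<longleftrightarrow> even (length V - j)"
    "e \<in> A \<Longrightarrow> a \<in> e \<Longrightarrow> b \<in> e \<Longrightarrow> v \<in> set V \<Longrightarrow> \<not> (a < v \<and> v < b)"
proof -
  note h = half_invariants[OF g order_refl, folded A_def V_def]
  note r2 = conjunct2[OF h] note r3 = conjunct2[OF r2] note r4 = conjunct2[OF r3] note r5 = conjunct2[OF r4] note r6 = conjunct2[OF r5]
  show "\<Union>A \<union> set V = {1..N}" by (rule conjunct1[OF h])
  show "\<Union>A \<inter> set V = {}" by (rule conjunct1[OF r2])
  show "sorted_wrt (>) V" by (rule conjunct1[OF r3])
  show "disjoint A" by (rule conjunct1[OF r5])
  show e: "\<exists>a b. e = {a, b} \<and> a < b \<and> odd (a + b) \<and> (\<forall>v\<in>set V. \<not> (a < v \<and> v < b))" if "e \<in> A" for e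
    using conjunct1[OF r4] that by (rule bspec)
  show "e \<in> A \<Longrightarrow> e' \<in> A \<Longrightarrow> a \<in> e \<Longrightarrow> b \<in> e \<Longrightarrow> x \<in> e' \<Longrightarrow> y \<in> e' \<Longrightarrow> \<not> (a < x \<and> x < b \<and> b < y)"
    by (rule conjunct1[OF r6, rule_format])
  show "j < length V \<Longrightarrow> even (V ! j) \<longleftrightarrow> even (length V - j)"
    by (rule conjunct2[OF r6, rule_format])
  assume a: "e \<in> A" "a \<in> e" "b \<in> e" "v \<in> set V"
  obtain a' b' where ab: "e = {a', b'}" "a' < b'" "\<forall>v\<in>set V. \<not> (a' < v \<and> v < b')" using e[OF a(1)] by blast
  have "\<not> (a' < v \<and> v < b')" using ab(3) a(4) by blast
  then show "\<not> (a < v \<and> v < b)" using a(2,3) ab(1,2) by auto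
qed

lemma finite_hA: "good N c \<Longrightarrow> finite (hA N c N)"
  by (rule finite_UnionD) (metis half_full(1) finite_Un finite_atLeastAtMost)

lemma hA_pair: "good N c \<Longrightarrow> e \<in> hA N c N \<Longrightarrow> finite e \<and> card e = 2"
  using half_full(4)[of N c e] by auto

text \<open>Two decreasing lists are paired position by position, so the through lines are disjoint
  and parallel.\<close>

lemma zip_fst_unique:
  assumes "sorted_wrt (>) (V :: nat list)" "sorted_wrt (>) (W :: nat list)"
    "(x, y) \<in> set (zip V W)" "(x', y') \<in> set (zip V W)"
  shows "x = x' \<longleftrightarrow> y = y'" "x < x' \<longleftrightarrow> y < y'"
proof -
  obtain i where i: "i < length V" "i < length W" "x = V ! i" "y = W ! i" using assms(3) unfolding set_zip by auto
  obtain j where j: "j < length V" "j < length W" "x' = V ! j" "y' = W ! j" using assms(4) unfolding set_zip by auto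
  have V: "a < b \<Longrightarrow> b < length V \<Longrightarrow> V ! b < V ! a" for a b using assms(1) by (simp add: sorted_wrt_iff_nth_less)
  have W: "a < b \<Longrightarrow> b < length W \<Longrightarrow> W ! b < W ! a" for a b using assms(2) by (simp add: sorted_wrt_iff_nth_less)
  show "x = x' \<longleftrightarrow> y = y'" "x < x' \<longleftrightarrow> y < y'"
    using i j V[of i j] V[of j i] W[of i j] W[of j i] by (cases i j rule: linorder_cases; auto)+
qed

context
  fixes N :: nat and c d :: "nat \<Rightarrow> bool"
  assumes gc: "good N c" and gd: "good N d" and h: "ht c N = ht d N"
begin

abbreviation (input) "Vc \<equiv> hV N c N"
abbreviation (input) "Vd \<equiv> hV N d N"
abbreviation (input) "Ac \<equiv> hA N c N"
abbreviation (input) "Ad \<equiv> hA N d N"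
abbreviation (input) "CD \<equiv> cell_dia N (wt N c) (wt N d)"

lemma lenV: "length Vc = length Vd"
  using length_hV[OF gc order_refl] length_hV[OF gd order_refl] h by simp

lemma cell_eq: "CD = (`) Top ` Ac \<union> (`) Bot ` Ad \<union> (\<lambda>(x, y). {Top x, Bot y}) ` set (zip Vc Vd)"
  by (simp add: cell_dia_def hA_def hV_def)

lemma cell_cases:
  assumes "e \<in> CD"
  obtains (top) A where "A \<in> Ac" "e = Top ` A" | (bot) A where "A \<in> Ad" "e = Bot ` A"
    | (through) x y where "(x, y) \<in> set (zip Vc Vd)" "e = {Top x, Bot y}"
  using assms unfolding cell_eq by auto

lemma zip_in: "(x, y) \<in> set (zip Vc Vd) \<Longrightarrow> x \<in> set Vc \<and> y \<in> set Vd"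
  by (meson set_zip_leftD set_zip_rightD)

lemma zip_ex: "x \<in> set Vc \<Longrightarrow> \<exists>y. (x, y) \<in> set (zip Vc Vd)" "y \<in> set Vd \<Longrightarrow> \<exists>x. (x, y) \<in> set (zip Vc Vd)"
  using lenV by (metis in_set_impl_in_set_zip1, metis in_set_impl_in_set_zip2)

text \<open>A case distinction on the kinds of two edges. Arcs in one row do not cross, no vacant
  line lies under an arc, and the through lines are parallel.\<close>

lemma cell_diagram: "CD \<in> diagrams N"
proof -
  note C = half_full[OF gc] and D = half_full[OF gd]
  note zu = zip_fst_unique[OF C(3) D(3)]
  have P: "partition_on (points N) CD"
  proof (rule partition_onI)
    have "\<Union>CD = Top ` (\<Union>Ac \<union> set Vc) \<union> Bot ` (\<Union>Ad \<union> set Vd)"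
    proof (intro equalityI subsetI)
      fix z assume "z \<in> \<Union>CD"
      then obtain e where e: "e \<in> CD" "z \<in> e" by blast
      from e(1) show "z \<in> Top ` (\<Union>Ac \<union> set Vc) \<union> Bot ` (\<Union>Ad \<union> set Vd)"
        by (cases rule: cell_cases) (use e(2) zip_in in auto)
    next
      fix z assume "z \<in> Top ` (\<Union>Ac \<union> set Vc) \<union> Bot ` (\<Union>Ad \<union> set Vd)"
      then consider x A where "z = Top x" "x \<in> A" "A \<in> Ac" | x where "z = Top x" "x \<in> set Vc"
        | x A where "z = Bot x" "x \<in> A" "A \<in> Ad" | x where "z = Bot x" "x \<in> set Vd" by blast
      then show "z \<in> \<Union>CD"
      proof cases
        case 1 then show ?thesis unfolding cell_eq by blast
      next
        case 2
        then obtain y where "(x, y) \<in> set (zip Vc Vd)" using zip_ex by blast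
        then have "{Top x, Bot y} \<in> CD" unfolding cell_eq by (auto intro!: image_eqI[of _ _ "(x, y)"])
        then show ?thesis using 2 by blast
      next
        case 3 then show ?thesis unfolding cell_eq by blast
      next
        case 4
        then obtain y where "(y, x) \<in> set (zip Vc Vd)" using zip_ex by blast
        then have "{Top y, Bot x} \<in> CD" unfolding cell_eq by (auto intro!: image_eqI[of _ _ "(y, x)"])
        then show ?thesis using 4 by blast
      qed
    qed
    then show "\<Union>CD = points N" unfolding C(1) D(1) points_def .
    fix p q assume p: "p \<in> CD" and q: "q \<in> CD" and ne: "p \<noteq> q"
    show "disjnt p q"
    proof (rule ccontr)
      assume "\<not> disjnt p q"
      then obtain z where z: "z \<in> p" "z \<in> q" unfolding disjnt_def by blast
      from p q show False
      proof (cases rule: cell_cases[case_product cell_cases])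
        case (top_top A A')
        then obtain i where "i \<in> A" "i \<in> A'" using z by blast
        then show False using disjointD[OF C(5) top_top(1,3)] top_top ne by blast
      next
        case (top_bot A A') then show False using z by blast
      next
        case (top_through A x y)
        then have "x \<in> A" using z by auto
        then show False using top_through zip_in C(2) by blast
      next
        case (bot_top A A') then show False using z by blast
      next
        case (bot_bot A A')
        then obtain i where "i \<in> A" "i \<in> A'" using z by blast
        then show False using disjointD[OF D(5) bot_bot(1,3)] bot_bot ne by blast
      next
        case (bot_through A x y)
        then have "y \<in> A" using z by auto
        then show False using bot_through zip_in D(2) by blast
      next
        case (through_top x y A)
        then have "x \<in> A" using z by auto
        then show False using through_top zip_in C(2) by blast
      next
        case (through_bot x y A)
        then have "y \<in> A" using z by auto
        then show False using through_bot zip_in D(2) by blast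
      next
        case (through_through x y x' y')
        then have "x = x' \<or> y = y'" using z by auto
        then have "x = x' \<and> y = y'" using zu(1)[OF through_through(1,3)] by blast
        then show False using through_through ne by simp
      qed
    qed
  next
    show "{} \<notin> CD"
    proof
      assume "{} \<in> CD"
      then show False
        by (cases rule: cell_cases) (use C(4) D(4) in \<open>force+\<close>)
    qed
  qed
  have 2: "card e = 2" if "e \<in> CD" for e
    using that
  proof (cases rule: cell_cases)
    case (top A) then show ?thesis using hA_pair[OF gc] by (simp add: card_image inj_on_def)
  next
    case (bot A) then show ?thesis using hA_pair[OF gd] by (simp add: card_image inj_on_def)
  qed simp
  have AN: "i \<le> N" if "i \<in> A" "A \<in> Ac" for i A using C(1) that by (metis UnCI UnionI atLeastAtMost_iff)
  have BN: "i \<le> N" if "i \<in> A" "A \<in> Ad" for i A using D(1) that by (metis UnCI UnionI atLeastAtMost_iff)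
  have VN: "i \<le> N" if "i \<in> set Vc" for i using C(1) that by (metis UnCI atLeastAtMost_iff)
  have WN: "i \<le> N" if "i \<in> set Vd" for i using D(1) that by (metis UnCI atLeastAtMost_iff)
  have 3: "noncrossing N CD" unfolding noncrossing_def
  proof (clarify)
    fix e e' a b x y
    assume e: "e \<in> CD" "e' \<in> CD" "a \<in> e" "b \<in> e" "x \<in> e'" "y \<in> e'"
      and lt: "circ_pos N a < circ_pos N x" "circ_pos N x < circ_pos N b" "circ_pos N b < circ_pos N y"
    from e(1,2) show False
    proof (cases rule: cell_cases[case_product cell_cases])
      case (top_top A A')
      then obtain a' b' x' y' where "a = Top a'" "b = Top b'" "x = Top x'" "y = Top y'" "a' \<in> A" "b' \<in> A" "x' \<in> A'" "y' \<in> A'"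
        using e by blast
      then show False using C(6)[OF top_top(1,3), of a' b' x' y'] lt by simp
    next
      case (top_bot A A')
      then obtain b' x' where "b = Top b'" "x = Bot x'" "b' \<in> A" "x' \<in> A'" using e by blast
      then show False using lt AN[of b' A] BN[of x' A'] top_bot by simp
    next
      case (top_through A u v)
      then obtain a' b' where ab: "a = Top a'" "b = Top b'" "a' \<in> A" "b' \<in> A" using e by blast
      have uv: "u \<in> set Vc" "v \<in> set Vd" using zip_in top_through by auto
      have "x = Top u \<or> x = Bot v" using e top_through by auto
      then show False
        using lt ab C(8)[OF top_through(1) ab(3,4) uv(1)] AN[OF ab(4) top_through(1)] WN[OF uv(2)] by auto
    next
      case (bot_top A A')
      then obtain a' x' where "a = Bot a'" "x = Top x'" "a' \<in> A" "x' \<in> A'" using e by blast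
      then show False using lt BN[of a' A] AN[of x' A'] bot_top by simp
    next
      case (bot_bot A A')
      then obtain a' b' x' y' where q: "a = Bot a'" "b = Bot b'" "x = Bot x'" "y = Bot y'" "a' \<in> A" "b' \<in> A" "x' \<in> A'" "y' \<in> A'"
        using e by blast
      \<comment> \<open>On the circle the bottom row is read from right to left, hence the four
        points enter in reverse order.\<close>
      then show False using D(6)[OF bot_bot(3,1), of y' x' b' a'] lt BN[of a' A] BN[of b' A] BN[of x' A'] BN[of y' A'] bot_bot
        by simp linarith
    next
      case (bot_through A u v)
      then obtain a' b' where ab: "a = Bot a'" "b = Bot b'" "a' \<in> A" "b' \<in> A" using e by blast
      have uv: "u \<in> set Vc" "v \<in> set Vd" using zip_in bot_through by auto
      have "x = Top u \<or> x = Bot v" using e bot_through by auto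
      then show False
        using lt ab D(8)[OF bot_through(1) ab(4,3) uv(2)] BN[OF ab(3) bot_through(1)] BN[OF ab(4) bot_through(1)] VN[OF uv(1)] WN[OF uv(2)] by auto
    next
      case (through_top u v A)
      then obtain x' y' where xy: "x = Top x'" "y = Top y'" "x' \<in> A" "y' \<in> A" using e by blast
      have uv: "u \<in> set Vc" "v \<in> set Vd" using zip_in through_top by auto
      have "a = Top u \<or> a = Bot v" "b = Top u \<or> b = Bot v" using e through_top by auto
      then show False
        using lt xy C(8)[OF through_top(3) xy(3,4) uv(1)] AN[OF xy(4) through_top(3)] WN[OF uv(2)] by auto
    next
      case (through_bot u v A)
      then obtain x' y' where xy: "x = Bot x'" "y = Bot y'" "x' \<in> A" "y' \<in> A" using e by blast
      have uv: "u \<in> set Vc" "v \<in> set Vd" using zip_in through_bot by auto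
      have "a = Top u \<or> a = Bot v" "b = Top u \<or> b = Bot v" using e through_bot by auto
      then show False
        using lt xy D(8)[OF through_bot(3) xy(4,3) uv(2)] BN[OF xy(3) through_bot(3)] BN[OF xy(4) through_bot(3)] VN[OF uv(1)] WN[OF uv(2)] by auto
    next
      case (through_through u v u' v')
      have uv: "u \<in> set Vc" "v \<in> set Vd" "u' \<in> set Vc" "v' \<in> set Vd" using zip_in through_through by auto
      have "a = Top u \<or> a = Bot v" "b = Top u \<or> b = Bot v" "x = Top u' \<or> x = Bot v'" "y = Top u' \<or> y = Bot v'"
        using e through_through by auto
      then show False using lt zu(2)[OF through_through(1,3)] VN[OF uv(1)] WN[OF uv(2)] VN[OF uv(3)] WN[OF uv(4)]
        by (elim disjE) auto
    qed
  qed
  show ?thesis unfolding diagrams_def using P 2 3 by blast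
qed

lemma arcs_ok_iff:
  assumes g: "good N f"
  shows "arcs_ok (hA N f N) S \<longleftrightarrow> (\<forall>e\<in>hA N f N. \<forall>a\<in>e. \<forall>b\<in>e. ((a \<in> S) \<noteq> even a) = ((b \<in> S) \<noteq> even b))"
  unfolding arcs_ok_def
proof (rule ball_cong[OF refl])
  fix e assume "e \<in> hA N f N"
  then obtain a b where e: "e = {a, b}" "a < b" "odd (a + b)" using half_full(4)[OF g] by blast
  have "card (e \<inter> S) = 1 \<longleftrightarrow> (a \<in> S) \<noteq> (b \<in> S)" using e by (cases "a \<in> S"; cases "b \<in> S") auto
  also have "\<dots> \<longleftrightarrow> ((a \<in> S) \<noteq> even a) = ((b \<in> S) \<noteq> even b)" using e(3) by auto
  also have "\<dots> \<longleftrightarrow> (\<forall>a\<in>e. \<forall>b\<in>e. ((a \<in> S) \<noteq> even a) = ((b \<in> S) \<noteq> even b))" unfolding e(1) by auto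
  finally show "card (e \<inter> S) = 1 \<longleftrightarrow> (\<forall>a\<in>e. \<forall>b\<in>e. ((a \<in> S) \<noteq> even a) = ((b \<in> S) \<noteq> even b))" .
qed

text \<open>The alternating part of the labels can be removed. The ends of an arc have opposite
  parity, which becomes the condition that exactly one end is chosen; the ends of a through line
  have equal parity, because they stand at the same place in vacant lists of equal length.\<close>

lemma mono_cell: "mono_dia CD S T \<longleftrightarrow> arcs_ok Ac S \<and> arcs_ok Ad T \<and> (\<forall>(x, y)\<in>set (zip Vc Vd). x \<in> S \<longleftrightarrow> y \<in> T)"
proof -
  have par: "even x \<longleftrightarrow> even y" if "(x, y) \<in> set (zip Vc Vd)" for x y
  proof -
    obtain i where "i < length Vc" "i < length Vd" "x = Vc ! i" "y = Vd ! i" using \<open>(x, y) \<in> set (zip Vc Vd)\<close> unfolding set_zip by auto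
    then show ?thesis using half_full(7)[OF gc, of i] half_full(7)[OF gd, of i] lenV by simp
  qed
  have "mono_dia CD S T \<longleftrightarrow> (\<forall>e\<in>Ac. \<forall>a\<in>e. \<forall>b\<in>e. ((a \<in> S) \<noteq> even a) = ((b \<in> S) \<noteq> even b)) \<and>
     (\<forall>e\<in>Ad. \<forall>a\<in>e. \<forall>b\<in>e. ((a \<in> T) \<noteq> even a) = ((b \<in> T) \<noteq> even b)) \<and>
     (\<forall>(x, y)\<in>set (zip Vc Vd). ((x \<in> S) \<noteq> even x) = ((y \<in> T) \<noteq> even y))"
  proof -
    have im: "(\<forall>e\<in>f ` Z. P e) \<longleftrightarrow> (\<forall>z\<in>Z. P (f z))" for f :: "'x \<Rightarrow> 'y" and Z P by blast
    have th: "(\<forall>a\<in>(case z of (x, y) \<Rightarrow> {Top x, Bot y}). \<forall>b\<in>(case z of (x, y) \<Rightarrow> {Top x, Bot y}). lab S T a = lab S T b) \<longleftrightarrow>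
        (case z of (x, y) \<Rightarrow> ((x \<in> S) \<noteq> even x) = ((y \<in> T) \<noteq> even y))" for z
      by (cases z) auto
    show ?thesis unfolding mono_dia_def cell_eq ball_Un im th lab.simps conj_assoc ..
  qed
  also have "(\<forall>(x, y)\<in>set (zip Vc Vd). ((x \<in> S) \<noteq> even x) = ((y \<in> T) \<noteq> even y)) \<longleftrightarrow>
      (\<forall>(x, y)\<in>set (zip Vc Vd). x \<in> S \<longleftrightarrow> y \<in> T)"
    by (rule ball_cong[OF refl]) (use par in auto)
  finally show ?thesis unfolding arcs_ok_iff[OF gc] arcs_ok_iff[OF gd] .
qed

end

section \<open>Half-diagram vectors and their pairing with the walk vectors\<close>

text \<open>The vector of the half diagram: an antisymmetric pair for each arc, the highest weight vector at
  each vacant line.\<close>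

definition csm :: "nat \<Rightarrow> (nat \<Rightarrow> bool) \<Rightarrow> nat \<Rightarrow> vec" where
  "csm N c m = (\<lambda>S. if S \<subseteq> {1..m} \<and> arcs_ok (hA N c m) S \<and> S \<inter> set (hV N c m) = {} then sgn_set S else 0)"

definition pairing :: "nat \<Rightarrow> (nat \<Rightarrow> bool) \<Rightarrow> rat" where
  "pairing N c = ip N (csm N c N) (vc c N)"

text \<open>The weight fixes the size of \<open>T\<close> to be the number of arcs. Each arc takes
  exactly one point, so none is left for the vacant lines.\<close>

lemma arcs_ok_card:
  assumes g: "good N d" and T: "T \<subseteq> {1..N}" "arcs_ok (hA N d N) T" and w: "2 * int (card T) = int N - ht d N"
  shows "T \<inter> set (hV N d N) = {}"
proof -
  let ?A = "hA N d N" and ?V = "hV N d N"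
  note D = half_full[OF g]
  have finA: "finite ?A" by (rule finite_hA[OF g])
  have fin: "finite T" using T finite_subset by auto
  have dis: "\<And>a b. a \<in> ?A \<Longrightarrow> b \<in> ?A \<Longrightarrow> a \<noteq> b \<Longrightarrow> a \<inter> b = {}" using disjointD[OF D(5)] by blast
  have "card (\<Union>?A) = (\<Sum>e\<in>?A. card e)"
    by (rule card_Union_disjoint) (use D(5) hA_pair[OF g] in \<open>auto simp: disjoint_def disjnt_def pairwise_def\<close>)
  then have c1: "card (\<Union>?A) = 2 * card ?A" using hA_pair[OF g] by simp
  have "card (\<Union>?A \<union> set ?V) = card (\<Union>?A) + card (set ?V)"
    by (rule card_Un_disjoint) (use D(2) finA hA_pair[OF g] in auto)
  moreover have "card (set ?V) = length ?V"
  proof -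
    have "distinct ?V" using D(3) by (auto simp: distinct_conv_nth sorted_wrt_iff_nth_less) (metis less_irrefl linorder_neqE_nat)
    then show ?thesis by (rule distinct_card)
  qed
  ultimately have N: "N = 2 * card ?A + length ?V" unfolding D(1) c1 by simp
  have "card T = card (T \<inter> \<Union>?A) + card (T \<inter> set ?V)"
  proof -
    have "T = (T \<inter> \<Union>?A) \<union> (T \<inter> set ?V)" using D(1) T by blast
    then have "card T = card ((T \<inter> \<Union>?A) \<union> (T \<inter> set ?V))" by simp
    also have "\<dots> = card (T \<inter> \<Union>?A) + card (T \<inter> set ?V)"
      by (rule card_Un_disjoint) (use fin D(2) in auto)
    finally show ?thesis .
  qed
  moreover have "card (T \<inter> \<Union>?A) = card ?A"
  proof -
    have "T \<inter> \<Union>?A = (\<Union>e\<in>?A. e \<inter> T)" by blast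
    also have "card \<dots> = (\<Sum>e\<in>?A. card (e \<inter> T))"
      by (rule card_UN_disjoint) (use finA fin dis in auto)
    also have "\<dots> = card ?A" using T(2) unfolding arcs_ok_def by simp
    finally show ?thesis .
  qed
  moreover have "2 * int (card T) = 2 * int (card ?A)" using w N length_hV[OF g order_refl] by simp
  ultimately have "card (T \<inter> set ?V) = 0" by simp
  then show ?thesis using fin by simp
qed

text \<open>On the weight space of \<open>vc d N\<close> the matrix of the cell diagram has rank
  one: the weight forces \<open>T\<close> off the vacant lines of \<open>d\<close>, the through
  lines carry this over to \<open>S\<close>, and the conditions on \<open>S\<close> and
  \<open>T\<close> separate.\<close>

lemma rho_cell:
  assumes gc: "good N c" and gd: "good N d" and h: "ht c N = ht d N"
  shows "rho N (basis (cell_dia N (wt N c) (wt N d))) (vc d N) = sc (pairing N d) (csm N c N)"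
proof
  fix S
  let ?D = "cell_dia N (wt N c) (wt N d)"
  note mc = mono_cell[OF gc gd h]
  show "rho N (basis ?D) (vc d N) S = sc (pairing N d) (csm N c N) S"
  proof (cases "S \<subseteq> {1..N}")
    case S: True
    have "R ?D S T * vc d N T = csm N c N S * (csm N d N T * vc d N T)" if T: "T \<in> Pow {1..N}" for T
    proof (cases "vc d N T = 0")
      case False
      then have w: "2 * int (card T) = int N - ht d N" using vc_weight by blast
      have TN: "T \<subseteq> {1..N}" using T by simp
      have z: "(S \<inter> set (hV N c N) = {}) = (T \<inter> set (hV N d N) = {})" if "\<forall>(x, y)\<in>set (zip (hV N c N) (hV N d N)). x \<in> S \<longleftrightarrow> y \<in> T"
      proof -
        have q: "x \<in> S \<longleftrightarrow> y \<in> T" if "(x, y) \<in> set (zip (hV N c N) (hV N d N))" for x y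
          using bspec[OF \<open>\<forall>(x, y)\<in>set (zip (hV N c N) (hV N d N)). x \<in> S \<longleftrightarrow> y \<in> T\<close> that] by simp
        show ?thesis
        proof
          assume e: "S \<inter> set (hV N c N) = {}"
          show "T \<inter> set (hV N d N) = {}"
          proof (rule ccontr)
            assume "T \<inter> set (hV N d N) \<noteq> {}"
            then obtain y where y: "y \<in> T" "y \<in> set (hV N d N)" by blast
            then obtain x where x: "(x, y) \<in> set (zip (hV N c N) (hV N d N))" using zip_ex(2)[OF gc gd h] by blast
            then show False using q[OF x] y e zip_in[OF gc gd h x] by blast
          qed
        next
          assume e: "T \<inter> set (hV N d N) = {}"
          show "S \<inter> set (hV N c N) = {}"
          proof (rule ccontr)
            assume "S \<inter> set (hV N c N) \<noteq> {}"
            then obtain x where y: "x \<in> S" "x \<in> set (hV N c N)" by blast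
            then obtain y where x: "(x, y) \<in> set (zip (hV N c N) (hV N d N))" using zip_ex(1)[OF gc gd h] by blast
            then show False using q[OF x] y e zip_in[OF gc gd h x] by blast
          qed
        qed
      qed
      have sg: "(-1 :: rat) ^ (\<Sum>S + \<Sum>T) = sgn_set S * sgn_set T" by (simp add: sgn_set_def power_add)
      have "mono_dia ?D S T \<longleftrightarrow> (arcs_ok (hA N c N) S \<and> S \<inter> set (hV N c N) = {}) \<and> (arcs_ok (hA N d N) T \<and> T \<inter> set (hV N d N) = {})"
      proof
        assume m: "mono_dia ?D S T"
        then show "(arcs_ok (hA N c N) S \<and> S \<inter> set (hV N c N) = {}) \<and> (arcs_ok (hA N d N) T \<and> T \<inter> set (hV N d N) = {})"
          using z arcs_ok_card[OF gd TN _ w] unfolding mc by blast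
      next
        assume m: "(arcs_ok (hA N c N) S \<and> S \<inter> set (hV N c N) = {}) \<and> (arcs_ok (hA N d N) T \<and> T \<inter> set (hV N d N) = {})"
        then have "\<forall>(x, y)\<in>set (zip (hV N c N) (hV N d N)). x \<in> S \<longleftrightarrow> y \<in> T"
          using zip_in[OF gc gd h] by blast
        then show "mono_dia ?D S T" using m unfolding mc by blast
      qed
      then show ?thesis using S TN sg unfolding R_def csm_def by auto
    qed simp
    then have "(\<Sum>T\<in>Pow {1..N}. R ?D S T * vc d N T) = (\<Sum>T\<in>Pow {1..N}. csm N c N S * (csm N d N T * vc d N T))"
      by (rule sum.cong[OF refl])
    then have "rho N (basis ?D) (vc d N) S = (\<Sum>T\<in>Pow {1..N}. csm N c N S * (csm N d N T * vc d N T))"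
      using S by (simp only: rho_basis[OF cell_diagram[OF gc gd h]] if_True)
    then show ?thesis by (simp add: sc_def pairing_def ip_def sum_distrib_left mult.commute mult.left_commute)
  next
    case False
    then show ?thesis by (simp add: rho_def sc_def csm_def)
  qed
qed

text \<open>Fills the place \<open>v\<close> only; this is the summand \<open>j = v\<close> of
  \<open>low\<close>.\<close>

definition cv :: "nat \<Rightarrow> vec \<Rightarrow> vec" where
  "cv v y = (\<lambda>S. if v \<in> S then y (S - {v}) else 0)"

lemma supp_csm: "supp m (csm N c m)"
  by (simp add: supp_def csm_def)

lemma csm_up:
  assumes g: "good N c" and m: "Suc m \<le> N" and c: "c (Suc m)"
  shows "csm N c (Suc m) = t0 m (csm N c m)"
proof
  fix S
  have e: "{1..Suc m} = insert (Suc m) {1..m}" by auto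
  show "csm N c (Suc m) S = t0 m (csm N c m) S"
    unfolding csm_def t0_def h_Suc[OF m] e using c by auto
qed

text \<open>Closing an arc appends an antisymmetric pair: either the new place or the vacant line is
  filled. The relative sign is negative because the two places have opposite parity.\<close>

lemma csm_down:
  assumes g: "good N c" and m: "Suc m \<le> N" and c: "\<not> c (Suc m)"
  shows "csm N c (Suc m) = sc ((-1) ^ Suc m) (t1 m (csm N c m) - t0 m (cv (hd (hV N c m)) (csm N c m)))"
    and "hd (hV N c m) \<in> set (hV N c m)" "hd (hV N c m) \<in> {1..m}"
proof -
  let ?A = "hA N c m" and ?V = "hV N c m"
  have mN: "m \<le> N" using m by simp
  note I = half_invariants[OF g mN]
  have "0 \<le> ht c (Suc m)" using ht_nonneg[OF g m] .
  then have "1 \<le> length ?V" using c length_hV[OF g mN] by simp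
  then obtain v V where V: "?V = v # V" by (cases ?V) auto
  note un = conjunct1[OF I] conjunct1[OF conjunct2[OF I]]
  have "sorted_wrt (>) ?V" by (rule conjunct1[OF conjunct2[OF conjunct2[OF I]]])
  then have vV: "v \<notin> set V" unfolding V by auto
  have vA: "v \<notin> \<Union>?A" "v \<in> {1..m}" using un V by auto
  have sA: "Suc m \<notin> \<Union>?A" "Suc m \<notin> set V" using un V by (metis UnCI atLeastAtMost_iff not_less_eq_eq order_refl, metis UnCI atLeastAtMost_iff list.set_intros(2) not_less_eq_eq order_refl)
  have odd: "odd (v + Suc m)"
  proof -
    have "{v, Suc m} \<in> hA N c (Suc m)" using h_Suc(1)[OF m] c V by simp
    from bspec[OF conjunct1[OF conjunct2[OF conjunct2[OF conjunct2[OF half_invariants[OF g m]]]]] this]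
    obtain a b where "{v, Suc m} = {a, b}" "odd (a + b)" by blast
    then show ?thesis by (auto simp: doubleton_eq_iff add.commute)
  qed
  have hv: "hd ?V = v" using V by simp
  show "hd ?V \<in> set ?V" "hd ?V \<in> {1..m}" using V vA by simp_all
  have hA': "hA N c (Suc m) = insert {v, Suc m} ?A" and hV': "hV N c (Suc m) = V" using h_Suc[OF m] c V by simp_all
  have e: "{1..Suc m} = insert (Suc m) {1..m}" by auto
  have okA: "arcs_ok ?A (S - {x}) = arcs_ok ?A S" if "x \<notin> \<Union>?A" for S x
  proof -
    have "a \<inter> (S - {x}) = a \<inter> S" if "a \<in> ?A" for a using that \<open>x \<notin> \<Union>?A\<close> by blast
    then show ?thesis unfolding arcs_ok_def by simp
  qed
  have ok': "arcs_ok (insert {v, Suc m} ?A) S \<longleftrightarrow> (v \<in> S) \<noteq> (Suc m \<in> S) \<and> arcs_ok ?A S" for S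
  proof -
    have "v \<noteq> Suc m" using vA by auto
    then have "card ({v, Suc m} \<inter> S) = 1 \<longleftrightarrow> (v \<in> S) \<noteq> (Suc m \<in> S)" by (cases "v \<in> S"; cases "Suc m \<in> S") auto
    then show ?thesis unfolding arcs_ok_def by simp
  qed
  show "csm N c (Suc m) = sc ((-1) ^ Suc m) (t1 m (csm N c m) - t0 m (cv (hd ?V) (csm N c m)))"
  proof
    fix S
    show "csm N c (Suc m) S = sc ((-1) ^ Suc m) (t1 m (csm N c m) - t0 m (cv (hd ?V) (csm N c m))) S"
    proof (cases "S \<subseteq> {1..Suc m}")
      case False
      then have "\<not> S - {Suc m} \<subseteq> {1..m}" "Suc m \<notin> S \<Longrightarrow> \<not> S - {v} \<subseteq> {1..m}" using e vA by auto
      then show ?thesis using False by (auto simp: csm_def sc_def t0_def t1_def cv_def hv)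
    next
      case True
      then have fin: "finite S" by (rule finite_subset) simp
      show ?thesis
      proof (cases "Suc m \<in> S")
        case t: True
        have "\<Sum>S = Suc m + \<Sum>(S - {Suc m})" by (rule sum.remove[OF fin t])
        then have sg: "sgn_set S = (-1) ^ Suc m * sgn_set (S - {Suc m})" unfolding sgn_set_def by (simp add: power_add)
        have "csm N c m (S - {Suc m}) = (if arcs_ok ?A S \<and> v \<notin> S \<and> S \<inter> set V = {} then sgn_set (S - {Suc m}) else 0)"
        proof -
          have sub: "S - {Suc m} \<subseteq> {1..m}" using True unfolding e by blast
          have "v \<noteq> Suc m" using vA(2) by auto
          moreover have a: "(S - {Suc m}) \<inter> set V = S \<inter> set V" using sA(2) by blast
          ultimately have "(S - {Suc m}) \<inter> set (v # V) = {} \<longleftrightarrow> v \<notin> S \<and> S \<inter> set V = {}"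
            by (simp only: list.set Int_insert_right a) (simp split: if_splits)
          then show ?thesis unfolding csm_def okA[OF sA(1)] V using sub by (simp only: simp_thms)
        qed
        moreover have "csm N c (Suc m) S = (if arcs_ok ?A S \<and> v \<notin> S \<and> S \<inter> set V = {} then sgn_set S else 0)"
          unfolding csm_def hA' hV' ok' by (simp only: True t simp_thms conj_ac)
        ultimately show ?thesis unfolding sc_def fun_diff_def t0_def t1_def if_P[OF t] sg by simp
      next
        case f: False
        show ?thesis
        proof (cases "v \<in> S")
          case t: True
          have "\<Sum>S = v + \<Sum>(S - {v})" by (rule sum.remove[OF fin t])
          then have "sgn_set S = (-1) ^ v * sgn_set (S - {v})" unfolding sgn_set_def by (simp add: power_add)
          moreover have "(-1 :: rat) ^ v = - ((-1) ^ Suc m)" using odd by (cases "even v") auto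
          ultimately have sg: "sgn_set S = - ((-1) ^ Suc m) * sgn_set (S - {v})" by simp
          have "csm N c m (S - {v}) = (if arcs_ok ?A S \<and> S \<inter> set V = {} then sgn_set (S - {v}) else 0)"
          proof -
            have sub: "S - {v} \<subseteq> {1..m}" using True f unfolding e by blast
            have "(S - {v}) \<inter> set (v # V) = S \<inter> set V" using vV by (simp only: list.set) blast
            then show ?thesis unfolding csm_def okA[OF vA(1)] V using sub by (simp only: simp_thms)
          qed
          moreover have "csm N c (Suc m) S = (if arcs_ok ?A S \<and> S \<inter> set V = {} then sgn_set S else 0)"
            unfolding csm_def hA' hV' ok' by (simp only: True t f simp_thms)
          ultimately show ?thesis unfolding sc_def fun_diff_def t0_def t1_def cv_def hv if_P[OF t] if_not_P[OF f] sg by simp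
        next
          case False
          then show ?thesis using f unfolding csm_def hA' hV' ok' by (simp add: sc_def t0_def t1_def cv_def hv)
        qed
      qed
    qed
  qed
qed

text \<open>Emptying the place \<open>v\<close> again gives \<open>q\<close> back. Emptying any
  other place gives a term of \<open>rai m q\<close>, and these add up to 0, since \<open>q\<close>
  vanishes on sets that contain \<open>v\<close>.\<close>

lemma rai_cv:
  assumes s: "supp m q" and r: "rai m q = 0" and v: "v \<in> {1..m}" and z: "\<And>S. v \<in> S \<Longrightarrow> q S = 0"
  shows "rai m (cv v q) = q"
proof
  fix S
  show "rai m (cv v q) S = q S"
  proof (cases "S \<subseteq> {1..m}")
    case False then show ?thesis using s by (simp add: rai_def supp_def)
  next
    case True
    show ?thesis
    proof (cases "v \<in> S")
      case vS: True
      have e: "{1..m} - (S - {v}) = insert v ({1..m} - S)" "v \<notin> {1..m} - S" using v vS by auto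
      have "rai m q (S - {v}) = (\<Sum>j\<in>insert v ({1..m} - S). q (insert j (S - {v})))"
        unfolding rai_def e(1) using True by auto
      also have "\<dots> = q (insert v (S - {v})) + (\<Sum>j\<in>{1..m} - S. q (insert j (S - {v})))" using e(2) by simp
      finally have "(\<Sum>j\<in>{1..m} - S. q (insert j (S - {v}))) = 0" unfolding r using z[of "insert v (S - {v})"] by simp
      moreover have "(\<Sum>j\<in>{1..m} - S. cv v q (insert j S)) = (\<Sum>j\<in>{1..m} - S. q (insert j (S - {v})))"
        by (rule sum.cong) (use vS in \<open>auto simp: cv_def insert_Diff_if\<close>)
      ultimately show ?thesis using True z[OF vS] by (simp add: rai_def)
    next
      case vS: False
      have "(\<Sum>j\<in>{1..m} - S. cv v q (insert j S)) = (\<Sum>j\<in>{1..m} - S. if j = v then q S else 0)"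
        by (rule sum.cong) (use vS in \<open>auto simp: cv_def\<close>)
      also have "\<dots> = q S" using v vS by simp
      finally show ?thesis using True by (simp add: rai_def)
    qed
  qed
qed

text \<open>A down step multiplies the pairing by \<open>ht c m + 1\<close> up to sign:
  \<open>ht c m\<close> comes from the \<open>t1\<close> parts, and 1 from the other parts, where
  lowering on one side becomes raising on the other and undoes \<open>cv\<close>. For a good walk
  the factor is nonzero.\<close>

lemma csm_sl2:
  assumes g: "good N c"
  shows "m \<le> N \<Longrightarrow> rai m (csm N c m) = 0 \<and> ip m (csm N c m) (vc c m) \<noteq> 0"
proof (induction m)
  case 0
  have "csm N c 0 = vc c 0" by (rule ext) (auto simp: csm_def h_0 arcs_ok_def sgn_set_def)
  moreover have "ip 0 (vc c 0) (vc c 0) = 1" by (simp add: ip_def)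
  ultimately show ?case using vc_sl2(1)[of 0 c] by (simp only: zero_neq_one[symmetric] not_False_eq_True simp_thms)
next
  case (Suc m)
  let ?q = "csm N c m"
  have r: "rai m ?q = 0" and n: "ip m ?q (vc c m) \<noteq> 0" using Suc by auto
  show ?case
  proof (cases "c (Suc m)")
    case True
    have "rai (Suc m) (csm N c (Suc m)) = 0"
      by (simp only: csm_up[OF g Suc.prems True] rai_t0 r t_linear)
    moreover have "ip (Suc m) (csm N c (Suc m)) (vc c (Suc m)) = ip m ?q (vc c m)"
      using True by (simp only: csm_up[OF g Suc.prems True] vc.simps if_True ip_t)
    ultimately show ?thesis using n by simp
  next
    case False
    note d = csm_down[OF g Suc.prems False]
    let ?v = "hd (hV N c m)"
    have z: "?q S = 0" if "?v \<in> S" for S using d(2) that unfolding csm_def by auto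
    have rc: "rai m (cv ?v ?q) = ?q" by (rule rai_cv[OF supp_csm r d(3) z])
    have "rai (Suc m) (csm N c (Suc m)) = 0"
      by (simp only: d(1) rai_linear rai_t0 rai_t1[OF supp_csm] r rc t_linear sc_simps add_0_left diff_self)
    moreover have "ip (Suc m) (csm N c (Suc m)) (vc c (Suc m)) \<noteq> 0"
    proof -
      have l: "ip m (cv ?v ?q) (low m (vc c m)) = ip m ?q (vc c m)"
        unfolding ip_commute[of m "cv ?v ?q"] ip_low rc by (rule ip_commute)
      have "ip (Suc m) (csm N c (Suc m)) (vc c (Suc m)) = (-1) ^ Suc m * (of_int (ht c m) + 1) * ip m ?q (vc c m)"
        using False by (simp only: d(1) vc.simps if_False ip_linear ip_t l) (simp add: algebra_simps)
      moreover have "0 \<le> ht c m" using ht_nonneg[OF g] Suc.prems by simp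
      ultimately show ?thesis using n by (simp add: add_eq_0_iff2)
    qed
    ultimately show ?thesis by blast
  qed
qed

lemma pairing_nonzero: "good N c \<Longrightarrow> pairing N c \<noteq> 0"
  unfolding pairing_def using csm_sl2 by blast

section \<open>The rescaled walk vectors and the operators of the KLR generators\<close>

definition wk :: "tab \<Rightarrow> nat \<Rightarrow> bool" where
  "wk t i \<longleftrightarrow> snd (t i) = 1"

text \<open>The coefficient of the walk vector in the half-diagram vector, so that the idempotent of
  \<open>t\<close> sends the half-diagram vector exactly to \<open>ww N t\<close>.\<close>

definition kk :: "nat \<Rightarrow> tab \<Rightarrow> rat" where
  "kk N t = pairing N (wk t) / nrm (wk t) N"

text \<open>The rescaled seminormal basis vector on which \<open>f_{st}\<close> acts as a multiple of a matrix unit.\<close>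

definition ww :: "nat \<Rightarrow> tab \<Rightarrow> vec" where
  "ww N t = sc (kk N t) (vc (wk t) N)"

lemma wk_wt: "i \<in> {1..N} \<Longrightarrow> wk (wt N c) i = c i"
  unfolding wk_def by (rule snd_wt)

lemma wt_wk: "t \<in> Std2 N \<Longrightarrow> wt N (wk t) = t"
  unfolding Std2_iff using wt_cong[of N] wk_wt by metis

lemma good_wk: "t \<in> Std2 N \<Longrightarrow> good N (wk t)"
  using wt_wk wt_in_Std2 by metis

lemma vc_wk_wt: "vc (wk (wt N c)) N = vc c N"
  by (rule vc_cong) (use wk_wt in auto)

lemma finite_Std2: "finite (Std2 N)"
proof (rule finite_subset)
  show "Std2 N \<subseteq> (\<lambda>A. wt N (\<lambda>i. i \<in> A)) ` Pow {1..N}"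
  proof
    fix t assume "t \<in> Std2 N"
    then obtain c where "t = wt N c" unfolding Std2_iff by blast
    moreover have "wt N c = wt N (\<lambda>i. i \<in> {i \<in> {1..N}. c i})" by (rule wt_cong) auto
    ultimately show "t \<in> (\<lambda>A. wt N (\<lambda>i. i \<in> A)) ` Pow {1..N}" by blast
  qed
qed simp

lemma kk_nonzero: "t \<in> Std2 N \<Longrightarrow> kk N t \<noteq> 0"
  unfolding kk_def using pairing_nonzero[OF good_wk] nrm_pos[OF good_wk] by (metis divide_eq_0_iff less_irrefl)

lemma supp_ww [simp]: "supp N (ww N t)"
  unfolding ww_def by (simp add: supp_sc)

lemma rho_idem_ww:
  assumes "s \<in> Std2 N" "t \<in> Std2 N"
  shows "rho N (seminormal_idem N s) (ww N t) = (if t = s then ww N t else 0)"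
  using rho_seminormal(1)[OF good_wk[OF assms(1)] good_wk[OF assms(2)]]
  unfolding wt_wk[OF assms(1)] wt_wk[OF assms(2)] ww_def rho_vsc
  by (cases "t = s") (simp_all only: if_True if_False sc_simps simp_thms)

lemma idem_TL: "s \<in> Std2 N \<Longrightarrow> seminormal_idem N s \<in> TL N UNIV"
  using rho_seminormal(2)[OF good_wk good_wk] wt_wk by metis

lemma TL_eqI_ww:
  assumes "x \<in> TL N UNIV" "y \<in> TL N UNIV" and e: "\<And>t. t \<in> Std2 N \<Longrightarrow> rho N x (ww N t) = rho N y (ww N t)"
  shows "x = y"
proof (rule TL_faithful[OF assms(1,2)])
  fix c assume "good N c"
  then have t: "wt N c \<in> Std2 N" using wt_in_Std2 by blast
  have "sc (1 / kk N (wt N c)) (ww N (wt N c)) = vc c N"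
    unfolding ww_def vc_wk_wt using kk_nonzero[OF t] by (simp add: sc_simps)
  then show "rho N x (vc c N) = rho N y (vc c N)" using e[OF t] by (metis rho_vsc)
qed

text \<open>The walk vectors are an orthogonal basis of this module, so the idempotent is the
  orthogonal projection onto one of them.\<close>

lemma rho_idem_Wsp:
  assumes c: "good N c" and y: "y \<in> Wsp N"
  shows "rho N (seminormal_idem N (wt N c)) y = sc (ip N y (vc c N) / nrm c N) (vc c N)"
  using y unfolding Wsp_def
proof induction
  case zero
  then show ?case by (simp only: rho_vzero ip_linear) (simp add: sc_def fun_eq_iff)
next
  case (add b x k)
  then obtain d where d: "b = vc d N" "good N d" by blast
  have n: "nrm c N \<noteq> 0" using nrm_pos[OF c] by simp
  have "rho N (seminormal_idem N (wt N c)) b = sc (ip N b (vc c N) / nrm c N) (vc c N)"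
  proof (cases "wt N d = wt N c")
    case True
    then have e: "\<forall>i\<in>{1..N}. d i = c i" unfolding wt_eq_iff .
    then have v: "vc d N = vc c N" by (intro vc_cong) auto
    then show ?thesis using rho_seminormal(1)[OF c d(2)] True vc_orthogonal[of N c c] n unfolding d(1) v by (simp add: sc_simps)
  next
    case False
    then have e: "\<not> (\<forall>i\<in>{1..N}. d i = c i)" unfolding wt_eq_iff .
    have "rho N (seminormal_idem N (wt N c)) b = 0" using rho_seminormal(1)[OF c d(2)] unfolding d(1) if_not_P[OF False] .
    moreover have "ip N b (vc c N) = 0" unfolding d(1) vc_orthogonal[of N d c] using e by (rule if_not_P)
    ultimately show ?thesis by (simp only: div_0 sc_simps)
  qed
  then show ?case using add(3)
    by (simp only: rho_vadd rho_vsc ip_linear) (simp add: sc_def fun_eq_iff add_divide_distrib algebra_simps)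
qed

lemma csm_Wsp:
  assumes c: "good N c"
  shows "csm N c N \<in> Wsp N"
proof -
  have "sc (pairing N c) (csm N c N) \<in> Wsp N"
    using rho_Wsp[OF vc_in_Wsp[OF c], of "basis (cell_dia N (wt N c) (wt N c))"] unfolding rho_cell[OF c c refl] .
  then have "sc (1 / pairing N c) (sc (pairing N c) (csm N c N)) \<in> Wsp N" unfolding Wsp_def by (rule lspan_sc)
  then show ?thesis using pairing_nonzero[OF c] by (simp add: sc_simps)
qed

lemma rho_idem_csm:
  assumes "s \<in> Std2 N"
  shows "rho N (seminormal_idem N s) (csm N (wk s) N) = ww N s"
  using rho_idem_Wsp[OF good_wk[OF assms] csm_Wsp[OF good_wk[OF assms]]]
  unfolding wt_wk[OF assms] ww_def kk_def pairing_def .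

definition gam :: "nat \<Rightarrow> tab \<Rightarrow> rat" where
  "gam N t = kk N t * pairing N (wk t)"

lemma gam_nonzero: "t \<in> Std2 N \<Longrightarrow> gam N t \<noteq> 0"
  unfolding gam_def using kk_nonzero pairing_nonzero[OF good_wk] by simp

lemma fbasis_TL:
  assumes s: "s \<in> Std2 N" and t: "t \<in> Std2 N" and h: "ht (wk s) N = ht (wk t) N"
  shows "fbasis N s t \<in> TL N UNIV"
proof -
  have "cell_dia N s t \<in> diagrams N"
    using cell_diagram[OF good_wk[OF s] good_wk[OF t] h] unfolding wt_wk[OF s] wt_wk[OF t] .
  then show ?thesis unfolding fbasis_def
    by (intro TL_prod[OF subring_UNIV]) (use idem_TL s t TL_closed(5)[OF subring_UNIV] in auto)
qed

text \<open>The scalar depends on \<open>t\<close> only. Hence a rule that expresses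
  \<open>x f_{sa}\<close> by other \<open>f_{ta}\<close> holds with the same coefficients for the
  action of \<open>x\<close> on the vectors \<open>ww\<close>; the vectors are rescaled for this
  purpose.\<close>

lemma rho_fbasis:
  assumes s: "s \<in> Std2 N" and t: "t \<in> Std2 N" and r: "r \<in> Std2 N" and h: "ht (wk s) N = ht (wk t) N"
  shows "rho N (fbasis N s t) (ww N r) = (if r = t then sc (gam N t) (ww N s) else 0)"
proof -
  have e: "rho N (fbasis N s t) (ww N r) =
      rho N (seminormal_idem N s) (rho N (basis (cell_dia N s t)) (rho N (seminormal_idem N t) (ww N r)))"
    unfolding fbasis_def by (simp add: rho_prod)
  show ?thesis
  proof (cases "r = t")
    case True
    have "rho N (basis (cell_dia N s t)) (ww N t) = sc (kk N t) (sc (pairing N (wk t)) (csm N (wk s) N))"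
      unfolding ww_def rho_vsc
      using rho_cell[OF good_wk[OF s] good_wk[OF t] h] unfolding wt_wk[OF s] wt_wk[OF t] by simp
    then show ?thesis unfolding e unfolding True rho_idem_ww[OF t t]
      by (simp only: if_True rho_vsc rho_idem_csm[OF s] sc_simps gam_def simp_thms)
  next
    case False
    then show ?thesis unfolding e rho_idem_ww[OF t r] by (simp only: if_False rho_vzero)
  qed
qed

lemma Std_Par2_walk:
  assumes "lam \<in> Par2 N" "s \<in> Std lam" "a \<in> Std lam"
  shows "s \<in> Std2 N" "a \<in> Std2 N" "ht (wk s) N = ht (wk a) N"
proof -
  show S: "s \<in> Std2 N" "a \<in> Std2 N" using assms unfolding Std2_def by blast+
  obtain c where c: "s = wt N c" "dn c N = card {z \<in> young lam. snd z = 2}" using Std_obtain_walk[OF assms(1,2)] by blast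
  obtain d where d: "a = wt N d" "dn d N = card {z \<in> young lam. snd z = 2}" using Std_obtain_walk[OF assms(1,3)] by blast
  have "ht c N = ht d N" using c d up_dn_sum[of c N] up_dn_sum[of d N] by (simp add: ht_up_dn)
  moreover have "ht (wk s) N = ht c N" "ht (wk a) N = ht d N"
    unfolding c(1) d(1) by (auto intro!: ht_cong simp: wk_wt)
  ultimately show "ht (wk s) N = ht (wk a) N" by simp
qed

lemma ht_wk_wt: "m \<le> N \<Longrightarrow> ht (wk (wt N c)) m = ht c m"
  by (rule ht_cong) (simp add: wk_wt)

lemma ht_swap:
  assumes "s \<in> Std2 N" "swap_entries s l \<in> Std2 N" "1 \<le> l" "l < N"
  shows "ht (wk (swap_entries s l)) N = ht (wk s) N"
proof -
  obtain c where c: "good N c" "s = wt N c" using assms(1) unfolding Std2_iff by blast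
  have ne: "c l \<noteq> c (Suc l)" using swap_entries_equal[OF assms(3,4), of c] assms(2) c by auto
  show ?thesis unfolding c(2) swap_entries_wt[where c=c, OF assms(3,4) ne] ht_wk_wt[OF order_refl]
    using ht_swc[OF assms(3), of N c] assms(4) by simp
qed

text \<open>\<open>psi\<close> is defined by a unique description, so an element with the prescribed
  products has to be constructed and shown to be the only one before its action can be read
  off.\<close>

lemma rho_psi:
  assumes l: "1 \<le> l" "l < N" and s: "s \<in> Std2 N"
  shows "rho N (psi p N l) (ww N s) =
    (if swap_entries s l \<in> Std2 N then sc (beta p N s l) (ww N (swap_entries s l)) else 0)
    - sc (delta p s l / of_int (axial s l)) (ww N s)"
    and "psi p N l \<in> TL N UNIV"
proof -
  let ?A = "TL N UNIV"
  define rhs where "rhs s a = (if swap_entries s l \<in> Std2 N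
           then scale (beta p N s l) (fbasis N (swap_entries s l) a) else 0)
          - scale (delta p s l / of_int (axial s l)) (fbasis N s a)" for s a
  define img where "img s = (if swap_entries s l \<in> Std2 N then sc (beta p N s l) (ww N (swap_entries s l)) else 0)
    - sc (delta p s l / of_int (axial s l)) (ww N s)" for s
  note cl = TL_closed[OF subring_UNIV]
  have rhsT: "rhs s a \<in> ?A" if "s \<in> Std2 N" "a \<in> Std2 N" "ht (wk s) N = ht (wk a) N" for s a
    unfolding rhs_def by (cases "swap_entries s l \<in> Std2 N")
      (simp_all only: if_True if_False, (intro cl fbasis_TL UNIV_I that; simp only: that ht_swap[OF that(1) _ l])+)
  have rr: "rho N (rhs s a) (ww N r) = (if r = a then sc (gam N a) (img s) else 0)"
    if "s \<in> Std2 N" "a \<in> Std2 N" "ht (wk s) N = ht (wk a) N" "r \<in> Std2 N" for s a r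
  proof (cases "swap_entries s l \<in> Std2 N")
    case True
    have h: "ht (wk (swap_entries s l)) N = ht (wk a) N" using ht_swap[OF that(1) True l] that by simp
    show ?thesis unfolding rhs_def img_def if_P[OF True] rho_diff rho_scale rho_fbasis[OF True that(2,4) h] rho_fbasis[OF that(1,2,4,3)]
      by (cases "r = a") (simp_all only: if_True if_False simp_thms sc_simps mult.commute diff_self)
  next
    case False
    show ?thesis unfolding rhs_def img_def if_not_P[OF False] rho_diff rho_scale rho_zero rho_fbasis[OF that(1,2,4,3)]
      by (cases "r = a") (simp_all only: if_True if_False simp_thms sc_simps mult.commute diff_self)
  qed
  \<comment> \<open>\<open>fbasis N s s\<close> divided by \<open>gam N s\<close> is the idempotent
    of \<open>s\<close>, and these sum to 1. So \<open>x0\<close> is the sum of the prescribed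
    products of the generator with the idempotents.\<close>
  define x0 where "x0 = (\<Sum>s\<in>Std2 N. scale (1 / gam N s) (rhs s s))"
  have x0T: "x0 \<in> ?A" unfolding x0_def by (intro TL_sum[OF subring_UNIV] cl UNIV_I rhsT) auto
  have x0w: "rho N x0 (ww N s) = img s" if s: "s \<in> Std2 N" for s
  proof -
    have "rho N x0 (ww N s) = (\<Sum>t\<in>Std2 N. if t = s then img s else 0)"
      unfolding x0_def rho_sum
    proof (rule sum.cong[OF refl])
      fix t assume t: "t \<in> Std2 N"
      show "rho N (scale (1 / gam N t) (rhs t t)) (ww N s) = (if t = s then img s else 0)"
      proof (cases "t = s")
        case True
        then show ?thesis unfolding rho_scale rr[OF t t refl s] using gam_nonzero[OF s] by (simp add: sc_simps)
      next
        case False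
        then have "s \<noteq> t" by simp
        then show ?thesis unfolding rho_scale rr[OF t t refl s] using False by (simp only: if_False sc_simps)
      qed
    qed
    then show ?thesis using s finite_Std2 by (simp add: sum.delta)
  qed
  have sat: "tl_mult N x0 (fbasis N s a) = rhs s a" if "lam \<in> Par2 N" "s \<in> Std lam" "a \<in> Std lam" for lam s a
  proof (rule TL_eqI_ww)
    note w = Std_Par2_walk[OF that]
    show "tl_mult N x0 (fbasis N s a) \<in> ?A" by (intro cl x0T fbasis_TL w)
    show "rhs s a \<in> ?A" by (rule rhsT[OF w])
    fix t assume t: "t \<in> Std2 N"
    show "rho N (tl_mult N x0 (fbasis N s a)) (ww N t) = rho N (rhs s a) (ww N t)"
      unfolding rho_mult rho_fbasis[OF w(1,2) t w(3)] rr[OF w t]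
      by (cases "t = a") (simp_all only: if_True if_False simp_thms rho_vsc rho_vzero x0w[OF w(1)])
  qed
  \<comment> \<open>The products with \<open>fbasis N t t\<close> alone determine the element,
    because \<open>fbasis N t t\<close> acts on \<open>ww N t\<close> by a nonzero scalar.\<close>
  have uniq: "x = x0" if x: "x \<in> ?A" and e: "\<forall>lam\<in>Par2 N. \<forall>s\<in>Std lam. \<forall>a\<in>Std lam. tl_mult N x (fbasis N s a) = rhs s a" for x
  proof (rule TL_eqI_ww[OF x x0T])
    fix t assume t: "t \<in> Std2 N"
    then obtain lam where lam: "lam \<in> Par2 N" "t \<in> Std lam" unfolding Std2_def by blast
    have "tl_mult N x (fbasis N t t) = tl_mult N x0 (fbasis N t t)" using e sat lam by metis
    then have "rho N x (rho N (fbasis N t t) (ww N t)) = rho N x0 (rho N (fbasis N t t) (ww N t))"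
      unfolding rho_mult[symmetric] by simp
    then have "sc (gam N t) (rho N x (ww N t)) = sc (gam N t) (rho N x0 (ww N t))"
      unfolding rho_fbasis[OF t t t refl] by (simp only: if_True rho_vsc simp_thms)
    then have "sc (1 / gam N t) (sc (gam N t) (rho N x (ww N t))) = sc (1 / gam N t) (sc (gam N t) (rho N x0 (ww N t)))"
      by (rule arg_cong)
    then show "rho N x (ww N t) = rho N x0 (ww N t)" using gam_nonzero[OF t] by (simp add: sc_simps)
  qed
  have "psi p N l = x0"
    unfolding psi_def rhs_def[symmetric]
    by (rule the_equality) (use x0T sat uniq in blast)+
  then show "rho N (psi p N l) (ww N s) =
    (if swap_entries s l \<in> Std2 N then sc (beta p N s l) (ww N (swap_entries s l)) else 0)
    - sc (delta p s l / of_int (axial s l)) (ww N s)" "psi p N l \<in> TL N UNIV"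
    using x0w[OF s] x0T unfolding img_def by simp_all
qed

section \<open>Products of KLR generators\<close>

text \<open>The difference of the contents of \<open>l\<close> and \<open>l + 1\<close> when the two
  steps differ: negative at a peak, positive at a valley.\<close>

definition ax :: "(nat \<Rightarrow> bool) \<Rightarrow> nat \<Rightarrow> int" where
  "ax c l = (if c l then - (ht c (l - 1) + 1) else ht c (l - 1) + 1)"

text \<open>The coefficient of the swapped tableau depends on the axial distance alone:
  \<open>0 < r\<close> means a valley, and then the swapped tableau is the less dominant
  one.\<close>

definition bet :: "nat \<Rightarrow> int \<Rightarrow> rat" where
  "bet p r = (let al = (if 0 < r then 1 else (of_int r ^ 2 - 1) / of_int r ^ 2) in
     if [r = 0] (mod int p) then al / (1 - of_int r)
     else if [r = 1] (mod int p) then al * of_int r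
     else al * of_int r / (1 - of_int r))"

definition del :: "nat \<Rightarrow> int \<Rightarrow> rat" where
  "del p r = (if [r = 0] (mod int p) then 1 / of_int r else 0)"

definition flip :: "nat set \<Rightarrow> (nat \<Rightarrow> bool) \<Rightarrow> nat \<Rightarrow> bool" where
  "flip F c = (\<lambda>i. if i \<in> F \<or> (\<exists>l\<in>F. i = Suc l) then \<not> c i else c i)"

lemma shape_sum:
  assumes "m \<le> N"
  shows "(\<Sum>r=1..j. shape_upto (wt N c) m r) = min (up c m) j + min (dn c m) j"
  using assms
proof (induction m)
  case 0 then show ?case by (simp add: shape_upto_def)
next
  case (Suc m)
  let ?t = "wt N c"
  have s: "shape_upto ?t (Suc m) r = shape_upto ?t m r + (if r = fst (?t (Suc m)) then 1 else 0)" for r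
  proof -
    have "{i \<in> {1..Suc m}. fst (?t i) = r} = {i \<in> {1..m}. fst (?t i) = r} \<union> (if r = fst (?t (Suc m)) then {Suc m} else {})"
      by (auto simp: le_Suc_eq)
    then show ?thesis unfolding shape_upto_def by (auto simp: card_insert_if)
  qed
  have "(\<Sum>r=1..j. shape_upto ?t (Suc m) r) = (\<Sum>r=1..j. shape_upto ?t m r) + (\<Sum>r=1..j. if r = fst (?t (Suc m)) then 1 else 0)"
    unfolding s by (rule sum.distrib)
  also have "(\<Sum>r=1..j. if r = fst (?t (Suc m)) then 1 else 0) = (if fst (?t (Suc m)) \<in> {1..j} then 1 else (0::nat))"
    by (simp only: sum.delta finite_atLeastAtMost)
  finally show ?case using Suc by (auto simp: wt_apply min_def)
qed

text \<open>The shapes differ only after the entry \<open>l\<close>, where the swap moves a box from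
  the second column to the end of the first, that is, downwards.\<close>

lemma tab_less_swc:
  assumes g: "good N c" and l: "1 \<le> l" "l < N" and c: "\<not> c l" "c (Suc l)"
  shows "tab_less N (wt N (swc l c)) (wt N c)" "\<not> tab_less N (wt N c) (wt N (swc l c))"
proof -
  obtain k where k: "l = Suc k" using l by (cases l) auto
  define a b where "a = up c k" and "b = dn c k"
  have g1: "dn c l \<le> up c l" using good_dn_up[OF g] l by simp
  have v: "up c l = a" "dn c l = Suc b" "b < a" using c g1 unfolding k a_def b_def by auto
  have "up (swc l c) k = a" "dn (swc l c) k = b" using up_swc[OF l(1), of k c] dn_swc[OF l(1), of k c] k unfolding a_def b_def by auto
  then have v': "up (swc l c) l = Suc a" "dn (swc l c) l = b" using c unfolding k by auto
  have "wt N (swc l c) \<noteq> wt N c" unfolding wt_eq_iff using c l by (metis atLeastAtMost_iff less_imp_le swc_simps(1))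
  moreover have "tab_le N (wt N (swc l c)) (wt N c)"
    unfolding tab_le_def
  proof (intro allI impI)
    fix m j assume m: "m \<le> N"
    show "(\<Sum>r = 1..j. shape_upto (wt N (swc l c)) m r) \<le> (\<Sum>r = 1..j. shape_upto (wt N c) m r)"
      unfolding shape_sum[OF m] using v v' up_swc[OF l(1), of m c] dn_swc[OF l(1), of m c] by (cases "m = l") auto
  qed
  ultimately show "tab_less N (wt N (swc l c)) (wt N c)" unfolding tab_less_def by blast
  \<comment> \<open>Row \<open>Suc b\<close> is the one that loses its second box, so the first
    \<open>Suc b\<close> rows separate the two shapes.\<close>
  have "\<not> (\<Sum>r = 1..Suc b. shape_upto (wt N c) l r) \<le> (\<Sum>r = 1..Suc b. shape_upto (wt N (swc l c)) l r)"
    using shape_sum[of l N c "Suc b"] shape_sum[of l N "swc l c" "Suc b"] l v v' by simp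
  then show "\<not> tab_less N (wt N c) (wt N (swc l c))" unfolding tab_less_def tab_le_def using l by (meson less_imp_le)
qed

locale odd_prime =
  fixes p :: nat
  assumes prime: "prime p" and odd: "odd p"
begin

lemma p3: "3 \<le> p"
  using prime_ge_2_nat[OF prime] odd by (cases "p = 2") auto

lemma not_cong_1: "\<not> [1 = 0] (mod int p)" "\<not> [-1 = 0] (mod int p)"
  using p3 by (auto simp: cong_0_iff)

lemma axial_wt:
  assumes l: "1 \<le> l" "l < N"
  shows "c l \<noteq> c (Suc l) \<Longrightarrow> axial (wt N c) l = ax c l" "c l = c (Suc l) \<Longrightarrow> axial (wt N c) l = 1"
proof -
  have a: "axial (wt N c) l = cn c l - cn c (Suc l)" unfolding axial_def using l by (simp add: cont_wt)
  show "axial (wt N c) l = 1" if "c l = c (Suc l)" using cn_step[OF l(1) that] a by simp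
  show "axial (wt N c) l = ax c l" if ne: "c l \<noteq> c (Suc l)"
  proof (cases "c l")
    case True then show ?thesis using cn_axial[OF l(1)] ne a unfolding ax_def by simp
  next
    case False
    obtain j where j: "l = Suc j" using l by (cases l) auto
    have "ht (swc l c) j = ht c j" using ht_swc[OF l(1), of j c] j by simp
    then show ?thesis using cn_axial[OF l(1), of "swc l c"] cn_swc[OF l(1) ne] False ne a unfolding ax_def j by simp
  qed
qed

text \<open>Two equal steps have axial distance 1 and a peak that starts on the ground has -1.
  Neither is 0 modulo p, so the diagonal term is absent, and the swapped tableau is not standard. In
  the remaining case the action is the sum of a swap and a diagonal term.\<close>

lemma psi_walk:
  assumes g: "good N c" and l: "1 \<le> l" "l < N"
  shows "c l = c (Suc l) \<Longrightarrow> rho N (psi p N l) (ww N (wt N c)) = 0"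
    and "c l \<Longrightarrow> \<not> c (Suc l) \<Longrightarrow> ht c (l - 1) = 0 \<Longrightarrow> rho N (psi p N l) (ww N (wt N c)) = 0"
    and "c l \<noteq> c (Suc l) \<Longrightarrow> (c l \<longrightarrow> 1 \<le> ht c (l - 1)) \<Longrightarrow> good N (swc l c) \<and>
      rho N (psi p N l) (ww N (wt N c)) = sc (bet p (ax c l)) (ww N (wt N (swc l c))) - sc (del p (ax c l)) (ww N (wt N c))"
proof -
  have s: "wt N c \<in> Std2 N" using g wt_in_Std2 by blast
  note r = rho_psi(1)[OF l s, of p]
  have del_eq: "delta p (wt N c) l / of_int (axial (wt N c) l) = del p (axial (wt N c) l)" unfolding delta_def del_def by simp
  show "rho N (psi p N l) (ww N (wt N c)) = 0" if e: "c l = c (Suc l)"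
  proof -
    have "del p (axial (wt N c) l) = 0" unfolding axial_wt(2)[OF l e] del_def using not_cong_1 by simp
    then show ?thesis unfolding r del_eq using swap_entries_equal[OF l e] by (simp only: if_False sc_simps diff_self)
  qed
  show "rho N (psi p N l) (ww N (wt N c)) = 0" if e: "c l" "\<not> c (Suc l)" "ht c (l - 1) = 0"
  proof -
    have ne: "c l \<noteq> c (Suc l)" using e by simp
    have "ax c l = - 1" unfolding ax_def using e by simp
    then have "del p (axial (wt N c) l) = 0" unfolding axial_wt(1)[OF l ne] del_def using not_cong_1 by simp
    moreover have "ht (swc l c) l < 0" using ht_swc_at[OF l(1), of c] e by simp
    then have "\<not> good N (swc l c)" using l unfolding good_def by (metis less_imp_le not_le)
    then have "swap_entries (wt N c) l \<notin> Std2 N" unfolding swap_entries_wt[where c=c, OF l ne] wt_in_Std2 .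
    ultimately show ?thesis unfolding r del_eq by (simp only: if_False sc_simps diff_self)
  qed
  assume ne: "c l \<noteq> c (Suc l)" and h: "c l \<longrightarrow> 1 \<le> ht c (l - 1)"
  have h0: "0 \<le> ht c (l - 1)" using ht_nonneg[OF g, of "l - 1"] l by simp
  have g': "good N (swc l c)"
    using good_swc_peak[OF g l] good_swc_valley[where c=c, OF g l] ne h by blast
  have sw: "swap_entries (wt N c) l = wt N (swc l c)" by (rule swap_entries_wt[OF l ne])
  have st: "swap_entries (wt N c) l \<in> Std2 N" unfolding sw wt_in_Std2 using g' .
  have "alpha N (wt N c) l = (if 0 < ax c l then 1 else (of_int (ax c l) ^ 2 - 1) / of_int (ax c l) ^ 2)"
  proof (cases "c l")
    case True
    then have "\<not> swc l c l" "swc l c (Suc l)" using ne by simp_all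
    then have "\<not> tab_less N (wt N (swc l c)) (wt N (swc l (swc l c)))" by (intro tab_less_swc(2)[OF g' l])
    then show ?thesis using True h0 unfolding alpha_def sw axial_wt(1)[OF l ne] ax_def by simp
  next
    case False
    then have "tab_less N (wt N (swc l c)) (wt N c)" using tab_less_swc(1)[OF g l] ne by simp
    then show ?thesis using False h0 unfolding alpha_def sw axial_wt(1)[OF l ne] ax_def by simp
  qed
  then have "beta p N (wt N c) l = bet p (ax c l)"
    unfolding beta_def bet_def axial_wt(1)[OF l ne] using st by (simp add: Let_def)
  moreover have de: "delta p (wt N c) l / of_int (ax c l) = del p (ax c l)"
    unfolding delta_def del_def axial_wt(1)[OF l ne] by simp
  ultimately show "good N (swc l c) \<and>
      rho N (psi p N l) (ww N (wt N c)) = sc (bet p (ax c l)) (ww N (wt N (swc l c))) - sc (del p (ax c l)) (ww N (wt N c))"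
    using g' st unfolding r axial_wt(1)[OF l ne] de sw by (simp only: if_True simp_thms)
qed

definition psis :: "nat \<Rightarrow> nat list \<Rightarrow> vec \<Rightarrow> vec" where
  "psis N ls v = foldr (\<lambda>l. rho N (psi p N l)) ls v"

lemma psis_linear: "psis N ls (v + w) = psis N ls v + psis N ls w" "psis N ls (sc k v) = sc k (psis N ls v)" "psis N ls 0 = 0"
  by (induction ls) (simp_all only: psis_def foldr.simps o_apply id_apply rho_vadd rho_vsc rho_vzero)

abbreviation gap :: "nat list \<Rightarrow> bool" where
  "gap ls \<equiv> sorted_wrt (\<lambda>x y. Suc (Suc x) \<le> y) ls"

lemma flip_prefix: "(\<And>l. l \<in> F \<Longrightarrow> i < l) \<Longrightarrow> flip F c i = c i"
  unfolding flip_def by force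

lemma flip_insert_head:
  assumes F: "\<And>k. k \<in> F \<Longrightarrow> Suc (Suc l) \<le> k" and ne: "c l \<noteq> c (Suc l)"
  shows "swc l (flip F c) = flip (insert l F) c"
proof
  fix i
  have nF: "l \<notin> F" "Suc l \<notin> F" "\<not> (\<exists>k\<in>F. l = Suc k)" "\<not> (\<exists>k\<in>F. Suc l = Suc k)" using F by fastforce+
  show "swc l (flip F c) i = flip (insert l F) c i"
    using nF ne unfolding swc_def flip_def by auto
qed

text \<open>The indices are at least two apart, so the generators act on disjoint pairs of steps.
  The generator with the largest index acts first, and a swap there leaves the walk to its left
  unchanged, hence also the axial distances met later. So each pair is independently swapped or
  kept.\<close>

lemma psis_expand:
  assumes g: "good N c"
  shows "gap ls \<Longrightarrow> (\<And>l. l \<in> set ls \<Longrightarrow> 1 \<le> l \<and> l < N \<and> c l \<noteq> c (Suc l) \<and> (c l \<longrightarrow> 1 \<le> ht c (l - 1))) \<Longrightarrow>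
    (\<forall>F\<subseteq>set ls. good N (flip F c)) \<and>
    psis N ls (ww N (wt N c)) = (\<Sum>F\<in>Pow (set ls). sc ((\<Prod>l\<in>F. bet p (ax c l)) * (\<Prod>l\<in>set ls - F. - del p (ax c l))) (ww N (wt N (flip F c))))"
proof (induction ls)
  case Nil
  have "flip {} c = c" by (rule ext) (simp add: flip_def)
  then show ?case using g by (simp add: psis_def sc_simps)
next
  case (Cons l ls)
  let ?co = "\<lambda>X F. (\<Prod>l\<in>F. bet p (ax c l)) * (\<Prod>l\<in>X - F. - del p (ax c l))"
  have l: "1 \<le> l" "l < N" "c l \<noteq> c (Suc l)" "c l \<longrightarrow> 1 \<le> ht c (l - 1)" using Cons.prems(2)[of l] by auto
  have gp: "\<And>k. k \<in> set ls \<Longrightarrow> Suc (Suc l) \<le> k" using Cons.prems(1) by auto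
  have gf: "\<And>F. F \<subseteq> set ls \<Longrightarrow> good N (flip F c)"
    and IH: "psis N ls (ww N (wt N c)) = (\<Sum>F\<in>Pow (set ls). sc (?co (set ls) F) (ww N (wt N (flip F c))))"
    using Cons.IH Cons.prems by auto
  have step: "good N (flip (insert l F) c)"
    "rho N (psi p N l) (ww N (wt N (flip F c))) = sc (bet p (ax c l)) (ww N (wt N (flip (insert l F) c))) - sc (del p (ax c l)) (ww N (wt N (flip F c)))"
    if F: "F \<subseteq> set ls" for F
  proof -
    have pre: "flip F c i = c i" if "i \<le> Suc l" for i by (rule flip_prefix) (use F gp that in fastforce)
    have hp: "ht (flip F c) (l - 1) = ht c (l - 1)" by (rule ht_cong) (use pre in auto)
    have fl: "flip F c l = c l" "flip F c (Suc l) = c (Suc l)" using pre by auto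
    have ne': "flip F c l \<noteq> flip F c (Suc l)" "flip F c l \<longrightarrow> 1 \<le> ht (flip F c) (l - 1)" unfolding fl hp using l by auto
    have "ax (flip F c) l = ax c l" unfolding ax_def fl hp ..
    moreover have "swc l (flip F c) = flip (insert l F) c"
      by (rule flip_insert_head[OF _ l(3)]) (use F gp in blast)
    moreover note psi_walk(3)[OF gf[OF F] l(1,2) ne']
    ultimately show "good N (flip (insert l F) c)"
      "rho N (psi p N l) (ww N (wt N (flip F c))) = sc (bet p (ax c l)) (ww N (wt N (flip (insert l F) c))) - sc (del p (ax c l)) (ww N (wt N (flip F c)))"
      by (simp_all only:)
  qed
  have 1: "\<forall>F\<subseteq>set (l # ls). good N (flip F c)"
  proof (intro allI impI)
    fix F assume F: "F \<subseteq> set (l # ls)"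
    show "good N (flip F c)"
    proof (cases "l \<in> F")
      case True
      then have "insert l (F - {l}) = F" "F - {l} \<subseteq> set ls" using F by auto
      then show ?thesis using step(1)[of "F - {l}"] by simp
    next
      case False then show ?thesis using gf[of F] F by auto
    qed
  qed
  have nl: "l \<notin> set ls" using gp by fastforce
  have "psis N (l # ls) (ww N (wt N c)) = rho N (psi p N l) (psis N ls (ww N (wt N c)))" by (simp add: psis_def)
  also have "\<dots> = (\<Sum>F\<in>Pow (set ls). sc (?co (set ls) F) (rho N (psi p N l) (ww N (wt N (flip F c)))))"
    unfolding IH rho_vsum rho_vsc ..
  also have "\<dots> = (\<Sum>F\<in>Pow (set ls). sc (?co (set (l # ls)) (insert l F)) (ww N (wt N (flip (insert l F) c))) + sc (?co (set (l # ls)) F) (ww N (wt N (flip F c))))"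
  proof (rule sum.cong[OF refl])
    fix F assume "F \<in> Pow (set ls)"
    then have F: "F \<subseteq> set ls" by simp
    have finF: "finite F" using F finite_subset by auto
    have lF: "l \<notin> F" using F nl by blast
    have e: "set (l # ls) - insert l F = set ls - F" "set (l # ls) - F = insert l (set ls - F)" using lF nl by auto
    have c1: "?co (set (l # ls)) (insert l F) = ?co (set ls) F * bet p (ax c l)" unfolding e using finF lF by simp
    have c2: "?co (set (l # ls)) F = ?co (set ls) F * (- del p (ax c l))" unfolding e using nl by simp
    show "sc (?co (set ls) F) (rho N (psi p N l) (ww N (wt N (flip F c)))) =
       sc (?co (set (l # ls)) (insert l F)) (ww N (wt N (flip (insert l F) c))) + sc (?co (set (l # ls)) F) (ww N (wt N (flip F c)))"
      unfolding step(2)[OF F] c1 c2 by (rule ext) (simp add: sc_def algebra_simps)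
  qed
  also have "\<dots> = (\<Sum>F\<in>Pow (set ls). sc (?co (set (l # ls)) (insert l F)) (ww N (wt N (flip (insert l F) c)))) +
      (\<Sum>F\<in>Pow (set ls). sc (?co (set (l # ls)) F) (ww N (wt N (flip F c))))"
    by (rule sum.distrib)
  also have "(\<Sum>F\<in>Pow (set ls). sc (?co (set (l # ls)) (insert l F)) (ww N (wt N (flip (insert l F) c)))) =
      (\<Sum>F\<in>insert l ` Pow (set ls). sc (?co (set (l # ls)) F) (ww N (wt N (flip F c))))"
    by (subst sum.reindex) (use nl in \<open>auto simp: inj_on_def\<close>)
  also have "\<dots> + (\<Sum>F\<in>Pow (set ls). sc (?co (set (l # ls)) F) (ww N (wt N (flip F c)))) =
     (\<Sum>F\<in>insert l ` Pow (set ls) \<union> Pow (set ls). sc (?co (set (l # ls)) F) (ww N (wt N (flip F c))))"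
    by (rule sum.union_disjoint[symmetric]) (use nl in auto)
  also have "insert l ` Pow (set ls) \<union> Pow (set ls) = Pow (set (l # ls))" by (simp add: Pow_insert Un_commute)
  finally show ?case using 1 by blast
qed

text \<open>Diagonal terms arise only at axial distances divisible by p. Without such distances a
  single term of the expansion survives, in which every pair is swapped.\<close>

lemma psis_flip:
  assumes g: "good N c" and gp: "gap ls"
    and l: "\<And>l. l \<in> set ls \<Longrightarrow> 1 \<le> l \<and> l < N \<and> c l \<noteq> c (Suc l) \<and> (c l \<longrightarrow> 1 \<le> ht c (l - 1))"
    and d: "\<And>l. l \<in> set ls \<Longrightarrow> \<not> [ax c l = 0] (mod int p)"
  shows "good N (flip (set ls) c)"
    "psis N ls (ww N (wt N c)) = sc (\<Prod>l\<in>set ls. bet p (ax c l)) (ww N (wt N (flip (set ls) c)))"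
proof -
  let ?co = "\<lambda>F. (\<Prod>l\<in>F. bet p (ax c l)) * (\<Prod>l\<in>set ls - F. - del p (ax c l))"
  have ex: "\<forall>F\<subseteq>set ls. good N (flip F c)"
    "psis N ls (ww N (wt N c)) = (\<Sum>F\<in>Pow (set ls). sc (?co F) (ww N (wt N (flip F c))))"
    using psis_expand[OF g gp l] by blast+
  show "good N (flip (set ls) c)" using ex(1) by blast
  have "(\<Sum>F\<in>Pow (set ls). sc (?co F) (ww N (wt N (flip F c)))) =
     (\<Sum>F\<in>Pow (set ls). if F = set ls then sc (\<Prod>l\<in>set ls. bet p (ax c l)) (ww N (wt N (flip (set ls) c))) else 0)"
  proof (rule sum.cong[OF refl])
    fix F assume F: "F \<in> Pow (set ls)"
    show "sc (?co F) (ww N (wt N (flip F c))) = (if F = set ls then sc (\<Prod>l\<in>set ls. bet p (ax c l)) (ww N (wt N (flip (set ls) c))) else 0)"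
    proof (cases "F = set ls")
      case True then show ?thesis by simp
    next
      case False
      then obtain k where k: "k \<in> set ls - F" using F by blast
      then have "- del p (ax c k) = 0" using d[of k] unfolding del_def by simp
      then have "(\<Prod>l\<in>set ls - F. - del p (ax c l)) = 0" using k by (intro prod_zero) auto
      then have "?co F = 0" by simp
      then show ?thesis using False by (simp only: sc_simps if_False)
    qed
  qed
  also have "\<dots> = sc (\<Prod>l\<in>set ls. bet p (ax c l)) (ww N (wt N (flip (set ls) c)))"
    by (subst sum.delta) simp_all
  finally show "psis N ls (ww N (wt N c)) = sc (\<Prod>l\<in>set ls. bet p (ax c l)) (ww N (wt N (flip (set ls) c)))" using ex(2) by simp
qed

text \<open>Consider the rightmost index with two equal steps. The generators that act before it do
  not touch these steps, so it kills every term of their expansion.\<close>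

lemma psis_kill:
  assumes g: "good N c"
  shows "gap ls \<Longrightarrow> (\<And>l. l \<in> set ls \<Longrightarrow> 1 \<le> l \<and> l < N \<and> (c l \<longrightarrow> c (Suc l) \<or> 1 \<le> ht c (l - 1))) \<Longrightarrow>
    \<exists>l\<in>set ls. c l = c (Suc l) \<Longrightarrow> psis N ls (ww N (wt N c)) = 0"
proof (induction ls)
  case (Cons l ls)
  have e: "psis N (l # ls) (ww N (wt N c)) = rho N (psi p N l) (psis N ls (ww N (wt N c)))" by (simp add: psis_def)
  have gp: "\<And>k. k \<in> set ls \<Longrightarrow> Suc (Suc l) \<le> k" "gap ls" using Cons.prems(1) by auto
  show ?case
  proof (cases "\<exists>l\<in>set ls. c l = c (Suc l)")
    case True
    have "psis N ls (ww N (wt N c)) = 0"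
      by (rule Cons.IH[OF gp(2) _ True]) (rule Cons.prems(2), simp only: list.set insert_iff simp_thms)
    then show ?thesis unfolding e by (simp only: rho_vzero)
  next
    case False
    then have eq: "c l = c (Suc l)" using Cons.prems(3) by auto
    have "\<And>l. l \<in> set ls \<Longrightarrow> 1 \<le> l \<and> l < N \<and> c l \<noteq> c (Suc l) \<and> (c l \<longrightarrow> 1 \<le> ht c (l - 1))"
      using False Cons.prems(2) by auto
    then have ex: "\<forall>F\<subseteq>set ls. good N (flip F c)"
      "psis N ls (ww N (wt N c)) = (\<Sum>F\<in>Pow (set ls). sc ((\<Prod>l\<in>F. bet p (ax c l)) * (\<Prod>l\<in>set ls - F. - del p (ax c l))) (ww N (wt N (flip F c))))"
      using psis_expand[OF g gp(2)] by blast+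
    have k: "rho N (psi p N l) (ww N (wt N (flip F c))) = 0" if F: "F \<in> Pow (set ls)" for F
    proof (rule psi_walk(1))
      show "good N (flip F c)" using ex(1) F by blast
      show "1 \<le> l" "l < N" using Cons.prems(2)[of l] by auto
      have "flip F c i = c i" if "i \<le> Suc l" for i by (rule flip_prefix) (use F gp that in fastforce)
      then show "flip F c l = flip F c (Suc l)" using eq by simp
    qed
    show ?thesis unfolding e ex(2) rho_vsum rho_vsc
    proof (rule sum.neutral, rule ballI)
      fix F assume "F \<in> Pow (set ls)"
      from k[OF this] show "sc ((\<Prod>l\<in>F. bet p (ax c l)) * (\<Prod>l\<in>set ls - F. - del p (ax c l))) (rho N (psi p N l) (ww N (wt N (flip F c)))) = 0"
        by (simp only: sc_simps)
    qed
  qed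
qed simp

end

section \<open>The diamond\<close>

text \<open>The indices of the factors of one \<open>Psi\<close>; they act on \<open>j\<close>
  consecutive pairs of steps after position \<open>x\<close>.\<close>

definition cells :: "nat \<Rightarrow> nat \<Rightarrow> nat list" where
  "cells x j = map (\<lambda>a. Suc x + 2 * a) [0..<j]"

definition zig :: "nat \<Rightarrow> nat \<Rightarrow> bool \<Rightarrow> (nat \<Rightarrow> bool) \<Rightarrow> bool" where
  "zig x j s d \<longleftrightarrow> (\<forall>a<j. d (Suc (x + 2 * a)) = s \<and> d (Suc (Suc (x + 2 * a))) = (\<not> s))"

lemma set_cells: "set (cells x j) = (\<lambda>a. Suc (x + 2 * a)) ` {..<j}"
  unfolding cells_def by (simp add: lessThan_atLeast0)

lemma cells_mem: "l \<in> set (cells x j) \<longleftrightarrow> (\<exists>a<j. l = Suc (x + 2 * a))"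
  unfolding set_cells by (rule iffI) (blast | force)+

lemma prod_cells: "(\<Prod>l\<in>set (cells x j). k) = (k :: rat) ^ j"
proof -
  have "card (set (cells x j)) = j" unfolding set_cells by (subst card_image) (simp_all add: inj_on_def)
  then show ?thesis by simp
qed

lemma pairs_ht: "(\<And>a. a < j \<Longrightarrow> d (Suc (x + 2 * a)) \<noteq> d (Suc (Suc (x + 2 * a)))) \<Longrightarrow> a \<le> j \<Longrightarrow> ht d (x + 2 * a) = ht d x"
proof (induction a)
  case (Suc a)
  then have "d (Suc (x + 2 * a)) \<noteq> d (Suc (Suc (x + 2 * a)))" "ht d (x + 2 * a) = ht d x" by auto
  then show ?case by simp
qed simp

lemma zig_ht: "zig x j s d \<Longrightarrow> a \<le> j \<Longrightarrow> ht d (x + 2 * a) = ht d x"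
  by (rule pairs_ht) (auto simp: zig_def)

lemma ht_ramp:
  assumes "\<And>l. x < l \<Longrightarrow> l \<le> x + k \<Longrightarrow> d l = s"
  shows "ht d (x + k) = ht d x + (if s then int k else - int k)"
  using assms
proof (induction k)
  case (Suc k)
  have "d (Suc (x + k)) = s" "ht d (x + k) = ht d x + (if s then int k else - int k)" using Suc by auto
  then show ?case by simp
qed simp

context odd_prime
begin

lemma gap_cells: "gap (cells x j)"
proof (induction j)
  case 0 show ?case unfolding cells_def by simp
next
  case (Suc j) then show ?case unfolding cells_def by (simp add: sorted_wrt_append)
qed

lemma psis_append: "psis N (xs @ ys) v = psis N xs (psis N ys v)"
  unfolding psis_def by simp

lemma zig_ax:
  assumes "zig x j s d" "l \<in> set (cells x j)"
  shows "ax d l = (if s then - (ht d x + 1) else ht d x + 1)" "d l = s" "d (Suc l) = (\<not> s)" "ht d (l - 1) = ht d x"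
proof -
  obtain a where a: "a < j" "l = Suc (x + 2 * a)" using assms(2) cells_mem by auto
  have "d l = s" "d (Suc l) = (\<not> s)" "ht d (l - 1) = ht d x"
    using assms(1) zig_ht[OF assms(1), of a] a unfolding zig_def by auto
  then show "ax d l = (if s then - (ht d x + 1) else ht d x + 1)" "d l = s" "d (Suc l) = (\<not> s)" "ht d (l - 1) = ht d x"
    unfolding ax_def by auto
qed

lemma psis_zig:
  assumes g: "good N d" and z: "zig x j s d" and N: "x + 2 * j \<le> N" and h: "s \<longrightarrow> 1 \<le> ht d x"
    and p: "\<not> [ht d x + 1 = 0] (mod int p)"
    and f: "\<And>l. flip (set (cells x j)) d l = d' l"
  shows "good N d'"
    "psis N (cells x j) (ww N (wt N d)) = sc (bet p (if s then - (ht d x + 1) else ht d x + 1) ^ j) (ww N (wt N d'))"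
proof -
  have l: "1 \<le> l \<and> l < N \<and> d l \<noteq> d (Suc l) \<and> (d l \<longrightarrow> 1 \<le> ht d (l - 1))" if "l \<in> set (cells x j)" for l
    using zig_ax[OF z that] h N that unfolding cells_mem by auto
  have q: "\<not> [ax d l = 0] (mod int p)" if "l \<in> set (cells x j)" for l
    using zig_ax(1)[OF z that] p by (metis cong_0_iff dvd_minus_iff)
  have d': "flip (set (cells x j)) d = d'" using f by (rule ext)
  show "good N d'" unfolding d'[symmetric] by (rule psis_flip(1)[OF g gap_cells]) (use l q in blast)+
  have "(\<Prod>l\<in>set (cells x j). bet p (ax d l)) = (\<Prod>l\<in>set (cells x j). bet p (if s then - (ht d x + 1) else ht d x + 1))"
    by (rule prod.cong[OF refl]) (simp only: zig_ax(1)[OF z])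
  then show "psis N (cells x j) (ww N (wt N d)) = sc (bet p (if s then - (ht d x + 1) else ht d x + 1) ^ j) (ww N (wt N d'))"
    using psis_flip(2)[OF g gap_cells, of x j] l q unfolding d' prod_cells by simp
qed

lemma bet_nonzero: "r \<le> -2 \<Longrightarrow> bet p r \<noteq> 0"
proof -
  assume r: "r \<le> -2"
  have "rat_of_int r \<le> of_int (-2)" using r unfolding of_int_le_iff .
  then have q: "rat_of_int r \<le> -2" by simp
  have "0 \<le> (rat_of_int r + 2) * (rat_of_int r - 2)" using q by (intro mult_nonpos_nonpos) auto
  then have "1 < (rat_of_int r)\<^sup>2" by (simp add: algebra_simps power2_eq_square)
  then show ?thesis using q r unfolding bet_def Let_def by simp
qed

text \<open>A pair of steps met with axial distance \<open>- h\<close> on the way in is met with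
  \<open>h\<close> on the way out. In general the two coefficients are \<open>- (h - 1) / h\<close>
  and \<open>h / (1 - h)\<close>, which cancel; at residue 1 the KLR coefficient lacks its
  denominator, which leaves \<open>h + 1\<close> or \<open>1 - h\<close>.\<close>

lemma bet_pair:
  assumes h: "2 \<le> h" and p: "\<not> [h = 0] (mod int p)"
  shows "bet p (- h) * bet p h = (if [h = -1] (mod int p) then of_int h + 1 else if [h = 1] (mod int p) then 1 - of_int h else 1)"
proof -
  have q: "rat_of_int h \<ge> of_int 2" using h unfolding of_int_le_iff .
  have nz: "rat_of_int h \<noteq> 0" "1 - rat_of_int h \<noteq> 0" "1 + rat_of_int h \<noteq> 0" using q by auto
  have 1: "[- h = 0] (mod int p) \<longleftrightarrow> False" "[- h = 1] (mod int p) \<longleftrightarrow> [h = -1] (mod int p)"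
    using p cong_minus_minus_iff[of h 0] cong_minus_minus_iff[of h "-1"] by auto
  have 2: "\<not> ([h = -1] (mod int p) \<and> [h = 1] (mod int p))"
  proof
    assume "[h = -1] (mod int p) \<and> [h = 1] (mod int p)"
    then have "[1 = -1] (mod int p)" using cong_trans cong_sym by blast
    then have "int p dvd 2" by (simp add: cong_iff_dvd_diff)
    then show False using p3 zdvd_imp_le by fastforce
  qed
  have e: "(of_int h ^ 2 - 1) / of_int h ^ 2 * rat_of_int (- h) = - ((of_int h - 1) * (1 + of_int h) / of_int h)"
    using nz by (simp add: field_simps power2_eq_square)
  have m: "bet p (- h) = (if [h = -1] (mod int p) then - ((of_int h - 1) * (1 + of_int h) / of_int h) else - ((of_int h - 1) / of_int h))"
    unfolding bet_def Let_def 1 using h nz e by (auto simp: divide_simps)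
  have n: "bet p h = (if [h = 1] (mod int p) then of_int h else of_int h / (1 - of_int h))"
    unfolding bet_def Let_def using p h by auto
  show ?thesis unfolding m n using 2 nz by (auto simp: field_simps)
qed

end

text \<open>A stretched peak: p steps up and p steps down from height \<open>m * p - 1\<close>,
  where \<open>m\<close> is the absolute value of the axial distance at the corresponding peak of
  the short walk.\<close>

locale peak_walk = odd_prime +
  fixes N b m :: nat and c :: "nat \<Rightarrow> bool"
  assumes good_c: "good N c" and bN: "b + 2 * p \<le> N" and m1: "1 \<le> m"
    and asc: "\<And>l. b < l \<Longrightarrow> l \<le> b + p \<Longrightarrow> c l"
    and desc: "\<And>l. b + p < l \<Longrightarrow> l \<le> b + 2 * p \<Longrightarrow> \<not> c l"
    and ht_b: "ht c b + 1 = int (m * p)"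
begin

text \<open>\<open>Pw j\<close> is the walk with the tip of the peak cut down to a zigzag by \<open>\<Psi>_1, \<dots>, \<Psi>_j\<close>; \<open>Vw j\<close> is the valley
  obtained by reflecting the peak, filled up to the same zigzag. Here \<open>b = i p - 1\<close>.\<close>

definition Pw :: "nat \<Rightarrow> nat \<Rightarrow> bool" where
  "Pw j l = (if b + p < l + j \<and> l \<le> b + p + j then even (l + b + p + j) else c l)"

definition Vw :: "nat \<Rightarrow> nat \<Rightarrow> bool" where
  "Vw j l = (if b + p < l + j \<and> l \<le> b + p + j then odd (l + b + p + j) else if b < l \<and> l \<le> b + 2 * p then \<not> c l else c l)"

lemma flip_cells: "flip (set (cells x j)) d l = (if x < l \<and> l \<le> x + 2 * j then \<not> d l else d l)"
proof -
  have "(l \<in> set (cells x j) \<or> (\<exists>k\<in>set (cells x j). l = Suc k)) \<longleftrightarrow> x < l \<and> l \<le> x + 2 * j"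
  proof
    assume "l \<in> set (cells x j) \<or> (\<exists>k\<in>set (cells x j). l = Suc k)"
    then show "x < l \<and> l \<le> x + 2 * j" by (auto simp: cells_mem)
  next
    assume l: "x < l \<and> l \<le> x + 2 * j"
    then obtain k where k: "l = Suc (x + k)" using less_iff_Suc_add[of x l] by auto
    then have k2: "k < 2 * j" using l by simp
    show "l \<in> set (cells x j) \<or> (\<exists>k\<in>set (cells x j). l = Suc k)"
    proof (cases "even k")
      case True
      then obtain a where "k = 2 * a" by blast
      then have "l \<in> set (cells x j)" unfolding cells_mem using k k2 by auto
      then show ?thesis by simp
    next
      case False
      then obtain a where "k = 2 * a + 1" using oddE by blast
      then have "Suc (x + 2 * a) \<in> set (cells x j)" "l = Suc (Suc (x + 2 * a))" unfolding cells_mem using k k2 by auto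
      then show ?thesis by blast
    qed
  qed
  then show ?thesis unfolding flip_def by auto
qed

lemma Pw_0: "Pw 0 = c"
  unfolding Pw_def by (rule ext) auto

lemma Pw_ht:
  assumes "e + j = p"
  shows "ht (Pw j) (b + e) + 1 = int (m * p) + int e" "1 \<le> e \<Longrightarrow> ht (Pw j) (b + e - 1) + 1 = int (m * p) + int e - 1"
proof -
  have *: "ht (Pw j) (b + k) + 1 = int (m * p) + int k" if "k \<le> e" for k
  proof -
    have "ht (Pw j) (b + k) = ht c (b + k)" by (rule ht_cong) (use assms that in \<open>auto simp: Pw_def\<close>)
    also have "\<dots> = ht c b + (if True then int k else - int k)" by (rule ht_ramp) (use asc assms that in auto)
    finally show ?thesis using ht_b by simp
  qed
  show "ht (Pw j) (b + e) + 1 = int (m * p) + int e" using *[of e] by simp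
  show "ht (Pw j) (b + e - 1) + 1 = int (m * p) + int e - 1" if "1 \<le> e" using *[of "e - 1"] that by (simp add: of_nat_diff)
qed

lemma Vw_ht:
  assumes "e + j = p"
  shows "ht (Vw j) (b + e) + 1 = int (m * p) - int e"
proof -
  have "ht (Vw j) (b + e) = ht (Vw j) b + (if False then int e else - int e)" by (rule ht_ramp) (use asc assms in \<open>auto simp: Vw_def\<close>)
  also have "ht (Vw j) b = ht c b" by (rule ht_cong) (use assms in \<open>auto simp: Vw_def\<close>)
  finally show ?thesis using ht_b by simp
qed

lemma zig_Pw: "e + j = p \<Longrightarrow> zig (b + e) j False (Pw j)"
  unfolding zig_def Pw_def by auto

lemma zig_Pw_Suc:
  assumes "e + Suc j = p"
  shows "zig (b + e) (Suc j) True (Pw j)"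
  unfolding zig_def
proof (intro allI impI)
  fix a assume a: "a < Suc j"
  have p: "p = e + Suc j" using assms by simp
  have "Pw j (Suc (b + e + 2 * a))"
  proof (cases "a = 0")
    case True then show ?thesis using asc[of "Suc (b + e)"] p unfolding Pw_def by simp
  next
    case False then show ?thesis using a p unfolding Pw_def by auto
  qed
  moreover have "\<not> Pw j (Suc (Suc (b + e + 2 * a)))"
  proof (cases "a = j")
    case True then show ?thesis using desc[of "Suc (Suc (b + e + 2 * a))"] p unfolding Pw_def by simp
  next
    case False then show ?thesis using a p unfolding Pw_def by auto
  qed
  ultimately show "Pw j (Suc (b + e + 2 * a)) = True \<and> Pw j (Suc (Suc (b + e + 2 * a))) = (\<not> True)" by simp
qed

lemma zig_Vw: "e + j = p \<Longrightarrow> zig (b + e) j True (Vw j)"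
  unfolding zig_def Vw_def by auto

lemma flip_Pw:
  assumes "e + Suc j = p"
  shows "flip (set (cells (b + e) (Suc j))) (Pw j) l = Pw (Suc j) l"
    and "flip (set (cells (b + e) (Suc j))) (Pw (Suc j)) l = Pw j l"
proof -
  have p: "p = e + Suc j" using assms by simp
  consider "l = Suc (b + e)" | "l = b + e + 2 * Suc j" | "Suc (b + e) < l \<and> l < b + e + 2 * Suc j" | "l \<le> b + e \<or> b + e + 2 * Suc j < l" by linarith
  then have "(if b + e < l \<and> l \<le> b + e + 2 * Suc j then \<not> Pw j l else Pw j l) = Pw (Suc j) l"
  proof cases
    case 1
    have "\<not> b + p < l + j" "b + p < l + Suc j" "l \<le> b + p + Suc j" "odd (l + b + p + Suc j)" "b + e < l" "l \<le> b + e + 2 * Suc j" "b < l" "l \<le> b + 2 * p"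
      using 1 p by presburger+
    moreover have "c l" using asc[of l] 1 p by simp
    ultimately show ?thesis unfolding Pw_def by (simp only: if_True if_False simp_thms)
  next
    case 2
    have "\<not> l \<le> b + p + j" "b + p < l + Suc j" "l \<le> b + p + Suc j" "even (l + b + p + Suc j)" "b + e < l" "l \<le> b + e + 2 * Suc j" "b < l" "l \<le> b + 2 * p"
      using 2 p by presburger+
    moreover have "\<not> c l" using desc[of l] 2 p by simp
    ultimately show ?thesis unfolding Pw_def by (simp only: if_True if_False simp_thms)
  next
    case 3
    then have "b + e < l" "l \<le> b + e + 2 * Suc j" "b + p < l + Suc j" "l \<le> b + p + Suc j" "b + p < l + j" "l \<le> b + p + j"
      using p by simp_all
    then show ?thesis unfolding Pw_def by simp
  next
    case 4
    then have "\<not> (b + e < l \<and> l \<le> b + e + 2 * Suc j)" "\<not> (b + p < l + Suc j \<and> l \<le> b + p + Suc j)" "\<not> (b + p < l + j \<and> l \<le> b + p + j)"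
      using p by auto
    then show ?thesis unfolding Pw_def by (simp only: if_False)
  qed
  then show "flip (set (cells (b + e) (Suc j))) (Pw j) l = Pw (Suc j) l"
     "flip (set (cells (b + e) (Suc j))) (Pw (Suc j)) l = Pw j l" unfolding flip_cells by (auto split: if_splits)
qed

lemma flip_Vw:
  assumes "e + Suc j = p"
  shows "flip (set (cells (b + e) (Suc j))) (Vw (Suc j)) l = Vw j l"
proof -
  have p: "p = e + Suc j" using assms by simp
  consider "l = Suc (b + e)" | "l = b + e + 2 * Suc j" | "Suc (b + e) < l \<and> l < b + e + 2 * Suc j" | "l \<le> b + e \<or> b + e + 2 * Suc j < l" by linarith
  then show ?thesis
  proof cases
    case 1
    have "\<not> b + p < l + j" "b + p < l + Suc j" "l \<le> b + p + Suc j" "odd (l + b + p + Suc j)" "b + e < l" "l \<le> b + e + 2 * Suc j" "b < l" "l \<le> b + 2 * p"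
      using 1 p by presburger+
    moreover have "c l" using asc[of l] 1 p by simp
    ultimately show ?thesis unfolding Vw_def flip_cells by (simp only: if_True if_False simp_thms)
  next
    case 2
    have "\<not> l \<le> b + p + j" "b + p < l + Suc j" "l \<le> b + p + Suc j" "even (l + b + p + Suc j)" "b + e < l" "l \<le> b + e + 2 * Suc j" "b < l" "l \<le> b + 2 * p"
      using 2 p by presburger+
    moreover have "\<not> c l" using desc[of l] 2 p by simp
    ultimately show ?thesis unfolding Vw_def flip_cells by (simp only: if_True if_False simp_thms)
  next
    case 3
    then have "b + e < l" "l \<le> b + e + 2 * Suc j" "b + p < l + Suc j" "l \<le> b + p + Suc j" "b + p < l + j" "l \<le> b + p + j"
      using p by simp_all
    then show ?thesis unfolding Vw_def flip_cells by simp
  next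
    case 4
    then have "\<not> (b + e < l \<and> l \<le> b + e + 2 * Suc j)" "\<not> (b + p < l + Suc j \<and> l \<le> b + p + Suc j)" "\<not> (b + p < l + j \<and> l \<le> b + p + j)"
      using p by auto
    then show ?thesis unfolding Vw_def flip_cells by (simp only: if_False)
  qed
qed

abbreviation Cs :: "nat \<Rightarrow> nat list" where
  "Cs j \<equiv> cells (b + (p - j)) j"

lemma mp_shift: "0 < e \<Longrightarrow> e < p \<Longrightarrow> \<not> [int (k * p) + int e = 0] (mod int p)" "0 < e \<Longrightarrow> e < p \<Longrightarrow> \<not> [int (k * p) - int e = 0] (mod int p)"
proof -
  assume e: "0 < e" "e < p"
  have "\<not> int p dvd int e" using e by (simp add: nat_dvd_not_less)
  then show "\<not> [int (k * p) + int e = 0] (mod int p)" "\<not> [int (k * p) - int e = 0] (mod int p)"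
    unfolding cong_0_iff using dvd_triv_right[of "int p" "int k"]
    by (simp_all add: dvd_add_right_iff dvd_diff_right_iff)
qed

text \<open>\<open>\<Psi>_q\<close> meets q peaks side by side, all starting at height
  \<open>m * p + (p - q) - 1\<close>. Their axial distance is not divisible by p as long as
  \<open>q < p\<close>, so all of them are turned into valleys.\<close>

lemma ascent:
  assumes "j < p"
  shows "good N (Pw j) \<and> psis N (concat (map Cs (rev [1..<Suc j]))) (ww N (wt N c)) =
    sc (\<Prod>q\<in>{1..j}. bet p (- int (m * p) - int (p - q)) ^ q) (ww N (wt N (Pw j)))"
  using assms
proof (induction j)
  case 0
  show ?case using good_c unfolding Pw_0 psis_def by (simp add: sc_simps)
next
  case (Suc j)
  define e where "e = p - Suc j"
  have e: "e + Suc j = p" "0 < e" "e < p" using Suc.prems unfolding e_def by auto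
  have eq: "Suc e + j = p" using e by simp
  have ht: "ht (Pw j) (b + e) + 1 = int (m * p) + int e" using Pw_ht(2)[OF eq] by simp
  have "1 \<le> m * p" using m1 p3 by simp
  then have big: "1 \<le> int (m * p)" by linarith
  have IH: "good N (Pw j)" "psis N (concat (map Cs (rev [1..<Suc j]))) (ww N (wt N c)) =
    sc (\<Prod>q\<in>{1..j}. bet p (- int (m * p) - int (p - q)) ^ q) (ww N (wt N (Pw j)))" using Suc by auto
  have "\<not> [ht (Pw j) (b + e) + 1 = 0] (mod int p)" unfolding ht by (rule mp_shift(1)[OF e(2,3)])
  note z = psis_zig[OF IH(1) zig_Pw_Suc[OF e(1)] _ _ this flip_Pw(1)[OF e(1)]]
  have N: "b + e + 2 * Suc j \<le> N" using bN e by simp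
  have h1: "1 \<le> ht (Pw j) (b + e)" using ht big e by linarith
  note z = z[OF N impI[OF h1]]
  have r: "- (int (m * p) + int e) = - int (m * p) - int (p - Suc j)" unfolding e_def by simp
  have l: "concat (map Cs (rev [1..<Suc (Suc j)])) = cells (b + e) (Suc j) @ concat (map Cs (rev [1..<Suc j]))"
    unfolding e_def by simp
  have "psis N (concat (map Cs (rev [1..<Suc (Suc j)]))) (ww N (wt N c)) =
     sc (\<Prod>q\<in>{1..j}. bet p (- int (m * p) - int (p - q)) ^ q) (sc (bet p (- int (m * p) - int (p - Suc j)) ^ Suc j) (ww N (wt N (Pw (Suc j)))))"
    unfolding l psis_append IH(2) psis_linear z(2) ht r by (simp only: if_True)
  then show ?case using z(1) by (simp add: sc_simps)
qed

text \<open>The same layers in reverse order: each zigzag of valleys is turned back into peaks, at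
  the same axial distances with the opposite sign.\<close>

lemma descent:
  assumes "j < p" "good N (Pw j)"
  shows "psis N (concat (map Cs [1..<Suc j])) (ww N (wt N (Pw j))) =
    sc (\<Prod>q\<in>{1..j}. bet p (int (m * p) + int (p - q)) ^ q) (ww N (wt N c))"
  using assms
proof (induction j)
  case 0
  show ?case unfolding Pw_0 psis_def by (simp add: sc_simps)
next
  case (Suc j)
  define e where "e = p - Suc j"
  have e: "e + Suc j = p" "0 < e" "e < p" using Suc.prems unfolding e_def by auto
  have ht: "ht (Pw (Suc j)) (b + e) + 1 = int (m * p) + int e" using Pw_ht(1)[OF e(1)] by simp
  have "\<not> [ht (Pw (Suc j)) (b + e) + 1 = 0] (mod int p)" unfolding ht by (rule mp_shift(1)[OF e(2,3)])
  note z = psis_zig[OF Suc.prems(2) zig_Pw[OF e(1)] _ _ this flip_Pw(2)[OF e(1)]]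
  have N: "b + e + 2 * Suc j \<le> N" using bN e by simp
  have "False \<longrightarrow> 1 \<le> ht (Pw (Suc j)) (b + e)" by simp
  note z = z[OF N this]
  have r: "int (m * p) + int e = int (m * p) + int (p - Suc j)" unfolding e_def by simp
  have l: "concat (map Cs [1..<Suc (Suc j)]) = concat (map Cs [1..<Suc j]) @ cells (b + e) (Suc j)"
    unfolding e_def by simp
  have IH: "psis N (concat (map Cs [1..<Suc j])) (ww N (wt N (Pw j))) =
    sc (\<Prod>q\<in>{1..j}. bet p (int (m * p) + int (p - q)) ^ q) (ww N (wt N c))" using Suc.IH Suc.prems(1) z(1) by simp
  have "psis N (concat (map Cs [1..<Suc (Suc j)])) (ww N (wt N (Pw (Suc j)))) =
     sc (bet p (int (m * p) + int (p - Suc j)) ^ Suc j) (sc (\<Prod>q\<in>{1..j}. bet p (int (m * p) + int (p - q)) ^ q) (ww N (wt N c)))"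
    unfolding l psis_append z(2) psis_linear IH ht r by (simp only: if_False)
  then show ?case by (simp add: sc_simps mult.commute)
qed

text \<open>On the reflected walk the remaining layers deepen the valley, at axial distances of at
  most -2, where the coefficients do not vanish. For \<open>m = 1\<close> this fails at the last
  layer \<open>\<Psi>_1\<close>: it meets a peak that starts on the ground and yields 0.\<close>

lemma valley:
  assumes "j < p" "good N (Vw j)"
  shows "2 \<le> m \<Longrightarrow> good N (Vw 0) \<and> (\<exists>B. B \<noteq> 0 \<and> psis N (concat (map Cs [1..<Suc j])) (ww N (wt N (Vw j))) = sc B (ww N (wt N (Vw 0))))"
    and "m = 1 \<Longrightarrow> 1 \<le> j \<Longrightarrow> psis N (concat (map Cs [1..<Suc j])) (ww N (wt N (Vw j))) = 0"
proof -
  have "(2 \<le> m \<longrightarrow> good N (Vw 0) \<and> (\<exists>B. B \<noteq> 0 \<and> psis N (concat (map Cs [1..<Suc j])) (ww N (wt N (Vw j))) = sc B (ww N (wt N (Vw 0))))) \<and>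
      (m = 1 \<longrightarrow> 1 \<le> j \<longrightarrow> psis N (concat (map Cs [1..<Suc j])) (ww N (wt N (Vw j))) = 0)"
    using assms
  proof (induction j)
    case 0
    have "psis N (concat (map Cs [1..<Suc 0])) (ww N (wt N (Vw 0))) = sc 1 (ww N (wt N (Vw 0)))" unfolding psis_def by (simp add: sc_simps)
    then show ?case using 0 by (intro conjI impI exI[of _ 1]) simp_all
  next
    case (Suc j)
    define e where "e = p - Suc j"
    have e: "e + Suc j = p" "0 < e" "e < p" using Suc.prems unfolding e_def by auto
    have ht: "ht (Vw (Suc j)) (b + e) + 1 = int (m * p) - int e" by (rule Vw_ht[OF e(1)])
    have N: "b + e + 2 * Suc j \<le> N" using bN e by simp
    have l: "concat (map Cs [1..<Suc (Suc j)]) = concat (map Cs [1..<Suc j]) @ cells (b + e) (Suc j)"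
      unfolding e_def by simp
    show ?case
    proof (cases "m = 1 \<and> j = 0")
      case True
      have z: "Vw (Suc j) (Suc (b + e))" "\<not> Vw (Suc j) (Suc (Suc (b + e)))"
        using zig_Vw[OF e(1)] unfolding zig_def by (auto dest: spec[of _ 0])
      have "int (m * p) - int e = 1" using True e(1) by auto
      then have "ht (Vw (Suc j)) (Suc (b + e) - 1) = 0" using ht by simp
      then have k: "rho N (psi p N (Suc (b + e))) (ww N (wt N (Vw (Suc j)))) = 0"
        by (intro psi_walk(2)[OF Suc.prems(2)] z) (use N in auto)
      have "psis N (concat (map Cs [1..<Suc (Suc j)])) (ww N (wt N (Vw (Suc j)))) = rho N (psi p N (Suc (b + e))) (ww N (wt N (Vw (Suc j))))"
        unfolding l using True by (simp add: psis_def cells_def)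
      then show ?thesis unfolding k using True by simp
    next
      case False
      have "2 \<le> int (m * p) - int e"
      proof (cases "m = 1")
        case True then show ?thesis using False e(1) by auto
      next
        case False
        then have "2 * p \<le> m * p" using m1 by (intro mult_le_mono1) simp
        then have "2 * int p \<le> int (m * p)" by (metis of_nat_le_iff of_nat_mult of_nat_numeral)
        then show ?thesis using e p3 by linarith
      qed
      then have h1: "1 \<le> ht (Vw (Suc j)) (b + e)" using ht by linarith
      have nz: "bet p (- (int (m * p) - int e)) ^ Suc j \<noteq> 0"
        using bet_nonzero[of "- (int (m * p) - int e)"] \<open>2 \<le> int (m * p) - int e\<close> by (simp del: of_nat_mult)
      have "\<not> [ht (Vw (Suc j)) (b + e) + 1 = 0] (mod int p)" unfolding ht by (rule mp_shift(2)[OF e(2,3)])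
      note z = psis_zig[OF Suc.prems(2) zig_Vw[OF e(1)] N impI[OF h1] this flip_Vw[OF e(1)]]
      have gj: "j < p" using Suc.prems(1) by simp
      note IH = Suc.IH[OF gj z(1)]
      have s: "psis N (concat (map Cs [1..<Suc (Suc j)])) (ww N (wt N (Vw (Suc j)))) =
        sc (bet p (- (int (m * p) - int e)) ^ Suc j) (psis N (concat (map Cs [1..<Suc j])) (ww N (wt N (Vw j))))"
        unfolding l psis_append z(2) psis_linear ht by (simp only: if_True)
      show ?thesis
      proof (intro conjI impI)
        assume m: "2 \<le> m"
        show "good N (Vw 0)" using IH m by blast
        obtain B where B: "B \<noteq> 0" "psis N (concat (map Cs [1..<Suc j])) (ww N (wt N (Vw j))) = sc B (ww N (wt N (Vw 0)))"
          using IH m by blast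
        show "\<exists>B. B \<noteq> 0 \<and> psis N (concat (map Cs [1..<Suc (Suc j)])) (ww N (wt N (Vw (Suc j)))) = sc B (ww N (wt N (Vw 0)))"
          unfolding s B(2) using B(1) nz by (intro exI[of _ "bet p (- (int (m * p) - int e)) ^ Suc j * B"]) (simp add: sc_simps)
      next
        assume m: "m = 1" "1 \<le> Suc j"
        then have "psis N (concat (map Cs [1..<Suc j])) (ww N (wt N (Vw j))) = 0"
          by (intro conjunct2[OF IH, THEN mp, THEN mp]) (use False m in simp_all)
        then show "psis N (concat (map Cs [1..<Suc (Suc j)])) (ww N (wt N (Vw (Suc j)))) = 0"
          unfolding s by (simp only: sc_simps)
      qed
    qed
  qed
  then show "2 \<le> m \<Longrightarrow> good N (Vw 0) \<and> (\<exists>B. B \<noteq> 0 \<and> psis N (concat (map Cs [1..<Suc j])) (ww N (wt N (Vw j))) = sc B (ww N (wt N (Vw 0))))"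
    and "m = 1 \<Longrightarrow> 1 \<le> j \<Longrightarrow> psis N (concat (map Cs [1..<Suc j])) (ww N (wt N (Vw j))) = 0" by blast+
qed

lemma psis_sum: "psis N ls (\<Sum>F\<in>A. g F) = (\<Sum>F\<in>A. psis N ls (g F))"
  by (induction ls) (simp_all only: psis_def foldr.simps o_apply id_apply rho_vsum)

text \<open>Here all p peaks have axial distance \<open>- m p\<close>, divisible by p, so each of
  them may stay, with coefficient \<open>1 / (m p)\<close>, or flip. A mixed choice treats two
  neighbouring peaks differently; the two steps between them are then equal, and
  \<open>\<Psi>_{p-1}\<close> kills the term.\<close>

lemma apex:
  assumes "good N (Pw (p - 1))"
  shows "good N (Vw (p - 1))"
    "psis N (Cs (p - 1)) (psis N (cells b p) (ww N (wt N (Pw (p - 1))))) =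
     sc ((1 / of_int (int (m * p))) ^ p) (psis N (Cs (p - 1)) (ww N (wt N (Pw (p - 1))))) +
     sc (bet p (- int (m * p)) ^ p) (psis N (Cs (p - 1)) (ww N (wt N (Vw (p - 1)))))"
proof -
  let ?D = "Pw (p - 1)" and ?S = "set (cells b p)"
  have p1: "0 + Suc (p - 1) = p" "1 + (p - 1) = p" using p3 by auto
  have z: "zig b p True ?D" using zig_Pw_Suc[OF p1(1)] p1(1) by simp
  have htc: "ht ?D b = ht c b" by (rule ht_cong) (use p3 in \<open>auto simp: Pw_def\<close>)
  have ht: "ht ?D b + 1 = int (m * p)" using htc ht_b by simp
  have "p \<le> m * p" using m1 by simp
  then have mp: "3 \<le> int (m * p)" using p3 by linarith
  have l: "1 \<le> l \<and> l < N \<and> ?D l \<noteq> ?D (Suc l) \<and> (?D l \<longrightarrow> 1 \<le> ht ?D (l - 1))" if "l \<in> ?S" for l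
    using zig_ax[OF z that] ht mp bN that unfolding cells_mem by auto
  have axv: "ax ?D l = - int (m * p)" if "l \<in> ?S" for l using zig_ax(1)[OF z that] ht by simp
  let ?co = "\<lambda>F. (\<Prod>l\<in>F. bet p (ax ?D l)) * (\<Prod>l\<in>?S - F. - del p (ax ?D l))"
  have ex: "\<forall>F\<subseteq>?S. good N (flip F ?D)"
    "psis N (cells b p) (ww N (wt N ?D)) = (\<Sum>F\<in>Pow ?S. sc (?co F) (ww N (wt N (flip F ?D))))"
    using psis_expand[OF assms gap_cells, of b p] l by blast+
  have full: "flip ?S ?D = Vw (p - 1)"
  proof
    fix l
    have "?D l \<longleftrightarrow> \<not> Vw (p - 1) l" if "b < l" "l \<le> b + 2 * p"
      using that unfolding Pw_def Vw_def by auto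
    moreover have "?D l \<longleftrightarrow> Vw (p - 1) l" if "\<not> (b < l \<and> l \<le> b + 2 * p)"
    proof -
      have "\<not> (b + p < l + (p - 1) \<and> l \<le> b + p + (p - 1))" using that p3 by linarith
      then show ?thesis using that unfolding Pw_def Vw_def by (simp only: if_False)
    qed
    ultimately show "flip ?S ?D l = Vw (p - 1) l" unfolding flip_cells by auto
  qed
  show "good N (Vw (p - 1))" using ex(1) unfolding full[symmetric] by blast
  have kill: "psis N (Cs (p - 1)) (ww N (wt N (flip F ?D))) = 0" if F: "F \<subseteq> ?S" "F \<noteq> {}" "F \<noteq> ?S" for F
  proof -
    let ?d = "flip F ?D"
    have Fm: "\<exists>a<p. k = Suc (b + 2 * a)" if "k \<in> F" for k using F(1) that cells_mem by blast
    have pe: "Suc (b + 2 * a) \<noteq> b + 2 * a'" for a a' by presburger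
    have d1: "?d (Suc (b + 2 * a)) \<longleftrightarrow> Suc (b + 2 * a) \<notin> F" "?d (Suc (Suc (b + 2 * a))) \<longleftrightarrow> Suc (b + 2 * a) \<in> F" if a: "a < p" for a
    proof -
      have D: "?D (Suc (b + 2 * a))" "\<not> ?D (Suc (Suc (b + 2 * a)))" using z a unfolding zig_def by auto
      have n1: "\<not> (\<exists>k\<in>F. Suc (b + 2 * a) = Suc k)" using Fm pe by (metis Suc_inject)
      have n2: "Suc (Suc (b + 2 * a)) \<notin> F" using Fm pe by (metis Suc_inject)
      show "?d (Suc (b + 2 * a)) \<longleftrightarrow> Suc (b + 2 * a) \<notin> F" using D(1) n1 unfolding flip_def by simp
      show "?d (Suc (Suc (b + 2 * a))) \<longleftrightarrow> Suc (b + 2 * a) \<in> F" using D(2) n2 unfolding flip_def by auto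
    qed
    show ?thesis
    proof (rule psis_kill)
    show "good N ?d" using ex(1) F by blast
    show "gap (Cs (p - 1))" by (rule gap_cells)
    have hd: "ht ?d (b + 2 * a) = ht c b" if "a \<le> p" for a
    proof -
      have "ht ?d (b + 2 * a) = ht ?d b" by (rule pairs_ht[OF _ that]) (use d1 in simp)
      also have "ht ?d b = ht ?D b" by (rule ht_cong, rule flip_prefix) (use Fm in fastforce)
      finally show ?thesis using htc by simp
    qed
    have Cs_mem: "\<exists>a. Suc a < p \<and> l = Suc (Suc (b + 2 * a))" if "l \<in> set (Cs (p - 1))" for l
      using that p3 unfolding cells_mem by force
    fix l assume "l \<in> set (Cs (p - 1))"
    then obtain a where a: "Suc a < p" "l = Suc (Suc (b + 2 * a))" using Cs_mem by blast
    have "1 \<le> ht ?d (l - 1)" if "?d l"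
    proof -
      have "\<not> ?d (Suc (b + 2 * a))" using that d1[of a] a by simp
      then have "ht ?d (l - 1) = ht c b - 1" using hd[of a] a by simp
      then show ?thesis using ht_b mp by simp
    qed
    then show "1 \<le> l \<and> l < N \<and> (?d l \<longrightarrow> ?d (Suc l) \<or> 1 \<le> ht ?d (l - 1))" using a bN by auto
  next
    show "\<exists>l\<in>set (Cs (p - 1)). ?d l = ?d (Suc l)"
    proof (rule ccontr)
      assume n: "\<not> (\<exists>l\<in>set (Cs (p - 1)). ?d l = ?d (Suc l))"
      \<comment> \<open>The last step of one pair and the first step of the next differ exactly if
        both pairs are flipped or neither is.\<close>
      have st: "Suc (b + 2 * a) \<in> F \<longleftrightarrow> Suc (b + 2 * Suc a) \<in> F" if a: "Suc a < p" for a
      proof -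
        have "Suc (Suc (b + 2 * a)) \<in> set (Cs (p - 1))" unfolding cells_mem using a by (intro exI[of _ a]) simp
        then have "?d (Suc (Suc (b + 2 * a))) \<noteq> ?d (Suc (b + 2 * Suc a))" using n by auto
        then show ?thesis using d1(2)[of a] d1(1)[of "Suc a"] a by simp
      qed
      have all: "a < p \<Longrightarrow> Suc (b + 2 * a) \<in> F \<longleftrightarrow> Suc b \<in> F" for a
        by (induction a) (use st in auto)
      show False
      proof (cases "Suc b \<in> F")
        case True
        then have "?S \<subseteq> F" using all unfolding set_cells by auto
        then show False using F by auto
      next
        case False
        then have "F = {}" using all Fm by blast
        then show False using F by simp
      qed
    qed
  qed
  qed
  have ne: "?S \<noteq> {}" using p3 unfolding set_cells by (simp add: lessThan_empty_iff)
  have co: "?co {} = (1 / of_int (int (m * p))) ^ p" "?co ?S = bet p (- int (m * p)) ^ p"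
  proof -
    have dl: "- del p (- int (m * p)) = 1 / of_int (int (m * p))"
      unfolding del_def cong_0_iff by simp
    have "(\<Prod>l\<in>?S. - del p (ax ?D l)) = (\<Prod>l\<in>?S. 1 / of_int (int (m * p)))"
      by (rule prod.cong[OF refl]) (simp only: axv dl)
    then show "?co {} = (1 / of_int (int (m * p))) ^ p" unfolding prod_cells by (simp only: Diff_empty prod.empty mult_1)
    have "(\<Prod>l\<in>?S. bet p (ax ?D l)) = (\<Prod>l\<in>?S. bet p (- int (m * p)))"
      by (rule prod.cong[OF refl]) (simp only: axv)
    then show "?co ?S = bet p (- int (m * p)) ^ p" unfolding prod_cells by (simp only: Diff_cancel prod.empty mult_1_right)
  qed
  have e0: "flip {} ?D = ?D" unfolding flip_def by (rule ext) simp
  have "psis N (Cs (p - 1)) (psis N (cells b p) (ww N (wt N ?D))) =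
      (\<Sum>F\<in>Pow ?S. sc (?co F) (psis N (Cs (p - 1)) (ww N (wt N (flip F ?D)))))"
    unfolding ex(2) psis_sum psis_linear ..
  also have "\<dots> = (\<Sum>F\<in>{{}, ?S}. sc (?co F) (psis N (Cs (p - 1)) (ww N (wt N (flip F ?D)))))"
  proof (rule sum.mono_neutral_right)
    show "\<forall>F\<in>Pow ?S - {{}, ?S}. sc (?co F) (psis N (Cs (p - 1)) (ww N (wt N (flip F ?D)))) = 0"
    proof
      fix F assume "F \<in> Pow ?S - {{}, ?S}"
      then have "psis N (Cs (p - 1)) (ww N (wt N (flip F ?D))) = 0" by (intro kill) auto
      then show "sc (?co F) (psis N (Cs (p - 1)) (ww N (wt N (flip F ?D)))) = 0" by (simp only: sc_simps)
    qed
  qed auto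
  also have "\<dots> = sc (?co {}) (psis N (Cs (p - 1)) (ww N (wt N (flip {} ?D)))) + sc (?co ?S) (psis N (Cs (p - 1)) (ww N (wt N (flip ?S ?D))))"
    using ne by (subst sum.insert) (auto simp only: finite.intros insert_iff empty_iff sum.insert sum.empty add_0_right simp_thms)
  finally show "psis N (Cs (p - 1)) (psis N (cells b p) (ww N (wt N (Pw (p - 1))))) =
     sc ((1 / of_int (int (m * p))) ^ p) (psis N (Cs (p - 1)) (ww N (wt N (Pw (p - 1))))) +
     sc (bet p (- int (m * p)) ^ p) (psis N (Cs (p - 1)) (ww N (wt N (Vw (p - 1)))))"
    unfolding co e0 full .
qed

text \<open>Only two layers survive the pairing of coefficients. The layer \<open>q = 1\<close> has
  distance \<open>(m + 1) p - 1\<close> and contributes \<open>(m + 1) p\<close>; the layer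
  \<open>q = p - 1\<close> has distance \<open>m p + 1\<close> and contributes the power
  \<open>p - 1\<close> of \<open>- m p\<close>. The diagonal terms at the apex divide by the p-th
  power of \<open>m p\<close>.\<close>

lemma coefficient:
  "(\<Prod>q\<in>{1..p - 1}. bet p (- int (m * p) - int (p - q)) ^ q) * (1 / of_int (int (m * p))) ^ p *
   (\<Prod>q\<in>{1..p - 1}. bet p (int (m * p) + int (p - q)) ^ q) = (of_nat m + 1) / of_nat m"
proof -
  define h where "h q = int (m * p) + int (p - q)" for q
  have "p \<le> m * p" using m1 by simp
  then have mp: "int p \<le> int (m * p)" by linarith
  have pair: "bet p (- h q) * bet p (h q) = (if q = 1 then of_int (h q) + 1 else if q = p - 1 then 1 - of_int (h q) else 1)"
    if q: "q \<in> {1..p - 1}" for q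
  proof -
    have hq: "h q = int (m * p) + int p - int q" unfolding h_def using q by auto
    have "q < p" using q p3 by auto
    then have qp: "int q < int p" "3 \<le> int p" "1 \<le> int q" using q p3 by auto
    then have 2: "2 \<le> h q" using mp unfolding hq by linarith
    have small: "\<And>x. 0 < x \<Longrightarrow> x < int p \<Longrightarrow> \<not> int p dvd x" using zdvd_imp_le by fastforce
    have dv: "int p dvd int (m * p) + int p - x \<longleftrightarrow> int p dvd x" for x
      by (rule dvd_diff_right_iff) simp
    have c0: "\<not> [h q = 0] (mod int p)" unfolding cong_0_iff hq dv using small[of "int q"] qp by linarith
    have "[h q = -1] (mod int p) \<longleftrightarrow> int p dvd int (m * p) + int p - (int q - 1)" unfolding cong_iff_dvd_diff hq by (simp add: algebra_simps)
    also have "\<dots> \<longleftrightarrow> q = 1" unfolding dv using small[of "int q - 1"] qp by (cases "q = 1") auto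
    finally have c1: "[h q = -1] (mod int p) \<longleftrightarrow> q = 1" .
    have "[h q = 1] (mod int p) \<longleftrightarrow> int p dvd int (m * p) + int p - (int q + 1)" unfolding cong_iff_dvd_diff hq by (simp add: algebra_simps)
    also have "\<dots> \<longleftrightarrow> q = p - 1" unfolding dv
    proof (cases "int q + 1 = int p")
      case True then show "int p dvd int q + 1 \<longleftrightarrow> q = p - 1" using \<open>q < p\<close> by auto
    next
      case False
      then have "\<not> int p dvd int q + 1" using small[of "int q + 1"] qp by linarith
      then show "int p dvd int q + 1 \<longleftrightarrow> q = p - 1" using False \<open>q < p\<close> by auto
    qed
    finally have c2: "[h q = 1] (mod int p) \<longleftrightarrow> q = p - 1" .
    show ?thesis unfolding bet_pair[OF 2 c0] c1 c2 ..
  qed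
  have x: "rat_of_int (int (m * p)) \<noteq> 0" "rat_of_nat m \<noteq> 0" using m1 p3 by auto
  have "(\<Prod>q\<in>{1..p - 1}. bet p (- h q) ^ q) * (\<Prod>q\<in>{1..p - 1}. bet p (h q) ^ q) = (\<Prod>q\<in>{1..p - 1}. (bet p (- h q) * bet p (h q)) ^ q)"
    unfolding prod.distrib[symmetric] power_mult_distrib ..
  also have "\<dots> = (\<Prod>q\<in>{1, p - 1}. (bet p (- h q) * bet p (h q)) ^ q)"
    by (rule prod.mono_neutral_right) (use p3 pair in auto)
  also have "\<dots> = (bet p (- h 1) * bet p (h 1)) * (bet p (- h (p - 1)) * bet p (h (p - 1))) ^ (p - 1)"
    using p3 by simp
  also have "bet p (- h 1) * bet p (h 1) = (of_nat m + 1) * of_nat p"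
    using pair[of 1] p3 unfolding h_def by (simp add: of_nat_diff algebra_simps)
  also have "bet p (- h (p - 1)) * bet p (h (p - 1)) = - of_int (int (m * p))"
    using pair[of "p - 1"] p3 unfolding h_def by (simp add: of_nat_diff)
  \<comment> \<open>As p is odd, the exponent is even and the sign disappears.\<close>
  also have "(- of_int (int (m * p)) :: rat) ^ (p - 1) = of_int (int (m * p)) ^ (p - 1)"
    using odd by simp
  finally have E: "(\<Prod>q\<in>{1..p - 1}. bet p (- h q) ^ q) * (\<Prod>q\<in>{1..p - 1}. bet p (h q) ^ q) =
     (of_nat m + 1) * of_nat p * of_int (int (m * p)) ^ (p - 1)" .
  have pw: "rat_of_int (int (m * p)) ^ p = of_int (int (m * p)) ^ (p - 1) * of_int (int (m * p))"
    using p3 by (metis One_nat_def Suc_pred less_le_trans power_Suc2 zero_less_numeral)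
  have mh: "- int (m * p) - int (p - q) = - h q" for q unfolding h_def by simp
  have "(\<Prod>q\<in>{1..p - 1}. bet p (- h q) ^ q) * (1 / of_int (int (m * p))) ^ p * (\<Prod>q\<in>{1..p - 1}. bet p (h q) ^ q) =
     ((\<Prod>q\<in>{1..p - 1}. bet p (- h q) ^ q) * (\<Prod>q\<in>{1..p - 1}. bet p (h q) ^ q)) * (1 / of_int (int (m * p))) ^ p" by (simp only: mult_ac)
  also have "\<dots> = (of_nat m + 1) / of_nat m"
    unfolding E power_divide pw using x by (simp add: field_simps)
  finally show ?thesis unfolding mh h_def[symmetric] .
qed

lemma diamond_peak:
  "\<exists>B. B \<noteq> 0 \<and> (2 \<le> m \<longrightarrow> good N (Vw 0)) \<and>
    psis N (concat (map Cs ([1..<p] @ [p] @ rev [1..<p]))) (ww N (wt N c)) =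
    sc ((of_nat m + 1) / of_nat m) (ww N (wt N c)) + (if 2 \<le> m then sc B (ww N (wt N (Vw 0))) else 0)"
proof -
  have p1: "p - 1 < p" "Suc (p - 1) = p" "1 \<le> p - 1" using p3 by auto
  note up = ascent[OF p1(1), unfolded p1(2)]
  note g = conjunct1[OF up] and up = conjunct2[OF up]
  note ap = apex[OF g]
  note dn = descent[OF p1(1) g, unfolded p1(2)]
  let ?A = "concat (map Cs [1..<p - 1])"
  have l: "concat (map Cs [1..<p]) = ?A @ Cs (p - 1)"
  proof -
    have "[1..<p] = [1..<p - 1] @ [p - 1]" using p1 by (metis upt_Suc_append)
    then show ?thesis by simp
  qed
  let ?E = "\<Prod>q\<in>{1..p - 1}. bet p (- int (m * p) - int (p - q)) ^ q"
  let ?k = "(1 / rat_of_int (int (m * p))) ^ p" and ?k' = "bet p (- int (m * p)) ^ p"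
  have ls: "concat (map Cs ([1..<p] @ [p] @ rev [1..<p])) = ?A @ Cs (p - 1) @ cells b p @ concat (map Cs (rev [1..<p]))"
    using l by simp
  have "psis N (concat (map Cs ([1..<p] @ [p] @ rev [1..<p]))) (ww N (wt N c)) =
     sc ?E (sc ?k (psis N (concat (map Cs [1..<p])) (ww N (wt N (Pw (p - 1))))) + sc ?k' (psis N (concat (map Cs [1..<p])) (ww N (wt N (Vw (p - 1))))))"
    unfolding ls l psis_append up psis_linear ap(2) ..
  also have "\<dots> = sc ((of_nat m + 1) / of_nat m) (ww N (wt N c)) + sc (?E * ?k') (psis N (concat (map Cs [1..<p])) (ww N (wt N (Vw (p - 1)))))"
    unfolding dn coefficient[symmetric] by (rule ext) (simp add: sc_def algebra_simps)
  finally have main: "psis N (concat (map Cs ([1..<p] @ [p] @ rev [1..<p]))) (ww N (wt N c)) =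
     sc ((of_nat m + 1) / of_nat m) (ww N (wt N c)) + sc (?E * ?k') (psis N (concat (map Cs [1..<p])) (ww N (wt N (Vw (p - 1)))))" .
  note va = valley[OF p1(1) ap(1), unfolded p1(2)]
  show ?thesis
  proof (cases "2 \<le> m")
    case True
    obtain B where B: "good N (Vw 0)" "B \<noteq> 0" "psis N (concat (map Cs [1..<p])) (ww N (wt N (Vw (p - 1)))) = sc B (ww N (wt N (Vw 0)))"
      using va(1)[OF True] by blast
    have "p \<le> m * p" using m1 by simp
    then have mp: "3 \<le> int (m * p)" using p3 by linarith
    \<comment> \<open>All axial distances on the way in are at most -2, where \<open>bet\<close>
      does not vanish.\<close>
    have "?E \<noteq> 0"
    proof (subst prod_zero_iff, simp, safe)
      fix q assume "bet p (- int (m * p) - int (p - q)) ^ q = 0"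
      then have "bet p (- int (m * p) - int (p - q)) = 0" by simp
      moreover have "- int (m * p) - int (p - q) \<le> -2" using mp by linarith
      ultimately show False using bet_nonzero by blast
    qed
    moreover have "?k' \<noteq> 0" using bet_nonzero[of "- int (m * p)"] mp by (simp del: of_nat_mult)
    ultimately have "?E * ?k' * B \<noteq> 0" using B(2) by simp
    then show ?thesis unfolding main B(3) using B(1) True by (intro exI[of _ "?E * ?k' * B"]) (simp add: sc_simps)
  next
    case False
    then have m: "m = 1" using m1 by simp
    show ?thesis unfolding main va(2)[OF m p1(3)] using False
      by (intro exI[of _ 1]) (simp only: sc_simps if_False simp_thms zero_neq_one one_neq_zero not_False_eq_True)
  qed
qed

end

section \<open>The residue block and the injections\<close>

text \<open>A stretched walk is constant from position \<open>i * p\<close> to the position before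
  \<open>(i + 1) * p\<close>, so its value at \<open>i * p\<close> is the i-th step of the short
  walk.\<close>

definition proj :: "nat \<Rightarrow> (nat \<Rightarrow> bool) \<Rightarrow> nat \<Rightarrow> bool" where
  "proj p c i = c (i * p)"

definition blk :: "nat \<Rightarrow> nat \<Rightarrow> (nat \<Rightarrow> bool) \<Rightarrow> bool" where
  "blk p N c \<longleftrightarrow> good N c \<and> (\<forall>l. 1 \<le> l \<and> l < N \<and> \<not> p dvd Suc l \<longrightarrow> c l = c (Suc l))"

text \<open>The stretched form of exchanging the steps \<open>i\<close> and \<open>i + 1\<close> of
  the short walk: when these steps differ, exchanging them negates both.\<close>

definition sb :: "nat \<Rightarrow> nat \<Rightarrow> (nat \<Rightarrow> bool) \<Rightarrow> nat \<Rightarrow> bool" where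
  "sb p i c l = (if i * p \<le> l \<and> l < (i + 2) * p then \<not> c l else c l)"

lemma sb_sb: "sb p i (sb p i c) = c"
  unfolding sb_def by (rule ext) simp

lemma good_1: "good N c \<Longrightarrow> 1 \<le> N \<Longrightarrow> c 1"
  unfolding good_def by (metis One_nat_def add.left_neutral ht.simps neg_0_le_iff_le not_one_le_zero)

lemma finite_block: "finite (residue_block p N)"
  by (rule finite_subset[OF _ finite_Std2[of N]]) (auto simp: residue_block_def)

lemma rho_block:
  assumes "t \<in> Std2 N"
  shows "rho N (block_idem p N) (ww N t) = (if t \<in> residue_block p N then ww N t else 0)"
proof -
  have "rho N (block_idem p N) (ww N t) = (\<Sum>s\<in>residue_block p N. rho N (seminormal_idem N s) (ww N t))"
    unfolding block_idem_def rho_sum ..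
  also have "\<dots> = (\<Sum>s\<in>residue_block p N. if s = t then ww N t else 0)"
    by (rule sum.cong[OF refl]) (simp only: rho_idem_ww[OF _ assms] residue_block_def mem_Collect_eq eq_commute[of t])
  also have "\<dots> = (if t \<in> residue_block p N then ww N t else 0)"
    by (rule sum.delta[OF finite_block])
  finally show ?thesis .
qed

context odd_prime
begin

section \<open>Stretched walks and the action of the diamond on them\<close>

lemma blk_const:
  assumes c: "blk p N c" and l: "1 \<le> l" "i * p \<le> l" "l < Suc i * p" "l \<le> N"
  shows "c l = c (if i = 0 then 1 else i * p)"
  using l
proof (induction l)
  case (Suc l)
  show ?case
  proof (cases "Suc l = (if i = 0 then 1 else i * p)")
    case False
    have "3 \<le> i * p" if "i \<noteq> 0" using p3 that mult_le_mono1[of 1 i p] by linarith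
    then have l: "1 \<le> l" "i * p \<le> l" using Suc.prems False by (auto split: if_splits)
    have "\<not> p dvd Suc l"
    proof
      assume "p dvd Suc l"
      then obtain k where k: "Suc l = p * k" by blast
      have "Suc l = k * p" using k by (simp add: mult.commute)
      then have "i * p < k * p" "k * p < Suc i * p" using l Suc.prems(3) by linarith+
      then have "i < k" "k < Suc i" by (meson mult_less_cancel2)+
      then show False by simp
    qed
    then have "c l = c (Suc l)" using c l Suc.prems unfolding blk_def by simp
    then show ?thesis using Suc.IH l Suc.prems by simp
  qed (simp only:)
qed simp

lemma blk_first: "blk p N c \<Longrightarrow> 1 \<le> l \<Longrightarrow> l < p \<Longrightarrow> l \<le> N \<Longrightarrow> c l"
  using blk_const[of N c l 0] good_1[of N c] unfolding blk_def by simp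

lemma blk_run: "blk p N c \<Longrightarrow> 1 \<le> i \<Longrightarrow> i * p \<le> l \<Longrightarrow> l < Suc i * p \<Longrightarrow> l \<le> N \<Longrightarrow> c l = proj p c i"
  using blk_const[of N c l i] p3 unfolding proj_def by (cases i) auto

text \<open>The first \<open>p - 1\<close> steps go up, from 0 to \<open>p - 1\<close>, and only
  then do the intervals of length p begin. This is why it is the height plus one that is multiplied
  by p.\<close>

lemma blk_ht:
  assumes c: "blk p N c"
  shows "Suc i * p - 1 \<le> N \<Longrightarrow> ht c (Suc i * p - 1) + 1 = int p * (ht (proj p c) i + 1)"
proof (induction i)
  case 0
  have "ht c (0 + (p - 1)) = ht c 0 + (if True then int (p - 1) else - int (p - 1))"
    by (rule ht_ramp) (use blk_first[OF c] 0 in auto)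
  then show ?case using p3 by (simp add: of_nat_diff)
next
  case (Suc i)
  have e: "Suc (Suc i) * p - 1 = Suc i * p - 1 + p" using p3 by simp
  have "ht c (Suc i * p - 1 + p) = ht c (Suc i * p - 1) + (if proj p c (Suc i) then int p else - int p)"
  proof (rule ht_ramp)
    fix l assume l: "Suc i * p - 1 < l" "l \<le> Suc i * p - 1 + p"
    have "Suc i * p \<le> l" "l < Suc (Suc i) * p" "l \<le> N" using l Suc.prems e p3 by linarith+
    then show "c l = proj p c (Suc i)" by (intro blk_run[OF c]) simp_all
  qed
  then show ?case using Suc e by (simp add: algebra_simps split: if_splits)
qed

lemma one_col: "i \<in> {1..N} \<Longrightarrow> cont (one_column N) i = 1 - int i"
  unfolding cont_def one_column_def by simp

text \<open>In one column the contents drop by one at every step. Two equal steps of a walk do the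
  same, and at a turn after step \<open>l\<close> the drop is off by \<open>ht c l + 1\<close> up to
  sign. This is divisible by p at the ends of the intervals. Conversely, a turn gives a congruence
  for the height and the content a second one, and together they force p to divide
  \<open>l + 1\<close>.\<close>

lemma block_walk: "wt N c \<in> residue_block p N \<longleftrightarrow> blk p N c"
proof
  assume c: "blk p N c"
  then have g: "good N c" unfolding blk_def by simp
  have div: "int p dvd ht c l + 1" if "p dvd Suc l" "l \<le> N" for l
  proof -
    obtain k where k: "Suc l = p * k" using \<open>p dvd Suc l\<close> by blast
    then obtain i where "k = Suc i" by (cases k) auto
    then have "l = Suc i * p - 1" using k by (simp add: mult.commute)
    then show ?thesis using blk_ht[OF c, of i] that(2) by simp
  qed
  have "i \<le> N \<Longrightarrow> 1 \<le> i \<Longrightarrow> [cn c i = 1 - int i] (mod int p)" for i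
  proof (induction i)
    case (Suc i)
    show ?case
    proof (cases "i = 0")
      case True then show ?thesis using good_1[OF g] Suc.prems unfolding cn_def by simp
    next
      case False
      then obtain j where j: "i = Suc j" by (cases i) auto
      have IH: "int p dvd cn c i - (1 - int i)" using Suc False by (simp add: cong_iff_dvd_diff)
      have "int p dvd cn c i - cn c (Suc i) - 1"
      proof (cases "c i = c (Suc i)")
        case True then show ?thesis using cn_step[of i c] False by simp
      next
        case ne: False
        have "1 \<le> i \<and> i < N" using \<open>i \<noteq> 0\<close> Suc.prems by simp
        then have "p dvd Suc i" using c ne unfolding blk_def by blast
        then have d: "int p dvd ht c i + 1" using div Suc.prems by simp
        show ?thesis
        proof (cases "c i")
          case True
          then have "cn c i - cn c (Suc i) - 1 = - (ht c i + 1)" using cn_axial[of i c] ne False j by simp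
          then show ?thesis using d by (metis dvd_minus_iff)
        next
          case cf: False
          have "ht (swc i c) j = ht c j" using ht_swc[of i j c] j by simp
          then have "cn c i - cn c (Suc i) - 1 = ht c i + 1" using cn_axial[of i "swc i c"] cn_swc[of i c] cf ne j by simp
          then show ?thesis using d by (simp only:)
        qed
      qed
      then have "int p dvd (cn c i - (1 - int i)) - (cn c i - cn c (Suc i) - 1)" using IH by (rule dvd_diff[rotated])
      then show ?thesis unfolding cong_iff_dvd_diff by (simp add: algebra_simps)
    qed
  qed simp
  then show "wt N c \<in> residue_block p N" unfolding residue_block_def using g by (simp add: wt_in_Std2 cont_wt one_col)
next
  assume r: "wt N c \<in> residue_block p N"
  then have g: "good N c" unfolding residue_block_def by (simp add: wt_in_Std2)
  have cg: "int p dvd cn c i - (1 - int i)" if "i \<in> {1..N}" for i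
    using r that unfolding residue_block_def by (simp add: cont_wt one_col cong_iff_dvd_diff)
  have "c l = c (Suc l)" if l: "1 \<le> l" "l < N" "\<not> p dvd Suc l" for l
  proof (rule ccontr)
    assume ne: "c l \<noteq> c (Suc l)"
    obtain j where j: "l = Suc j" using l by (cases l) auto
    have "int p dvd (cn c l - (1 - int l)) - (cn c (Suc l) - (1 - int (Suc l)))" by (rule dvd_diff; rule cg) (use l in auto)
    then have d: "int p dvd cn c l - cn c (Suc l) - 1" by (simp add: algebra_simps)
    have s: "int (up c j) + int (dn c j) = int j" using up_dn_sum[of c j] by linarith
    have "int p dvd int (Suc l)"
    proof (cases "c l")
      case True
      have "cn c l - cn c (Suc l) - 1 = - (ht c j + 2)" using cn_axial[of l c] ne True l j by simp
      then have d1: "int p dvd ht c j + 2" using d by (metis dvd_minus_iff)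
      have "int p dvd - int (up c j) - (1 - int l)" using cg[of l] True l j unfolding cn_def by simp
      \<comment> \<open>Combining the congruences with \<open>up c j + dn c j = j\<close> eliminates
        both counts and leaves \<open>l + 1\<close>.\<close>
      then have "int p dvd (ht c j + 2) + 2 * (- int (up c j) - (1 - int l))" using d1 by (intro dvd_add[of _ "ht c j + 2"] dvd_mult)
      moreover have "(ht c j + 2) + 2 * (- int (up c j) - (1 - int l)) = int (Suc l)" using s j ht_up_dn[of c j] by simp
      ultimately show ?thesis by (simp only:)
    next
      case False
      have "ht (swc l c) j = ht c j" using ht_swc[of l j c] j by simp
      then have "cn c l - cn c (Suc l) - 1 = ht c j" using cn_axial[of l "swc l c"] cn_swc[of l c] False ne j by simp
      then have d1: "int p dvd ht c j" using d by simp
      have "int p dvd 1 - int (dn c j) - (1 - int l)" using cg[of l] False l j unfolding cn_def by simp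
      then have "int p dvd 2 * (1 - int (dn c j) - (1 - int l)) - ht c j" using d1 by (intro dvd_diff[of _ _ "ht c j"] dvd_mult)
      moreover have "2 * (1 - int (dn c j) - (1 - int l)) - ht c j = int (Suc l)" using s j ht_up_dn[of c j] by simp
      ultimately show ?thesis by (simp only:)
    qed
    then show False using l(3) by (simp only: of_nat_dvd_iff)
  qed
  then show "blk p N c" unfolding blk_def using g by blast
qed

lemma next_rank_bound: "p - 1 \<le> N \<Longrightarrow> i \<le> next_rank p N \<Longrightarrow> Suc i * p - 1 \<le> N"
proof -
  assume N: "p - 1 \<le> N" and i: "i \<le> next_rank p N"
  have "i * p \<le> next_rank p N * p" using i by simp
  also have "\<dots> \<le> N - (p - 1)" unfolding next_rank_def by simp
  finally show ?thesis using N p3 by simp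
qed

lemma good_proj: "p - 1 \<le> N \<Longrightarrow> blk p N c \<Longrightarrow> good (next_rank p N) (proj p c)"
  unfolding good_def
proof (intro allI impI)
  fix i assume N: "p - 1 \<le> N" and c: "blk p N c" and i: "i \<le> next_rank p N"
  have b: "Suc i * p - 1 \<le> N" by (rule next_rank_bound[OF N i])
  have "0 \<le> ht c (Suc i * p - 1)" using c b unfolding blk_def good_def by blast
  then have "0 < int p * (ht (proj p c) i + 1)" using blk_ht[OF c b] by linarith
  then show "0 \<le> ht (proj p c) i" using p3 by (simp add: zero_less_mult_iff)
qed

lemma sb_blk:
  assumes N: "p - 1 \<le> N" and c: "blk p N c" and i: "1 \<le> i" "i < next_rank p N" "proj p c i \<noteq> proj p c (Suc i)" and g: "good N (sb p i c)"
  shows "blk p N (sb p i c)" "proj p (sb p i c) j = swc i (proj p c) j"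
proof -
  show "blk p N (sb p i c)" unfolding blk_def
  proof (intro conjI g allI impI)
    fix l assume l: "1 \<le> l \<and> l < N \<and> \<not> p dvd Suc l"
    have "Suc l \<noteq> i * p" "Suc l \<noteq> (i + 2) * p" using l by (metis dvd_triv_right)+
    then have "(i * p \<le> l \<and> l < (i + 2) * p) \<longleftrightarrow> (i * p \<le> Suc l \<and> Suc l < (i + 2) * p)" by linarith
    moreover have "c l = c (Suc l)" using c l unfolding blk_def by blast
    ultimately show "sb p i c l = sb p i c (Suc l)" unfolding sb_def by simp
  qed
  have "i * p \<le> j * p \<longleftrightarrow> i \<le> j" "j * p < (i + 2) * p \<longleftrightarrow> j < i + 2"
    using p3 mult_less_cancel2[of j p "i + 2"] mult_le_cancel2[of i p j] by linarith+
  then show "proj p (sb p i c) j = swc i (proj p c) j"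
    using i(3) unfolding proj_def sb_def swc_def by (auto simp: le_Suc_eq less_Suc_eq)
qed

lemma rho_Psi_list:
  assumes "i \<ge> 1" and v: "supp N v" and js: "\<And>j. j \<in> set js \<Longrightarrow> j \<le> p"
  shows "foldr (\<lambda>x. rho N x) (map (Psi p N i) js) v = psis N (concat (map (\<lambda>j. cells (i * p - 1 + (p - j)) j) js)) v \<and> supp N (foldr (\<lambda>x. rho N x) (map (Psi p N i) js) v)"
  using js
proof (induction js)
  case Nil then show ?case using v by (simp add: psis_def)
next
  case (Cons j js)
  have j: "j \<le> p" using Cons.prems by simp
  have "p \<le> i * p" "(i + 1) * p = i * p + p" using assms(1) by simp_all
  \<comment> \<open>The first index \<open>(i + 1) * p - j\<close> is one past the base point
    \<open>i * p - 1 + (p - j)\<close> of the zigzag.\<close>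
  then have l: "(i + 1) * p - j + 2 * a = Suc (i * p - 1 + (p - j)) + 2 * a" for a using j p3 by linarith
  have s: "supp N (foldr (\<lambda>x. rho N x) (map (Psi p N i) js) v)"
    by (rule conjunct2[OF Cons.IH]) (use Cons.prems in simp)
  have "rho N (Psi p N i j) w = psis N (cells (i * p - 1 + (p - j)) j) w" if "supp N w" for w
    unfolding Psi_def rho_prod[OF that] psis_def cells_def l by (simp add: foldr_map o_def)
  from this[OF s] have "foldr (\<lambda>x. rho N x) (map (Psi p N i) (j # js)) v =
      psis N (concat (map (\<lambda>j. cells (i * p - 1 + (p - j)) j) (j # js))) v"
    using Cons.IH Cons.prems by (simp add: psis_append del: One_nat_def)
  moreover have "supp N (foldr (\<lambda>x. rho N x) (map (Psi p N i) (j # js)) v)" by simp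
  ultimately show ?case by (rule conjI)
qed

lemma rho_diamond:
  assumes i: "i \<ge> 1" and v: "supp N v"
  shows "rho N (diamond p N i) v = rho N (block_idem p N)
    (psis N (concat (map (\<lambda>j. cells (i * p - 1 + (p - j)) j) ([1..<p] @ [p] @ rev [1..<p]))) (rho N (block_idem p N) v))"
proof -
  have *: "foldr (\<lambda>x. rho N x) (map (Psi p N i) ([1..<p] @ [p] @ rev [1..<p])) (rho N (block_idem p N) v) =
     psis N (concat (map (\<lambda>j. cells (i * p - 1 + (p - j)) j) ([1..<p] @ [p] @ rev [1..<p]))) (rho N (block_idem p N) v)"
    by (rule conjunct1[OF rho_Psi_list[OF i supp_rho]]) auto
  have "rho N (diamond p N i) v = rho N (block_idem p N)
    (foldr (\<lambda>x. rho N x) (map (Psi p N i) ([1..<p] @ [p] @ rev [1..<p])) (rho N (block_idem p N) v))"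
    unfolding diamond_def rho_prod[OF v] foldr_append by simp
  then show ?thesis unfolding * .
qed

lemma rho_block_walk:
  assumes "good N c"
  shows "rho N (block_idem p N) (ww N (wt N c)) = (if blk p N c then ww N (wt N c) else 0)"
  using rho_block[of "wt N c" N p] assms unfolding wt_in_Std2 block_walk by blast

text \<open>After the idempotent the first factor to act is \<open>\<Psi>_1\<close>, a single
  generator at \<open>(i + 1) p - 1\<close>. It sits where the stretched steps \<open>i\<close> and
  \<open>i + 1\<close> meet, and these are equal.\<close>

lemma diamond_flat:
  assumes N: "p - 1 \<le> N" and c: "blk p N c" and i: "1 \<le> i" "i < next_rank p N" "proj p c i = proj p c (Suc i)"
  shows "rho N (diamond p N i) (ww N (wt N c)) = 0"
proof -
  let ?l = "Suc i * p - 1"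
  have g: "good N c" using c unfolding blk_def by simp
  have ip: "p \<le> i * p" using i by simp
  have "Suc (Suc i) * p - 1 \<le> N" by (rule next_rank_bound[OF N]) (use i in simp)
  then have lN: "1 \<le> ?l" "?l < N" "Suc ?l = Suc i * p" using p3 ip by auto
  have "c ?l = proj p c i" by (rule blk_run[OF c]) (use i lN ip p3 in auto)
  moreover have "c (Suc ?l) = proj p c (Suc i)" unfolding lN(3) proj_def ..
  ultimately have e: "c ?l = c (Suc ?l)" using i(3) by simp
  have "[1..<p] = 1 # [2..<p]" using p3 upt_conv_Cons[of 1 p] by (simp add: numeral_2_eq_2)
  then have "rev [1..<p] = rev [2..<p] @ [1]" by simp
  moreover have "cells (i * p - 1 + (p - 1)) 1 = [?l]" unfolding cells_def using p3 ip by simp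
  ultimately have l: "\<exists>ls. concat (map (\<lambda>j. cells (i * p - 1 + (p - j)) j) ([1..<p] @ [p] @ rev [1..<p])) = ls @ [?l]"
    by (simp only: map_append concat_append list.map concat.simps append_Nil2 append_assoc[symmetric]) blast
  have "psis N [?l] (ww N (wt N c)) = rho N (psi p N ?l) (ww N (wt N c))" by (simp add: psis_def)
  also have "\<dots> = 0" by (rule psi_walk(1)[OF g lN(1,2) e])
  finally have z: "psis N [?l] (ww N (wt N c)) = 0" .
  have b: "rho N (block_idem p N) (ww N (wt N c)) = ww N (wt N c)" using rho_block_walk[OF g] c by simp
  show ?thesis using l unfolding rho_diamond[OF i(1) supp_ww] b by (auto simp only: psis_append z psis_linear rho_vzero)
qed

text \<open>With \<open>m\<close> the height of the short walk plus one, \<open>(m + 1) / m\<close>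
  is the diagonal entry of \<open>u_i\<close> in the seminormal form. The idempotents on both sides
  fix the walks that occur, since the reflected walk is stretched as well.\<close>

lemma diamond_tip:
  assumes N: "p - 1 \<le> N" and c: "blk p N c" and i: "1 \<le> i" "i < next_rank p N" "proj p c i" "\<not> proj p c (Suc i)"
  shows "ht (proj p c) (i - 1) = 0 \<Longrightarrow> rho N (diamond p N i) (ww N (wt N c)) = sc 2 (ww N (wt N c))"
    and "1 \<le> ht (proj p c) (i - 1) \<Longrightarrow> blk p N (sb p i c) \<and> (\<exists>B. B \<noteq> 0 \<and> rho N (diamond p N i) (ww N (wt N c)) =
      sc ((of_int (ht (proj p c) (i - 1)) + 2) / (of_int (ht (proj p c) (i - 1)) + 1)) (ww N (wt N c)) + sc B (ww N (wt N (sb p i c))))"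
proof -
  define m where "m = nat (ht (proj p c) (i - 1) + 1)"
  have g: "good N c" using c unfolding blk_def by simp
  have h0: "0 \<le> ht (proj p c) (i - 1)" by (rule ht_nonneg[OF good_proj[OF N c]]) (use i in simp)
  have m: "int m = ht (proj p c) (i - 1) + 1" using h0 unfolding m_def by simp
  have ip: "p \<le> i * p" using i by simp
  have b2: "Suc (Suc i) * p - 1 \<le> N" by (rule next_rank_bound[OF N]) (use i in simp)
  have b1: "Suc (i - 1) * p - 1 \<le> N" by (rule next_rank_bound[OF N]) (use i in simp)
  have e: "i * p - 1 + 2 * p = Suc (Suc i) * p - 1" using ip p3 by simp
  have "peak_walk p N (i * p - 1) m c"
  proof (unfold_locales)
    show "good N c" by (rule g)
    show "i * p - 1 + 2 * p \<le> N" unfolding e by (rule b2)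
    show "1 \<le> m" using m h0 by linarith
    show "ht c (i * p - 1) + 1 = int (m * p)" using blk_ht[OF c b1] m i(1) by (simp add: mult.commute)
    show "c l" if "i * p - 1 < l" "l \<le> i * p - 1 + p" for l
    proof -
      have "c l = proj p c i" by (rule blk_run[OF c i(1)]) (use that b2 ip p3 in auto)
      then show ?thesis using i(3) by simp
    qed
    show "\<not> c l" if "i * p - 1 + p < l" "l \<le> i * p - 1 + 2 * p" for l
    proof -
      have "c l = proj p c (Suc i)" by (rule blk_run[OF c], simp) (use that b2 ip p3 in auto)
      then show ?thesis using i(4) by simp
    qed
  qed
  then interpret peak_walk p N "i * p - 1" m c .
  have V: "Vw 0 = sb p i c"
  proof
    fix l
    have "i * p - 1 < l \<longleftrightarrow> i * p \<le> l" "l \<le> i * p - 1 + 2 * p \<longleftrightarrow> l < (i + 2) * p"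
      using ip p3 distrib_right[of i 2 p] by linarith+
    moreover have "\<not> (i * p - 1 + p < l + 0 \<and> l \<le> i * p - 1 + p + 0)" by linarith
    ultimately show "Vw 0 l = sb p i c l" unfolding Vw_def sb_def by (simp only: if_False)
  qed
  have b: "rho N (block_idem p N) (ww N (wt N c)) = ww N (wt N c)" using rho_block_walk[OF g] c by simp
  obtain B where B: "B \<noteq> 0" "2 \<le> m \<longrightarrow> good N (sb p i c)"
    "psis N (concat (map Cs ([1..<p] @ [p] @ rev [1..<p]))) (ww N (wt N c)) =
    sc ((of_nat m + 1) / of_nat m) (ww N (wt N c)) + (if 2 \<le> m then sc B (ww N (wt N (sb p i c))) else 0)"
    using diamond_peak unfolding V by blast
  have D: "rho N (diamond p N i) (ww N (wt N c)) = rho N (block_idem p N)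
     (sc ((of_nat m + 1) / of_nat m) (ww N (wt N c)) + (if 2 \<le> m then sc B (ww N (wt N (sb p i c))) else 0))"
    unfolding rho_diamond[OF i(1) supp_ww] b B(3) ..
  show "rho N (diamond p N i) (ww N (wt N c)) = sc 2 (ww N (wt N c))" if h: "ht (proj p c) (i - 1) = 0"
  proof -
    have m1: "m = 1" using m h by simp
    have "\<not> 2 \<le> (1::nat)" "((of_nat 1 :: rat) + 1) / of_nat 1 = 2" by simp_all
    then show ?thesis unfolding D rho_vadd rho_vsc b m1 by (simp only: if_False rho_vzero add_0_right)
  qed
  assume h: "1 \<le> ht (proj p c) (i - 1)"
  then have m2: "2 \<le> m" using m by linarith
  have sbb: "blk p N (sb p i c)" by (rule sb_blk(1)[OF N c i(1,2)]) (use i B(2) m2 in auto)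
  have b': "rho N (block_idem p N) (ww N (wt N (sb p i c))) = ww N (wt N (sb p i c))"
    using rho_block_walk[of N "sb p i c"] sbb unfolding blk_def by simp
  have mr: "rat_of_nat m = of_int (ht (proj p c) (i - 1)) + 1" using m by (metis of_int_add of_int_1 of_int_of_nat_eq)
  have "rho N (diamond p N i) (ww N (wt N c)) = sc ((of_int (ht (proj p c) (i - 1)) + 2) / (of_int (ht (proj p c) (i - 1)) + 1)) (ww N (wt N c)) + sc B (ww N (wt N (sb p i c)))"
    unfolding D rho_vadd if_P[OF m2] rho_vsc b b' mr by (simp only: add.assoc one_add_one)
  then show "blk p N (sb p i c) \<and> (\<exists>B. B \<noteq> 0 \<and> rho N (diamond p N i) (ww N (wt N c)) =
      sc ((of_int (ht (proj p c) (i - 1)) + 2) / (of_int (ht (proj p c) (i - 1)) + 1)) (ww N (wt N c)) + sc B (ww N (wt N (sb p i c))))"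
    using sbb B(1) by blast
qed

lemma sb_ht_before: "ht (sb p i c) l = ht c l" if "l < i * p"
  by (rule ht_cong) (use that in \<open>simp add: sb_def\<close>)

text \<open>Reflecting a valley into a peak does not lower the walk anywhere.\<close>

lemma good_sb_valley:
  assumes N: "p - 1 \<le> N" and c: "blk p N c" and i: "1 \<le> i" "i < next_rank p N" "\<not> proj p c i" "proj p c (Suc i)"
  shows "good N (sb p i c)"
proof -
  have ip: "p \<le> i * p" using i by simp
  have b2: "Suc (Suc i) * p - 1 \<le> N" by (rule next_rank_bound[OF N]) (use i in simp)
  define b where "b = i * p - 1"
  have e: "Suc b = i * p" "b + 2 * p = Suc (Suc i) * p - 1" using ip p3 unfolding b_def by auto
  have lo: "\<not> c l" if "b < l" "l \<le> b + p" for l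
  proof -
    have "c l = proj p c i" by (rule blk_run[OF c i(1)]) (use that e b2 ip p3 in auto)
    then show ?thesis using i(3) by simp
  qed
  have hi: "c l" if "b + p < l" "l \<le> b + 2 * p" for l
  proof -
    have "c l = proj p c (Suc i)" by (rule blk_run[OF c], simp) (use that e b2 ip p3 in auto)
    then show ?thesis using i(4) by simp
  qed
  let ?d = "sb p i c"
  have d: "?d l = (if b < l \<and> l \<le> b + 2 * p then \<not> c l else c l)" for l
  proof -
    have "b < l \<longleftrightarrow> i * p \<le> l" "l \<le> b + 2 * p \<longleftrightarrow> l < (i + 2) * p" using e p3 by auto
    then show ?thesis unfolding sb_def by simp
  qed
  have "ht ?d l = ht c l" if "l \<le> b" for l by (rule sb_ht_before) (use that e in simp)
  then have hb: "ht ?d b = ht c b" by simp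
  have le: "ht c l \<le> ht ?d l" for l
  proof (induction l rule: less_induct)
    case (less l)
    consider "l \<le> b" | "b < l" "l \<le> b + p" | "b + p < l" "l \<le> b + 2 * p" | "b + 2 * p < l" by linarith
    then show ?case
    proof cases
      case 1 then show ?thesis using sb_ht_before[of l i c] e by simp
    next
      case 2
      then obtain k where k: "l = b + k" "k \<le> p" by (metis add_le_cancel_left le_add_diff_inverse less_imp_le)
      have "ht c (b + k) = ht c b + (if False then int k else - int k)" by (rule ht_ramp) (use lo k in simp)
      moreover have "ht ?d (b + k) = ht ?d b + (if True then int k else - int k)" by (rule ht_ramp) (use lo k d in simp)
      ultimately show ?thesis using k hb by simp
    next
      case 3
      then obtain k where k: "l = b + p + k" "k \<le> p" using le_Suc_ex[of "b + p" l] by auto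
      have "ht c (b + p) = ht c b + (if False then int p else - int p)" by (rule ht_ramp) (use lo in simp)
      moreover have "ht ?d (b + p) = ht ?d b + (if True then int p else - int p)" by (rule ht_ramp) (use lo d in simp)
      moreover have "ht c (b + p + k) = ht c (b + p) + (if True then int k else - int k)" by (rule ht_ramp) (use hi k in simp)
      moreover have "ht ?d (b + p + k) = ht ?d (b + p) + (if False then int k else - int k)" by (rule ht_ramp) (use hi k d in simp)
      ultimately show ?thesis using k hb by simp
    next
      case 4
      then obtain l' where "l = Suc l'" by (cases l) auto
      then show ?thesis using less.IH[of l'] d[of l] 4 by auto
    qed
  qed
  show ?thesis using c le unfolding good_def blk_def by (meson order_trans)
qed

lemma sb_ht:
  assumes "i \<ge> 1"
  shows "ht (proj p (sb p i c)) (i - 1) = ht (proj p c) (i - 1)"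
proof (rule ht_cong)
  fix j assume "j \<le> i - 1"
  then have "j * p < i * p" using assms p3 by simp
  then show "proj p (sb p i c) j = proj p c j" unfolding proj_def sb_def by simp
qed

end

section \<open>Transport of diagonal elements along the injections\<close>

lemma seminormal_action_subring:
  assumes "subring Q"
  shows "seminormal_action N Q (rho N) {c. good N c} (\<lambda>c. vc c N) (\<lambda>c. c)"
proof -
  interpret A: seminormal_action N UNIV "rho N" "{c. good N c}" "\<lambda>c. vc c N" "\<lambda>c. c"
    by (rule rho_seminormal_action)
  show ?thesis
  proof (unfold_locales)
    show "subring Q" by (rule assms)
  qed (rule A.H_add A.H_scale A.H_mult A.H_vadd A.H_vsc A.H_one A.walk A.flat A.tip; (assumption | rule TL_mono UNIV_I)+)+
qed

lemma idem_TL_subring: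
  assumes Q: "subring Q" and g: "good N c" and k: "\<And>e i. e \<in> contents N \<Longrightarrow> i \<in> {1..N} \<Longrightarrow> e \<noteq> cn c i \<Longrightarrow> k e i \<in> Q \<and> k e i \<noteq> 0"
  shows "tl_prod N (idem_factors N (wt N c) k) \<in> TL N Q"
proof -
  interpret A: seminormal_action N Q "rho N" "{c. good N c}" "\<lambda>c. vc c N" "\<lambda>c. c"
    by (rule seminormal_action_subring[OF Q])
  have "c \<in> {c. good N c}" using g by simp
  then show ?thesis using A.factors_act(4)[OF _ g] k by blast
qed

text \<open>Diagonal elements with eigenvalues 0 and 1. Integrality is included because the
  injections are homomorphisms only over the localised integers.\<close>

definition acts :: "nat \<Rightarrow> nat \<Rightarrow> tl \<Rightarrow> ((nat \<Rightarrow> bool) \<Rightarrow> bool) \<Rightarrow> bool" where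
  "acts p N x W \<longleftrightarrow> x \<in> TL N (localized_int p) \<and>
    (\<forall>c. good N c \<longrightarrow> rho N x (ww N (wt N c)) = (if W c then ww N (wt N c) else 0))"

context odd_prime
begin

lemma subring_localized: "subring (localized_int p)"
  unfolding subring_def
proof (intro conjI ballI)
  have "(1 :: rat) = of_int 1 / of_int 1" "\<not> int p dvd 1" using p3 by auto
  then show "1 \<in> localized_int p" unfolding localized_int_def by blast
  fix x y assume "x \<in> localized_int p" "y \<in> localized_int p"
  then obtain a b c d where x: "x = of_int a / of_int b" "\<not> int p dvd b" and y: "y = of_int c / of_int d" "\<not> int p dvd d"
    unfolding localized_int_def by blast
  have nz: "b \<noteq> 0" "d \<noteq> 0" using x y by auto
  have bd: "\<not> int p dvd b * d" using x(2) y(2) prime prime_dvd_mult_iff[of "int p" b d] by simp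
  have "x - y = of_int (a * d - c * b) / of_int (b * d)" unfolding x(1) y(1) using nz by (simp add: field_simps)
  then show "x - y \<in> localized_int p" unfolding localized_int_def using bd by blast
  have "x * y = of_int (a * c) / of_int (b * d)" unfolding x(1) y(1) by simp
  then show "x * y \<in> localized_int p" unfolding localized_int_def using bd by blast
qed

text \<open>Pulled back along the injection, the action on stretched walks satisfies the seminormal
  conditions for the short walks, by the computation of the diamond. Let \<open>E\<close> be the
  product of Jucys-Murphy factors that isolates one short walk. In the small algebra
  \<open>x E\<close> is \<open>E\<close> or 0; applying the injection and evaluating at the
  stretched walk, where \<open>E\<close> acts by a nonzero scalar, gives the eigenvalue of
  \<open>x\<close> there.\<close>

lemma acts_iota:
  assumes N: "p - 1 \<le> N" and f: "is_iota_KLR p N \<phi>" and x: "acts p (next_rank p N) x W"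
  shows "acts p N (\<phi> x) (\<lambda>c. blk p N c \<and> W (proj p c))"
proof -
  let ?M = "next_rank p N" and ?Q = "localized_int p"
  note Q = subring_localized
  have im: "\<And>z. z \<in> TL ?M ?Q \<Longrightarrow> \<phi> z \<in> TL N ?Q"
    and add: "\<And>z w. z \<in> TL ?M ?Q \<Longrightarrow> w \<in> TL ?M ?Q \<Longrightarrow> \<phi> (z + w) = \<phi> z + \<phi> w"
    and scl: "\<And>k z. k \<in> ?Q \<Longrightarrow> z \<in> TL ?M ?Q \<Longrightarrow> \<phi> (scale k z) = scale k (\<phi> z)"
    and mul: "\<And>z w. z \<in> TL ?M ?Q \<Longrightarrow> w \<in> TL ?M ?Q \<Longrightarrow> \<phi> (tl_mult ?M z w) = tl_mult N (\<phi> z) (\<phi> w)"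
    and one: "\<phi> (tl_one ?M) = block_idem p N"
    and gen: "\<And>i. 1 \<le> i \<Longrightarrow> i < ?M \<Longrightarrow> \<phi> (tl_u ?M i) = diamond p N i"
    using f unfolding is_iota_KLR_def Let_def by (blast | fast)+
  let ?H = "\<lambda>z v. rho N (\<phi> z) v" and ?b = "\<lambda>c. ww N (wt N c)"
  have "seminormal_action ?M ?Q ?H {c. blk p N c} ?b (proj p)"
  proof (unfold_locales)
    show "subring ?Q" by (rule Q)
    show "rho N (\<phi> (z + w)) v = rho N (\<phi> z) v + rho N (\<phi> w) v" if "z \<in> TL ?M ?Q" "w \<in> TL ?M ?Q" for z w v
      unfolding add[OF that] by (rule rho_add)
    show "rho N (\<phi> (scale k z)) v = sc k (rho N (\<phi> z) v)" if "k \<in> ?Q" "z \<in> TL ?M ?Q" for k z v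
      unfolding scl[OF that] by (rule rho_scale)
    show "rho N (\<phi> (tl_mult ?M z w)) v = rho N (\<phi> z) (rho N (\<phi> w) v)" if "z \<in> TL ?M ?Q" "w \<in> TL ?M ?Q" for z w v
      unfolding mul[OF that] by (rule rho_mult)
    show "rho N (\<phi> z) (v + w) = rho N (\<phi> z) v + rho N (\<phi> z) w" for z v w by (rule rho_vadd)
    show "rho N (\<phi> z) (sc k v) = sc k (rho N (\<phi> z) v)" for z k v by (rule rho_vsc)
    show "rho N (\<phi> (tl_one ?M)) (ww N (wt N c)) = ww N (wt N c)" if "c \<in> {c. blk p N c}" for c
      unfolding one using rho_block_walk[of N c] that unfolding blk_def by simp
    show "good ?M (proj p c)" if "c \<in> {c. blk p N c}" for c
      using good_proj[OF N, of c] that by simp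
    show "rho N (\<phi> (tl_u ?M i)) (ww N (wt N c)) = 0" if "c \<in> {c. blk p N c}" "1 \<le> i" "i < ?M" "proj p c i = proj p c (Suc i)" for c i
      unfolding gen[OF that(2,3)] by (rule diamond_flat[OF N _ that(2-4)]) (use that in simp)
  next
    fix c i
    assume "c \<in> {c. blk p N c}" and i: "1 \<le> i" "i < ?M" and ne: "proj p c i \<noteq> proj p c (Suc i)"
    then have c: "blk p N c" by simp
    let ?k = "\<lambda>c. (rat_of_int (ht (proj p c) (i - 1)) + 2) / (of_int (ht (proj p c) (i - 1)) + 1)"
    have peak: "\<exists>B. blk p N (sb p i c) \<and> (\<forall>j\<in>{1..?M}. proj p (sb p i c) j = swc i (proj p c) j) \<and> B \<noteq> 0 \<and>
        rho N (\<phi> (tl_u ?M i)) (ww N (wt N c)) = sc (?k c) (ww N (wt N c)) + sc B (ww N (wt N (sb p i c)))"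
      if c: "blk p N c" "proj p c i" "\<not> proj p c (Suc i)" "1 \<le> ht (proj p c) (i - 1)" for c
    proof -
      have b: "blk p N (sb p i c)" using diamond_tip(2)[OF N c(1) i c(2-4)] by blast
      have "good N (sb p i c)" using b unfolding blk_def by blast
      then have "\<forall>j\<in>{1..?M}. proj p (sb p i c) j = swc i (proj p c) j"
        using sb_blk(2)[OF N c(1) i] c by blast
      then show ?thesis using b diamond_tip(2)[OF N c(1) i c(2-4)] unfolding gen[OF i] by blast
    qed
    show "(proj p c i \<and> ht (proj p c) (i - 1) = 0 \<and> rho N (\<phi> (tl_u ?M i)) (ww N (wt N c)) = sc 2 (ww N (wt N c))) \<or>
      (\<exists>q\<in>{c. blk p N c}. \<exists>r\<in>{c. blk p N c}. \<exists>B. (c = q \<or> c = r) \<and> proj p q i \<and> \<not> proj p q (Suc i) \<and> 0 \<le> ht (proj p q) (i - 1) \<and>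
         (\<forall>j\<in>{1..?M}. proj p r j = swc i (proj p q) j) \<and> B \<noteq> 0 \<and>
         rho N (\<phi> (tl_u ?M i)) (ww N (wt N q)) = sc (?k q) (ww N (wt N q)) + sc B (ww N (wt N r)))"
    proof (cases "proj p c i")
      case up: True
      then have dn: "\<not> proj p c (Suc i)" using ne by simp
      have h0: "0 \<le> ht (proj p c) (i - 1)" by (rule ht_nonneg[OF good_proj[OF N c]]) (use i in simp)
      show ?thesis
      proof (cases "ht (proj p c) (i - 1) = 0")
        case True
        then have "rho N (\<phi> (tl_u ?M i)) (ww N (wt N c)) = sc 2 (ww N (wt N c))"
          unfolding gen[OF i] by (rule diamond_tip(1)[OF N c i up dn])
        then show ?thesis using True up by blast
      next
        case False
        then have "1 \<le> ht (proj p c) (i - 1)" using h0 by simp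
        from peak[OF c up dn this] obtain B where
          "blk p N (sb p i c)" "\<forall>j\<in>{1..?M}. proj p (sb p i c) j = swc i (proj p c) j" "B \<noteq> 0"
          "rho N (\<phi> (tl_u ?M i)) (ww N (wt N c)) = sc (?k c) (ww N (wt N c)) + sc B (ww N (wt N (sb p i c)))" by blast
        then show ?thesis using c up dn h0 by blast
      qed
    next
      case dn: False
      then have up: "proj p c (Suc i)" using ne by simp
      let ?q = "sb p i c"
      have g: "good N ?q" by (rule good_sb_valley[OF N c i dn up])
      note q = sb_blk[OF N c i ne g]
      \<comment> \<open>The short walk steps down at \<open>i\<close> and stays nonnegative, so the
        valley and the reflected peak start at height at least 1.\<close>
      have "ht (proj p c) i = ht (proj p c) (i - 1) - 1" using i(1) dn by (cases i) auto
      moreover have "0 \<le> ht (proj p c) i" by (rule ht_nonneg[OF good_proj[OF N c]]) (use i in simp)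
      ultimately have h: "1 \<le> ht (proj p ?q) (i - 1)" unfolding sb_ht[OF i(1)] by simp
      have qi: "proj p ?q i" "\<not> proj p ?q (Suc i)" unfolding q(2) using dn up by (simp_all add: swc_def)
      from peak[OF q(1) qi h] obtain B where B: "\<forall>j\<in>{1..?M}. proj p c j = swc i (proj p ?q) j" "B \<noteq> 0"
          "rho N (\<phi> (tl_u ?M i)) (ww N (wt N ?q)) = sc (?k ?q) (ww N (wt N ?q)) + sc B (ww N (wt N c))"
        unfolding sb_sb by blast
      have "0 \<le> ht (proj p ?q) (i - 1)" using h by simp
      then show ?thesis using c q(1) qi B by blast
    qed
  qed
  then interpret I: seminormal_action ?M ?Q ?H "{c. blk p N c}" ?b "proj p" .
  interpret A: seminormal_action ?M ?Q "rho ?M" "{c. good ?M c}" "\<lambda>c. vc c ?M" "\<lambda>c. c"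
    by (rule seminormal_action_subring[OF Q])
  have xT: "x \<in> TL ?M ?Q" and xW: "\<And>d. good ?M d \<Longrightarrow> rho ?M x (ww ?M (wt ?M d)) = (if W d then ww ?M (wt ?M d) else 0)"
    using x unfolding acts_def by blast+
  have "rho N (\<phi> x) (ww N (wt N c)) = (if blk p N c \<and> W (proj p c) then ww N (wt N c) else 0)" if g: "good N c" for c
  proof (cases "blk p N c")
    case False
    \<comment> \<open>Outside the block the image of the unit already gives 0.\<close>
    have "\<phi> x = \<phi> (tl_mult ?M x (tl_one ?M))" using tl_mult_one(2)[OF TL_mono[OF xT]] by simp
    also have "\<dots> = tl_mult N (\<phi> x) (block_idem p N)" unfolding mul[OF xT TL_closed(7)[OF Q]] one ..
    finally have "rho N (\<phi> x) (ww N (wt N c)) = rho N (\<phi> x) (rho N (block_idem p N) (ww N (wt N c)))"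
      unfolding rho_mult[symmetric] by (rule arg_cong)
    then show ?thesis using False rho_block_walk[OF g] rho_vzero by simp
  next
    case True
    let ?d = "proj p c"
    have gd: "good ?M ?d" by (rule good_proj[OF N True])
    \<comment> \<open>Coefficient 1 in place of the reciprocals of content differences keeps
      \<open>E\<close> in the domain of the injection.\<close>
    define k :: "int \<Rightarrow> nat \<Rightarrow> rat" where "k = (\<lambda>e i. 1)"
    have k: "k e i \<in> ?Q \<and> k e i \<noteq> 0" for e i unfolding k_def using subringD(1)[OF Q] by simp
    define E where "E = tl_prod ?M (idem_factors ?M (wt ?M ?d) k)"
    have cb: "c \<in> {c. blk p N c}" using True by simp
    have ET: "E \<in> TL ?M ?Q" unfolding E_def by (rule I.factors_act(4)[OF cb gd k])
    have "\<exists>q. q \<noteq> 0 \<and> rho N (\<phi> E) (ww N (wt N c)) = sc q (ww N (wt N c))"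
      unfolding E_def by (rule I.factors_act(2)[OF cb gd _ refl]) (rule k)
    then obtain q where "q \<noteq> 0 \<and> rho N (\<phi> E) (ww N (wt N c)) = sc q (ww N (wt N c))" ..
    note q = conjunct1[OF this] conjunct2[OF this]
    have xE: "tl_mult ?M x E = scale (if W ?d then 1 else 0) E"
    proof (rule TL_eqI_ww)
      show "tl_mult ?M x E \<in> TL ?M UNIV" by (rule TL_mono[OF TL_closed(6)[OF Q xT ET]])
      show "scale (if W ?d then 1 else 0) E \<in> TL ?M UNIV" by (rule TL_closed(3)[OF subring_UNIV UNIV_I TL_mono[OF ET]])
      fix t assume t: "t \<in> Std2 ?M"
      have gt: "wk t \<in> {c. good ?M c}" using good_wk[OF t] by simp
      have wt: "wt ?M (wk t) = t" by (rule wt_wk[OF t])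
      show "rho ?M (tl_mult ?M x E) (ww ?M t) = rho ?M (scale (if W ?d then 1 else 0) E) (ww ?M t)"
      proof (cases "t = wt ?M ?d")
        case True
        obtain q' where "rho ?M E (vc (wk t) ?M) = sc q' (vc (wk t) ?M)"
        proof -
          have "\<exists>q'. q' \<noteq> 0 \<and> rho ?M E (vc (wk t) ?M) = sc q' (vc (wk t) ?M)"
            unfolding E_def by (rule A.factors_act(2)[OF gt gd]) (use k wt True in simp_all)
          then show thesis using that by blast
        qed
        then have e: "rho ?M E (ww ?M t) = sc q' (ww ?M t)" unfolding ww_def rho_vsc by (simp only: sc_simps mult.commute)
        have "rho ?M x (ww ?M t) = (if W ?d then ww ?M t else 0)" unfolding True by (rule xW[OF gd])
        then show ?thesis unfolding rho_mult rho_scale e rho_vsc by (cases "W ?d") (simp_all only: if_True if_False sc_simps mult_1_left mult_zero_left simp_thms)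
      next
        case False
        then have "rho ?M E (vc (wk t) ?M) = 0"
          unfolding E_def by (intro A.factors_act(1)[OF gt gd k]) (use wt in simp)
        then have e: "rho ?M E (ww ?M t) = 0" unfolding ww_def rho_vsc by (simp only: sc_simps)
        show ?thesis unfolding rho_mult rho_scale e rho_vzero sc_simps ..
      qed
    qed
    have w: "(if W ?d then 1 else 0) \<in> ?Q" using subringD(1,2)[OF Q] by simp
    have "sc q (rho N (\<phi> x) (ww N (wt N c))) = rho N (\<phi> (tl_mult ?M x E)) (ww N (wt N c))"
      unfolding mul[OF xT ET] rho_mult q(2) rho_vsc ..
    also have "\<dots> = sc (if W ?d then 1 else 0) (sc q (ww N (wt N c)))"
      unfolding xE scl[OF w ET] rho_scale q(2) ..
    finally have "sc (1 / q) (sc q (rho N (\<phi> x) (ww N (wt N c)))) = sc (1 / q) (sc (if W ?d then 1 else 0) (sc q (ww N (wt N c))))" by (rule arg_cong)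
    then have "rho N (\<phi> x) (ww N (wt N c)) = sc (if W ?d then 1 else 0) (ww N (wt N c))" using q(1) by (simp add: sc_simps mult.commute)
    then show ?thesis using True by (cases "W ?d") (simp_all only: if_True if_False sc_simps simp_thms)
  qed
  then show ?thesis unfolding acts_def using im[OF xT] by blast
qed

lemma next_rank_eq: "p - 1 \<le> N \<Longrightarrow> Suc (next_rank p N) = Suc N div p"
proof -
  assume N: "p - 1 \<le> N"
  then have "Suc N = (N - (p - 1)) + p" using p3 by simp
  then have "Suc N div p = ((N - (p - 1)) + p) div p" by (rule arg_cong)
  also have "\<dots> = Suc ((N - (p - 1)) div p)" using p3 by (subst div_add_self2) auto
  finally show ?thesis unfolding next_rank_def by simp
qed

definition pj :: "nat \<Rightarrow> (nat \<Rightarrow> bool) \<Rightarrow> nat \<Rightarrow> bool" where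
  "pj i c l = c (l * p ^ i)"

lemma pj_simps: "pj 0 c = c" "pj (Suc i) c = proj p (pj i c)"
  unfolding pj_def proj_def by (simp_all add: mult_ac)

text \<open>Every injection of the chain adds the condition that the walk seen at its stage is
  stretched. The walk seen at stage \<open>i\<close> is obtained by sampling \<open>c\<close> at the
  multiples of \<open>p ^ i\<close>.\<close>

lemma chain_acts:
  assumes "\<And>i. i < j \<Longrightarrow> is_iota_KLR p (chain_rank p n i) (\<iota> i)" "\<And>i. i < j \<Longrightarrow> p - 1 \<le> chain_rank p n i"
    and "acts p (chain_rank p n j) x W"
  shows "acts p n (chain_comp \<iota> j x) (\<lambda>c. (\<forall>i<j. blk p (chain_rank p n i) (pj i c)) \<and> W (pj j c))"
  using assms
proof (induction j arbitrary: x W)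
  case 0 then show ?case by (simp add: pj_simps)
next
  case (Suc j)
  have a: "acts p (chain_rank p n j) (\<iota> j x) (\<lambda>c. blk p (chain_rank p n j) c \<and> W (proj p c))"
    by (rule acts_iota) (use Suc.prems in simp_all)
  have "acts p n (chain_comp \<iota> j (\<iota> j x)) (\<lambda>c. (\<forall>i<j. blk p (chain_rank p n i) (pj i c)) \<and> (blk p (chain_rank p n j) (pj j c) \<and> W (proj p (pj j c))))"
    by (rule Suc.IH) (use Suc.prems a in simp_all)
  moreover have "((\<forall>i<j. blk p (chain_rank p n i) (pj i c)) \<and> (blk p (chain_rank p n j) (pj j c) \<and> W (proj p (pj j c)))) \<longleftrightarrow>
    ((\<forall>i<Suc j. blk p (chain_rank p n i) (pj i c)) \<and> W (pj (Suc j) c))" for c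
    unfolding pj_simps less_Suc_eq by blast
  ultimately show ?case by (simp only: chain_comp.simps o_apply)
qed

text \<open>All contents lie between \<open>1 - N\<close> and 1, so their differences are at most
  \<open>N < p\<close> in absolute value; the nonzero ones are units of the localised
  integers.\<close>

lemma acts_one_column:
  assumes "N < p"
  shows "acts p N (seminormal_idem N (one_column N)) (\<lambda>c. \<forall>l\<in>{1..N}. c l)"
proof -
  let ?T = "\<lambda>_::nat. True"
  have g: "good N ?T"
  proof -
    have "ht ?T m = int m" for m by (induction m) simp_all
    then show ?thesis unfolding good_def by simp
  qed
  have up: "up ?T m = m" for m by (induction m) simp_all
  have o: "one_column N = wt N ?T" unfolding one_column_def wt_def up by simp
  have "seminormal_idem N (wt N ?T) \<in> TL N (localized_int p)"
    unfolding seminormal_idem_factors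
  proof (rule idem_TL_subring[OF subring_localized g])
    fix e i assume e: "e \<in> contents N" "i \<in> {1..N}" "e \<noteq> cn ?T i"
    have "cn ?T i \<in> contents N" unfolding contents_eq using g e by blast
    from contents_bounds[OF this] contents_bounds[OF e(1)] have "\<bar>cn ?T i - e\<bar> \<le> int N" by linarith
    then have "\<bar>cn ?T i - e\<bar> < int p" using assms by linarith
    moreover have "cn ?T i - e \<noteq> 0" using e by simp
    ultimately have "\<not> int p dvd cn ?T i - e"
      using dvd_imp_le_int[of "cn ?T i - e" "int p"] by linarith
    then have "of_int 1 / rat_of_int (cn ?T i - e) \<in> localized_int p" unfolding localized_int_def by blast
    then show "1 / rat_of_int (cont (wt N ?T) i - e) \<in> localized_int p \<and> 1 / rat_of_int (cont (wt N ?T) i - e) \<noteq> 0"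
      using e by (simp add: cont_wt)
  qed
  then have "seminormal_idem N (one_column N) \<in> TL N (localized_int p)" unfolding o .
  moreover have "rho N (seminormal_idem N (one_column N)) (ww N (wt N c)) = (if \<forall>l\<in>{1..N}. c l then ww N (wt N c) else 0)"
    if "good N c" for c
    using rho_idem_ww[of "wt N ?T" N "wt N c"] that g unfolding o wt_in_Std2 wt_eq_iff by simp
  ultimately show ?thesis unfolding acts_def by blast
qed

end

section \<open>Walks with prescribed signs\<close>

locale expansion = odd_prime +
  fixes n k a :: nat
  assumes top: "Suc n div p ^ k = a" and a: "1 \<le> a" "a < p"
begin

text \<open>\<open>A j\<close> deletes the last \<open>j\<close> digits of \<open>n + 1\<close>, and
  \<open>B j\<close> replaces them by zeros. Consequently the numbers \<open>B j\<close> are the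
  boundaries between the sections in which the entries of a tableau \<open>t_m\<close> are
  placed.\<close>

definition A :: "nat \<Rightarrow> nat" where "A j = Suc n div p ^ j"
definition B :: "nat \<Rightarrow> nat" where "B j = A j * p ^ j"

lemma top_exp: "top_exp p n = k"
  unfolding top_exp_def
proof (rule Greatest_equality)
  have "a * p ^ k \<le> Suc n" unfolding top[symmetric] by simp
  then show "p ^ k \<le> n + 1" using a by (metis Suc_eq_plus1 le_trans mult.commute mult.right_neutral mult_le_mono2)
  fix y assume y: "p ^ y \<le> n + 1"
  show "y \<le> k"
  proof (rule ccontr)
    assume "\<not> y \<le> k"
    then have "p ^ Suc k \<le> p ^ y" using p3 by (intro power_increasing) auto
    then have "p * p ^ k \<le> Suc n" using y by simp
    then have "p \<le> Suc n div p ^ k" using p3 by (simp add: less_eq_div_iff_mult_less_eq)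
    then show False unfolding top using a by simp
  qed
qed

lemma A_step: "A j = A (Suc j) * p + digit p n j"
proof -
  have "A (Suc j) = A j div p" unfolding A_def power_Suc2 by (rule div_mult2_eq)
  moreover have "digit p n j = A j mod p" unfolding digit_def A_def by simp
  ultimately show ?thesis by simp
qed

lemma A_pos: "j \<le> k \<Longrightarrow> 1 \<le> A j"
proof -
  assume "j \<le> k"
  then have "p ^ j \<le> p ^ k" using p3 by (intro power_increasing) auto
  then have "A k \<le> A j" unfolding A_def using p3 by (intro div_le_mono2) auto
  then show ?thesis using top a unfolding A_def by simp
qed

lemma digit_less: "digit p n j < p"
  unfolding digit_def using p3 by simp

lemma digit_top: "digit p n k = a"
  unfolding digit_def using top a by simp

lemma B_top: "B k = a * p ^ k"
  unfolding B_def A_def top ..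

lemma B_step: "B j = B (Suc j) + digit p n j * p ^ j"
  unfolding B_def by (subst A_step) (simp add: algebra_simps)

lemma B_pos: "j \<le> k \<Longrightarrow> p ^ j \<le> B j" "j \<le> k \<Longrightarrow> 1 \<le> B j"
proof -
  assume j: "j \<le> k"
  then show "p ^ j \<le> B j" using A_pos[of j] mult_le_mono1[of 1 "A j" "p ^ j"] unfolding B_def by simp
  have "1 \<le> p ^ j" using p3 by simp
  then show "1 \<le> B j" using \<open>p ^ j \<le> B j\<close> by (rule order_trans)
qed

lemma B_0: "B 0 = Suc n"
  unfolding B_def A_def by simp

lemma B_anti: "i \<le> j \<Longrightarrow> B j \<le> B i"
proof (induction rule: dec_induct)
  case (step j)
  then show ?case using B_step[of j] by linarith
qed simp

text \<open>In terms of the rank plus one, passing to the next algebra of the chain is division by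
  p, that is, deletion of the last digit.\<close>

lemma rank_A: "i \<le> k \<Longrightarrow> Suc (chain_rank p n i) = A i"
proof (induction i)
  case (Suc i)
  then have IH: "Suc (chain_rank p n i) = A i" by simp
  have "p \<le> A (Suc i) * p" using A_pos[of "Suc i"] Suc.prems by simp
  then have "p \<le> A i" using A_step[of i] by linarith
  then have "Suc (chain_rank p n (Suc i)) = A i div p" using next_rank_eq[of "chain_rank p n i"] IH by simp
  also have "\<dots> = A (Suc i)" unfolding A_def power_Suc2 by (rule div_mult2_eq[symmetric])
  finally show ?case .
qed (simp add: A_def)

lemma rank_big: "i < k \<Longrightarrow> p - 1 \<le> chain_rank p n i"
proof -
  assume i: "i < k"
  have "p \<le> A (Suc i) * p" using A_pos[of "Suc i"] i by simp
  then have "p \<le> A i" using A_step[of i] by linarith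
  then show ?thesis using rank_A[of i] i by simp
qed

text \<open>The walks of the tableaux \<open>t_m\<close>, with \<open>s j\<close> the sign of the
  digit \<open>j\<close>. Positions start at 1, so the first section has \<open>B k - 1\<close>
  steps.\<close>

definition secs :: "(nat \<Rightarrow> bool) \<Rightarrow> (nat \<Rightarrow> bool) \<Rightarrow> bool" where
  "secs s c \<longleftrightarrow> (\<forall>l. 1 \<le> l \<and> l < B k \<longrightarrow> c l) \<and> (\<forall>j<k. \<forall>l. B (Suc j) \<le> l \<and> l < B j \<longrightarrow> c l = s j)"

lemma secs_agree:
  assumes "secs s c" "secs s c'"
  shows "l \<in> {1..n} \<Longrightarrow> c l = c' l"
proof -
  have "i \<le> k \<Longrightarrow> \<forall>l. 1 \<le> l \<and> l < B i \<longrightarrow> c l = c' l" for i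
  proof (induction rule: inc_induct)
    case base then show ?case using assms unfolding secs_def by blast
  next
    case (step i)
    show ?case
    proof (intro allI impI)
      fix l assume l: "1 \<le> l \<and> l < B i"
      show "c l = c' l"
      proof (cases "l < B (Suc i)")
        case True then show ?thesis using step.IH l by blast
      next
        case False then show ?thesis using assms step.hyps l unfolding secs_def by (metis not_less)
      qed
    qed
  qed
  from this[of 0] show "l \<in> {1..n} \<Longrightarrow> c l = c' l" unfolding B_0 by simp
qed

lemma secs_change:
  assumes "secs s c" "\<And>j. j < k \<Longrightarrow> digit p n j \<noteq> 0 \<Longrightarrow> s j = s' j"
  shows "secs s' c"
  unfolding secs_def
proof (intro conjI allI impI)
  show "c l" if "1 \<le> l \<and> l < B k" for l using assms(1) that unfolding secs_def by blast
  show "c l = s' j" if "j < k" "B (Suc j) \<le> l \<and> l < B j" for j l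
  proof -
    have "digit p n j \<noteq> 0"
    proof
      assume "digit p n j = 0"
      then have "B j = B (Suc j)" using B_step[of j] by simp
      then show False using that by linarith
    qed
    then show ?thesis using assms that unfolding secs_def by metis
  qed
qed

lemma secs_cong:
  assumes "secs s c" "\<And>l. l \<in> {1..n} \<Longrightarrow> c l = c' l"
  shows "secs s c'"
  unfolding secs_def
proof (intro conjI allI impI)
  show "c' l" if "1 \<le> l \<and> l < B k" for l
  proof -
    have "l \<in> {1..n}" using that B_anti[of 0 k] unfolding B_0 by auto
    then show ?thesis using assms that unfolding secs_def by blast
  qed
  show "c' l = s j" if j: "j < k" and l: "B (Suc j) \<le> l \<and> l < B j" for j l
  proof -
    have "1 \<le> B (Suc j)" by (rule B_pos) (use j in simp)
    then have "1 \<le> l" using l by simp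
    then have "l \<in> {1..n}" using l B_anti[of 0 j] unfolding B_0 by auto
    then show ?thesis using assms j l unfolding secs_def by metis
  qed
qed

text \<open>Before the section of digit \<open>i\<close> the height plus one is at least
  \<open>p ^ (i + 1)\<close>. The section descends by at most the digit times \<open>p ^ i\<close>,
  and since the digit is at most \<open>p - 1\<close>, at least \<open>p ^ i\<close> remains for the
  sections that follow.\<close>

lemma secs_ht:
  assumes s: "secs s c"
  shows "i \<le> k \<Longrightarrow> (\<forall>l<B i. 0 \<le> ht c l) \<and> int (p ^ i) \<le> ht c (B i - 1) + 1 \<and>
     ht c (B i - 1) + 1 = int (B k) + (\<Sum>j\<in>{i..<k}. (if s j then 1 else -1) * int (digit p n j * p ^ j))"
proof (induction rule: inc_induct)
  case base
  have up: "ht c (0 + l) = ht c 0 + (if True then int l else - int l)" if "l < B k" for l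
    by (rule ht_ramp) (use s that in \<open>simp add: secs_def\<close>)
  have "1 \<le> B k" by (rule B_pos) simp
  then have "ht c (B k - 1) + 1 = int (B k)" using up[of "B k - 1"] by (simp add: of_nat_diff)
  moreover have "int (p ^ k) \<le> int (B k)" using B_pos(1)[of k] by (simp only: of_nat_le_iff order_refl simp_thms)
  moreover have "0 \<le> ht c l" if "l < B k" for l using up[OF that] by simp
  ultimately show ?case by simp
next
  case (step i)
  let ?b = "B (Suc i) - 1"
  have pi: "p ^ Suc i \<le> B (Suc i)" by (rule B_pos) (use step.hyps in simp)
  have b1: "1 \<le> B (Suc i)" by (rule B_pos) (use step.hyps in simp)
  have ramp: "ht c (?b + l) = ht c ?b + (if s i then int l else - int l)" if "?b + l < B i" for l
  proof (rule ht_ramp)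
    fix x assume "?b < x" "x \<le> ?b + l"
    then have "B (Suc i) \<le> x" "x < B i" using that by auto
    then show "c x = s i" using s step.hyps unfolding secs_def by blast
  qed
  have IH: "\<And>l. l < B (Suc i) \<Longrightarrow> 0 \<le> ht c l" "int (p ^ Suc i) \<le> ht c ?b + 1"
    "ht c ?b + 1 = int (B k) + (\<Sum>j\<in>{Suc i..<k}. (if s j then 1 else -1) * int (digit p n j * p ^ j))"
    using step.IH by blast+
  have d: "digit p n i * p ^ i + p ^ i \<le> p ^ Suc i"
  proof -
    have "Suc (digit p n i) * p ^ i \<le> p * p ^ i" using digit_less[of i] by (intro mult_le_mono1) simp
    then show ?thesis by simp
  qed
  have di: "int (digit p n i * p ^ i) + int (p ^ i) \<le> int (p ^ Suc i)" using d by (simp only: of_nat_add[symmetric] of_nat_le_iff)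
  have Bi: "B i - 1 = ?b + digit p n i * p ^ i" using B_step[of i] b1 by linarith
  have Bi1: "?b + digit p n i * p ^ i < B i" using Bi B_step[of i] b1 by linarith
  have fin: "ht c (B i - 1) + 1 = ht c ?b + 1 + (if s i then 1 else -1) * int (digit p n i * p ^ i)"
    unfolding Bi ramp[OF Bi1] by simp
  have p0: "1 \<le> int (p ^ i)" using p3 by simp
  show ?case
  proof (intro conjI allI impI)
    fix l assume l: "l < B i"
    show "0 \<le> ht c l"
    proof (cases "l < B (Suc i)")
      case True then show ?thesis by (rule IH(1))
    next
      case False
      then obtain m where m: "l = ?b + m" using b1 by (metis add.commute le_add_diff_inverse2 le_diff_conv le_trans not_less nat_le_linear diff_le_self)
      have "m \<le> digit p n i * p ^ i" using l m Bi b1 by linarith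
      then have "int m \<le> int (digit p n i * p ^ i)" by (simp only: of_nat_le_iff)
      moreover have "ht c l = ht c ?b + (if s i then int m else - int m)" unfolding m by (rule ramp) (use l m in simp)
      then have "ht c ?b - int m \<le> ht c l" by (cases "s i") simp_all
      ultimately show ?thesis using IH(2) di p0 by linarith
    qed
  next
    have "- int (digit p n i * p ^ i) \<le> (if s i then 1 else -1) * int (digit p n i * p ^ i)" by simp
    then show "int (p ^ i) \<le> ht c (B i - 1) + 1" unfolding fin using IH(2) di by linarith
    show "ht c (B i - 1) + 1 = int (B k) + (\<Sum>j\<in>{i..<k}. (if s j then 1 else -1) * int (digit p n j * p ^ j))"
      unfolding fin IH(3) using step.hyps by (simp add: sum.atLeast_Suc_lessThan)
  qed
qed

lemma secs_good:
  assumes "secs s c"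
  shows "good n c" "ht c n + 1 = int (B k) + (\<Sum>j<k. (if s j then 1 else -1) * int (digit p n j * p ^ j))"
  using secs_ht[OF assms, of 0] unfolding B_0 good_def lessThan_atLeast0 by (simp_all add: less_Suc_eq_le)

end

section \<open>Sign choices and the tableaux of the p-Jones-Wenzl idempotent\<close>

lemma tab_of_columns_wt:
  assumes "set cs \<subseteq> {1, 2}"
  shows "tab_of_columns cs = wt (length cs) (\<lambda>l. cs ! (l - 1) = 1)"
proof -
  let ?c = "\<lambda>l. cs ! (l - 1) = 1"
  have two: "cs ! i = 2 \<longleftrightarrow> cs ! i \<noteq> 1" if "i < length cs" for i using assms nth_mem[OF that] by auto
  have count: "i \<le> length cs \<Longrightarrow> count_list (take i cs) 1 = up ?c i \<and> count_list (take i cs) 2 = dn ?c i" for i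
  proof (induction i)
    case (Suc i)
    then have "take (Suc i) cs = take i cs @ [cs ! i]" by (simp add: take_Suc_conv_app_nth)
    then show ?case using Suc two[of i] by (simp add: count_list_append)
  qed simp
  show ?thesis
    unfolding tab_of_columns_def wt_def
  proof (rule restrict_ext)
    fix i assume i: "i \<in> {1..length cs}"
    then have "i - 1 < length cs" by auto
    then show "(count_list (take i cs) (cs ! (i - 1)), cs ! (i - 1)) = (if ?c i then (up ?c i, 1) else (dn ?c i, 2))"
      using two[of "i - 1"] count[of i] i by auto
  qed
qed

context expansion
begin

lemma small_sum:
  assumes "\<And>j. \<bar>\<tau> j\<bar> \<le> (1::int)"
  shows "\<bar>\<Sum>j<i. \<tau> j * int (digit p n j * p ^ j)\<bar> < int (p ^ i)"
proof (induction i)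
  case (Suc i)
  have "\<bar>\<tau> i * int (digit p n i * p ^ i)\<bar> \<le> int (digit p n i * p ^ i)"
    using mult_right_mono[OF assms[of i], of "int (digit p n i * p ^ i)"] by (simp add: abs_mult)
  moreover have "digit p n i * p ^ i + p ^ i \<le> p ^ Suc i"
    using mult_le_mono1[of "Suc (digit p n i)" p "p ^ i"] digit_less[of i] by simp
  then have "int (digit p n i * p ^ i) + int (p ^ i) \<le> int (p ^ Suc i)" by (simp only: of_nat_add[symmetric] of_nat_le_iff)
  moreover have "(\<Sum>j<Suc i. \<tau> j * int (digit p n j * p ^ j)) = (\<Sum>j<i. \<tau> j * int (digit p n j * p ^ j)) + \<tau> i * int (digit p n i * p ^ i)"
    by (rule sum.lessThan_Suc)
  ultimately show ?case using Suc.IH by linarith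
qed simp

text \<open>A nonzero term at the highest place is larger in absolute value than all lower terms
  together, so it cannot be cancelled.\<close>

lemma zero_sum:
  assumes "\<And>j. \<bar>\<tau> j\<bar> \<le> (1::int)"
  shows "(\<Sum>j<i. \<tau> j * int (digit p n j * p ^ j)) = 0 \<Longrightarrow> j < i \<Longrightarrow> digit p n j \<noteq> 0 \<Longrightarrow> \<tau> j = 0"
proof (induction i)
  case (Suc i)
  have e: "(\<Sum>j<i. \<tau> j * int (digit p n j * p ^ j)) + \<tau> i * int (digit p n i * p ^ i) = 0"
    using Suc.prems(1) by (simp only: sum.lessThan_Suc)
  have top: "\<tau> i * int (digit p n i * p ^ i) = 0"
  proof (rule ccontr)
    assume "\<tau> i * int (digit p n i * p ^ i) \<noteq> 0"
    then have "\<tau> i * int (digit p n i) \<noteq> 0" by auto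
    then have "1 \<le> \<bar>\<tau> i * int (digit p n i)\<bar>" by linarith
    then have "1 * int (p ^ i) \<le> \<bar>\<tau> i * int (digit p n i)\<bar> * int (p ^ i)" by (rule mult_right_mono) simp
    then have "int (p ^ i) \<le> \<bar>\<tau> i * int (digit p n i * p ^ i)\<bar>" by (simp add: abs_mult)
    then show False using small_sum[of \<tau> i, OF assms] e by linarith
  qed
  show ?case
  proof (cases "j = i")
    case True then show ?thesis using top Suc.prems(3) p3 by simp
  next
    case False
    have "(\<Sum>j<i. \<tau> j * int (digit p n j * p ^ j)) = 0" using e unfolding top by (simp only: add_0_right)
    then show ?thesis using Suc.IH Suc.prems False by simp
  qed
qed simp

lemma signs_unique:
  assumes "sg \<in> sign_choices" "sg' \<in> sign_choices" "signed_value p n sg = signed_value p n sg'" "j < k" "digit p n j \<noteq> 0"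
  shows "sg j = sg' j"
proof -
  \<comment> \<open>Half the difference of two signs is -1, 0 or 1, the range to which the size
    estimate applies.\<close>
  define \<tau> where "\<tau> j = (sg j - sg' j) div 2" for j
  have pm: "sg j = 1 \<or> sg j = -1" "sg' j = 1 \<or> sg' j = -1" for j using assms(1,2) unfolding sign_choices_def by auto
  have t: "sg j - sg' j = 2 * \<tau> j" "\<bar>\<tau> j\<bar> \<le> 1" for j unfolding \<tau>_def using pm[of j] by auto
  have "(\<Sum>j<k. sg j * int (digit p n j * p ^ j)) - (\<Sum>j<k. sg' j * int (digit p n j * p ^ j)) = 0"
    using assms(3) unfolding signed_value_def top_exp by simp
  also have "(\<Sum>j<k. sg j * int (digit p n j * p ^ j)) - (\<Sum>j<k. sg' j * int (digit p n j * p ^ j)) = (\<Sum>j<k. (sg j - sg' j) * int (digit p n j * p ^ j))"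
    by (simp only: sum_subtractf left_diff_distrib)
  also have "\<dots> = 2 * (\<Sum>j<k. \<tau> j * int (digit p n j * p ^ j))" unfolding t(1) sum_distrib_left by (simp only: mult.assoc)
  finally have "(\<Sum>j<k. \<tau> j * int (digit p n j * p ^ j)) = 0" by simp
  then have "\<tau> j = 0" by (rule zero_sum[OF t(2) _ assms(4,5)])
  then show ?thesis using t(1)[of j] by simp
qed

definition cols :: "(nat \<Rightarrow> nat) \<Rightarrow> nat \<Rightarrow> nat list" where
  "cols v i = replicate (B k - 1) 1 @ concat (map (\<lambda>j. replicate (digit p n j * p ^ j) (v j)) (rev [i..<k]))"

lemma cols_nth:
  "i \<le> k \<Longrightarrow> length (cols v i) = B i - 1 \<and> (\<forall>l. 1 \<le> l \<and> l < B k \<longrightarrow> cols v i ! (l - 1) = 1) \<and>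
    (\<forall>j. i \<le> j \<and> j < k \<longrightarrow> (\<forall>l. B (Suc j) \<le> l \<and> l < B j \<longrightarrow> cols v i ! (l - 1) = v j))"
proof (induction rule: inc_induct)
  case base then show ?case unfolding cols_def by (auto simp: nth_replicate)
next
  case (step i)
  have e: "cols v i = cols v (Suc i) @ replicate (digit p n i * p ^ i) (v i)"
    unfolding cols_def using step.hyps by (simp add: upt_conv_Cons)
  have b: "1 \<le> B (Suc i)" by (rule B_pos) (use step.hyps in simp)
  have IH: "length (cols v (Suc i)) = B (Suc i) - 1" "\<And>l. 1 \<le> l \<and> l < B k \<Longrightarrow> cols v (Suc i) ! (l - 1) = 1"
    "\<And>j l. Suc i \<le> j \<and> j < k \<Longrightarrow> B (Suc j) \<le> l \<and> l < B j \<Longrightarrow> cols v (Suc i) ! (l - 1) = v j"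
    using step.IH by blast+
  have old: "cols v i ! (l - 1) = cols v (Suc i) ! (l - 1)" if "1 \<le> l" "l < B (Suc i)" for l
    unfolding e nth_append IH(1) using that b by auto
  have kb: "B k \<le> B (Suc i)" by (rule B_anti) (use step.hyps in simp)
  show ?case
  proof (intro conjI allI impI)
    show "length (cols v i) = B i - 1" unfolding e using IH(1) B_step[of i] b by simp
    show "cols v i ! (l - 1) = 1" if "1 \<le> l \<and> l < B k" for l
      using old[of l] IH(2)[OF that] that kb by simp
    fix j l assume j: "i \<le> j \<and> j < k" and l: "B (Suc j) \<le> l \<and> l < B j"
    show "cols v i ! (l - 1) = v j"
    proof (cases "j = i")
      case True
      have "\<not> l - 1 < B (Suc i) - 1" "l - 1 - (B (Suc i) - 1) < digit p n i * p ^ i"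
        using l b B_step[of i] unfolding True by linarith+
      then show ?thesis unfolding e nth_append IH(1) True by simp
    next
      case False
      then have "B j \<le> B (Suc i)" by (intro B_anti) (use j in simp)
      moreover have "1 \<le> B (Suc j)" by (rule B_pos) (use j in simp)
      ultimately show ?thesis using old[of l] IH(3)[of j l] False j l by simp
    qed
  qed
qed

lemma jw_walk:
  assumes m: "m \<in> jw_index p n"
  obtains sg c where "sg \<in> sign_choices" "signed_value p n sg = m" "secs (\<lambda>j. sg j = 1) c" "jw_tab p n m = wt n c"
    "good n c" "ht c n = m"
proof -
  define sg where "sg = signs_of p n m"
  define v :: "nat \<Rightarrow> nat" where "v j = (if sg j = 1 then 1 else 2)" for j
  define c where "c l \<longleftrightarrow> cols v 0 ! (l - 1) = 1" for l
  have "\<exists>sg. sg \<in> sign_choices \<and> signed_value p n sg = m" using m unfolding jw_index_def by blast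
  from someI_ex[OF this] have sg: "sg \<in> sign_choices" "signed_value p n sg = m" unfolding sg_def signs_of_def by blast+
  have "set (cols v 0) \<subseteq> {1, 2}" unfolding cols_def v_def by auto
  moreover have "length (cols v 0) = n" using cols_nth[of 0 v] B_0 by simp
  ultimately have "tab_of_columns (cols v 0) = wt n c" using tab_of_columns_wt[of "cols v 0"] unfolding c_def by simp
  moreover have "jw_tab p n m = tab_of_columns (cols v 0)"
    unfolding jw_tab_def cols_def top_exp digit_top B_top v_def sg_def ..
  ultimately have jw: "jw_tab p n m = wt n c" by simp
  have v1: "v j = 1 \<longleftrightarrow> sg j = 1" for j unfolding v_def by simp
  have se: "secs (\<lambda>j. sg j = 1) c" unfolding secs_def c_def using cols_nth[of 0 v] v1 by simp
  note g = secs_good[OF se]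
  have pm: "(if sg j = 1 then 1 else -1) = sg j" for j using sg(1) unfolding sign_choices_def by force
  have "ht c n + 1 = m + 1" unfolding g(2) pm sg(2)[symmetric] signed_value_def top_exp digit_top B_top by simp
  then have "ht c n = m" by simp
  then show ?thesis using that[OF sg se jw g(1)] by blast
qed

text \<open>The number \<open>m\<close> is the final height of the walk of its tableau.\<close>

lemma jw_inj: "inj_on (jw_tab p n) (jw_index p n)"
proof (rule inj_onI)
  fix m m' assume m: "m \<in> jw_index p n" "m' \<in> jw_index p n" and e: "jw_tab p n m = jw_tab p n m'"
  obtain sg c where c: "sg \<in> sign_choices" "signed_value p n sg = m" "secs (\<lambda>j. sg j = 1) c" "jw_tab p n m = wt n c" "good n c" "ht c n = m"
    by (rule jw_walk[OF m(1)])
  obtain sg' c' where c': "sg' \<in> sign_choices" "signed_value p n sg' = m'" "secs (\<lambda>j. sg' j = 1) c'" "jw_tab p n m' = wt n c'" "good n c'" "ht c' n = m'"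
    by (rule jw_walk[OF m(2)])
  have "\<forall>l\<in>{1..n}. c l = c' l" using e unfolding c(4) c'(4) wt_eq_iff .
  then have "ht c n = ht c' n" by (intro ht_cong) simp
  then show "m = m'" unfolding c(6) c'(6) .
qed

text \<open>The signs chosen for \<open>m\<close> in the definition of the tableau may differ from
  given ones, but only at digits 0, by uniqueness; there the section is empty and the walk is the
  same.\<close>

lemma jw_iff_secs: "good n c \<Longrightarrow> (\<exists>m\<in>jw_index p n. wt n c = jw_tab p n m) \<longleftrightarrow> (\<exists>s. secs s c)"
proof
  assume "\<exists>m\<in>jw_index p n. wt n c = jw_tab p n m"
  then obtain m where m: "m \<in> jw_index p n" "wt n c = jw_tab p n m" by blast
  obtain sg' c' where c': "sg' \<in> sign_choices" "signed_value p n sg' = m" "secs (\<lambda>j. sg' j = 1) c'" "jw_tab p n m = wt n c'" "good n c'" "ht c' n = m"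
    by (rule jw_walk[OF m(1)])
  have "c' l = c l" if "l \<in> {1..n}" for l using m(2) that unfolding c'(4) wt_eq_iff by simp
  then show "\<exists>s. secs s c" using secs_cong[OF c'(3)] by blast
next
  assume "\<exists>s. secs s c"
  then obtain s where s: "secs s c" by blast
  define sg :: "nat \<Rightarrow> int" where "sg j = (if s j then 1 else -1)" for j
  have sg: "sg \<in> sign_choices" unfolding sign_choices_def sg_def by simp
  define m where "m = signed_value p n sg"
  have m: "m \<in> jw_index p n" unfolding m_def jw_index_def using sg by blast
  obtain sg' c' where c': "sg' \<in> sign_choices" "signed_value p n sg' = m" "secs (\<lambda>j. sg' j = 1) c'" "jw_tab p n m = wt n c'" "good n c'" "ht c' n = m"
    by (rule jw_walk[OF m])
  have "secs (\<lambda>j. sg' j = 1) c"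
  proof (rule secs_change[OF s])
    fix j assume "j < k" "digit p n j \<noteq> 0"
    then have "sg j = sg' j" by (intro signs_unique[OF sg c'(1)]) (simp_all add: c'(2) m_def)
    then show "s j = (sg' j = 1)" unfolding sg_def by (auto split: if_splits)
  qed
  then have "\<forall>l\<in>{1..n}. c l = c' l" using secs_agree c'(3) by blast
  then have "wt n c = jw_tab p n m" unfolding c'(4) wt_eq_iff .
  then show "\<exists>m\<in>jw_index p n. wt n c = jw_tab p n m" using m by blast
qed

text \<open>Being stretched at stage \<open>i\<close> means that the value at a multiple of
  \<open>p ^ i\<close> equals the value at the next lower multiple of \<open>p ^ (i + 1)\<close>.
  Iterating, a position may be rounded down. The lower bound on \<open>l\<close> keeps the rounded
  position positive, and the bound by \<open>B j\<close> keeps the quotients within the ranks of the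
  chain.\<close>

lemma floor_run:
  assumes W: "\<forall>i<k. blk p (chain_rank p n i) (pj i c)" and l: "l < B j"
  shows "i \<le> k \<Longrightarrow> i \<le> Suc j \<Longrightarrow> p ^ i \<le> l \<Longrightarrow> c l = c (l div p ^ i * p ^ i)"
proof (induction i)
  case (Suc i)
  have pp: "0 < p" "0 < p ^ i" using p3 by simp_all
  have "p ^ i \<le> p ^ Suc i" using p3 by simp
  then have "p ^ i \<le> l" using Suc.prems(3) by (rule order_trans)
  then have IH: "c l = pj i c (l div p ^ i)" using Suc unfolding pj_def by simp
  let ?q = "l div p ^ i"
  have qq: "?q div p = l div p ^ Suc i" unfolding power_Suc2 by (rule div_mult2_eq[symmetric])
  have "l < A i * p ^ i" using l B_anti[of j] B_anti[of i j] Suc.prems unfolding B_def[symmetric] by simp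
  then have "?q < A i" by (rule less_mult_imp_div_less)
  then have q: "?q \<le> chain_rank p n i" using rank_A[of i] Suc.prems by simp
  have q1: "1 \<le> ?q div p" unfolding qq using Suc.prems(3) pp by (simp add: div_greater_zero_iff Suc_le_eq)
  have q2: "?q div p * p \<le> ?q" "?q < Suc (?q div p) * p" using pp div_times_less_eq_dividend dividend_less_div_times[of p ?q] by (simp_all add: algebra_simps)
  have "pj i c ?q = proj p (pj i c) (?q div p)" by (rule blk_run[OF _ q1 q2 q]) (use W Suc.prems in simp)
  then show ?case unfolding IH proj_def pj_def qq power_Suc by (simp only: mult.assoc)
qed simp

text \<open>The section of digit \<open>j\<close> is shorter than \<open>p ^ (j + 1)\<close> and
  starts at the multiple \<open>B (j + 1)\<close> of this power, so every position in it rounds down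
  to its first one.\<close>

lemma chain_secs:
  assumes W: "\<forall>i<k. blk p (chain_rank p n i) (pj i c)" and T: "\<forall>l\<in>{1..a - 1}. pj k c l"
  shows "secs (\<lambda>j. c (B (Suc j))) c"
  unfolding secs_def
proof (intro conjI allI impI)
  have pp: "0 < p ^ i" for i using p3 by simp
  fix l assume l: "1 \<le> l \<and> l < B k"
  show "c l"
  proof (cases "p ^ k \<le> l")
    case True
    then have "c l = pj k c (l div p ^ k)" using floor_run[OF W, of l k k] l unfolding pj_def by simp
    moreover have "l div p ^ k < a" using l unfolding B_top by (intro less_mult_imp_div_less) simp
    moreover have "1 \<le> l div p ^ k" using True pp by (simp add: div_greater_zero_iff Suc_le_eq)
    ultimately show ?thesis using T by simp
  next
    case False
    \<comment> \<open>Below \<open>p ^ k\<close> the position is rounded at its own scale. The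
      quotient is then less than p, and the first \<open>p - 1\<close> steps of a stretched walk go
      up.\<close>
    obtain i where i: "p ^ i \<le> l" "l < p ^ (i + 1)" using ex_power_ivl1[of p l] p3 l by auto
    have "p ^ i < p ^ k" using i False by simp
    then have ik: "i < k" using p3 by (simp add: power_strict_increasing_iff)
    have "c l = pj i c (l div p ^ i)" using floor_run[OF W, of l k i] l i ik unfolding pj_def by simp
    moreover have "l < A i * p ^ i" using l B_anti[of i k] ik unfolding B_def[symmetric] by simp
    then have "l div p ^ i < A i" by (rule less_mult_imp_div_less)
    then have "l div p ^ i \<le> chain_rank p n i" using rank_A[of i] ik by simp
    moreover have "1 \<le> l div p ^ i" using i pp by (simp add: div_greater_zero_iff Suc_le_eq)
    moreover have "l div p ^ i < p" using i by (intro less_mult_imp_div_less) simp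
    ultimately show ?thesis using blk_first[of "chain_rank p n i" "pj i c"] W ik by simp
  qed
next
  fix j l assume j: "j < k" and l: "B (Suc j) \<le> l \<and> l < B j"
  have "digit p n j * p ^ j < p ^ Suc j" using digit_less[of j] p3 by simp
  then have "l < B (Suc j) + p ^ Suc j" using l B_step[of j] by linarith
  then have "l div p ^ Suc j = A (Suc j)" using l unfolding B_def by (intro div_nat_eqI) (simp_all add: mult.commute)
  moreover have "p ^ Suc j \<le> l" using B_pos(1)[of "Suc j"] l j by linarith
  ultimately show "c l = c (B (Suc j))" using floor_run[OF W, of l j "Suc j"] l j unfolding B_def[of "Suc j"] by (simp del: power_Suc)
qed

text \<open>Neighbouring multiples of \<open>p ^ i\<close> lie in one section unless a boundary
  \<open>B (j + 1)\<close> with \<open>j \<ge> i\<close> separates them. This boundary is a multiple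
  of \<open>p ^ (i + 1)\<close>, so it is the larger of the two, and a turn is allowed
  there.\<close>

lemma secs_chain:
  assumes s: "secs s c"
  shows "\<forall>i<k. blk p (chain_rank p n i) (pj i c)" "\<forall>l\<in>{1..a - 1}. pj k c l"
proof -
  have adj: "pj i c l = pj i c (Suc l)" if i: "i < k" and l: "1 \<le> l" "l < chain_rank p n i" "\<not> p dvd Suc l" for i l
  proof -
    let ?x = "l * p ^ i" and ?y = "Suc l * p ^ i"
    have pp: "0 < p ^ i" using p3 by simp
    have xy: "1 \<le> ?x" "?x < ?y" using l pp by (simp_all add: Suc_le_eq)
    have "j \<le> k \<Longrightarrow> i \<le> j \<longrightarrow> ?y < B j \<longrightarrow> c ?x = c ?y" for j
    proof (induction rule: inc_induct)
      case base then show ?case using s xy unfolding secs_def by auto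
    next
      case (step j)
      show ?case
      proof (intro impI)
        assume j: "i \<le> j" and y: "?y < B j"
        consider "?y < B (Suc j)" | "B (Suc j) \<le> ?x" | "?x < B (Suc j)" "B (Suc j) \<le> ?y" by linarith
        then show "c ?x = c ?y"
        proof cases
          case 1 then show ?thesis using step.IH j by simp
        next
          case 2
          then have "c ?x = s j" "c ?y = s j" using s step.hyps xy y unfolding secs_def by auto
          then show ?thesis by simp
        next
          case 3
          define D where "D = A (Suc j) * p ^ (j - i)"
          have "p ^ Suc j = p ^ (j - i) * p * p ^ i" using j by (simp add: power_add[symmetric])
          then have D: "B (Suc j) = D * p * p ^ i" unfolding B_def D_def by (simp only: mult.assoc)
          have "l < D * p" "D * p \<le> Suc l" using 3 pp unfolding D by (simp_all del: mult_Suc)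
          then have "Suc l = D * p" by simp
          then show ?thesis using l(3) by simp
        qed
      qed
    qed
    from this[of i] have "?y < B i \<longrightarrow> c ?x = c ?y" using i by simp
    moreover have "Suc l < A i" using rank_A[of i] i l by simp
    then have "?y < B i" unfolding B_def using pp by (simp del: mult_Suc)
    ultimately show ?thesis unfolding pj_def by simp
  qed
  have g: "i < k \<Longrightarrow> good (chain_rank p n i) (pj i c)" for i
  proof (induction i)
    case 0 then show ?case using secs_good(1)[OF s] unfolding pj_simps by simp
  next
    case (Suc i)
    then have "blk p (chain_rank p n i) (pj i c)" unfolding blk_def using adj by simp
    then show ?case using good_proj[OF rank_big, of i "pj i c"] Suc.prems unfolding pj_simps by simp
  qed
  show "\<forall>i<k. blk p (chain_rank p n i) (pj i c)" unfolding blk_def using g adj by blast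
  show "\<forall>l\<in>{1..a - 1}. pj k c l"
  proof
    fix l assume l: "l \<in> {1..a - 1}"
    have pp: "0 < p ^ k" using p3 by simp
    then have "1 \<le> l * p ^ k" "l * p ^ k < B k" unfolding B_top using l by (auto simp: Suc_le_eq)
    then show "pj k c l" using s unfolding secs_def pj_def by blast
  qed
qed

section \<open>Comparison of the two projections\<close>

lemma chain_iff_jw: "good n c \<Longrightarrow> ((\<forall>i<k. blk p (chain_rank p n i) (pj i c)) \<and> (\<forall>l\<in>{1..a - 1}. pj k c l)) \<longleftrightarrow>
    (\<exists>m\<in>jw_index p n. wt n c = jw_tab p n m)"
  using jw_iff_secs chain_secs secs_chain by blast

lemma jw_Std2: "m \<in> jw_index p n \<Longrightarrow> jw_tab p n m \<in> Std2 n"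
proof -
  assume m: "m \<in> jw_index p n"
  obtain sg c where c: "sg \<in> sign_choices" "signed_value p n sg = m" "secs (\<lambda>j. sg j = 1) c" "jw_tab p n m = wt n c" "good n c" "ht c n = m"
    by (rule jw_walk[OF m])
  show ?thesis unfolding c(4) wt_in_Std2 by (rule c(5))
qed

lemma finite_jw_index: "finite (jw_index p n)"
  by (rule finite_imageD[OF finite_subset[OF _ finite_Std2[of n]] jw_inj]) (use jw_Std2 in blast)

lemma pJW_TL: "pJW p n \<in> TL n UNIV"
  unfolding pJW_def by (rule TL_sum[OF subring_UNIV idem_TL[OF jw_Std2]])

text \<open>The tableaux \<open>t_m\<close> are distinct for different \<open>m\<close>, so at most
  one summand acts on a given walk vector.\<close>

lemma rho_pJW:
  assumes "good n c"
  shows "rho n (pJW p n) (ww n (wt n c)) = (if \<exists>m\<in>jw_index p n. wt n c = jw_tab p n m then ww n (wt n c) else 0)"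
proof -
  have cs: "wt n c \<in> Std2 n" using assms wt_in_Std2 by simp
  have "rho n (pJW p n) (ww n (wt n c)) = (\<Sum>m\<in>jw_index p n. if wt n c = jw_tab p n m then ww n (wt n c) else 0)"
    unfolding pJW_def rho_sum by (rule sum.cong[OF refl]) (rule rho_idem_ww[OF jw_Std2 cs])
  also have "\<dots> = (if \<exists>m\<in>jw_index p n. wt n c = jw_tab p n m then ww n (wt n c) else 0)"
  proof (cases "\<exists>m\<in>jw_index p n. wt n c = jw_tab p n m")
    case True
    then obtain m where m: "m \<in> jw_index p n" "wt n c = jw_tab p n m" by blast
    have "(\<Sum>m'\<in>jw_index p n. if wt n c = jw_tab p n m' then ww n (wt n c) else 0) = (\<Sum>m'\<in>jw_index p n. if m' = m then ww n (wt n c) else 0)"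
    proof (rule sum.cong[OF refl])
      fix m' assume "m' \<in> jw_index p n"
      then have "wt n c = jw_tab p n m' \<longleftrightarrow> m' = m" using inj_onD[OF jw_inj] m by metis
      then show "(if wt n c = jw_tab p n m' then ww n (wt n c) else 0) = (if m' = m then ww n (wt n c) else 0)" by (simp only:)
    qed
    also have "\<dots> = (if m \<in> jw_index p n then ww n (wt n c) else 0)" by (rule sum.delta[OF finite_jw_index])
    finally show ?thesis using True m(1) by (simp only: if_True)
  next
    case False
    then show ?thesis unfolding if_not_P[OF False] by (intro sum.neutral ballI if_not_P) blast
  qed
  finally show "rho n (pJW p n) (ww n (wt n c)) = (if \<exists>m\<in>jw_index p n. wt n c = jw_tab p n m then ww n (wt n c) else 0)" .
qed

end

lemma sum_digits_less:
  fixes a :: "nat \<Rightarrow> nat"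
  assumes "\<And>i. i < k \<Longrightarrow> a i < p"
  shows "(\<Sum>i<k. a i * p ^ i) < p ^ k"
  using assms
proof (induction k)
  case (Suc k)
  have "Suc (a k) * p ^ k \<le> p * p ^ k" using Suc.prems[of k] by (intro mult_le_mono1) simp
  moreover have "(\<Sum>i<k. a i * p ^ i) < p ^ k" using Suc by simp
  ultimately show ?case by simp
qed simp

theorem theorem6p12:
  fixes p n k :: nat and a :: "nat \<Rightarrow> nat" and \<iota> :: "nat \<Rightarrow> tl \<Rightarrow> tl"
  assumes "prime p" and "odd p" and "p \<le> n"
    and "n + 1 = (\<Sum>i\<le>k. a i * p ^ i)" and "\<forall>i\<le>k. a i < p" and "a k \<noteq> 0"
    and "\<forall>i<k. is_iota_KLR p (chain_rank p n i) (\<iota> i)"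
  shows "pJW p n = chain_comp \<iota> k (seminormal_idem (a k - 1) (one_column (a k - 1)))"
proof -
  have "n + 1 = (\<Sum>i<k. a i * p ^ i) + a k * p ^ k" using assms(4) by (simp add: lessThan_Suc_atMost[symmetric])
  moreover have lt: "(\<Sum>i<k. a i * p ^ i) < p ^ k" using assms(5) by (intro sum_digits_less) simp
  ultimately have div: "Suc n div p ^ k = a k" by (intro div_nat_eqI) (simp_all add: mult.commute)
  interpret expansion p n k "a k"
    using assms div by unfold_locales auto
  let ?E = "seminormal_idem (a k - 1) (one_column (a k - 1))"
  have rk: "chain_rank p n k = a k - 1" using rank_A[of k] div unfolding A_def by simp
  have "acts p (chain_rank p n k) ?E (\<lambda>c. \<forall>l\<in>{1..a k - 1}. c l)"
    unfolding rk using assms(5) by (intro acts_one_column) (auto intro: le_less_trans[OF diff_le_self])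
  then have "acts p n (chain_comp \<iota> k ?E) (\<lambda>c. (\<forall>i<k. blk p (chain_rank p n i) (pj i c)) \<and> (\<forall>l\<in>{1..a k - 1}. pj k c l))"
    using chain_acts[where j = k] assms(7) rank_big by blast
  then have mem: "chain_comp \<iota> k ?E \<in> TL n UNIV" and act: "\<And>c. good n c \<Longrightarrow> rho n (chain_comp \<iota> k ?E) (ww n (wt n c)) =
      (if (\<forall>i<k. blk p (chain_rank p n i) (pj i c)) \<and> (\<forall>l\<in>{1..a k - 1}. pj k c l) then ww n (wt n c) else 0)"
    unfolding acts_def using TL_mono by blast+
  \<comment> \<open>Both sides are diagonal on the walk vectors, so it remains to compare the sets
    of walks with eigenvalue 1.\<close>
  show ?thesis
  proof (rule TL_eqI_ww[OF _ mem])
    fix t assume "t \<in> Std2 n"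
    then obtain c where c: "good n c" "t = wt n c" unfolding Std2_iff by blast
    show "rho n (pJW p n) (ww n t) = rho n (chain_comp \<iota> k ?E) (ww n t)"
      unfolding c(2) act[OF c(1)] chain_iff_jw[OF c(1)] rho_pJW[OF c(1)] ..
  next
    show "pJW p n \<in> TL n UNIV" by (rule pJW_TL)
  qed
qed

end
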